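(* Let $\mathbb G$ be a homogeneous group with a homogeneous distance $d$, and let $\Sigma\subset\mathbb G$ be a $C^1$ smooth embedded submanifold of topological dimension $n\ge 1$ and degree $N$. Let $p\in\Sigma$ be an algebraically regular point of maximum degree $N$ and let $A_p\Sigma$ be the ($n$-dimensional) homogeneous tangent space of $\Sigma$ at $p$. Assume that one of the following holds: (1) $p$ is a horizontal point; (2) $\mathbb G$ has step two; (3) $\Sigma$ is one dimensional; (4) $p$ is a transversal point. Then the spherical Federer density of the intrinsic measure $\mu_\Sigma$ at $p$ satisfies $$\theta^{N}(\mu_\Sigma,p)=\beta_d(A_p\Sigma).$$
   Context: Homogeneous groups. A homogeneous group is a finite dimensional real vector space $\mathbb G=H^1\oplus\cdots\oplus H^\iota$, $H^\iota\neq\{0\}$, with a nilpotent Lie bracket satisfying $[H^i,H^j]\subset H^{i+j}$ ($H^k=\{0\}$ for $k>\iota$), with group law given by the Baker-Campbell-Hausdorff formula $xy=x+y+\frac12[x,y]+\cdots$ (so the identity is $0$ and $x^{-1}=-x$), and with the linear dilations $\delta_r$, $r>0$, $\delta_r x=r^ix$ for $x\in H^i$. The integer $\iota$ is the step. Put $q=\dim\mathbb G$, $h_j=\dim H^j$, $m_j=h_1+\cdots+h_j$, $m_0=0$. $\mathrm{Lie}(\mathbb G)$ is the Lie algebra of left invariant vector fields; $\mathbb G$ is identified with $T_0\mathbb G$, and then $\exp X=X(0)$. A scalar product on $\mathbb G$ making the $H^j$ mutually orthogonal is fixed; $|\cdot|$ is its norm and $g$ is the left invariant Riemannian metric equal to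 it at $0$. A homogeneous distance $d$ is a left invariant distance with $d(\delta_rx,\delta_ry)=r\,d(x,y)$; $\mathbb B(x,r)$ denotes the closed $d$-ball. A homogeneous subgroup is a Lie subgroup that is a linear subspace invariant under all $\delta_r$. A horizontal subgroup is a homogeneous subgroup contained in $H^1$. A vertical subgroup is a homogeneous subgroup of the form $N_\ell\oplus H^{\ell+1}\oplus\cdots\oplus H^\iota$, with $\ell\in\{1,\dots,\iota\}$ and $N_\ell\subset H^\ell$ a linear subspace. Degree and homogeneous tangent space. Fix an orthonormal basis $(e_1,\dots,e_q)$ such that $(e_i)_{m_{j-1}<i\le m_j}$ is a basis of $H^j$ for each $j$; let $X_i\in\mathrm{Lie}(\mathbb G)$ with $X_i(0)=e_i$, and $d_i=j$ if $m_{j-1}<i\le m_j$. For $I=(i_1<\cdots<i_k)$ put $X_I=X_{i_1}\wedge\cdots\wedge X_{i_k}$, $d(X_I)=d_{i_1}+\cdots+d_{i_k}$, and $\pi_M(\sum_I c_IX_I)=\sum_{d(X_I)=M}c_IX_I$. For $z\in\Lambda_k(T_p\mathbb G)$ let $\pi_{p,M}(z)=\pi_M(\xi)(p)$, where $\xi$ is the unique left invariant $k$-vector field with $\xi(p)=z$. For $p\in\Sigma$ let $\tau_\Sigma(p)=t_1\wedge\cdots\wedge t_n$ with $(t_i)$ a basis of $T_p\Sigma$. The pointwise degree is $d_\Sigma(p)=\max\{M:\pi_{p,M}(\tau_\Sigma(p))\ne0\}$; the degree of $\Sigma$ is $d(\Sigma)=\max_{p\in\Sigma}d_\Sigma(p)$;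 $p$ has maximum degree if $d_\Sigma(p)=d(\Sigma)$. With $M=d_\Sigma(p)$ and $\xi$ the left invariant $n$-vector field such that $\xi(p)=\tau_\Sigma(p)$, let $\mathcal A_p\Sigma=\{X\in\mathrm{Lie}(\mathbb G):X\wedge\pi_M(\xi)=0\}$ and $A_p\Sigma=\exp\mathcal A_p\Sigma$ (homogeneous tangent space). The point $p$ is algebraically regular if $\mathcal A_p\Sigma$ is a Lie subalgebra. A horizontal (resp. transversal) point is an algebraically regular point whose $A_p\Sigma$ is a horizontal (resp. vertical) subgroup. Intrinsic measure. For any auxiliary Riemannian metric $\tilde g$ on $\mathbb G$, let $\tau_\Sigma$ be a tangent $n$-vector field with $\|\tau_\Sigma(p)\|_{\tilde g}=1$, let $\tau^{\tilde g}_{\Sigma,N}(p)=\pi_{p,N}(\tau_\Sigma(p))$, let $\sigma_{\tilde g}$ be the $n$-dimensional Riemannian measure induced by $\tilde g$ on $\Sigma$, and $\mu_\Sigma=\|\tau^{\tilde g}_{\Sigma,N}\|_g\,\sigma_{\tilde g}$ (independent of $\tilde g$), regarded as a measure on $\mathbb G$ concentrated on $\Sigma$. Spherical Federer density: $\theta^\alpha(\mu,x)=\inf_{\varepsilon>0}\sup\{2^\alpha\mu(B)/\mathrm{diam}(B)^\alpha: B \text{ a closed } d\text{-ball of positive radius},\ x\in B,\ \mathrm{diam}(B)<\varepsilon\}$. Spherical factor: for an $n$-dimensional linear subspace $S\subset\mathbb G$, $\beta_d(S)=\max_{d(u,0)\le1}\mathcal H^n_{|\cdot|}(\mathbb B(u,1)\cap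 S)$, where $\mathcal H^n_{|\cdot|}$ is the $n$-dimensional Hausdorff measure of the Euclidean norm $|\cdot|$, normalized to agree with Lebesgue measure on $n$-dimensional affine subspaces.
   Formalization: The formal statement additionally assumes H^1 ≠ {0}; without it the claim fails, e.g. for G = H^2 = R with d(x,y) = |x-y|^{1/2} and Σ = G, where the density is 4 but the spherical factor is 2. *)

theory Defs
  imports "HOL-Analysis.Analysis"
begin

section \<open>Homogeneous groups\<close>

text \<open>The fixed scalar product is the inner product of the type \<open>'a::euclidean_space\<close>;
  the dimension \<open>q\<close> is \<open>DIM('a)\<close>, and every tangent space is identified with \<open>'a\<close>.
  The layer \<open>H\<^sup>j\<close> is \<open>layer G j\<close>.\<close>

record 'a graded_group =
  bracket :: "'a \<Rightarrow> 'a \<Rightarrow> 'a"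
  layer :: "nat \<Rightarrow> 'a set"
  step :: nat
  gmul :: "'a \<Rightarrow> 'a \<Rightarrow> 'a"

text \<open>Right-nested brackets \<open>[v\<^sub>1,[v\<^sub>2,\<dots>[v\<^sub>m\<^sub>-\<^sub>1,v\<^sub>m]\<dots>]]\<close>.\<close>

fun nested_bracket :: "('a::zero \<Rightarrow> 'a \<Rightarrow> 'a) \<Rightarrow> 'a list \<Rightarrow> 'a" where
  "nested_bracket br [] = 0"
| "nested_bracket br [v] = v"
| "nested_bracket br (v # w # vs) = br v (nested_bracket br (w # vs))"

text \<open>Dynkin's form of the Baker-Campbell-Hausdorff series of \<open>x\<close> and \<open>y\<close>: a list
  \<open>[(r\<^sub>1,s\<^sub>1),\<dots>,(r\<^sub>k,s\<^sub>k)]\<close> with all \<open>r\<^sub>i + s\<^sub>i > 0\<close> contributes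
  \<open>(-1)\<^sup>k\<^sup>-\<^sup>1 / (k m \<Prod>\<^sub>i r\<^sub>i! s\<^sub>i!)\<close> times the right-nested bracket of the word
  \<open>x\<^sup>r\<^sup>1 y\<^sup>s\<^sup>1 \<dots> x\<^sup>r\<^sup>k y\<^sup>s\<^sup>k\<close> of length \<open>m = \<Sum>\<^sub>i (r\<^sub>i + s\<^sub>i)\<close>. Words longer than the nilpotency
  bound \<open>N\<close> have zero bracket and are omitted, so the sum is finite.\<close>

definition bch :: "('a::real_vector \<Rightarrow> 'a \<Rightarrow> 'a) \<Rightarrow> nat \<Rightarrow> 'a \<Rightarrow> 'a \<Rightarrow> 'a" where
  "bch br N x y =
     (\<Sum>ps \<in> {ps. ps \<noteq> [] \<and> (\<forall>(r, s) \<in> set ps. r + s > 0) \<and>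
                 (\<Sum>(r, s)\<leftarrow>ps. r + s) \<le> N}.
        ((- 1) ^ (length ps - 1) /
           (real (length ps) * real (\<Sum>(r, s)\<leftarrow>ps. r + s) * (\<Prod>(r, s)\<leftarrow>ps. fact r * fact s)))
        *\<^sub>R nested_bracket br (concat (map (\<lambda>(r, s). replicate r x @ replicate s y) ps)))"

text \<open>Orthogonal layers spanning the space form a direct sum, and the grading with positive
  degrees makes the bracket nilpotent. That the Baker-Campbell-Hausdorff product is a group law is
  a classical consequence of the other conditions.\<close>

definition homogeneous_group :: "('a::euclidean_space) graded_group \<Rightarrow> bool" where
  "homogeneous_group G \<longleftrightarrow>
     step G \<ge> 1 \<and>
     (\<forall>j. subspace (layer G j)) \<and>
     (\<forall>j. j \<notin> {1..step G} \<longrightarrow> layer G j = {0}) \<and>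
     layer G (step G) \<noteq> {0} \<and>
     (\<forall>i j. i \<noteq> j \<longrightarrow> (\<forall>x\<in>layer G i. \<forall>y\<in>layer G j. orthogonal x y)) \<and>
     span (\<Union>j\<in>{1..step G}. layer G j) = UNIV \<and>
     bilinear (bracket G) \<and>
     (\<forall>x. bracket G x x = 0) \<and>
     (\<forall>x y z. bracket G x (bracket G y z) + bracket G y (bracket G z x)
                + bracket G z (bracket G x y) = 0) \<and>
     (\<forall>i\<ge>1. \<forall>j\<ge>1. \<forall>x\<in>layer G i. \<forall>y\<in>layer G j. bracket G x y \<in> layer G (i + j)) \<and>
     group (gmul G) 0 uminus \<and>
     (\<forall>x y. gmul G x y = bch (bracket G) (step G) x y)"

definition dilation :: "('a::euclidean_space) graded_group \<Rightarrow> real \<Rightarrow> 'a \<Rightarrow> 'a" where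
  "dilation G r = (THE f. linear f \<and> (\<forall>j\<in>{1..step G}. \<forall>x\<in>layer G j. f x = r ^ j *\<^sub>R x))"

definition homogeneous_distance ::
    "('a::euclidean_space) graded_group \<Rightarrow> ('a \<Rightarrow> 'a \<Rightarrow> real) \<Rightarrow> bool" where
  "homogeneous_distance G d \<longleftrightarrow>
     Metric_space UNIV d \<and>
     (\<forall>x y z. d (gmul G z x) (gmul G z y) = d x y) \<and>
     (\<forall>r>0. \<forall>x y. d (dilation G r x) (dilation G r y) = r * d x y)"

definition homogeneous_subgroup ::
    "('a::euclidean_space) graded_group \<Rightarrow> 'a set \<Rightarrow> bool" where
  "homogeneous_subgroup G S \<longleftrightarrow>
     subspace S \<and> (\<forall>x\<in>S. \<forall>y\<in>S. gmul G x y \<in> S) \<and> (\<forall>r>0. dilation G r ` S \<subseteq> S)"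

definition horizontal_subgroup ::
    "('a::euclidean_space) graded_group \<Rightarrow> 'a set \<Rightarrow> bool" where
  "horizontal_subgroup G S \<longleftrightarrow> homogeneous_subgroup G S \<and> S \<subseteq> layer G 1"

definition vertical_subgroup ::
    "('a::euclidean_space) graded_group \<Rightarrow> 'a set \<Rightarrow> bool" where
  "vertical_subgroup G S \<longleftrightarrow>
     homogeneous_subgroup G S \<and>
     (\<exists>l\<in>{1..step G}. \<exists>N. subspace N \<and> N \<subseteq> layer G l \<and>
        S = span (N \<union> (\<Union>j\<in>{l<..step G}. layer G j)))"

section \<open>Left invariant vector fields\<close>

definition left_invariant_fields :: "('a::euclidean_space) graded_group \<Rightarrow> ('a \<Rightarrow> 'a) set" where
  "left_invariant_fields G =
     {X. \<forall>p x. X (gmul G p x) = frechet_derivative (gmul G p) (at x) (X x)}"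

definition field_bracket :: "('a::euclidean_space \<Rightarrow> 'a) \<Rightarrow> ('a \<Rightarrow> 'a) \<Rightarrow> 'a \<Rightarrow> 'a" where
  "field_bracket X Y p =
     frechet_derivative Y (at p) (X p) - frechet_derivative X (at p) (Y p)"

definition lie_subalgebra ::
    "('a::euclidean_space) graded_group \<Rightarrow> ('a \<Rightarrow> 'a) set \<Rightarrow> bool" where
  "lie_subalgebra G L \<longleftrightarrow>
     L \<subseteq> left_invariant_fields G \<and> (\<lambda>p. 0) \<in> L \<and>
     (\<forall>X\<in>L. \<forall>Y\<in>L. (\<lambda>p. X p + Y p) \<in> L) \<and>
     (\<forall>c. \<forall>X\<in>L. (\<lambda>p. c *\<^sub>R X p) \<in> L) \<and>
     (\<forall>X\<in>L. \<forall>Y\<in>L. field_bracket X Y \<in> L)"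

text \<open>\<open>m\<^sub>j = h\<^sub>1 + \<dots> + h\<^sub>j\<close>.\<close>

definition layer_sum :: "('a::euclidean_space) graded_group \<Rightarrow> nat \<Rightarrow> nat" where
  "layer_sum G j = (\<Sum>k=1..j. dim (layer G k))"

text \<open>Bases are indexed by \<open>1,\<dots>,q\<close>.\<close>

definition graded_basis :: "('a::euclidean_space) graded_group \<Rightarrow> (nat \<Rightarrow> 'a) \<Rightarrow> bool" where
  "graded_basis G e \<longleftrightarrow>
     (\<forall>i\<in>{1..DIM('a)}. \<forall>j\<in>{1..DIM('a)}. e i \<bullet> e j = (if i = j then 1 else 0)) \<and>
     (\<forall>j\<in>{1..step G}. span (e ` {layer_sum G (j - 1)<..layer_sum G j}) = layer G j)"

definition index_degree :: "('a::euclidean_space) graded_group \<Rightarrow> nat \<Rightarrow> nat" where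
  "index_degree G i = (THE j. j \<ge> 1 \<and> layer_sum G (j - 1) < i \<and> i \<le> layer_sum G j)"

text \<open>\<open>frame G e i\<close> is the element \<open>X\<^sub>i\<close> of \<open>Lie(G)\<close> with \<open>X\<^sub>i(0) = e\<^sub>i\<close>.\<close>

definition frame :: "('a::euclidean_space) graded_group \<Rightarrow> (nat \<Rightarrow> 'a) \<Rightarrow> nat \<Rightarrow> 'a \<Rightarrow> 'a" where
  "frame G e i = (THE X. X \<in> left_invariant_fields G \<and> X 0 = e i)"

section \<open>Multivectors\<close>

text \<open>A multivector \<open>z\<close> in \<open>\<Lambda>(T\<^sub>pG)\<close> is represented by its coefficients \<open>c I\<close> with respect to
  the basis \<open>X\<^sub>I(p)\<close>, \<open>I \<subseteq> {1..q}\<close>. The same coefficients represent the left invariant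
  multivector field \<open>\<Sum>\<^sub>I c\<^sub>I X\<^sub>I\<close> whose value at \<open>p\<close> is \<open>z\<close>.\<close>

type_synonym multivector = "nat set \<Rightarrow> real"

text \<open>\<open>X\<^sub>I \<and> X\<^sub>J\<close> is \<open>\<plusminus> X\<^sub>I\<^sub>\<union>\<^sub>J\<close> for disjoint \<open>I\<close>, \<open>J\<close>, with the sign given by the number of
  inversions, and zero otherwise.\<close>

definition wedge :: "multivector \<Rightarrow> multivector \<Rightarrow> multivector" (infixr \<open>\<and>\<^sub>m\<close> 70) where
  "(a \<and>\<^sub>m b) K =
     (\<Sum>I\<in>Pow K. (- 1) ^ card {(i, j). i \<in> I \<and> j \<in> K - I \<and> j < i} * a I * b (K - I))"

definition vec_coeffs ::
    "('a::euclidean_space) graded_group \<Rightarrow> (nat \<Rightarrow> 'a) \<Rightarrow> 'a \<Rightarrow> 'a \<Rightarrow> multivector" where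
  "vec_coeffs G e p v I =
     (\<Sum>i\<in>{1..DIM('a)}. if I = {i}
        then representation ((\<lambda>k. frame G e k p) ` {1..DIM('a)}) v (frame G e i p) else 0)"

text \<open>\<open>v\<^sub>1 \<and> \<dots> \<and> v\<^sub>k\<close> for a list of vectors in \<open>T\<^sub>pG\<close>.\<close>

definition simple_multivector ::
    "('a::euclidean_space) graded_group \<Rightarrow> (nat \<Rightarrow> 'a) \<Rightarrow> 'a \<Rightarrow> 'a list \<Rightarrow> multivector" where
  "simple_multivector G e p vs =
     foldr (\<and>\<^sub>m) (map (vec_coeffs G e p) vs) (\<lambda>I. if I = {} then 1 else 0)"

definition degree_proj ::
    "('a::euclidean_space) graded_group \<Rightarrow> nat \<Rightarrow> multivector \<Rightarrow> multivector" where
  "degree_proj G M c I = (if (\<Sum>i\<in>I. index_degree G i) = M then c I else 0)"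

text \<open>The norm of the left invariant metric \<open>g\<close>, for which \<open>(X\<^sub>I)\<close> is orthonormal; \<open>q\<close> is the
  dimension of the group.\<close>

definition left_invariant_norm :: "nat \<Rightarrow> multivector \<Rightarrow> real" where
  "left_invariant_norm q c = sqrt (\<Sum>I\<in>Pow {1..q}. (c I)\<^sup>2)"

text \<open>The determinant of the Gram matrix of a family \<open>(v\<^sub>i)\<^sub>i\<^sub>\<in>\<^sub>I\<close> with respect to the scalar
  product \<open>B\<close>, that is, the squared \<open>B\<close>-norm of the wedge product of the family.\<close>

definition gram_det :: "'i set \<Rightarrow> ('a \<Rightarrow> 'a \<Rightarrow> real) \<Rightarrow> ('i \<Rightarrow> 'a) \<Rightarrow> real" where
  "gram_det I B v = (\<Sum>\<pi> | \<pi> permutes I. of_int (sign \<pi>) * (\<Prod>i\<in>I. B (v i) (v (\<pi> i))))"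

section \<open>Submanifolds, degree and homogeneous tangent space\<close>

text \<open>Meant for open \<open>S\<close> and finite-dimensional domains.\<close>

primrec Ck_on ::
    "nat \<Rightarrow> 'a::real_normed_vector set \<Rightarrow> ('a \<Rightarrow> 'b::real_normed_vector) \<Rightarrow> bool" where
  "Ck_on 0 S f \<longleftrightarrow> continuous_on S f"
| "Ck_on (Suc k) S f \<longleftrightarrow>
     f differentiable_on S \<and> (\<forall>v. Ck_on k S (\<lambda>x. frechet_derivative f (at x) v))"

text \<open>Local \<open>C\<^sup>1\<close> parametrizations of \<open>\<Sigma>\<close>, defined on open subsets of \<open>\<real>\<^sup>n\<close>, \<open>n = CARD('n)\<close>.\<close>

definition local_param ::
    "'a::euclidean_space set \<Rightarrow> (real ^ 'n) set \<Rightarrow> (real ^ 'n \<Rightarrow> 'a) \<Rightarrow> bool" where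
  "local_param \<Sigma> V \<Phi> \<longleftrightarrow>
     open V \<and> Ck_on 1 V \<Phi> \<and> (\<forall>x\<in>V. inj (frechet_derivative \<Phi> (at x))) \<and>
     openin (top_of_set \<Sigma>) (\<Phi> ` V) \<and> (\<exists>\<Psi>. homeomorphism V (\<Phi> ` V) \<Phi> \<Psi>)"

definition C1_submanifold :: "'n::finite itself \<Rightarrow> 'a::euclidean_space set \<Rightarrow> bool" where
  "C1_submanifold _ \<Sigma> \<longleftrightarrow>
     (\<forall>p\<in>\<Sigma>. \<exists>(V :: (real ^ 'n) set) \<Phi>. local_param \<Sigma> V \<Phi> \<and> p \<in> \<Phi> ` V)"

definition tangent_space :: "'a::euclidean_space set \<Rightarrow> 'a \<Rightarrow> 'a set" where
  "tangent_space \<Sigma> p =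
     {v. \<exists>\<gamma> \<epsilon>. \<epsilon> > 0 \<and> Ck_on 1 {-\<epsilon><..<\<epsilon>} \<gamma> \<and> \<gamma> ` {-\<epsilon><..<\<epsilon>} \<subseteq> \<Sigma> \<and>
         \<gamma> 0 = p \<and> (\<gamma> has_vector_derivative v) (at (0::real))}"

definition tangent_basis :: "'a::euclidean_space set \<Rightarrow> 'a \<Rightarrow> 'a list \<Rightarrow> bool" where
  "tangent_basis \<Sigma> p vs \<longleftrightarrow>
     distinct vs \<and> independent (set vs) \<and> span (set vs) = tangent_space \<Sigma> p"

text \<open>\<open>\<tau>\<^sub>\<Sigma>(p)\<close>, for an arbitrary choice of the basis.\<close>

definition tangent_multivector ::
    "('a::euclidean_space) graded_group \<Rightarrow> (nat \<Rightarrow> 'a) \<Rightarrow> 'a set \<Rightarrow> 'a \<Rightarrow> multivector" where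
  "tangent_multivector G e \<Sigma> p =
     simple_multivector G e p (SOME vs. tangent_basis \<Sigma> p vs)"

definition pointwise_degree ::
    "('a::euclidean_space) graded_group \<Rightarrow> (nat \<Rightarrow> 'a) \<Rightarrow> 'a set \<Rightarrow> 'a \<Rightarrow> nat" where
  "pointwise_degree G e \<Sigma> p =
     Max {M. degree_proj G M (tangent_multivector G e \<Sigma> p) \<noteq> (\<lambda>I. 0)}"

definition manifold_degree ::
    "('a::euclidean_space) graded_group \<Rightarrow> (nat \<Rightarrow> 'a) \<Rightarrow> 'a set \<Rightarrow> nat" where
  "manifold_degree G e \<Sigma> = Max (pointwise_degree G e \<Sigma> ` \<Sigma>)"

text \<open>The space \<open>\<A>\<^sub>p\<Sigma>\<close> of fields. The coefficients of \<open>X\<close> with respect to \<open>(X\<^sub>i)\<close> are those of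
  \<open>X p\<close> with respect to \<open>(X\<^sub>i(p))\<close>.\<close>

definition tangent_fields ::
    "('a::euclidean_space) graded_group \<Rightarrow> (nat \<Rightarrow> 'a) \<Rightarrow> 'a set \<Rightarrow> 'a \<Rightarrow> ('a \<Rightarrow> 'a) set" where
  "tangent_fields G e \<Sigma> p =
     {X \<in> left_invariant_fields G.
        vec_coeffs G e p (X p) \<and>\<^sub>m
          degree_proj G (pointwise_degree G e \<Sigma> p) (tangent_multivector G e \<Sigma> p) = (\<lambda>I. 0)}"

text \<open>\<open>A\<^sub>p\<Sigma> = exp \<A>\<^sub>p\<Sigma>\<close>, where \<open>exp X = X(0)\<close>.\<close>

definition homogeneous_tangent_space ::
    "('a::euclidean_space) graded_group \<Rightarrow> (nat \<Rightarrow> 'a) \<Rightarrow> 'a set \<Rightarrow> 'a \<Rightarrow> 'a set" where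
  "homogeneous_tangent_space G e \<Sigma> p = (\<lambda>X. X 0) ` tangent_fields G e \<Sigma> p"

definition algebraically_regular ::
    "('a::euclidean_space) graded_group \<Rightarrow> (nat \<Rightarrow> 'a) \<Rightarrow> 'a set \<Rightarrow> 'a \<Rightarrow> bool" where
  "algebraically_regular G e \<Sigma> p \<longleftrightarrow> lie_subalgebra G (tangent_fields G e \<Sigma> p)"

definition horizontal_point ::
    "('a::euclidean_space) graded_group \<Rightarrow> (nat \<Rightarrow> 'a) \<Rightarrow> 'a set \<Rightarrow> 'a \<Rightarrow> bool" where
  "horizontal_point G e \<Sigma> p \<longleftrightarrow>
     algebraically_regular G e \<Sigma> p \<and> horizontal_subgroup G (homogeneous_tangent_space G e \<Sigma> p)"

definition transversal_point ::
    "('a::euclidean_space) graded_group \<Rightarrow> (nat \<Rightarrow> 'a) \<Rightarrow> 'a set \<Rightarrow> 'a \<Rightarrow> bool" where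
  "transversal_point G e \<Sigma> p \<longleftrightarrow>
     algebraically_regular G e \<Sigma> p \<and> vertical_subgroup G (homogeneous_tangent_space G e \<Sigma> p)"

section \<open>Intrinsic measure\<close>

definition riemannian_metric :: "('a::euclidean_space \<Rightarrow> 'a \<Rightarrow> 'a \<Rightarrow> real) \<Rightarrow> bool" where
  "riemannian_metric g \<longleftrightarrow>
     (\<forall>p. bilinear (g p) \<and> (\<forall>v w. g p v w = g p w v) \<and> (\<forall>v. v \<noteq> 0 \<longrightarrow> g p v v > 0)) \<and>
     (\<forall>v w k. Ck_on k UNIV (\<lambda>p. g p v w))"

text \<open>\<open>\<sigma>\<close> is the Riemannian measure induced by \<open>g\<close> on \<open>\<Sigma>\<close>, extended by zero to a Borel measure
  on the ambient space: in every local parametrization \<open>\<Phi>\<close> its density with respect to Lebesgue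
  measure is the square root of the determinant of the metric coefficients
  \<open>g(\<partial>\<^sub>i\<Phi>, \<partial>\<^sub>j\<Phi>)\<close>. This determines \<open>\<sigma>\<close> uniquely.\<close>

definition riemannian_measure ::
    "'n::finite itself \<Rightarrow> ('a::euclidean_space \<Rightarrow> 'a \<Rightarrow> 'a \<Rightarrow> real) \<Rightarrow> 'a set \<Rightarrow> 'a measure \<Rightarrow> bool" where
  "riemannian_measure _ g \<Sigma> \<sigma> \<longleftrightarrow>
     sets \<sigma> = sets borel \<and> emeasure \<sigma> (- \<Sigma>) = 0 \<and>
     (\<forall>(V :: (real ^ 'n) set) \<Phi> B. local_param \<Sigma> V \<Phi> \<and> B \<in> sets borel \<and> B \<subseteq> \<Phi> ` V \<longrightarrow>
        emeasure \<sigma> B =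
          (\<integral>\<^sup>+ x \<in> V \<inter> \<Phi> -` B.
             ennreal (sqrt (gram_det UNIV (g (\<Phi> x))
               (\<lambda>i. frechet_derivative \<Phi> (at x) (axis i 1)))) \<partial>lborel))"

text \<open>\<open>\<tau>\<^sub>\<Sigma>(p)\<close> normalized by \<open>\<parallel>\<tau>\<^sub>\<Sigma>(p)\<parallel>\<^sub>g = 1\<close>; it is determined up to sign.\<close>

definition unit_tangent_multivector ::
    "('a::euclidean_space) graded_group \<Rightarrow> (nat \<Rightarrow> 'a) \<Rightarrow> ('a \<Rightarrow> 'a \<Rightarrow> 'a \<Rightarrow> real) \<Rightarrow> 'a set \<Rightarrow> 'a
       \<Rightarrow> multivector" where
  "unit_tangent_multivector G e g \<Sigma> p =
     simple_multivector G e p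
       (SOME vs. tangent_basis \<Sigma> p vs \<and> sqrt (gram_det {..<length vs} (g p) (\<lambda>i. vs ! i)) = 1)"

text \<open>\<open>\<mu>\<^sub>\<Sigma>\<close>, computed from the auxiliary metric \<open>g\<close> and its Riemannian measure \<open>\<sigma>\<close> on \<open>\<Sigma>\<close>.\<close>

definition intrinsic_measure ::
    "('a::euclidean_space) graded_group \<Rightarrow> (nat \<Rightarrow> 'a) \<Rightarrow> ('a \<Rightarrow> 'a \<Rightarrow> 'a \<Rightarrow> real) \<Rightarrow> 'a set
       \<Rightarrow> 'a measure \<Rightarrow> 'a measure" where
  "intrinsic_measure G e g \<Sigma> \<sigma> =
     density \<sigma> (\<lambda>p. if p \<in> \<Sigma>
       then ennreal (left_invariant_norm DIM('a)
         (degree_proj G (manifold_degree G e \<Sigma>) (unit_tangent_multivector G e g \<Sigma> p)))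
       else 0)"

section \<open>Federer density and spherical factor\<close>

definition diam :: "('a \<Rightarrow> 'a \<Rightarrow> real) \<Rightarrow> 'a set \<Rightarrow> real" where
  "diam d B = (SUP (x, y) \<in> B \<times> B. d x y)"

definition federer_density ::
    "('a \<Rightarrow> 'a \<Rightarrow> real) \<Rightarrow> real \<Rightarrow> 'a measure \<Rightarrow> 'a \<Rightarrow> ennreal" where
  "federer_density d \<alpha> \<mu> x =
     (INF \<epsilon>\<in>{0<..}.
        SUP B \<in> {B. (\<exists>y r. r > 0 \<and> B = Metric_space.mcball UNIV d y r) \<and> x \<in> B \<and> diam d B < \<epsilon>}.
          ennreal (2 powr \<alpha>) * emeasure \<mu> B / ennreal (diam d B powr \<alpha>))"

text \<open>Hausdorff measure of dimension \<open>n \<ge> 1\<close> without normalizing factor. The covering sets are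
  required to be bounded since \<^const>\<open>diameter\<close> is only meaningful for such sets.\<close>

definition hausdorff_raw :: "nat \<Rightarrow> 'a::metric_space set \<Rightarrow> ennreal" where
  "hausdorff_raw n E =
     (SUP \<delta>\<in>{0<..}.
        INF C \<in> {C :: nat \<Rightarrow> 'a set. E \<subseteq> \<Union> (range C) \<and> (\<forall>i. bounded (C i) \<and> diameter (C i) \<le> \<delta>)}.
          \<Sum>i. ennreal (diameter (C i) ^ n))"

text \<open>The Hausdorff measure of dimension \<open>n = CARD('n)\<close>, normalized by giving measure \<open>1\<close> to the
  unit cube of \<open>\<real>\<^sup>n\<close>. By isometry invariance and the uniqueness of translation invariant measures
  it agrees with Lebesgue measure on every \<open>n\<close>-dimensional affine subspace.\<close>

definition hausdorff :: "'n::finite itself \<Rightarrow> 'a::metric_space set \<Rightarrow> ennreal" where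
  "hausdorff _ E = hausdorff_raw CARD('n) E / hausdorff_raw CARD('n) (cbox 0 One :: (real ^ 'n) set)"

definition spherical_factor ::
    "'n::finite itself \<Rightarrow> ('a::euclidean_space \<Rightarrow> 'a \<Rightarrow> real) \<Rightarrow> 'a set \<Rightarrow> ennreal" where
  "spherical_factor n d S =
     (GREATEST c. \<exists>u. d u 0 \<le> 1 \<and> c = hausdorff n (Metric_space.mcball UNIV d u 1 \<inter> S))"

end

theory Submission
  imports Defs
begin

text \<open>Translate \<open>p\<close> to the identity. The homogeneous tangent space \<open>A\<close> of \<open>\<Sigma>\<close> at \<open>p\<close> has an
  orthonormal basis of vectors \<open>a\<^sub>i\<close> lying in layers of degree \<open>k\<^sub>i\<close>, where \<open>\<Sum>\<^sub>i k\<^sub>i = N\<close>, and near the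
  identity \<open>\<Sigma>\<close> is a graph over \<open>A\<close> whose left translated tangent spaces are spanned by vectors
  \<open>a\<^sub>i + m\<^sub>i\<close> with \<open>m\<^sub>i\<close> orthogonal to \<open>A\<close>. A component of \<open>m\<^sub>i\<close> of degree larger than \<open>k\<^sub>i\<close> would
  give \<open>\<Sigma>\<close> a degree larger than \<open>N\<close> at a nearby point, so there is none, and the component of degree
  \<open>k\<^sub>i\<close> vanishes at \<open>p\<close>. Hence the tangent spaces of the dilated graphs converge to \<open>A\<close>; integrating
  along rays with Gronwall's inequality, the dilated graphs converge to \<open>A\<close> uniformly on compact sets.
  The measure blows up to Lebesgue measure on \<open>A\<close>, and comparing balls with slightly
  enlarged balls identifies the density with the supremum over \<open>u\<close> of the volumes of the slices
  \<open>B(u, 1) \<inter> A\<close>. These volumes are upper semicontinuous in \<open>u\<close>, so the supremum is attained.\<close>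

subsection \<open>Multivectors in coordinates\<close>

text \<open>Rescaling divides the component of the graph in the layer of degree \<open>j\<close> by
  \<open>s ^ j\<close>, while C1 regularity controls only first order errors, so a Taylor expansion
  cannot give the limit for \<open>j > 1\<close>. A differential equation gives it. Dilations
  intertwine left translations, so a rescaled ray has its left translated velocity in the span of
  the vectors \<open>a_i + s^(k_i) dl (1/s) m_i\<close>, where the degree \<open>j\<close> part of
  \<open>m_i\<close> carries the factor \<open>s^(k_i - j)\<close>. Negative exponents do not occur
  because the degree is at most \<open>N\<close> at every point near \<open>p\<close>, not just at
  \<open>p\<close>; exponent 0 is harmless because that part is continuous and vanishes at
  \<open>p\<close>; positive exponents give decay. The limit equation is solved over each ray by the
  ray itself, since lines through 0 are one-parameter subgroups. Parametrizing by the orthogonal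
  projection to \<open>A\<close> makes the density of the measure equal to 1 at \<open>p\<close>,
  and dilations multiply volumes in \<open>A\<close> by \<open>s^N\<close>, so no constant remains.
  Two comparisons have to be made beforehand: of \<open>d\<close> with the Euclidean topology, and
  of Hausdorff with Lebesgue measure.\<close>

definition inv_sign :: "nat set \<Rightarrow> nat \<Rightarrow> real" where
  "inv_sign K i = (- 1) ^ card {j \<in> K. j < i}"

lemma inv_sign_square [simp]: "inv_sign K i * inv_sign K i = 1"
  by (simp add: inv_sign_def flip: power_mult_distrib)

lemma inv_sign_remove:
  assumes "finite K" "j \<in> K"
  shows "inv_sign (K - {j}) i = (if j < i then - inv_sign K i else inv_sign K i)"
proof (cases "j < i")
  case True
  have "{l \<in> K. l < i} = insert j {l \<in> K - {j}. l < i}" using True assms by auto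
  then have "card {l \<in> K. l < i} = Suc (card {l \<in> K - {j}. l < i})" using assms by simp
  then show ?thesis using True by (simp add: inv_sign_def)
next
  case False
  then have "{l \<in> K - {j}. l < i} = {l \<in> K. l < i}" by auto
  then show ?thesis using False by (simp add: inv_sign_def)
qed

lemma inv_sign_insert:
  assumes "finite K" "j \<notin> K"
  shows "inv_sign (insert j K) i = (if j < i then - inv_sign K i else inv_sign K i)"
  using inv_sign_remove[of "insert j K" j i] assms by auto

definition vec_mv :: "(nat \<Rightarrow> 'a::euclidean_space) \<Rightarrow> 'a \<Rightarrow> multivector" where
  "vec_mv e v I = (\<Sum>i\<in>{1..DIM('a)}. if I = {i} then v \<bullet> e i else 0)"

definition wedge_list :: "(nat \<Rightarrow> 'a::euclidean_space) \<Rightarrow> 'a list \<Rightarrow> multivector" where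
  "wedge_list e vs = foldr (\<and>\<^sub>m) (map (vec_mv e) vs) (\<lambda>I. if I = {} then 1 else 0)"

lemma wedge_list_Nil: "wedge_list e [] K = (if K = {} then 1 else 0)"
  by (simp add: wedge_list_def)

lemma wedge_list_Cons: "wedge_list e (v # vs) = vec_mv e v \<and>\<^sub>m wedge_list e vs"
  by (simp add: wedge_list_def)

text \<open>Expansion along the first factor: \<open>vec_mv\<close> lives on singletons, and for the
  singleton of \<open>i\<close> the inversion count in \<open>wedge\<close> is the number of
  elements of \<open>K\<close> below \<open>i\<close>. All later wedge products are computed through
  this formula.\<close>

lemma vec_mv_wedge:
  fixes e :: "nat \<Rightarrow> 'a::euclidean_space"
  assumes K: "finite K"
  shows "(vec_mv e v \<and>\<^sub>m X) K =
    (\<Sum>i\<in>K \<inter> {1..DIM('a)}. inv_sign K i * (v \<bullet> e i) * X (K - {i}))"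
proof -
  let ?f = "\<lambda>I. (- 1) ^ card {(i, j). i \<in> I \<and> j \<in> K - I \<and> j < i} * vec_mv e v I * X (K - I)"
  have "(vec_mv e v \<and>\<^sub>m X) K = (\<Sum>I\<in>Pow K. ?f I)" by (simp add: wedge_def)
  also have "\<dots> = (\<Sum>I\<in>(\<lambda>i. {i}) ` (K \<inter> {1..DIM('a)}). ?f I)"
  proof (rule sum.mono_neutral_right)
    show "\<forall>I\<in>Pow K - (\<lambda>i. {i}) ` (K \<inter> {1..DIM('a)}). ?f I = 0"
    proof
      fix I assume I: "I \<in> Pow K - (\<lambda>i. {i}) ` (K \<inter> {1..DIM('a)})"
      then have "vec_mv e v I = 0" unfolding vec_mv_def by (intro sum.neutral) auto
      then show "?f I = 0" by simp
    qed
  qed (use K in auto)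
  also have "\<dots> = (\<Sum>i\<in>K \<inter> {1..DIM('a)}. ?f {i})"
    by (subst sum.reindex) auto
  also have "\<dots> = (\<Sum>i\<in>K \<inter> {1..DIM('a)}. inv_sign K i * (v \<bullet> e i) * X (K - {i}))"
  proof (rule sum.cong[OF refl])
    fix i assume i: "i \<in> K \<inter> {1..DIM('a)}"
    have "{(i', j). i' \<in> {i} \<and> j \<in> K - {i} \<and> j < i'} = Pair i ` {j \<in> K. j < i}" by auto
    then have "card {(i', j). i' \<in> {i} \<and> j \<in> K - {i} \<and> j < i'} = card {j \<in> K. j < i}"
      by (simp add: card_image inj_on_def)
    moreover have "vec_mv e v {i} = v \<bullet> e i" using i by (simp add: vec_mv_def)
    ultimately show "?f {i} = inv_sign K i * (v \<bullet> e i) * X (K - {i})" by (simp add: inv_sign_def)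
  qed
  finally show ?thesis .
qed

lemma wedge_infinite: "infinite K \<Longrightarrow> (X \<and>\<^sub>m Y) K = 0"
  by (simp add: wedge_def)

lemma wedge_list_infinite: "infinite K \<Longrightarrow> wedge_list e vs K = 0"
  by (cases vs) (auto simp: wedge_list_Nil wedge_list_Cons wedge_infinite)

lemma wedge_list_outside:
  fixes e :: "nat \<Rightarrow> 'a::euclidean_space"
  assumes "\<not> K \<subseteq> {1..DIM('a)}" shows "wedge_list e vs K = 0"
  using assms
proof (induction vs arbitrary: K)
  case Nil
  then show ?case by (auto simp: wedge_list_Nil)
next
  case (Cons v vs)
  show ?case
  proof (cases "finite K")
    case True
    have "wedge_list e vs (K - {i}) = 0" if "i \<in> {1..DIM('a)}" for i
      using Cons that by (intro Cons.IH) auto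
    then show ?thesis unfolding wedge_list_Cons vec_mv_wedge[OF True] by (intro sum.neutral) auto
  qed (simp add: wedge_list_infinite)
qed

lemma wedge_list_linear:
  "wedge_list e (xs @ (a *\<^sub>R x + b *\<^sub>R y) # ys) K =
    a * wedge_list e (xs @ x # ys) K + b * wedge_list e (xs @ y # ys) K"
proof (induction xs arbitrary: K)
  case Nil
  show ?case
  proof (cases "finite K")
    case True
    show ?thesis unfolding append_Nil wedge_list_Cons vec_mv_wedge[OF True]
      by (simp add: inner_add_left sum_distrib_left sum.distrib[symmetric] algebra_simps)
  qed (simp add: wedge_list_infinite)
next
  case (Cons v xs)
  show ?case
  proof (cases "finite K")
    case True
    show ?thesis unfolding append_Cons wedge_list_Cons vec_mv_wedge[OF True] Cons
      by (simp add: sum_distrib_left sum.distrib[symmetric] algebra_simps)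
  qed (simp add: wedge_list_infinite)
qed

lemma sum_antisymmetric_zero:
  fixes F :: "'i \<Rightarrow> 'i \<Rightarrow> real"
  assumes "\<And>i j. i \<in> A \<Longrightarrow> j \<in> A \<Longrightarrow> F i j = - F j i"
  shows "(\<Sum>i\<in>A. \<Sum>j\<in>A. F i j) = 0"
proof -
  have "(\<Sum>i\<in>A. \<Sum>j\<in>A. F i j) = (\<Sum>i\<in>A. \<Sum>j\<in>A. - F j i)"
    by (intro sum.cong refl assms)
  also have "\<dots> = - (\<Sum>i\<in>A. \<Sum>j\<in>A. F j i)" by (simp only: sum_negf)
  also have "(\<Sum>i\<in>A. \<Sum>j\<in>A. F j i) = (\<Sum>i\<in>A. \<Sum>j\<in>A. F i j)" by (rule sum.swap)
  finally show ?thesis by simp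
qed

text \<open>Expanding both copies of \<open>u\<close> gives a sum over ordered pairs of distinct
  indices. Taking out the smaller index flips the sign of the larger one, but not conversely, so the
  summand is antisymmetric.\<close>

lemma wedge_list_repeat: "wedge_list e (xs @ u # u # ys) K = 0"
  for e :: "nat \<Rightarrow> 'a::euclidean_space"
proof (induction xs arbitrary: K)
  case Nil
  let ?Q = "{1..DIM('a)}" and ?X = "wedge_list e ys"
  show ?case
  proof (cases "finite K")
    case True
    \<comment> \<open>The diagonal, absent from the inner sum over \<open>K - {i}\<close>, is filled
      with zeros so that both indices run over the same set.\<close>
    define F where "F i j = (if i = j then 0 else
        inv_sign K i * (u \<bullet> e i) * (inv_sign (K - {i}) j * (u \<bullet> e j) * ?X (K - {i} - {j})))" for i j
    have "wedge_list e (u # u # ys) K = (\<Sum>i\<in>K \<inter> ?Q. \<Sum>j\<in>(K - {i}) \<inter> ?Q.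
        inv_sign K i * (u \<bullet> e i) * (inv_sign (K - {i}) j * (u \<bullet> e j) * ?X (K - {i} - {j})))"
      using True by (simp add: wedge_list_Cons vec_mv_wedge sum_distrib_left)
    also have "\<dots> = (\<Sum>i\<in>K \<inter> ?Q. \<Sum>j\<in>K \<inter> ?Q. F i j)"
    proof (rule sum.cong[OF refl])
      fix i assume i: "i \<in> K \<inter> ?Q"
      have "(\<Sum>j\<in>K \<inter> ?Q. F i j) = (\<Sum>j\<in>(K - {i}) \<inter> ?Q. F i j)"
        using True by (intro sum.mono_neutral_right) (auto simp: F_def)
      then show "(\<Sum>j\<in>(K - {i}) \<inter> ?Q.
        inv_sign K i * (u \<bullet> e i) * (inv_sign (K - {i}) j * (u \<bullet> e j) * ?X (K - {i} - {j}))) = (\<Sum>j\<in>K \<inter> ?Q. F i j)"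
        by (simp only:) (rule sum.cong, auto simp: F_def)
    qed
    also have "\<dots> = 0"
    proof (rule sum_antisymmetric_zero)
      fix i j assume ij: "i \<in> K \<inter> ?Q" "j \<in> K \<inter> ?Q"
      have "K - {i} - {j} = K - {j} - {i}" by auto
      then show "F i j = - F j i" using ij True
        by (cases i j rule: linorder_cases) (auto simp: F_def inv_sign_remove)
    qed
    finally show ?thesis by simp
  qed (simp add: wedge_list_infinite)
next
  case (Cons v xs)
  show ?case
  proof (cases "finite K")
    case True
    show ?thesis unfolding append_Cons wedge_list_Cons vec_mv_wedge[OF True] Cons by simp
  qed (simp add: wedge_list_infinite)
qed

text \<open>Polarization: the product with \<open>x + y\<close> in both places vanishes.\<close>

lemma wedge_list_swap: "wedge_list e (xs @ x # y # ys) K = - wedge_list e (xs @ y # x # ys) K"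
proof -
  have "wedge_list e (xs @ (1 *\<^sub>R x + 1 *\<^sub>R y) # (x + y) # ys) K = 0"
    using wedge_list_repeat[of e xs "x + y" ys K] by simp
  then have "wedge_list e (xs @ x # (x + y) # ys) K + wedge_list e (xs @ y # (x + y) # ys) K = 0"
    unfolding wedge_list_linear by simp
  moreover have "wedge_list e (xs @ z # (x + y) # ys) K =
      wedge_list e (xs @ z # x # ys) K + wedge_list e (xs @ z # y # ys) K" for z
    using wedge_list_linear[of e "xs @ [z]" 1 x 1 y ys K] by simp
  ultimately show ?thesis by (simp add: wedge_list_repeat)
qed

lemma wedge_list_alternating: "wedge_list e (xs @ u # ys @ u # zs) K = 0"
proof (induction ys arbitrary: xs)
  case Nil
  then show ?case by (simp add: wedge_list_repeat)
next
  case (Cons y ys)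
  show ?case using wedge_list_swap[of e xs u y "ys @ u # zs" K] Cons[of "xs @ [y]"] by simp
qed

section \<open>Alternating forms, determinants and Gram determinants\<close>

lemma alternating_det:
  fixes D :: "('n::finite \<Rightarrow> 'a::real_vector) \<Rightarrow> real"
  assumes lin: "\<And>u i a x b y. D (u(i := a *\<^sub>R x + b *\<^sub>R y)) = a * D (u(i := x)) + b * D (u(i := y))"
    and alt: "\<And>u i j. i \<noteq> j \<Longrightarrow> u i = u j \<Longrightarrow> D u = 0"
  shows "D (\<lambda>i. \<Sum>j\<in>UNIV. C $ i $ j *\<^sub>R u j) = det C * D u"
proof -
  have zero: "D u = 0" if "u i = 0" for u i
    using lin[of u i 0 0 0 0] that by (simp add: fun_upd_idem)
  have scale: "D (u(i := a *\<^sub>R x)) = a * D (u(i := x))" for u i a x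
    using lin[of u i a x 0 0] by simp
  have add: "D (u(i := x + y)) = D (u(i := x)) + D (u(i := y))" for u i x y
    using lin[of u i 1 x 1 y] by simp
  have swap: "D (u \<circ> Transposition.transpose m n) = - D u" if "m \<noteq> n" for u m n
  proof -
    let ?s = "u m + u n"
    have "D (u(m := ?s, n := ?s)) = 0" using that by (intro alt[of m n]) auto
    moreover have "D (u(m := ?s, n := ?s)) = D (u(m := ?s, n := u m)) + D (u(m := ?s, n := u n))"
      by (rule add)
    moreover have "D (u(m := ?s, n := z)) = D (u(m := u m, n := z)) + D (u(m := u n, n := z))" for z
      using add[of "u(n := z)" m "u m" "u n"] unfolding fun_upd_twist[OF that, of u _ z] .
    moreover have "D (u(m := u m, n := u m)) = 0" "D (u(m := u n, n := u n)) = 0"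
      using that by (auto intro!: alt[of m n])
    moreover have "u(m := u n, n := u m) = u \<circ> Transposition.transpose m n"
      using that by (auto simp add: fun_eq_iff Transposition.transpose_def)
    moreover have "u(m := u m, n := u n) = u" by auto
    ultimately show ?thesis by simp
  qed
  \<comment> \<open>Induction over row operations: a zero row makes both sides 0, a diagonal matrix
    scales each slot, and adding a multiple of another row changes nothing by alternation. The claim
    is for all \<open>u\<close> because a column swap permutes \<open>u\<close>.\<close>
  have "\<forall>u. D (\<lambda>i. \<Sum>j\<in>UNIV. C $ i $ j *\<^sub>R u j) = det C * D u"
  proof (rule induct_matrix_row_operations, goal_cases)
    case zero_row: (1 A i)
    show ?case
    proof
      fix u :: "'n \<Rightarrow> 'a"
      have "(\<Sum>j\<in>UNIV. A $ i $ j *\<^sub>R u j) = 0"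
        using zero_row by (auto simp: row_def vec_eq_iff)
      then show "D (\<lambda>i. \<Sum>j\<in>UNIV. A $ i $ j *\<^sub>R u j) = det A * D u"
        using zero[of _ i] det_zero_row(1)[OF zero_row] by simp
    qed
  next
    case diagonal: (2 A)
    show ?case
    proof
      fix u :: "'n \<Rightarrow> 'a"
      have *: "D (\<lambda>i. if i \<in> S then A $ i $ i *\<^sub>R u i else u i) = (\<Prod>i\<in>S. A $ i $ i) * D u"
        if "finite S" for S
        using that
      proof induction
        case (insert x S)
        let ?w = "\<lambda>i. if i \<in> S then A $ i $ i *\<^sub>R u i else u i"
        have "(\<lambda>i. if i \<in> insert x S then A $ i $ i *\<^sub>R u i else u i) = ?w(x := A $ x $ x *\<^sub>R u x)"
          by auto
        moreover have "?w(x := u x) = ?w" using insert by auto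
        ultimately show ?case using insert scale[of ?w x "A $ x $ x" "u x"] by simp
      qed simp
      have "(\<Sum>j\<in>UNIV. A $ i $ j *\<^sub>R u j) = A $ i $ i *\<^sub>R u i" for i
      proof -
        have "(\<Sum>j\<in>UNIV. A $ i $ j *\<^sub>R u j) = (\<Sum>j\<in>UNIV. if j = i then A $ i $ i *\<^sub>R u i else 0)"
          using diagonal by (intro sum.cong) auto
        then show ?thesis by simp
      qed
      then show "D (\<lambda>i. \<Sum>j\<in>UNIV. A $ i $ j *\<^sub>R u j) = det A * D u"
        using *[of UNIV] det_diagonal[of A] diagonal by simp
    qed
  next
    case swap_cols: (3 A m n)
    let ?t = "Transposition.transpose m n"
    show ?case
    proof
      fix u :: "'n \<Rightarrow> 'a"
      have "(\<Sum>j\<in>UNIV. A $ i $ ?t j *\<^sub>R u j) = (\<Sum>j\<in>UNIV. A $ i $ j *\<^sub>R (u \<circ> ?t) j)" for i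
        by (rule sum.reindex_bij_witness[of _ ?t ?t]) auto
      then have "D (\<lambda>i. \<Sum>j\<in>UNIV. (\<chi> i j. A $ i $ ?t j) $ i $ j *\<^sub>R u j) = det A * D (u \<circ> ?t)"
        using swap_cols(1) by (simp only: vec_lambda_beta)
      also have "\<dots> = - det A * D u" using swap[OF swap_cols(2)] by simp
      also have "- det A = det (\<chi> i j. A $ i $ ?t j)"
        using swap_cols(2) det_permute_columns[of ?t A] by (simp add: permutes_swap_id sign_swap_id)
      finally show "D (\<lambda>i. \<Sum>j\<in>UNIV. (\<chi> i j. A $ i $ ?t j) $ i $ j *\<^sub>R u j) =
          det (\<chi> i j. A $ i $ ?t j) * D u" .
    qed
  next
    case row_op: (4 A m n c)
    let ?A = "\<chi> i. if i = m then row m A + c *\<^sub>R row n A else row i A"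
    show ?case
    proof
      fix u :: "'n \<Rightarrow> 'a"
      let ?f = "\<lambda>i. \<Sum>j\<in>UNIV. A $ i $ j *\<^sub>R u j"
      have "(\<lambda>i. \<Sum>j\<in>UNIV. ?A $ i $ j *\<^sub>R u j) = ?f(m := ?f m + c *\<^sub>R ?f n)"
        by (auto simp: fun_eq_iff row_def scaleR_add_left sum.distrib scaleR_right.sum)
      then have "D (\<lambda>i. \<Sum>j\<in>UNIV. ?A $ i $ j *\<^sub>R u j) = D (?f(m := ?f m)) + c * D (?f(m := ?f n))"
        using add[of ?f m "?f m" "c *\<^sub>R ?f n"] scale[of ?f m c "?f n"] by simp
      also have "D (?f(m := ?f n)) = 0" using row_op(2) by (intro alt[of m n]) auto
      also have "?f(m := ?f m) = ?f" by (rule fun_upd_triv)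
      finally have "D (\<lambda>i. \<Sum>j\<in>UNIV. ?A $ i $ j *\<^sub>R u j) = D ?f" by simp
      moreover have "det ?A = det A"
        using det_row_operation[OF row_op(2), of A c] unfolding scalar_mult_eq_scaleR .
      ultimately show "D (\<lambda>i. \<Sum>j\<in>UNIV. ?A $ i $ j *\<^sub>R u j) = det ?A * D u"
        using row_op(1) by simp
    qed
  qed
  then show ?thesis by blast
qed

lemma wedge_list_change_basis:
  fixes hs :: "'n::finite list" and e :: "nat \<Rightarrow> 'a::euclidean_space"
  assumes hs: "distinct hs" "set hs = UNIV"
  shows "wedge_list e (map (\<lambda>i. \<Sum>j\<in>UNIV. C $ i $ j *\<^sub>R u j) hs) K = det C * wedge_list e (map u hs) K"
proof (rule alternating_det[where D = "\<lambda>u. wedge_list e (map u hs) K"])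
  fix u :: "'n \<Rightarrow> 'a" and i a x b y
  have "i \<in> set hs" using hs by simp
  then obtain xs ys where s: "hs = xs @ i # ys" by (meson split_list)
  then have "i \<notin> set xs" "i \<notin> set ys" using hs(1) by auto
  then have "map (u(i := z)) hs = map u xs @ z # map u ys" for z by (simp add: s)
  then show "wedge_list e (map (u(i := a *\<^sub>R x + b *\<^sub>R y)) hs) K =
      a * wedge_list e (map (u(i := x)) hs) K + b * wedge_list e (map (u(i := y)) hs) K"
    by (simp add: wedge_list_linear)
next
  have *: "wedge_list e (map u (xs @ i # ys @ j # zs)) K = 0" if "u i = u j" for u :: "'n \<Rightarrow> 'a" and i j xs ys zs
    using wedge_list_alternating[of e "map u xs" "u j" "map u ys" "map u zs" K] that by simp
  fix u :: "'n \<Rightarrow> 'a" and i j assume ij: "i \<noteq> j" "u i = u j"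
  obtain xs ys where s: "hs = xs @ i # ys" using hs by (metis UNIV_I split_list)
  have "j \<in> set hs" using hs(2) by simp
  then have "j \<in> set xs \<or> j \<in> set ys" using s ij by auto
  then show "wedge_list e (map u hs) K = 0"
  proof
    assume "j \<in> set xs"
    then obtain xs1 xs2 where "xs = xs1 @ j # xs2" by (meson split_list)
    then show ?thesis using *[of u j i xs1 xs2 ys] ij s by simp
  next
    assume "j \<in> set ys"
    then obtain xs1 xs2 where "ys = xs1 @ j # xs2" by (meson split_list)
    then show ?thesis using *[of u i j xs xs1 xs2] ij s by simp
  qed
qed

lemma gram_det_UNIV: "gram_det (UNIV :: 'n::finite set) B v = det (\<chi> i j. B (v i) (v j))"
  by (simp add: gram_det_def det_def)

text \<open>The Gram matrix transforms by congruence with \<open>C\<close>, which accounts for the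
  square.\<close>

lemma gram_det_change_basis:
  fixes u :: "'n::finite \<Rightarrow> 'a::real_vector"
  assumes B: "bilinear B"
  shows "gram_det UNIV B (\<lambda>i. \<Sum>j\<in>UNIV. C $ i $ j *\<^sub>R u j) = (det C)\<^sup>2 * gram_det UNIV B u"
proof -
  interpret l: linear "B x" for x using B by (simp add: bilinear_def)
  interpret r: linear "\<lambda>x. B x y" for y using B by (simp add: bilinear_def)
  let ?G = "\<chi> i j. B (u i) (u j)"
  have "(\<chi> i k. B (\<Sum>j\<in>UNIV. C $ i $ j *\<^sub>R u j) (\<Sum>l\<in>UNIV. C $ k $ l *\<^sub>R u l)) = C ** ?G ** transpose C"
  proof -
    have "B (\<Sum>j\<in>UNIV. C $ i $ j *\<^sub>R u j) (\<Sum>l\<in>UNIV. C $ k $ l *\<^sub>R u l) =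
        (\<Sum>l\<in>UNIV. C $ k $ l * (\<Sum>j\<in>UNIV. C $ i $ j * B (u j) (u l)))" for i k
      by (simp only: l.sum l.scale r.sum r.scale real_scaleR_def)
    then show ?thesis
      by (simp add: vec_eq_iff matrix_matrix_mult_def transpose_def mult.commute)
  qed
  then show ?thesis unfolding gram_det_UNIV
    by (simp add: det_mul det_transpose power2_eq_square)
qed

text \<open>Conjugation with \<open>h\<close> carries permutations of the type to permutations of
  \<open>A\<close> and keeps the sign. This links lists indexed by numbers, as in
  \<open>unit_tangent_multivector\<close>, to families indexed by \<open>'n\<close>, as in
  \<open>riemannian_measure\<close>.\<close>

lemma gram_det_reindex:
  fixes h :: "'n::finite \<Rightarrow> nat"
  assumes h: "bij_betw h UNIV A"
  shows "gram_det A B v = gram_det UNIV B (v \<circ> h)"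
proof -
  have inj: "inj h" and A: "h ` UNIV = A" using h by (auto simp: bij_betw_def)
  have fA: "finite A" using A by (metis finite finite_imageI)
  let ?m = "map_permutation UNIV h" and ?m' = "map_permutation A (inv h)"
  have h': "bij_betw (inv h) A UNIV" using bij_betw_inv_into[OF h] .
  show ?thesis unfolding gram_det_def
  proof (rule sum.reindex_bij_witness[of _ ?m ?m'])
    fix p assume p: "p \<in> {p. p permutes A}"
    show "?m (?m' p) = p"
      using p h' A inj by (intro map_permutation_compose_inv) (auto simp: f_inv_into_f)
    show *: "?m' p \<in> {p. p permutes UNIV}"
      using p map_permutation_permutes[OF h'] by simp
    have "h (?m' p i) = p (h i)" for i
    proof -
      have "?m' p (inv h (h i)) = inv h (p (h i))"
        using p A h' by (intro map_permutation_apply) (auto simp: bij_betw_def)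
      moreover have "p (h i) \<in> A" using p A by (auto simp: permutes_in_image)
      ultimately show ?thesis using inj A by (simp add: f_inv_into_f)
    qed
    moreover have "sign (?m' p) = sign p"
      using p h' fA by (intro sign_map_permutation) (auto simp: bij_betw_def)
    moreover have "(\<Prod>i\<in>A. B (v i) (v (p i))) = (\<Prod>i\<in>UNIV. B (v (h i)) (v (p (h i))))"
      using prod.reindex[OF inj, of "\<lambda>i. B (v i) (v (p i))"] A by (simp add: o_def)
    ultimately show "of_int (sign (?m' p)) * (\<Prod>i\<in>UNIV. B ((v \<circ> h) i) ((v \<circ> h) (?m' p i))) =
      of_int (sign p) * (\<Prod>i\<in>A. B (v i) (v (p i)))" by simp
  next
    fix p :: "'n \<Rightarrow> 'n" assume p: "p \<in> {p. p permutes UNIV}"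
    show "?m' (?m p) = p"
      using p h inj by (intro map_permutation_compose_inv) auto
    show "?m p \<in> {p. p permutes A}"
      using p map_permutation_permutes[OF h] by simp
  qed
qed


section \<open>Interior products and the pairing of multivectors\<close>

definition contract :: "(nat \<Rightarrow> 'a::euclidean_space) \<Rightarrow> 'a \<Rightarrow> multivector \<Rightarrow> multivector" where
  "contract e v Y I = (\<Sum>i\<in>{1..DIM('a)} - I. inv_sign I i * (v \<bullet> e i) * Y (insert i I))"

definition mv_inner :: "nat \<Rightarrow> multivector \<Rightarrow> multivector \<Rightarrow> real" where
  "mv_inner q X Y = (\<Sum>K\<in>Pow {1..q}. X K * Y K)"

text \<open>Pairs with \<open>i \<in> K\<close> correspond to pairs with \<open>i \<notin> I\<close>
  through \<open>I = K - {i}\<close>, and removing \<open>i\<close> leaves the sign attached to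
  \<open>i\<close> unchanged. So \<open>contract\<close> is the interior product, adjoint to
  exterior multiplication.\<close>

lemma mv_inner_wedge_contract:
  fixes e :: "nat \<Rightarrow> 'a::euclidean_space"
  shows "mv_inner DIM('a) (vec_mv e v \<and>\<^sub>m X) Y = mv_inner DIM('a) X (contract e v Y)"
proof -
  let ?Q = "{1..DIM('a)}"
  have fin: "finite K" if "K \<in> Pow ?Q" for K using that finite_subset by auto
  have "mv_inner DIM('a) (vec_mv e v \<and>\<^sub>m X) Y
      = (\<Sum>K\<in>Pow ?Q. \<Sum>i\<in>K. inv_sign K i * (v \<bullet> e i) * X (K - {i}) * Y K)"
    unfolding mv_inner_def
  proof (rule sum.cong[OF refl])
    fix K assume K: "K \<in> Pow ?Q"
    then have "K \<inter> ?Q = K" by auto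
    then show "(vec_mv e v \<and>\<^sub>m X) K * Y K = (\<Sum>i\<in>K. inv_sign K i * (v \<bullet> e i) * X (K - {i}) * Y K)"
      unfolding vec_mv_wedge[OF fin[OF K]] by (simp only: sum_distrib_right)
  qed
  also have "\<dots> = (\<Sum>(K, i)\<in>Sigma (Pow ?Q) (\<lambda>K. K). inv_sign K i * (v \<bullet> e i) * X (K - {i}) * Y K)"
    by (rule sum.Sigma) (use fin in auto)
  also have "\<dots> = (\<Sum>(I, i)\<in>Sigma (Pow ?Q) (\<lambda>I. ?Q - I). X I * (inv_sign I i * (v \<bullet> e i) * Y (insert i I)))"
    by (rule sum.reindex_bij_witness[of _ "\<lambda>(I, i). (insert i I, i)" "\<lambda>(K, i). (K - {i}, i)"])
       (use fin in \<open>auto simp: inv_sign_remove insert_absorb mult_ac\<close>)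
  also have "\<dots> = (\<Sum>I\<in>Pow ?Q. \<Sum>i\<in>?Q - I. X I * (inv_sign I i * (v \<bullet> e i) * Y (insert i I)))"
    by (rule sum.Sigma[symmetric]) auto
  also have "\<dots> = mv_inner DIM('a) X (contract e v Y)"
    by (simp add: mv_inner_def contract_def sum_distrib_left)
  finally show ?thesis .
qed

text \<open>The Leibniz rule of the interior product. The terms that insert and remove the same
  index come from outside \<open>I\<close> on the left and from inside \<open>I\<close> on the
  right, and together give the full scalar product. For two different indices the order of insertion
  and removal costs one sign, so these terms cancel.\<close>

lemma contract_wedge:
  fixes e :: "nat \<Rightarrow> 'a::euclidean_space"
  assumes I: "I \<subseteq> {1..DIM('a)}"
  shows "contract e v (vec_mv e b \<and>\<^sub>m Y) I =
    (\<Sum>i\<in>{1..DIM('a)}. (v \<bullet> e i) * (b \<bullet> e i)) * Y I - (vec_mv e b \<and>\<^sub>m contract e v Y) I"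
proof -
  let ?Q = "{1..DIM('a)}"
  have fI: "finite I" using I finite_subset by auto
  define T where "T i j = inv_sign I i * (v \<bullet> e i) * (inv_sign (insert i I) j * (b \<bullet> e j) * Y (insert i I - {j}))" for i j
  define R where "R i j = inv_sign I j * (b \<bullet> e j) * (inv_sign (I - {j}) i * (v \<bullet> e i) * Y (insert i (I - {j})))" for i j
  have L: "contract e v (vec_mv e b \<and>\<^sub>m Y) I =
      (\<Sum>i\<in>?Q - I. (v \<bullet> e i) * (b \<bullet> e i) * Y I) + (\<Sum>i\<in>?Q - I. \<Sum>j\<in>I. T i j)"
    unfolding contract_def sum.distrib[symmetric]
  proof (rule sum.cong[OF refl])
    fix i assume i: "i \<in> ?Q - I"
    then have Q: "insert i I \<inter> ?Q = insert i I" using I by auto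
    have f: "finite (insert i I)" using fI by simp
    have "inv_sign I i * (v \<bullet> e i) * (vec_mv e b \<and>\<^sub>m Y) (insert i I) = (\<Sum>j\<in>insert i I. T i j)"
      unfolding vec_mv_wedge[OF f] Q T_def by (simp only: sum_distrib_left)
    also have "\<dots> = T i i + (\<Sum>j\<in>I. T i j)" using fI i by simp
    also have "T i i = inv_sign I i * inv_sign I i * (v \<bullet> e i) * (b \<bullet> e i) * Y I"
      using i fI by (simp add: T_def inv_sign_insert)
    finally show "inv_sign I i * (v \<bullet> e i) * (vec_mv e b \<and>\<^sub>m Y) (insert i I) =
        (v \<bullet> e i) * (b \<bullet> e i) * Y I + (\<Sum>j\<in>I. T i j)" by simp
  qed
  have IQ: "I \<inter> ?Q = I" using I by auto
  have Rr: "(vec_mv e b \<and>\<^sub>m contract e v Y) I =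
      (\<Sum>j\<in>I. (v \<bullet> e j) * (b \<bullet> e j) * Y I) + (\<Sum>j\<in>I. \<Sum>i\<in>?Q - I. R i j)"
    unfolding vec_mv_wedge[OF fI] IQ sum.distrib[symmetric]
  proof (rule sum.cong[OF refl])
    fix j assume j: "j \<in> I"
    have s: "?Q - (I - {j}) = insert j (?Q - I)" using j I by auto
    have "inv_sign I j * (b \<bullet> e j) * contract e v Y (I - {j}) = (\<Sum>i\<in>insert j (?Q - I). R i j)"
      unfolding contract_def s R_def by (simp only: sum_distrib_left)
    also have "\<dots> = R j j + (\<Sum>i\<in>?Q - I. R i j)" using j by simp
    also have "R j j = inv_sign I j * inv_sign I j * (v \<bullet> e j) * (b \<bullet> e j) * Y I"
      using j fI by (simp add: R_def inv_sign_remove insert_absorb)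
    finally show "inv_sign I j * (b \<bullet> e j) * contract e v Y (I - {j}) =
        (v \<bullet> e j) * (b \<bullet> e j) * Y I + (\<Sum>i\<in>?Q - I. R i j)" by simp
  qed
  have "(\<Sum>j\<in>I. \<Sum>i\<in>?Q - I. R i j) = (\<Sum>i\<in>?Q - I. \<Sum>j\<in>I. R i j)" by (rule sum.swap)
  also have "\<dots> = (\<Sum>i\<in>?Q - I. \<Sum>j\<in>I. - T i j)"
  proof (intro sum.cong refl)
    fix i j assume ij: "i \<in> ?Q - I" "j \<in> I"
    then have "insert i I - {j} = insert i (I - {j})" "i \<noteq> j" by auto
    then show "R i j = - T i j" using ij fI
      by (cases i j rule: linorder_cases) (auto simp: R_def T_def inv_sign_insert inv_sign_remove)
  qed
  finally have off: "(\<Sum>j\<in>I. \<Sum>i\<in>?Q - I. R i j) = - (\<Sum>i\<in>?Q - I. \<Sum>j\<in>I. T i j)"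
    by (simp add: sum_negf)
  have "(\<Sum>i\<in>?Q. (v \<bullet> e i) * (b \<bullet> e i)) * Y I =
      (\<Sum>i\<in>?Q - I. (v \<bullet> e i) * (b \<bullet> e i) * Y I) + (\<Sum>i\<in>I. (v \<bullet> e i) * (b \<bullet> e i) * Y I)"
    unfolding sum_distrib_right by (rule sum.subset_diff) (use I in auto)
  then show ?thesis using L Rr off by simp
qed

locale orthonormal_frame =
  fixes e :: "nat \<Rightarrow> 'a::euclidean_space"
  assumes orthonormal: "i \<in> {1..DIM('a)} \<Longrightarrow> j \<in> {1..DIM('a)} \<Longrightarrow> e i \<bullet> e j = (if i = j then 1 else 0)"
begin

lemma inj_e: "inj_on e {1..DIM('a)}"
proof (rule inj_onI)
  fix i j assume "i \<in> {1..DIM('a)}" "j \<in> {1..DIM('a)}" "e i = e j"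
  then show "i = j" using orthonormal[of i j] orthonormal[of i i] by (auto split: if_splits)
qed

lemma expand: "x = (\<Sum>i\<in>{1..DIM('a)}. (x \<bullet> e i) *\<^sub>R e i)"
proof -
  have "independent (e ` {1..DIM('a)})"
  proof (rule pairwise_orthogonal_independent)
    show "pairwise orthogonal (e ` {1..DIM('a)})"
      using orthonormal by (auto simp: pairwise_def orthogonal_def)
    show "0 \<notin> e ` {1..DIM('a)}" using orthonormal by force
  qed
  moreover have "card (e ` {1..DIM('a)}) = DIM('a)" using inj_e by (simp add: card_image)
  ultimately have "span (e ` {1..DIM('a)}) = UNIV"
    using card_ge_dim_independent[of "e ` {1..DIM('a)}" UNIV] by auto
  then have "x \<in> range (\<lambda>u. \<Sum>v\<in>e ` {1..DIM('a)}. u v *\<^sub>R v)"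
    using span_finite[of "e ` {1..DIM('a)}"] by auto
  then obtain u where "x = (\<Sum>v\<in>e ` {1..DIM('a)}. u v *\<^sub>R v)" by blast
  then have "x = (\<Sum>i\<in>{1..DIM('a)}. u (e i) *\<^sub>R e i)" unfolding sum.reindex[OF inj_e] o_def .
  then obtain c where c: "x = (\<Sum>i\<in>{1..DIM('a)}. c i *\<^sub>R e i)" by (rule that)
  have "x \<bullet> e j = c j" if "j \<in> {1..DIM('a)}" for j
  proof -
    have "x \<bullet> e j = (\<Sum>i\<in>{1..DIM('a)}. c i * (e i \<bullet> e j))" unfolding c by (simp add: inner_sum_left)
    also have "\<dots> = (\<Sum>i\<in>{1..DIM('a)}. if i = j then c j else 0)"
      using that orthonormal by (intro sum.cong) auto
    finally show ?thesis using that by simp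
  qed
  then show ?thesis by (subst c) simp
qed

lemma inner_expand: "x \<bullet> y = (\<Sum>i\<in>{1..DIM('a)}. (x \<bullet> e i) * (y \<bullet> e i))"
proof -
  have "x \<bullet> y = (\<Sum>i\<in>{1..DIM('a)}. (x \<bullet> e i) *\<^sub>R e i) \<bullet> y" using expand[of x] by simp
  also have "\<dots> = (\<Sum>i\<in>{1..DIM('a)}. (x \<bullet> e i) * (y \<bullet> e i))"
    unfolding inner_sum_left inner_scaleR_left inner_commute[of "e _" y] ..
  finally show ?thesis .
qed

lemma coords_eqI: "(\<And>i. i \<in> {1..DIM('a)} \<Longrightarrow> x \<bullet> e i = y \<bullet> e i) \<Longrightarrow> x = y"
  by (subst (1 2) expand) simp

lemma inner_sum_e:
  assumes "j \<in> {1..DIM('a)}" shows "(\<Sum>i\<in>{1..DIM('a)}. c i *\<^sub>R e i) \<bullet> e j = c j"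
proof -
  have "(\<Sum>i\<in>{1..DIM('a)}. c i *\<^sub>R e i) \<bullet> e j = (\<Sum>i\<in>{1..DIM('a)}. if i = j then c j else 0)"
    unfolding inner_sum_left using assms orthonormal by (intro sum.cong) auto
  then show ?thesis using assms by simp
qed

text \<open>By the Leibniz rule the contraction passes every factor without a contribution, until it
  meets a scalar.\<close>

lemma contract_wedge_list_orthogonal:
  assumes "\<And>b. b \<in> set bs \<Longrightarrow> v \<bullet> b = 0" "I \<subseteq> {1..DIM('a)}"
  shows "contract e v (wedge_list e bs) I = 0"
  using assms
proof (induction bs arbitrary: I)
  case Nil
  then show ?case by (simp add: contract_def wedge_list_Nil)
next
  case (Cons b bs)
  have fI: "finite I" using Cons.prems finite_subset by auto
  have "(vec_mv e b \<and>\<^sub>m contract e v (wedge_list e bs)) I = 0"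
    unfolding vec_mv_wedge[OF fI]
  proof (intro sum.neutral ballI)
    fix i
    have "contract e v (wedge_list e bs) (I - {i}) = 0"
      using Cons.prems by (intro Cons.IH) auto
    then show "inv_sign I i * (b \<bullet> e i) * contract e v (wedge_list e bs) (I - {i}) = 0" by simp
  qed
  moreover have "(\<Sum>i\<in>{1..DIM('a)}. (v \<bullet> e i) * (b \<bullet> e i)) = 0"
    using Cons.prems(1)[of b] inner_expand[of v b] by simp
  ultimately show ?case
    unfolding wedge_list_Cons contract_wedge[OF Cons.prems(2)] by simp
qed

text \<open>The pairing of two wedge products is the determinant of the mutual scalar products; here
  its first row has a single nonzero entry.\<close>

lemma mv_inner_wedge_list_Cons:
  assumes "\<And>b. b \<in> set bs \<Longrightarrow> v \<bullet> b = 0"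
  shows "mv_inner DIM('a) (wedge_list e (v # vs)) (wedge_list e (b # bs)) =
    (v \<bullet> b) * mv_inner DIM('a) (wedge_list e vs) (wedge_list e bs)"
proof -
  have "mv_inner DIM('a) (wedge_list e (v # vs)) (wedge_list e (b # bs)) =
      mv_inner DIM('a) (wedge_list e vs) (contract e v (vec_mv e b \<and>\<^sub>m wedge_list e bs))"
    by (simp add: wedge_list_Cons mv_inner_wedge_contract)
  also have "\<dots> = (\<Sum>K\<in>Pow {1..DIM('a)}. (v \<bullet> b) * (wedge_list e vs K * wedge_list e bs K))"
    unfolding mv_inner_def
  proof (rule sum.cong[OF refl])
    fix K assume K: "K \<in> Pow {1..DIM('a)}"
    then have fK: "finite K" using finite_subset by auto
    have "(vec_mv e b \<and>\<^sub>m contract e v (wedge_list e bs)) K = 0"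
      unfolding vec_mv_wedge[OF fK] using K assms
      by (intro sum.neutral) (auto simp: contract_wedge_list_orthogonal subset_iff)
    then show "wedge_list e vs K * contract e v (vec_mv e b \<and>\<^sub>m wedge_list e bs) K =
        (v \<bullet> b) * (wedge_list e vs K * wedge_list e bs K)"
      using K by (simp add: contract_wedge inner_expand[of v b])
  qed
  also have "\<dots> = (v \<bullet> b) * mv_inner DIM('a) (wedge_list e vs) (wedge_list e bs)"
    by (simp add: mv_inner_def sum_distrib_left)
  finally show ?thesis .
qed

lemma mv_inner_Nil: "mv_inner DIM('a) (wedge_list e []) (wedge_list e []) = 1"
proof -
  have "mv_inner DIM('a) (wedge_list e []) (wedge_list e []) = (\<Sum>K\<in>Pow {1..DIM('a)}. if K = {} then 1 else 0)"
    unfolding mv_inner_def by (intro sum.cong) (auto simp: wedge_list_Nil)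
  then show ?thesis by simp
qed

lemma mv_inner_dual:
  assumes "distinct hs" "\<And>i j. i \<in> set hs \<Longrightarrow> j \<in> set hs \<Longrightarrow> v i \<bullet> a j = (if i = j then 1 else 0)"
  shows "mv_inner DIM('a) (wedge_list e (map v hs)) (wedge_list e (map a hs)) = 1"
  using assms
proof (induction hs)
  case Nil
  then show ?case by (simp add: mv_inner_Nil)
next
  case (Cons i hs)
  have "mv_inner DIM('a) (wedge_list e (v i # map v hs)) (wedge_list e (a i # map a hs)) =
     (v i \<bullet> a i) * mv_inner DIM('a) (wedge_list e (map v hs)) (wedge_list e (map a hs))"
    using Cons.prems by (intro mv_inner_wedge_list_Cons) auto
  then show ?case using Cons by simp
qed

text \<open>The part \<open>z\<close> of an annihilating vector orthogonal to all \<open>a i\<close>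
  also annihilates, but the wedge product starting with \<open>z\<close> has squared norm
  \<open>z \<bullet> z\<close>. This turns the wedge condition defining the homogeneous tangent
  space into a span.\<close>

lemma wedge_annihilator:
  assumes hs: "distinct hs" "\<And>i j. i \<in> set hs \<Longrightarrow> j \<in> set hs \<Longrightarrow> a i \<bullet> a j = (if i = j then 1 else 0)"
  shows "{x. \<forall>K. (vec_mv e x \<and>\<^sub>m wedge_list e (map a hs)) K = 0} = span (a ` set hs)"
proof -
  let ?S = "{x. \<forall>K. (vec_mv e x \<and>\<^sub>m wedge_list e (map a hs)) K = 0}"
  have lin: "wedge_list e ((c *\<^sub>R x + d *\<^sub>R y) # zs) K = c * wedge_list e (x # zs) K + d * wedge_list e (y # zs) K"
    for c d x y zs K using wedge_list_linear[of e "[]" c x d y zs K] by simp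
  have S: "subspace ?S"
    unfolding subspace_def
  proof (intro conjI ballI allI)
    show "0 \<in> ?S" using lin[of 0 0 0 0] by (simp add: wedge_list_Cons)
    show "x + y \<in> ?S" if "x \<in> ?S" "y \<in> ?S" for x y
      using that lin[of 1 x 1 y] by (simp add: wedge_list_Cons)
    show "c *\<^sub>R x \<in> ?S" if "x \<in> ?S" for c x
      using that lin[of c x 0 0] by (simp add: wedge_list_Cons)
  qed
  have "a i \<in> ?S" if i: "i \<in> set hs" for i
  proof -
    obtain xs ys where "hs = xs @ i # ys" using i by (meson split_list)
    then show ?thesis
      using wedge_list_alternating[of e "[]" "a i" "map a xs" "map a ys"] by (simp add: wedge_list_Cons)
  qed
  then have 1: "span (a ` set hs) \<subseteq> ?S" using S by (intro span_minimal) auto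
  have 2: "?S \<subseteq> span (a ` set hs)"
  proof
    fix x assume x: "x \<in> ?S"
    define p where "p = (\<Sum>i\<in>set hs. (x \<bullet> a i) *\<^sub>R a i)"
    have p: "p \<in> span (a ` set hs)" unfolding p_def by (intro span_sum span_scale span_base) auto
    define z where "z = x - p"
    have z: "z \<bullet> a j = 0" if j: "j \<in> set hs" for j
    proof -
      have "p \<bullet> a j = (\<Sum>i\<in>set hs. if i = j then x \<bullet> a j else 0)"
        unfolding p_def inner_sum_left using hs(2) j by (intro sum.cong) auto
      then show ?thesis using j by (simp add: z_def inner_diff_left)
    qed
    have "z \<in> ?S" unfolding z_def using S x p 1 by (intro subspace_diff) auto
    then have "mv_inner DIM('a) (wedge_list e (z # map a hs)) (wedge_list e (z # map a hs)) = 0"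
      by (simp add: mv_inner_def wedge_list_Cons)
    moreover have "mv_inner DIM('a) (wedge_list e (z # map a hs)) (wedge_list e (z # map a hs)) = z \<bullet> z"
      using mv_inner_wedge_list_Cons[of "map a hs" z "map a hs" z] z mv_inner_dual[OF hs] by auto
    ultimately have "z = 0" by simp
    then show "x \<in> span (a ` set hs)" using p z_def by simp
  qed
  show ?thesis using 1 2 by blast
qed

text \<open>Here \<open>v h\<close> has degree at most \<open>k h\<close> and \<open>a h\<close> is
  its part of degree \<open>k h\<close>. A coefficient of total degree above the sum of the
  \<open>k h\<close> needs an index too high for some factor, and at total degree equal to the sum
  every factor must contribute its top part. The index type is arbitrary so that a foreign vector
  can be put in front of a list.\<close>

lemma wedge_list_top_degree:
  fixes deg :: "nat \<Rightarrow> nat" and k :: "'h \<Rightarrow> nat"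
  assumes "\<And>h i. h \<in> set hs \<Longrightarrow> i \<in> {1..DIM('a)} \<Longrightarrow> k h < deg i \<Longrightarrow> v h \<bullet> e i = 0"
    and "\<And>h i. h \<in> set hs \<Longrightarrow> i \<in> {1..DIM('a)} \<Longrightarrow> a h \<bullet> e i = (if deg i = k h then v h \<bullet> e i else 0)"
  shows "((\<Sum>h\<leftarrow>hs. k h) < sum deg K \<longrightarrow> wedge_list e (map v hs) K = 0) \<and>
    wedge_list e (map a hs) K = (if sum deg K = (\<Sum>h\<leftarrow>hs. k h) then wedge_list e (map v hs) K else (0::real))"
  using assms
proof (induction hs arbitrary: K)
  case Nil
  then show ?case by (auto simp: wedge_list_Nil)
next
  case (Cons h hs)
  have IH: "((\<Sum>h\<leftarrow>hs. k h) < sum deg K \<longrightarrow> wedge_list e (map v hs) K = 0)"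
    "wedge_list e (map a hs) K = (if sum deg K = (\<Sum>h\<leftarrow>hs. k h) then wedge_list e (map v hs) K else 0)" for K
    using Cons.IH[of K] Cons.prems by auto
  show ?case
  proof (cases "finite K")
    case fK: True
    have deg: "sum deg K = deg i + sum deg (K - {i})" if "i \<in> K" for i
      using that fK by (simp add: sum.remove)
    have vz: "(v h \<bullet> e i) * wedge_list e (map v hs) (K - {i}) = 0"
      if i: "i \<in> K \<inter> {1..DIM('a)}" and gt: "k h + (\<Sum>h\<leftarrow>hs. k h) < sum deg K" for i
    proof -
      have "k h < deg i \<or> (\<Sum>h\<leftarrow>hs. k h) < sum deg (K - {i})" using deg[of i] i gt by auto
      then show ?thesis using Cons.prems(1)[of h i] IH(1)[of "K - {i}"] i by auto
    qed
    have az: "(a h \<bullet> e i) * wedge_list e (map a hs) (K - {i}) =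
       (if sum deg K = k h + (\<Sum>h\<leftarrow>hs. k h) then (v h \<bullet> e i) * wedge_list e (map v hs) (K - {i}) else 0)"
      if i: "i \<in> K \<inter> {1..DIM('a)}" for i
    proof (cases "sum deg K = k h + (\<Sum>h\<leftarrow>hs. k h)")
      case True
      have a: "a h \<bullet> e i = (if deg i = k h then v h \<bullet> e i else 0)" using Cons.prems(2)[of h i] i by simp
      consider "deg i = k h" | "deg i > k h" | "deg i < k h" by linarith
      then show ?thesis
      proof cases
        case 1
        then have "sum deg (K - {i}) = (\<Sum>h\<leftarrow>hs. k h)" using deg[of i] i True by auto
        then show ?thesis using 1 a IH(2)[of "K - {i}"] True by simp
      next
        case 2
        then show ?thesis using a Cons.prems(1)[of h i] i by simp
      next
        case 3
        then have "sum deg (K - {i}) > (\<Sum>h\<leftarrow>hs. k h)" using deg[of i] i True by auto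
        then show ?thesis using a 3 IH(1)[of "K - {i}"] by simp
      qed
    next
      case False
      then have "deg i \<noteq> k h \<or> sum deg (K - {i}) \<noteq> (\<Sum>h\<leftarrow>hs. k h)" using deg[of i] i by auto
      then have "(a h \<bullet> e i) * wedge_list e (map a hs) (K - {i}) = 0"
        using Cons.prems(2)[of h i] i IH(2)[of "K - {i}"] by auto
      then show ?thesis using False by simp
    qed
    have 1: "wedge_list e (map v (h # hs)) K = (\<Sum>i\<in>K \<inter> {1..DIM('a)}. inv_sign K i * ((v h \<bullet> e i) * wedge_list e (map v hs) (K - {i})))"
      by (simp add: wedge_list_Cons vec_mv_wedge[OF fK] mult.assoc)
    have 2: "wedge_list e (map a (h # hs)) K = (\<Sum>i\<in>K \<inter> {1..DIM('a)}. inv_sign K i * ((a h \<bullet> e i) * wedge_list e (map a hs) (K - {i})))"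
      by (simp add: wedge_list_Cons vec_mv_wedge[OF fK] mult.assoc)
    have "wedge_list e (map v (h # hs)) K = 0" if "(\<Sum>h\<leftarrow>h # hs. k h) < sum deg K"
      unfolding 1 using vz that by (intro sum.neutral) auto
    moreover have "wedge_list e (map a (h # hs)) K =
        (if sum deg K = (\<Sum>h\<leftarrow>h # hs. k h) then wedge_list e (map v (h # hs)) K else 0)"
      unfolding 1 2 using az by auto
    ultimately show ?thesis by blast
  qed (simp add: wedge_list_infinite)
qed

text \<open>In the inductive step \<open>a n\<close> is the normalized leading part of an arbitrary vector of \<open>U\<close>,
  and one continues with \<open>U \<inter> (a n)\<^sup>\<bottom>\<close>.\<close>

lemma graded_echelon_basis:
  fixes deg :: "nat \<Rightarrow> nat"
  assumes "subspace U" "dim U = n"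
  shows "\<exists>(a :: nat \<Rightarrow> 'a) v k. (\<forall>r<n. \<forall>s<n. a r \<bullet> a s = (if r = s then 1 else 0)) \<and>
    (\<forall>r<n. \<forall>i\<in>{1..DIM('a)}. k r < deg i \<longrightarrow> v r \<bullet> e i = 0) \<and>
    (\<forall>r<n. \<forall>i\<in>{1..DIM('a)}. a r \<bullet> e i = (if deg i = k r then v r \<bullet> e i else 0)) \<and>
    span (v ` {..<n}) = U"
  using assms
proof (induction n arbitrary: U)
  case 0
  then have "U = {0}" using subspace_0 by auto
  then show ?case by simp
next
  case (Suc n)
  have "U \<noteq> {0}" using Suc.prems by auto
  then obtain w where w: "w \<in> U" "w \<noteq> 0" using subspace_0[OF Suc.prems(1)] by auto
  define D where "D = {deg i |i. i \<in> {1..DIM('a)} \<and> w \<bullet> e i \<noteq> 0}"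
  have fD: "finite D" unfolding D_def by (rule finite_subset[of _ "deg ` {1..DIM('a)}"]) auto
  obtain i0 where "i0 \<in> {1..DIM('a)}" "w \<bullet> e i0 \<noteq> 0" using w(2) coords_eqI[of w 0] inner_zero_left by metis
  then have "deg i0 \<in> D" unfolding D_def by blast
  then have "D \<noteq> {}" by blast
  define k where "k = Max D"
  have kD: "k \<in> D" unfolding k_def using fD \<open>D \<noteq> {}\<close> by (rule Max_in)
  have k: "deg i \<le> k" if "i \<in> {1..DIM('a)}" "w \<bullet> e i \<noteq> 0" for i
    unfolding k_def by (rule Max_ge[OF fD]) (use that in \<open>auto simp: D_def\<close>)
  define p where "p = (\<Sum>i\<in>{1..DIM('a)}. (if deg i = k then w \<bullet> e i else 0) *\<^sub>R e i)"
  have p: "p \<bullet> e i = (if deg i = k then w \<bullet> e i else 0)" if "i \<in> {1..DIM('a)}" for i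
    unfolding p_def by (rule inner_sum_e[OF that])
  obtain i1 where "i1 \<in> {1..DIM('a)}" "w \<bullet> e i1 \<noteq> 0" "k = deg i1" using kD unfolding D_def by blast
  then have "p \<bullet> e i1 \<noteq> 0" using p by simp
  then have "p \<noteq> 0" by auto
  define va where "va = (1 / norm p) *\<^sub>R w"
  define aa where "aa = (1 / norm p) *\<^sub>R p"
  have a_e: "aa \<bullet> e i = (if deg i = k then va \<bullet> e i else 0)" if "i \<in> {1..DIM('a)}" for i
    using p[OF that] by (simp add: aa_def va_def)
  have v_e: "va \<bullet> e i = 0" if "i \<in> {1..DIM('a)}" "k < deg i" for i
    using k[of i] that by (auto simp: va_def)
  have aa1: "aa \<bullet> aa = 1" using \<open>p \<noteq> 0\<close> unfolding norm_eq_1[symmetric] by (simp add: aa_def)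
  \<comment> \<open>\<open>aa\<close> is the top part of \<open>va\<close>, so pairing with
    \<open>aa\<close> sees the same components of both.\<close>
  have va1: "va \<bullet> aa = 1"
  proof -
    have "va \<bullet> aa = aa \<bullet> aa"
      unfolding inner_expand[of va aa] inner_expand[of aa aa] by (intro sum.cong) (auto simp: a_e)
    then show ?thesis using aa1 by simp
  qed
  have vU: "va \<in> U" unfolding va_def using w Suc.prems(1) by (simp add: subspace_scale)
  define U' where "U' = {u \<in> U. u \<bullet> aa = 0}"
  have U': "subspace U'" using Suc.prems(1) unfolding U'_def subspace_def by (auto simp: inner_add_left)
  have decomp: "u - (u \<bullet> aa) *\<^sub>R va \<in> U'" if "u \<in> U" for u
    using that vU Suc.prems(1) va1 unfolding U'_def
    by (simp add: subspace_diff subspace_scale inner_diff_left)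
  have "va \<notin> U'" using va1 by (simp add: U'_def)
  have "U \<subseteq> span (insert va U')"
  proof
    fix u assume "u \<in> U"
    then have "u - (u \<bullet> aa) *\<^sub>R va \<in> span (insert va U')" using decomp by (simp add: span_base)
    moreover have "(u \<bullet> aa) *\<^sub>R va \<in> span (insert va U')" by (simp add: span_base span_scale)
    ultimately have "(u - (u \<bullet> aa) *\<^sub>R va) + (u \<bullet> aa) *\<^sub>R va \<in> span (insert va U')" by (rule span_add)
    then show "u \<in> span (insert va U')" by simp
  qed
  moreover have "span (insert va U') \<subseteq> U"
    using vU Suc.prems(1) by (intro span_minimal) (auto simp: U'_def)
  ultimately have "span (insert va U') = U" by (intro antisym)
  then have "dim U = dim (insert va U')" using dim_span[of "insert va U'"] by simp
  also have "\<dots> = dim U' + 1"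
  proof -
    have "va \<notin> span U'" using U' \<open>va \<notin> U'\<close> by (metis span_eq_iff)
    then show ?thesis unfolding dim_insert by simp
  qed
  finally have "dim U' = n" using Suc.prems(2) by simp
  from Suc.IH[OF U' this] obtain a v kk where IH:
    "\<And>r s. r < n \<Longrightarrow> s < n \<Longrightarrow> a r \<bullet> a s = (if r = s then 1 else 0)"
    "\<And>r i. r < n \<Longrightarrow> i \<in> {1..DIM('a)} \<Longrightarrow> kk r < deg i \<Longrightarrow> v r \<bullet> e i = 0"
    "\<And>r i. r < n \<Longrightarrow> i \<in> {1..DIM('a)} \<Longrightarrow> a r \<bullet> e i = (if deg i = kk r then v r \<bullet> e i else 0)"
    "span (v ` {..<n}) = U'" by blast
  \<comment> \<open>If the degrees differ, the two leading parts have disjoint supports. If they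
    agree, \<open>a r\<close> may be replaced by \<open>v r\<close>, which lies in
    \<open>U'\<close>.\<close>
  have orth: "a r \<bullet> aa = 0" if r: "r < n" for r
  proof -
    have "v r \<in> U'" using IH(4) r span_base[of "v r" "v ` {..<n}"] by simp
    then have vr: "v r \<bullet> aa = 0" by (simp add: U'_def)
    show ?thesis
    proof (cases "kk r = k")
      case True
      have "a r \<bullet> aa = v r \<bullet> aa"
        unfolding inner_expand[of "a r" aa] inner_expand[of "v r" aa]
        using True by (intro sum.cong) (auto simp: a_e IH(3)[OF r])
      then show ?thesis using vr by simp
    next
      case False
      then show ?thesis unfolding inner_expand[of "a r" aa]
        by (intro sum.neutral) (auto simp: a_e IH(3)[OF r])
    qed
  qed
  let ?a = "a(n := aa)" and ?v = "v(n := va)" and ?k = "kk(n := k)"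
  have im: "?v ` {..<Suc n} = insert va (v ` {..<n})" by (auto simp: lessThan_Suc)
  have sp: "span (?v ` {..<Suc n}) = U"
  proof
    have "v ` {..<n} \<subseteq> U" using IH(4) span_superset[of "v ` {..<n}"] unfolding U'_def by blast
    then show "span (?v ` {..<Suc n}) \<subseteq> U" unfolding im using vU Suc.prems(1) by (intro span_minimal) auto
    show "U \<subseteq> span (?v ` {..<Suc n})"
    proof
      fix u assume "u \<in> U"
      then have "u - (u \<bullet> aa) *\<^sub>R va \<in> span (insert va (v ` {..<n}))"
        using decomp IH(4) span_mono[of "v ` {..<n}" "insert va (v ` {..<n})"] by blast
      moreover have "(u \<bullet> aa) *\<^sub>R va \<in> span (insert va (v ` {..<n}))" by (simp add: span_base span_scale)
      ultimately have "(u - (u \<bullet> aa) *\<^sub>R va) + (u \<bullet> aa) *\<^sub>R va \<in> span (insert va (v ` {..<n}))" by (rule span_add)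
      then show "u \<in> span (?v ` {..<Suc n})" unfolding im by simp
    qed
  qed
  show ?case
  proof (rule exI[of _ ?a], rule exI[of _ ?v], rule exI[of _ ?k], intro conjI allI impI ballI)
    show "span (?v ` {..<Suc n}) = U" by (rule sp)
  next
    fix r s assume "r < Suc n" "s < Suc n"
    then show "?a r \<bullet> ?a s = (if r = s then 1 else 0)"
      using IH(1)[of r s] orth[of r] orth[of s] aa1 inner_commute[of aa "a s"] by (auto simp: less_Suc_eq)
  next
    fix r i assume "r < Suc n" "i \<in> {1..DIM('a)}" "?k r < deg i"
    then show "?v r \<bullet> e i = 0" using IH(2)[of r i] v_e[of i] by (cases "r = n") auto
  next
    fix r i assume "r < Suc n" "i \<in> {1..DIM('a)}"
    then show "?a r \<bullet> e i = (if deg i = ?k r then ?v r \<bullet> e i else 0)"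
      using IH(3)[of r i] a_e[of i] by (cases "r = n") auto
  qed
qed

end

text \<open>Gram-Schmidt for an arbitrary scalar product; it will be the value at a point of the
  auxiliary Riemannian metric, unrelated to the inner product of the type.\<close>

lemma bilinear_orthonormal_basis:
  fixes U :: "'a::euclidean_space set"
  assumes B: "bilinear B" "\<And>x y. B x y = B y x" "\<And>x. x \<noteq> 0 \<Longrightarrow> B x x > 0"
    and "subspace U" "dim U = n"
  shows "\<exists>v :: nat \<Rightarrow> 'a. (\<forall>r<n. \<forall>s<n. B (v r) (v s) = (if r = s then 1 else (0::real))) \<and> span (v ` {..<n}) = U"
  using assms(4,5)
proof (induction n arbitrary: U)
  case 0
  then have "U = {0}" using subspace_0 by auto
  then show ?case by simp
next
  case (Suc n)
  interpret l: linear "B x" for x using B(1) by (simp add: bilinear_def)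
  interpret r: linear "\<lambda>x. B x y" for y using B(1) by (simp add: bilinear_def)
  have "U \<noteq> {0}" using Suc.prems by auto
  then obtain w where w: "w \<in> U" "w \<noteq> 0" using subspace_0[OF Suc.prems(1)] by auto
  define va where "va = (1 / sqrt (B w w)) *\<^sub>R w"
  have va1: "B va va = 1" using B(3)[OF w(2)] by (simp add: va_def l.scale r.scale)
  have vU: "va \<in> U" unfolding va_def using w Suc.prems(1) by (simp add: subspace_scale)
  define U' where "U' = {u \<in> U. B u va = 0}"
  have U': "subspace U'" using Suc.prems(1) unfolding U'_def subspace_def by (auto simp: r.add r.scale r.zero)
  have decomp: "u - B u va *\<^sub>R va \<in> U'" if "u \<in> U" for u
    using that vU Suc.prems(1) va1 unfolding U'_def
    by (simp add: subspace_diff subspace_scale r.diff r.scale)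
  have "va \<notin> U'" using va1 by (simp add: U'_def)
  have "U \<subseteq> span (insert va U')"
  proof
    fix u assume "u \<in> U"
    then have "u - B u va *\<^sub>R va \<in> span (insert va U')" using decomp by (simp add: span_base)
    moreover have "B u va *\<^sub>R va \<in> span (insert va U')" by (simp add: span_base span_scale)
    ultimately have "(u - B u va *\<^sub>R va) + B u va *\<^sub>R va \<in> span (insert va U')" by (rule span_add)
    then show "u \<in> span (insert va U')" by simp
  qed
  moreover have "span (insert va U') \<subseteq> U"
    using vU Suc.prems(1) by (intro span_minimal) (auto simp: U'_def)
  ultimately have "span (insert va U') = U" by (intro antisym)
  then have "dim U = dim (insert va U')" using dim_span[of "insert va U'"] by simp
  also have "\<dots> = dim U' + 1"
  proof -
    have "va \<notin> span U'" using U' \<open>va \<notin> U'\<close> by (metis span_eq_iff)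
    then show ?thesis unfolding dim_insert by simp
  qed
  finally have "dim U' = n" using Suc.prems(2) by simp
  from Suc.IH[OF U' this] obtain v where IH:
    "\<And>r s. r < n \<Longrightarrow> s < n \<Longrightarrow> B (v r) (v s) = (if r = s then 1 else 0)"
    "span (v ` {..<n}) = U'" by blast
  have vr: "B (v r) va = 0" if "r < n" for r
    using IH(2) that span_base[of "v r" "v ` {..<n}"] by (auto simp: U'_def)
  let ?v = "v(n := va)"
  have im: "?v ` {..<Suc n} = insert va (v ` {..<n})" by (auto simp: lessThan_Suc)
  have sp: "span (?v ` {..<Suc n}) = U"
  proof
    have "v ` {..<n} \<subseteq> U" using IH(2) span_superset[of "v ` {..<n}"] unfolding U'_def by blast
    then show "span (?v ` {..<Suc n}) \<subseteq> U" unfolding im using vU Suc.prems(1) by (intro span_minimal) auto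
    show "U \<subseteq> span (?v ` {..<Suc n})"
    proof
      fix u assume "u \<in> U"
      then have "u - B u va *\<^sub>R va \<in> span (insert va (v ` {..<n}))"
        using decomp IH(2) span_mono[of "v ` {..<n}" "insert va (v ` {..<n})"] by blast
      moreover have "B u va *\<^sub>R va \<in> span (insert va (v ` {..<n}))" by (simp add: span_base span_scale)
      ultimately have "(u - B u va *\<^sub>R va) + B u va *\<^sub>R va \<in> span (insert va (v ` {..<n}))" by (rule span_add)
      then show "u \<in> span (?v ` {..<Suc n})" unfolding im by simp
    qed
  qed
  show ?case
  proof (intro exI conjI allI impI)
    show "span (?v ` {..<Suc n}) = U" by (rule sp)
    fix r s assume "r < Suc n" "s < Suc n"
    then show "B (?v r) (?v s) = (if r = s then 1 else 0)"
      using IH(1)[of r s] vr[of r] vr[of s] va1 B(2)[of va "v s"] by (auto simp: less_Suc_eq)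
  qed
qed

subsection \<open>Hausdorff measure on isometric copies of \<open>\<real>\<^sup>n\<close>\<close>

lemma suminf_prod_decode_le:
  fixes f :: "nat \<Rightarrow> nat \<Rightarrow> ennreal"
  shows "(\<Sum>k. case prod_decode k of (i, j) \<Rightarrow> f i j) \<le> (\<Sum>i. \<Sum>j. f i j)"
proof -
  have "(\<Sum>k. case prod_decode k of (i, j) \<Rightarrow> f i j)
      = (\<integral>\<^sup>+ x. (case x of (i,j) \<Rightarrow> f i j) \<partial>(distr (count_space UNIV) (count_space UNIV) prod_decode))"
    by (subst nn_integral_distr) (auto simp: nn_integral_count_space_nat)
  also have "distr (count_space UNIV) (count_space UNIV) prod_decode = (count_space UNIV :: (nat \<times> nat) measure)"
    by (rule distr_bij_count_space) (rule bij_prod_decode)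
  also have "(\<integral>\<^sup>+ x. (case x of (i,j) \<Rightarrow> f i j) \<partial>count_space UNIV) = (\<Sum>i. \<Sum>j. f i j)"
    by (subst nn_integral_fst_count_space[symmetric]) (simp add: nn_integral_count_space_nat)
  finally show ?thesis by simp
qed

definition hausdorff_delta :: "nat \<Rightarrow> real \<Rightarrow> 'a::metric_space set \<Rightarrow> ennreal" where
  "hausdorff_delta n \<delta> E =
     (INF C \<in> {C :: nat \<Rightarrow> 'a set. E \<subseteq> \<Union> (range C) \<and> (\<forall>i. bounded (C i) \<and> diameter (C i) \<le> \<delta>)}.
          \<Sum>i. ennreal (diameter (C i) ^ n))"

lemma hausdorff_raw_eq: "hausdorff_raw n E = (SUP \<delta>\<in>{0<..}. hausdorff_delta n \<delta> E)"
  by (simp add: hausdorff_raw_def hausdorff_delta_def)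

lemma hausdorff_delta_le:
  assumes "E \<subseteq> \<Union> (range C)" "\<And>i. bounded (C i)" "\<And>i. diameter (C i) \<le> \<delta>"
  shows "hausdorff_delta n \<delta> E \<le> (\<Sum>i. ennreal (diameter (C i) ^ n))"
  unfolding hausdorff_delta_def by (rule INF_lower) (use assms in auto)

text \<open>A finite cover is padded with empty sets, which cost nothing because
  \<open>n \<ge> 1\<close>.\<close>

lemma hausdorff_delta_le_family:
  fixes C :: "'i \<Rightarrow> 'a::metric_space set"
  assumes I: "finite I" and "E \<subseteq> \<Union> (C ` I)" "\<And>i. i \<in> I \<Longrightarrow> bounded (C i)"
    "\<And>i. i \<in> I \<Longrightarrow> diameter (C i) \<le> \<delta>" and n: "n \<ge> 1" and d: "\<delta> \<ge> 0"
  shows "hausdorff_delta n \<delta> E \<le> (\<Sum>i\<in>I. ennreal (diameter (C i) ^ n))"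
proof -
  obtain h where h: "bij_betw h {0..<card I} I"
    using I ex_bij_betw_nat_finite by blast
  define D where "D k = (if k < card I then C (h k) else {})" for k
  have hI: "h k \<in> I" if "k < card I" for k
    using h that bij_betwE by fastforce
  have "hausdorff_delta n \<delta> E \<le> (\<Sum>k. ennreal (diameter (D k) ^ n))"
  proof (rule hausdorff_delta_le)
    show "E \<subseteq> \<Union> (range D)"
    proof
      fix x assume "x \<in> E"
      then obtain i where i: "i \<in> I" "x \<in> C i" using assms by auto
      then obtain k where "k < card I" "h k = i" using h
        by (metis atLeastLessThan_iff bij_betw_iff_bijections)
      then have "x \<in> D k" using i by (simp add: D_def)
      then show "x \<in> \<Union> (range D)" by blast
    qed
    show "bounded (D i)" "diameter (D i) \<le> \<delta>" for i
      using assms hI by (auto simp: D_def)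
  qed
  also have "\<dots> = (\<Sum>k\<in>{0..<card I}. ennreal (diameter (D k) ^ n))"
    by (rule suminf_finite) (use n in \<open>auto simp: D_def power_0_left\<close>)
  also have "\<dots> = (\<Sum>k\<in>{0..<card I}. ennreal (diameter (C (h k)) ^ n))"
    by (rule sum.cong) (auto simp: D_def)
  also have "\<dots> = (\<Sum>i\<in>I. ennreal (diameter (C i) ^ n))"
    by (rule sum.reindex_bij_betw[OF h])
  finally show ?thesis .
qed

lemma hausdorff_delta_mono: "E \<subseteq> F \<Longrightarrow> hausdorff_delta n \<delta> E \<le> hausdorff_delta n \<delta> F"
  unfolding hausdorff_delta_def by (rule INF_superset_mono) auto

lemma hausdorff_delta_countable_subadditive:
  fixes E :: "nat \<Rightarrow> 'a::metric_space set"
  shows "hausdorff_delta n \<delta> (\<Union>k. E k) \<le> (\<Sum>k. hausdorff_delta n \<delta> (E k))"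
proof (rule ennreal_le_epsilon)
  fix \<epsilon> :: real assume fin: "(\<Sum>k. hausdorff_delta n \<delta> (E k)) < top" and e: "\<epsilon> > 0"
  have "\<exists>C. E k \<subseteq> \<Union> (range C) \<and> (\<forall>i. bounded (C i) \<and> diameter (C i) \<le> \<delta>) \<and>
      (\<Sum>i. ennreal (diameter (C i) ^ n)) \<le> hausdorff_delta n \<delta> (E k) + ennreal (\<epsilon> * (1/2)^Suc k)" for k
  proof -
    have "hausdorff_delta n \<delta> (E k) < top"
      by (rule ennreal_suminf_lessD[OF fin])
    then have "hausdorff_delta n \<delta> (E k) < hausdorff_delta n \<delta> (E k) + ennreal (\<epsilon> * (1/2)^Suc k)"
      using e by (simp add: ennreal_zero_less_mult_iff)
    then obtain C where "C \<in> {C :: nat \<Rightarrow> 'a set. E k \<subseteq> \<Union> (range C) \<and> (\<forall>i. bounded (C i) \<and> diameter (C i) \<le> \<delta>)}"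
       "(\<Sum>i. ennreal (diameter (C i) ^ n)) < hausdorff_delta n \<delta> (E k) + ennreal (\<epsilon> * (1/2)^Suc k)"
      unfolding hausdorff_delta_def[of n \<delta> "E k"] INF_less_iff by blast
    then show ?thesis by (intro exI[of _ C]) auto
  qed
  then obtain C where C: "\<And>k. E k \<subseteq> \<Union> (range (C k))" "\<And>k i. bounded (C k i)" "\<And>k i. diameter (C k i) \<le> \<delta>"
      "\<And>k. (\<Sum>i. ennreal (diameter (C k i) ^ n)) \<le> hausdorff_delta n \<delta> (E k) + ennreal (\<epsilon> * (1/2)^Suc k)"
    by metis
  have "hausdorff_delta n \<delta> (\<Union>k. E k) \<le>
      (\<Sum>m. ennreal (diameter (case prod_decode m of (k, i) \<Rightarrow> C k i) ^ n))"
  proof (rule hausdorff_delta_le)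
    show "(\<Union>k. E k) \<subseteq> \<Union> (range (\<lambda>m. case prod_decode m of (k, i) \<Rightarrow> C k i))"
    proof safe
      fix x k assume "x \<in> E k"
      then obtain i where "x \<in> C k i" using C(1)[of k] by blast
      then show "x \<in> \<Union> (range (\<lambda>m. case prod_decode m of (k, i) \<Rightarrow> C k i))"
        by (intro UnionI[of "C k i"] range_eqI[of _ _ "prod_encode (k,i)"]) auto
    qed
  qed (auto split: prod.splits simp: C)
  also have "\<dots> = (\<Sum>m. case prod_decode m of (k, i) \<Rightarrow> ennreal (diameter (C k i) ^ n))"
    by (intro suminf_cong) (auto split: prod.splits)
  also have "\<dots> \<le> (\<Sum>k. \<Sum>i. ennreal (diameter (C k i) ^ n))"
    by (rule suminf_prod_decode_le)
  also have "\<dots> \<le> (\<Sum>k. hausdorff_delta n \<delta> (E k) + ennreal (\<epsilon> * (1/2)^Suc k))"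
    by (intro suminf_le C) auto
  also have "\<dots> = (\<Sum>k. hausdorff_delta n \<delta> (E k)) + (\<Sum>k. ennreal (\<epsilon> * (1/2)^Suc k))"
    by (subst suminf_add) auto
  also have "(\<Sum>k. ennreal (\<epsilon> * (1/2)^Suc k)) = ennreal \<epsilon>"
  proof -
    have "(\<lambda>k. \<epsilon> * (1/2)^Suc k) sums (\<epsilon> * 1)"
      by (intro sums_mult power_half_series)
    then show ?thesis using e by (intro suminf_ennreal_eq) auto
  qed
  finally show "hausdorff_delta n \<delta> (\<Union>k. E k) \<le> (\<Sum>k. hausdorff_delta n \<delta> (E k)) + ennreal \<epsilon>" .
qed

lemma hausdorff_raw_mono: "E \<subseteq> F \<Longrightarrow> hausdorff_raw n E \<le> hausdorff_raw n F"
  unfolding hausdorff_raw_eq by (rule SUP_mono) (blast intro: hausdorff_delta_mono)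

lemma hausdorff_raw_countable_subadditive:
  fixes E :: "nat \<Rightarrow> 'a::metric_space set"
  shows "hausdorff_raw n (\<Union>k. E k) \<le> (\<Sum>k. hausdorff_raw n (E k))"
  unfolding hausdorff_raw_eq[of n "\<Union>k. E k"]
proof (rule SUP_least)
  fix \<delta> :: real assume "\<delta> \<in> {0<..}"
  then have "(\<Sum>k. hausdorff_delta n \<delta> (E k)) \<le> (\<Sum>k. hausdorff_raw n (E k))"
    by (intro suminf_le) (auto simp: hausdorff_raw_eq intro: SUP_upper)
  then show "hausdorff_delta n \<delta> (\<Union>k. E k) \<le> (\<Sum>k. hausdorff_raw n (E k))"
    using hausdorff_delta_countable_subadditive order_trans by blast
qed

lemma hausdorff_raw_empty:
  assumes n: "n \<ge> 1"
  shows "hausdorff_raw n ({} :: 'a::metric_space set) = 0"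
proof -
  have "hausdorff_delta n \<delta> ({} :: 'a set) \<le> 0" if "\<delta> > 0" for \<delta> :: real
    using hausdorff_delta_le_family[of "{}" "{} :: 'a set" "\<lambda>_. {}" \<delta> n] n that by simp
  then have "hausdorff_raw n ({} :: 'a set) \<le> 0"
    unfolding hausdorff_raw_eq by (intro SUP_least) auto
  then show ?thesis by simp
qed

lemma hausdorff_raw_Un: 
  assumes "n \<ge> 1" shows "hausdorff_raw n (E \<union> F) \<le> hausdorff_raw n E + hausdorff_raw n F"
proof -
  define X where "X k = (if k = 0 then E else if k = 1 then F else {})" for k :: nat
  have "(\<Union>k. X k) = E \<union> F"
  proof -
    have "E \<union> F \<subseteq> X 0 \<union> X 1" by (simp add: X_def)
    moreover have "X 0 \<union> X 1 \<subseteq> (\<Union>k. X k)" by blast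
    moreover have "X k \<subseteq> E \<union> F" for k by (simp add: X_def)
    ultimately show ?thesis by blast
  qed
  then have "hausdorff_raw n (E \<union> F) \<le> (\<Sum>k. hausdorff_raw n (X k))"
    using hausdorff_raw_countable_subadditive[of n X] by simp
  also have "\<dots> = (\<Sum>k\<in>{0,1}. hausdorff_raw n (X k))"
    by (rule suminf_finite) (auto simp: X_def hausdorff_raw_empty[OF assms])
  also have "\<dots> = hausdorff_raw n E + hausdorff_raw n F" by (simp add: X_def)
  finally show ?thesis .
qed

lemma diameter_image_le:
  assumes L: "\<And>x y. x \<in> S \<Longrightarrow> y \<in> S \<Longrightarrow> dist (f x) (f y) \<le> l * dist x y" and "l \<ge> 0" "bounded S"
  shows "diameter (f ` S) \<le> l * diameter S" and "bounded (f ` S)"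
proof -
  show 1: "bounded (f ` S)"
  proof (cases "S = {}")
    case False
    then obtain x0 where "x0 \<in> S" by auto
    have "dist (f x0) (f x) \<le> l * diameter S" if "x \<in> S" for x
      using L[OF \<open>x0 \<in> S\<close> that] diameter_bounded_bound[OF assms(3) \<open>x0 \<in> S\<close> that] \<open>l \<ge> 0\<close>
      by (meson mult_left_mono order_trans)
    then show ?thesis unfolding bounded_def by blast
  qed auto
  show "diameter (f ` S) \<le> l * diameter S"
  proof (cases "S = {}")
    case False
    have "dist u v \<le> l * diameter S" if "u \<in> f ` S" "v \<in> f ` S" for u v
    proof -
      from that obtain x y where xy: "x \<in> S" "y \<in> S" "u = f x" "v = f y" by blast
      have "dist u v \<le> l * dist x y" using L xy by blast
      also have "\<dots> \<le> l * diameter S"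
        using xy \<open>l \<ge> 0\<close> diameter_bounded_bound[OF assms(3)] by (intro mult_left_mono) auto
      finally show ?thesis .
    qed
    then show ?thesis using False unfolding diameter_def[of "f ` S"]
      by (auto intro!: cSUP_least)
  qed auto
qed

lemma hausdorff_raw_lipschitz_image:
  fixes f :: "'a::metric_space \<Rightarrow> 'b::metric_space"
  assumes L: "\<And>x y. x \<in> E \<Longrightarrow> y \<in> E \<Longrightarrow> dist (f x) (f y) \<le> l * dist x y" and l: "l > 0"
  shows "hausdorff_raw n (f ` E) \<le> ennreal (l ^ n) * hausdorff_raw n E"
  unfolding hausdorff_raw_eq[of n "f ` E"]
proof (rule SUP_least)
  fix \<delta> :: real assume d: "\<delta> \<in> {0<..}"
  \<comment> \<open>With the factor on the left, the claim is a lower bound for an infimum and can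
    be checked on each cover.\<close>
  have "ennreal (1 / l ^ n) * hausdorff_delta n \<delta> (f ` E) \<le> hausdorff_delta n (\<delta> / l) E"
    unfolding hausdorff_delta_def[of n "\<delta> / l" E]
  proof (rule INF_greatest, clarify)
    fix C :: "nat \<Rightarrow> 'a set"
    assume C: "E \<subseteq> \<Union> (range C)" "\<forall>i. bounded (C i) \<and> diameter (C i) \<le> \<delta> / l"
    \<comment> \<open>The covering sets are cut with \<open>E\<close>, the only set on which
      \<open>f\<close> is known to be Lipschitz.\<close>
    define D where "D i = f ` (C i \<inter> E)" for i
    have b: "bounded (C i \<inter> E)" for i using C(2) bounded_subset by blast
    have D: "bounded (D i)" "diameter (D i) \<le> l * diameter (C i)" for i
    proof -
      have *: "bounded (D i)" "diameter (D i) \<le> l * diameter (C i \<inter> E)"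
        unfolding D_def using diameter_image_le[of "C i \<inter> E" f l] L l b by auto
      moreover have "diameter (C i \<inter> E) \<le> diameter (C i)"
        using C(2) by (intro diameter_subset) auto
      ultimately show "bounded (D i)" "diameter (D i) \<le> l * diameter (C i)"
        using l by (auto intro: order_trans mult_left_mono)
    qed
    have "hausdorff_delta n \<delta> (f ` E) \<le> (\<Sum>i. ennreal (diameter (D i) ^ n))"
    proof (rule hausdorff_delta_le)
      show "f ` E \<subseteq> \<Union> (range D)" using C(1) unfolding D_def by blast
      show "diameter (D i) \<le> \<delta>" for i
      proof -
        have "l * diameter (C i) \<le> l * (\<delta> / l)" using C(2) l by (intro mult_left_mono) auto
        then show ?thesis using D(2)[of i] l by simp
      qed
    qed (use D in auto)
    also have "\<dots> \<le> (\<Sum>i. ennreal (l ^ n) * ennreal (diameter (C i) ^ n))"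
    proof (rule suminf_le)
      fix i
      have "diameter (D i) ^ n \<le> (l * diameter (C i)) ^ n"
        using D diameter_ge_0 by (intro power_mono) auto
      then show "ennreal (diameter (D i) ^ n) \<le> ennreal (l ^ n) * ennreal (diameter (C i) ^ n)"
        using l diameter_ge_0[of "C i"] C(2) by (simp add: ennreal_mult[symmetric] power_mult_distrib)
    qed auto
    also have "\<dots> = ennreal (l ^ n) * (\<Sum>i. ennreal (diameter (C i) ^ n))" by simp
    finally have "ennreal (1 / l ^ n) * hausdorff_delta n \<delta> (f ` E) \<le>
       ennreal (1 / l ^ n) * (ennreal (l ^ n) * (\<Sum>i. ennreal (diameter (C i) ^ n)))"
      by (intro mult_left_mono) auto
    also have "\<dots> = (\<Sum>i. ennreal (diameter (C i) ^ n))"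
      using l by (simp add: mult.assoc[symmetric] ennreal_mult[symmetric])
    finally show "ennreal (1 / l ^ n) * hausdorff_delta n \<delta> (f ` E) \<le> (\<Sum>i. ennreal (diameter (C i) ^ n))" .
  qed
  also have "hausdorff_delta n (\<delta> / l) E \<le> hausdorff_raw n E"
    unfolding hausdorff_raw_eq by (rule SUP_upper) (use d l in auto)
  finally have "ennreal (l ^ n) * (ennreal (1 / l ^ n) * hausdorff_delta n \<delta> (f ` E)) \<le> ennreal (l ^ n) * hausdorff_raw n E"
    by (intro mult_left_mono) auto
  then show "hausdorff_delta n \<delta> (f ` E) \<le> ennreal (l ^ n) * hausdorff_raw n E"
    using l by (simp add: mult.assoc[symmetric] ennreal_mult[symmetric])
qed

lemma hausdorff_raw_isometry:
  fixes f :: "'a::metric_space \<Rightarrow> 'b::metric_space"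
  assumes iso: "\<And>x y. dist (f x) (f y) = dist x y"
  shows "hausdorff_raw n (f ` E) = hausdorff_raw n E"
proof (rule antisym)
  show "hausdorff_raw n (f ` E) \<le> hausdorff_raw n E"
    using hausdorff_raw_lipschitz_image[of E f 1 n] iso by simp
  have inj: "inj f" by (rule injI) (metis dist_eq_0_iff iso)
  have "E = inv f ` f ` E" using inj by (simp add: image_comp)
  moreover have "hausdorff_raw n (inv f ` f ` E) \<le> hausdorff_raw n (f ` E)"
  proof -
    have "dist (inv f x) (inv f y) \<le> 1 * dist x y" if "x \<in> f ` E" "y \<in> f ` E" for x y
      using that inj by (auto simp: iso)
    then show ?thesis using hausdorff_raw_lipschitz_image[of "f ` E" "inv f" 1 n] by simp
  qed
  ultimately show "hausdorff_raw n E \<le> hausdorff_raw n (f ` E)" by simp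
qed

section \<open>Hausdorff and Lebesgue measure of cubes and bounded Borel sets\<close>

abbreviation unit_cube :: "(real ^ 'n::finite) set" where "unit_cube \<equiv> cbox 0 One"

lemma cube_eq_image:
  fixes u :: "real ^ 'n::finite"
  assumes s: "s > 0"
  shows "cbox u (u + s *\<^sub>R One) = (\<lambda>x. u + s *\<^sub>R x) ` unit_cube"
proof -
  have "cbox u (u + s *\<^sub>R One) \<subseteq> (\<lambda>x. u + s *\<^sub>R x) ` unit_cube"
  proof
    fix x assume x: "x \<in> cbox u (u + s *\<^sub>R One)"
    have "x = u + s *\<^sub>R ((x - u) /\<^sub>R s)" using s by simp
    moreover have "(x - u) /\<^sub>R s \<in> unit_cube"
      using x s by (auto simp: mem_box inner_diff_left inner_add_left field_simps)
    ultimately show "x \<in> (\<lambda>x. u + s *\<^sub>R x) ` unit_cube" by blast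
  qed
  moreover have "(\<lambda>x. u + s *\<^sub>R x) ` unit_cube \<subseteq> cbox u (u + s *\<^sub>R One)"
    using s by (auto simp: mem_box inner_add_left)
  ultimately show ?thesis by blast
qed

lemma hausdorff_raw_cube_le:
  fixes u :: "real ^ 'n::finite"
  assumes s: "s > 0"
  shows "hausdorff_raw CARD('n) (cbox u (u + s *\<^sub>R One)) \<le>
    ennreal (s ^ CARD('n)) * hausdorff_raw CARD('n) (unit_cube :: (real ^ 'n) set)"
  unfolding cube_eq_image[OF s] using s
  by (intro hausdorff_raw_lipschitz_image) (auto simp: dist_norm simp flip: scaleR_diff_right)

lemma emeasure_cube:
  fixes u :: "real ^ 'n::finite"
  assumes s: "s \<ge> 0"
  shows "emeasure lborel (cbox u (u + s *\<^sub>R One)) = ennreal (s ^ CARD('n))"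
    and "emeasure lborel (box u (u + s *\<^sub>R One)) = ennreal (s ^ CARD('n))"
proof -
  have *: "(\<Prod>b\<in>(Basis :: (real ^ 'n) set). (u + s *\<^sub>R One - u) \<bullet> b) = s ^ CARD('n)"
    by simp
  have le: "u \<bullet> b \<le> (u + s *\<^sub>R One) \<bullet> b" if "b \<in> Basis" for b
    using s that by (simp add: inner_add_left)
  show "emeasure lborel (cbox u (u + s *\<^sub>R One)) = ennreal (s ^ CARD('n))"
    using emeasure_lborel_cbox[OF le] * by simp
  show "emeasure lborel (box u (u + s *\<^sub>R One)) = ennreal (s ^ CARD('n))"
    using emeasure_lborel_box[OF le] * by simp
qed

lemma emeasure_unit_cube: "emeasure lborel (unit_cube :: (real ^ 'n::finite) set) = 1"
  using emeasure_cube(1)[of 1 "0 :: real ^ 'n"] by simp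

text \<open>A dyadic grid of side \<open>1 / 2^m\<close> has at most \<open>(2 * 2^m) ^ n\<close>
  cubes of diameter at most \<open>n / 2^m\<close>, so the sums are bounded by
  \<open>(2 * n) ^ n\<close> for every \<open>m\<close>.\<close>

lemma hausdorff_raw_unit_cube_finite:
  "hausdorff_raw CARD('n) (unit_cube :: (real ^ 'n::finite) set) < top"
proof -
  let ?n = "CARD('n)"
  have n: "?n \<ge> 1" by (simp add: Suc_leI)
  have "hausdorff_delta ?n \<delta> (unit_cube :: (real ^ 'n) set) \<le> ennreal ((2 * real ?n) ^ ?n)" if d: "\<delta> > 0" for \<delta> :: real
  proof -
    obtain m :: nat where m: "real ?n / \<delta> < 2 ^ m" using real_arch_pow[of 2] by auto
    \<comment> \<open>The index \<open>2^m\<close> is included for points having a coordinate equal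
      to 1.\<close>
    define I where "I = (PiE UNIV (\<lambda>_. {..2^m}) :: ('n \<Rightarrow> nat) set)"
    define C where "C f = {x :: real ^ 'n. \<forall>i. real (f i) / 2^m \<le> x $ i \<and> x $ i \<le> (real (f i) + 1) / 2^m}" for f :: "'n \<Rightarrow> nat"
    have fI: "finite I" unfolding I_def by (rule finite_PiE) auto
    have dst: "dist x y \<le> real ?n / 2^m" if "x \<in> C f" "y \<in> C f" for x y f
    proof -
      have "\<bar>(x - y) $ i\<bar> \<le> 1 / 2^m" for i
      proof -
        have "real (f i) / 2^m \<le> x $ i" "x $ i \<le> real (f i) / 2^m + 1 / 2^m"
          "real (f i) / 2^m \<le> y $ i" "y $ i \<le> real (f i) / 2^m + 1 / 2^m"
          using that unfolding C_def by (auto simp: add_divide_distrib)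
        then show ?thesis unfolding vector_minus_component abs_le_iff by linarith
      qed
      then have "(\<Sum>i\<in>UNIV. \<bar>(x - y) $ i\<bar>) \<le> (\<Sum>i\<in>(UNIV::'n set). 1 / 2^m)" by (intro sum_mono)
      then show ?thesis using norm_le_l1_cart[of "x - y"] by (simp add: dist_norm)
    qed
    have bd: "bounded (C f)" for f
      using dst unfolding bounded_two_points by blast
    have dm: "diameter (C f) \<le> real ?n / 2^m" for f
      using dst by (intro diameter_le) (auto simp: dist_norm)
    have "hausdorff_delta ?n \<delta> (unit_cube :: (real ^ 'n) set) \<le> (\<Sum>f\<in>I. ennreal (diameter (C f) ^ ?n))"
    proof (rule hausdorff_delta_le_family[OF fI])
      show "unit_cube \<subseteq> \<Union> (C ` I)"
      proof
        fix x :: "real ^ 'n" assume x: "x \<in> unit_cube"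
        have x01: "0 \<le> x $ i" "x $ i \<le> 1" for i
        proof -
          have ax: "axis i 1 \<in> (Basis :: (real ^ 'n) set)" by simp
          then have "0 \<bullet> (axis i 1 :: real ^ 'n) \<le> x \<bullet> axis i 1 \<and> x \<bullet> axis i 1 \<le> One \<bullet> (axis i 1 :: real ^ 'n)"
            using x unfolding mem_box by blast
          then have "0 \<le> x \<bullet> axis i 1 \<and> x \<bullet> axis i 1 \<le> 1"
            using inner_sum_left_Basis[OF ax] by simp
          then show "0 \<le> x $ i" "x $ i \<le> 1" by (simp_all add: inner_axis)
        qed
        define f where "f i = nat \<lfloor>x $ i * 2^m\<rfloor>" for i
        have "f \<in> I" unfolding I_def f_def
        proof (auto simp: PiE_def extensional_def)
          fix i
          have "x $ i * 2^m \<le> 1 * 2^m" using x01 by (intro mult_right_mono) auto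
          then have "x $ i * 2 ^ m < 2 ^ m + 1" by linarith
          then show "\<lfloor>x $ i * 2 ^ m\<rfloor> \<le> 2 ^ m" unfolding floor_le_iff of_int_add of_int_power by simp
        qed
        moreover have "x \<in> C f"
        proof -
          have "real (f i) = of_int \<lfloor>x $ i * 2^m\<rfloor>" for i
            using x01[of i] by (simp add: f_def)
          then have "real (f i) \<le> x $ i * 2^m" "x $ i * 2^m \<le> real (f i) + 1" for i
            by simp_all
          then show ?thesis by (simp add: C_def field_simps)
        qed
        ultimately show "x \<in> \<Union> (C ` I)" by blast
      qed
      show "diameter (C f) \<le> \<delta>" for f
      proof -
        have "real ?n / 2^m \<le> \<delta>" using m d by (simp add: field_simps)
        then show ?thesis using dm[of f] by linarith
      qed
    qed (use bd n d in auto)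
    also have "\<dots> \<le> (\<Sum>f\<in>I. ennreal ((real ?n / 2^m) ^ ?n))"
      using dm bd diameter_ge_0 by (intro sum_mono ennreal_leI power_mono) auto
    also have "\<dots> = ennreal (real (card I) * (real ?n / 2^m) ^ ?n)"
      by (simp add: ennreal_of_nat_eq_real_of_nat ennreal_mult)
    also have "\<dots> \<le> ennreal ((2 * real ?n) ^ ?n)"
    proof (rule ennreal_leI)
      have "real (card I) = (2^m + 1) ^ ?n" unfolding I_def by (subst card_PiE) (auto simp: add.commute)
      also have "\<dots> \<le> (2 * 2^m) ^ ?n" by (intro power_mono) auto
      finally have "real (card I) * (real ?n / 2^m) ^ ?n \<le> (2 * 2^m) ^ ?n * (real ?n / 2^m) ^ ?n"
        by (intro mult_right_mono) auto
      also have "\<dots> = ((2 * 2^m) * (real ?n / 2^m)) ^ ?n" by (simp only: power_mult_distrib)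
      also have "(2 * 2^m) * (real ?n / 2^m) = 2 * real ?n" by simp
      finally show "real (card I) * (real ?n / 2^m) ^ ?n \<le> (2 * real ?n) ^ ?n" .
    qed
    finally show ?thesis .
  qed
  then have "hausdorff_raw ?n (unit_cube :: (real ^ 'n) set) \<le> ennreal ((2 * real ?n) ^ ?n)"
    unfolding hausdorff_raw_eq by (intro SUP_least) auto
  then show ?thesis using ennreal_less_top le_less_trans by blast
qed

text \<open>A nonempty set of diameter \<open>t\<close> lies in a cube of side \<open>2 * t\<close>
  centred at any of its points, so a cover costs at least \<open>1 / 2 ^ n\<close> times the
  Lebesgue measure of what it covers.\<close>

lemma hausdorff_raw_unit_cube_pos:
  "hausdorff_raw CARD('n) (unit_cube :: (real ^ 'n::finite) set) > 0"
proof -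
  let ?n = "CARD('n)"
  have "ennreal (1 / 2 ^ ?n) \<le> hausdorff_delta ?n 1 (unit_cube :: (real ^ 'n) set)"
    unfolding hausdorff_delta_def
  proof (rule INF_greatest, clarify)
    fix C :: "nat \<Rightarrow> (real ^ 'n) set"
    assume C: "unit_cube \<subseteq> \<Union> (range C)" "\<forall>i. bounded (C i) \<and> diameter (C i) \<le> 1"
    \<comment> \<open>For empty \<open>C i\<close> the centre is arbitrary; the diameter is 0, and
      so is the measure of \<open>K i\<close>.\<close>
    define K where "K i = (let c = (SOME x. x \<in> C i) - diameter (C i) *\<^sub>R One in
        cbox c (c + (2 * diameter (C i)) *\<^sub>R One))" for i
    have CK: "C i \<subseteq> K i" for i
    proof
      fix x assume x: "x \<in> C i"
      define y where "y = (SOME x. x \<in> C i)"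
      have y: "y \<in> C i" unfolding y_def using x by (rule someI)
      have "dist x y \<le> diameter (C i)" using C(2) x y by (intro diameter_bounded_bound) auto
      then have "\<bar>(x - y) \<bullet> b\<bar> \<le> diameter (C i)" if "b \<in> Basis" for b
        using Basis_le_norm[OF that, of "x - y"] by (simp add: dist_norm)
      then show "x \<in> K i"
        unfolding K_def y_def[symmetric] Let_def mem_box
        by (auto simp: inner_diff_left inner_add_left abs_le_iff algebra_simps)
    qed
    have Km: "emeasure lborel (K i) = ennreal (2 ^ ?n) * ennreal (diameter (C i) ^ ?n)" for i
      unfolding K_def Let_def using C(2) diameter_ge_0
      by (subst emeasure_cube) (auto simp: power_mult_distrib ennreal_mult)
    have [measurable]: "K i \<in> sets borel" for i unfolding K_def Let_def by simp
    have "1 = emeasure lborel (unit_cube :: (real ^ 'n) set)" by (simp add: emeasure_unit_cube)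
    also have "\<dots> \<le> emeasure lborel (\<Union> (range K))"
      using C(1) CK by (intro emeasure_mono) (auto, blast)
    also have "\<dots> \<le> (\<Sum>i. emeasure lborel (K i))"
      by (intro emeasure_subadditive_countably) auto
    also have "\<dots> = ennreal (2 ^ ?n) * (\<Sum>i. ennreal (diameter (C i) ^ ?n))"
      unfolding Km by simp
    finally have "ennreal (1 / 2 ^ ?n) * 1 \<le> ennreal (1 / 2 ^ ?n) * (ennreal (2 ^ ?n) * (\<Sum>i. ennreal (diameter (C i) ^ ?n)))"
      by (intro mult_left_mono) auto
    then show "ennreal (1 / 2 ^ ?n) \<le> (\<Sum>i. ennreal (diameter (C i) ^ ?n))"
      by (simp add: mult.assoc[symmetric] ennreal_mult[symmetric])
  qed
  also have "\<dots> \<le> hausdorff_raw ?n (unit_cube :: (real ^ 'n) set)"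
    unfolding hausdorff_raw_eq by (rule SUP_upper) auto
  finally show ?thesis by (rule less_le_trans[rotated]) simp
qed

text \<open>On cubes the Hausdorff measure is bounded by the volume times its value on the unit
  cube. A Borel set is covered by nonoverlapping dyadic cubes of total volume barely above its own,
  and countable subadditivity concludes.\<close>

lemma hausdorff_raw_le_lborel:
  fixes S :: "(real ^ 'n::finite) set"
  assumes S: "S \<in> sets borel" "S \<subseteq> cbox u (u + s *\<^sub>R One)" and s: "s > 0"
  shows "hausdorff_raw CARD('n) S \<le> hausdorff_raw CARD('n) (unit_cube :: (real ^ 'n) set) * emeasure lborel S"
proof -
  let ?n = "CARD('n)" and ?c = "hausdorff_raw CARD('n) (unit_cube :: (real ^ 'n) set)"
  have n: "?n \<ge> 1" by (simp add: Suc_leI)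
  have Sm: "S \<in> lmeasurable"
    by (rule bounded_set_imp_lmeasurable) (use S bounded_subset[OF bounded_cbox] in auto)
  have Se: "emeasure lborel S = ennreal (measure lebesgue S)"
    using S(1) emeasure_eq_measure2[OF Sm] by simp
  have "hausdorff_raw ?n S \<le> ?c * ennreal (measure lebesgue S + e)" if e: "e > 0" for e :: real
  proof -
    have "box u (u + s *\<^sub>R One) \<noteq> {}" using s by (auto simp: box_ne_empty inner_add_left)
    obtain \<D> where D: "countable \<D>" "\<And>K. K \<in> \<D> \<Longrightarrow> K \<noteq> {} \<and> (\<exists>c d. K = cbox c d)"
        "pairwise (\<lambda>A B. interior A \<inter> interior B = {}) \<D>"
        "\<And>c d. cbox c d \<in> \<D> \<Longrightarrow> \<exists>n. \<forall>i \<in> Basis. d \<bullet> i - c \<bullet> i = ((u + s *\<^sub>R One) \<bullet> i - u \<bullet> i)/2^n"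
        "S \<subseteq> \<Union>\<D>" "\<Union>\<D> \<in> lmeasurable" "measure lebesgue (\<Union>\<D>) \<le> measure lebesgue S + e"
      by (rule measurable_outer_intervals_bounded[OF Sm S(2) e]) blast
    define X where "X k = (if k \<in> to_nat_on \<D> ` \<D> then from_nat_into \<D> k else {})" for k
    have X: "X k \<in> \<D>" if "k \<in> to_nat_on \<D> ` \<D>" for k
      using that D(1) unfolding X_def by (auto simp: from_nat_into)
    have UX: "(\<Union>k. X k) = \<Union>\<D>"
    proof -
      have "K = X (to_nat_on \<D> K)" if "K \<in> \<D>" for K using that D(1) by (simp add: X_def)
      then have "\<Union>\<D> \<subseteq> (\<Union>k. X k)" by blast
      moreover have "X k \<subseteq> \<Union>\<D>" for k using X[of k] by (cases "k \<in> to_nat_on \<D> ` \<D>") (auto simp: X_def)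
      ultimately show ?thesis by blast
    qed
    \<comment> \<open>The ambient box is a cube and the subdivision halves all sides equally, so
      every member of \<open>\<D>\<close> is again a cube.\<close>
    have cube: "\<exists>c t. t > 0 \<and> K = cbox c (c + t *\<^sub>R One)" if "K \<in> \<D>" for K
    proof -
      obtain c d where cd: "K = cbox c d" using D(2)[OF \<open>K \<in> \<D>\<close>] by blast
      then obtain m where m: "\<forall>i \<in> Basis. d \<bullet> i - c \<bullet> i = ((u + s *\<^sub>R One) \<bullet> i - u \<bullet> i)/2^m"
        using D(4) \<open>K \<in> \<D>\<close> by blast
      have "d = c + (s / 2^m) *\<^sub>R One"
        using m by (intro euclidean_eqI[where 'a="real ^ 'n"]) (auto simp: inner_add_left algebra_simps)
      then show ?thesis using cd s by (intro exI[of _ c] exI[of _ "s / 2^m"]) auto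
    qed
    \<comment> \<open>Interiors are used because they are disjoint, while a cube and its interior
      have the same volume.\<close>
    have HX: "hausdorff_raw ?n (X k) \<le> ?c * emeasure lborel (interior (X k))" for k
    proof (cases "k \<in> to_nat_on \<D> ` \<D>")
      case True
      then obtain c t where ct: "t > 0" "X k = cbox c (c + t *\<^sub>R One)" using cube[OF X] by blast
      show ?thesis using hausdorff_raw_cube_le[OF ct(1), of c] ct(1) unfolding ct(2)
        by (simp add: emeasure_cube interior_cbox mult.commute)
    qed (simp add: X_def hausdorff_raw_empty[OF n])
    have dj: "disjoint_family (\<lambda>k. interior (X k))"
      unfolding disjoint_family_on_def
    proof (intro ballI impI)
      fix k l :: nat assume kl: "k \<noteq> l"
      show "interior (X k) \<inter> interior (X l) = {}"
      proof (cases "k \<in> to_nat_on \<D> ` \<D> \<and> l \<in> to_nat_on \<D> ` \<D>")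
        case True
        then have "X k \<noteq> X l" using kl D(1) unfolding X_def
          by (metis to_nat_on_from_nat_into)
        then show ?thesis using D(3) X True unfolding pairwise_def by blast
      qed (auto simp: X_def)
    qed
    have "hausdorff_raw ?n S \<le> hausdorff_raw ?n (\<Union>k. X k)"
      by (rule hausdorff_raw_mono) (use D(5) UX in simp)
    also have "\<dots> \<le> (\<Sum>k. hausdorff_raw ?n (X k))" by (rule hausdorff_raw_countable_subadditive)
    also have "\<dots> \<le> (\<Sum>k. ?c * emeasure lborel (interior (X k)))"
      by (intro suminf_le HX) auto
    also have "\<dots> = ?c * (\<Sum>k. emeasure lborel (interior (X k)))" by simp
    also have "(\<Sum>k. emeasure lborel (interior (X k))) = emeasure lborel (\<Union>k. interior (X k))"
      by (rule suminf_emeasure) (use dj in auto)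
    also have "emeasure lborel (\<Union>k. interior (X k)) = emeasure lebesgue (\<Union>k. interior (X k))"
      by (simp add: open_UN borel_open)
    also have "emeasure lebesgue (\<Union>k. interior (X k)) \<le> emeasure lebesgue (\<Union>\<D>)"
      using UX interior_subset D(6) by (intro emeasure_mono) (auto simp: fmeasurable_def, blast)
    also have "\<dots> = ennreal (measure lebesgue (\<Union>\<D>))"
      using D(6) by (simp add: emeasure_eq_measure2)
    also have "\<dots> \<le> ennreal (measure lebesgue S + e)" using D(7) by (rule ennreal_leI)
    finally show ?thesis by (simp add: mult_left_mono)
  qed
  then have *: "hausdorff_raw ?n S \<le> ?c * emeasure lborel S + ?c * ennreal e" if "e > 0" for e :: real
    using that unfolding Se by (simp add: distrib_left[symmetric])
  show ?thesis
  proof (rule ennreal_le_epsilon)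
    fix e :: real assume "e > 0"
    obtain c' where c': "?c = ennreal c'" "c' \<ge> 0" 
      using hausdorff_raw_unit_cube_finite[where 'n='n] by (cases ?c) auto
    have "?c * ennreal (e / (c' + 1)) \<le> ennreal e"
      using c' \<open>e > 0\<close> by (simp add: ennreal_mult[symmetric] field_simps)
    moreover have "e / (c' + 1) > 0" using c' \<open>e > 0\<close> by simp
    ultimately show "hausdorff_raw ?n S \<le> ?c * emeasure lborel S + ennreal e"
      using *[of "e / (c' + 1)"] by (meson add_left_mono order_trans)
  qed
qed

text \<open>The upper bound is applied to \<open>S\<close> and to its complement in a cube, where equality is known,
  so the two bounds cannot be strict.\<close>

lemma hausdorff_raw_eq_lborel:
  fixes S :: "(real ^ 'n::finite) set"
  assumes S: "S \<in> sets borel" "bounded S"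
  shows "hausdorff_raw CARD('n) S = hausdorff_raw CARD('n) (unit_cube :: (real ^ 'n) set) * emeasure lborel S"
proof (rule antisym)
  let ?n = "CARD('n)" and ?c = "hausdorff_raw CARD('n) (unit_cube :: (real ^ 'n) set)"
  have n: "?n \<ge> 1" by (simp add: Suc_leI)
  obtain b where b: "b > 0" "\<And>x. x \<in> S \<Longrightarrow> norm x \<le> b" using S(2) bounded_pos by blast
  define u where "u = - (b *\<^sub>R (One :: real ^ 'n))"
  define s where "s = 2 * b"
  have s: "s > 0" using b s_def by simp
  define B where "B = cbox u (u + s *\<^sub>R One)"
  have SB: "S \<subseteq> B"
  proof
    fix x assume "x \<in> S"
    have "\<bar>x \<bullet> i\<bar> \<le> b" if "i \<in> Basis" for i
      using Basis_le_norm[OF that, of x] b(2)[OF \<open>x \<in> S\<close>] by linarith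
    moreover have "u + s *\<^sub>R One = (2 * b - b) *\<^sub>R One" unfolding u_def s_def scaleR_diff_left by simp
    ultimately have "x \<in> cbox u (b *\<^sub>R One)" by (auto simp: u_def mem_box abs_le_iff minus_le_iff)
    then show "x \<in> B" using \<open>u + s *\<^sub>R One = _\<close> unfolding B_def by simp
  qed
  show "hausdorff_raw ?n S \<le> ?c * emeasure lborel S"
    using hausdorff_raw_le_lborel[OF S(1) _ s] SB B_def by blast
  have Bm: "B \<in> sets borel" by (simp add: B_def)
  have eB: "emeasure lborel B = ennreal (s ^ ?n)" unfolding B_def using s by (simp add: emeasure_cube)
  \<comment> \<open>A similarity takes the cube onto the unit cube, and the Lipschitz bound for it
    is the reverse inequality on cubes.\<close>
  have cB: "?c * emeasure lborel B \<le> hausdorff_raw ?n B"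
  proof -
    have "unit_cube = (\<lambda>x. (1 / s) *\<^sub>R (x - u)) ` B"
      unfolding B_def cube_eq_image[OF s] image_image using s by simp
    then have "?c \<le> ennreal ((1 / s) ^ ?n) * hausdorff_raw ?n B"
      using hausdorff_raw_lipschitz_image[of B "\<lambda>x. (1 / s) *\<^sub>R (x - u)" "1 / s" ?n] s
      by (auto simp: dist_norm simp flip: scaleR_diff_right)
    then have "?c * ennreal (s ^ ?n) \<le> (ennreal ((1 / s) ^ ?n) * hausdorff_raw ?n B) * ennreal (s ^ ?n)"
      by (intro mult_right_mono) auto
    also have "\<dots> = (ennreal ((1 / s) ^ ?n) * ennreal (s ^ ?n)) * hausdorff_raw ?n B"
      by (simp add: mult_ac)
    also have "ennreal ((1 / s) ^ ?n) * ennreal (s ^ ?n) = 1"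
      using s by (simp add: ennreal_mult[symmetric] power_one_over)
    finally show ?thesis using eB by simp
  qed
  have fin: "?c * emeasure lborel (B - S) < top"
  proof -
    have "emeasure lborel (B - S) \<le> emeasure lborel B" using Bm by (intro emeasure_mono) auto
    then have "emeasure lborel (B - S) < top" using eB by (simp add: le_less_trans)
    then show ?thesis using hausdorff_raw_unit_cube_finite[where 'n='n]
      by (simp add: ennreal_mult_less_top)
  qed
  have "?c * emeasure lborel S + ?c * emeasure lborel (B - S) = ?c * emeasure lborel B"
  proof -
    have "emeasure lborel S + emeasure lborel (B - S) = emeasure lborel (S \<union> (B - S))"
      using S(1) Bm by (intro plus_emeasure) auto
    also have "S \<union> (B - S) = B" using SB by blast
    finally show ?thesis by (simp add: distrib_left[symmetric])
  qed
  also have "\<dots> \<le> hausdorff_raw ?n (S \<union> (B - S))" using cB SB by (simp add: Un_absorb1)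
  also have "\<dots> \<le> hausdorff_raw ?n S + hausdorff_raw ?n (B - S)" by (rule hausdorff_raw_Un[OF n])
  also have "\<dots> \<le> hausdorff_raw ?n S + ?c * emeasure lborel (B - S)"
    by (intro add_left_mono hausdorff_raw_le_lborel[OF _ _ s, of _ u]) (use S Bm B_def in auto)
  finally have "?c * emeasure lborel (B - S) + ?c * emeasure lborel S
      \<le> ?c * emeasure lborel (B - S) + hausdorff_raw ?n S" by (simp only: add.commute)
  then show "?c * emeasure lborel S \<le> hausdorff_raw ?n S"
    using fin unfolding ennreal_add_left_cancel_le by auto
qed

text \<open>The normalizing constant cancels because it is neither 0 nor infinite.\<close>

lemma hausdorff_isometric_image:
  fixes S :: "(real ^ 'n::finite) set" and f :: "real ^ 'n \<Rightarrow> 'a::metric_space"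
  assumes S: "S \<in> sets borel" "bounded S" and iso: "\<And>x y. dist (f x) (f y) = dist x y"
  shows "hausdorff TYPE('n) (f ` S) = emeasure lborel S"
proof -
  let ?c = "hausdorff_raw CARD('n) (unit_cube :: (real ^ 'n) set)"
  have "?c \<noteq> 0" "?c \<noteq> top"
    using hausdorff_raw_unit_cube_finite[where 'n='n] hausdorff_raw_unit_cube_pos[where 'n='n] by auto
  then show ?thesis
    unfolding hausdorff_def hausdorff_raw_isometry[of f, OF iso] hausdorff_raw_eq_lborel[OF S]
    using ennreal_mult_divide_eq[of ?c "emeasure lborel S"] by (simp add: mult.commute)
qed

subsection \<open>The group law and left translations\<close>

lemma real_polynomial_function_derivative:
  assumes "real_polynomial_function f"
  shows "\<exists>f'. (\<forall>x. (f has_derivative f' x) (at x)) \<and> (\<forall>v. real_polynomial_function (\<lambda>x. f' x v))"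
  using assms
proof induction
  case (linear f)
  then show ?case
    by (intro exI[of _ "\<lambda>x. f"])
       (auto intro: bounded_linear_imp_has_derivative real_polynomial_function.intros(2))
next
  case (const c)
  then show ?case by (intro exI[of _ "\<lambda>x v. 0"]) (auto intro: real_polynomial_function.intros(2))
next
  case (add f g)
  then obtain f' g' where
    "\<And>x. (f has_derivative f' x) (at x)" "\<And>v. real_polynomial_function (\<lambda>x. f' x v)"
    "\<And>x. (g has_derivative g' x) (at x)" "\<And>v. real_polynomial_function (\<lambda>x. g' x v)" by blast
  then show ?case
    by (intro exI[of _ "\<lambda>x v. f' x v + g' x v"])
       (auto intro: has_derivative_add real_polynomial_function.intros(3))
next
  case (mult f g)
  then obtain f' g' where
    "\<And>x. (f has_derivative f' x) (at x)" "\<And>v. real_polynomial_function (\<lambda>x. f' x v)"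
    "\<And>x. (g has_derivative g' x) (at x)" "\<And>v. real_polynomial_function (\<lambda>x. g' x v)" by blast
  note F = this
  show ?case
  proof (intro exI[of _ "\<lambda>x v. f x * g' x v + f' x v * g x"] conjI allI)
    show "((\<lambda>x. f x * g x) has_derivative (\<lambda>v. f x * g' x v + f' x v * g x)) (at x)" for x
      by (intro has_derivative_mult F)
    show "real_polynomial_function (\<lambda>x. f x * g' x v + f' x v * g x)" for v
      by (rule real_polynomial_function.intros(3); rule real_polynomial_function.intros(4)) (use F mult.hyps in auto)
  qed
qed

text \<open>That the derivative is again polynomial in the base point later yields continuity and
  Lipschitz bounds for the differentials of left translations.\<close>

lemma polynomial_function_has_derivative:
  fixes f :: "'a::real_normed_vector \<Rightarrow> 'b::euclidean_space"
  assumes f: "polynomial_function f"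
  shows "(f has_derivative frechet_derivative f (at x)) (at x)"
    and "polynomial_function (\<lambda>x. frechet_derivative f (at x) v)"
proof -
  have "\<exists>f'. (\<forall>x. ((\<lambda>x. f x \<bullet> b) has_derivative f' x) (at x)) \<and> (\<forall>v. real_polynomial_function (\<lambda>x. f' x v))" for b
    by (rule real_polynomial_function_derivative)
       (use f bounded_linear_inner_left in \<open>auto simp: polynomial_function_def o_def\<close>)
  then obtain F where F: "\<And>b x. ((\<lambda>x. f x \<bullet> b) has_derivative F b x) (at x)"
      "\<And>b v. real_polynomial_function (\<lambda>x. F b x v)" by metis
  have "(f has_derivative (\<lambda>v. \<Sum>b\<in>Basis. F b x v *\<^sub>R b)) (at x)" for x
  proof -
    have "((\<lambda>x. \<Sum>b\<in>Basis. (f x \<bullet> b) *\<^sub>R b) has_derivative (\<lambda>v. \<Sum>b\<in>Basis. F b x v *\<^sub>R b)) (at x)"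
      by (intro has_derivative_sum has_derivative_scaleR_left F)
    then show ?thesis by (simp add: euclidean_representation)
  qed
  note D = this
  then have eq: "frechet_derivative f (at x) = (\<lambda>v. \<Sum>b\<in>Basis. F b x v *\<^sub>R b)" for x
    by (rule frechet_derivative_at[symmetric])
  show "(f has_derivative frechet_derivative f (at x)) (at x)" unfolding eq by (rule D)
  show "polynomial_function (\<lambda>x. frechet_derivative f (at x) v)"
    unfolding eq using F(2)
    by (intro polynomial_function_sum polynomial_function_mult polynomial_function_const)
       (auto simp: real_polynomial_function_eq)
qed

lemma polynomial_function_continuous: "polynomial_function f \<Longrightarrow> continuous_on S f"
  for f :: "'a::euclidean_space \<Rightarrow> 'b::euclidean_space"
  by (rule continuous_on_polymonial_function)

lemma polynomial_function_compose': "polynomial_function f \<Longrightarrow> polynomial_function g \<Longrightarrow> polynomial_function (\<lambda>x. g (f x))"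
  for f :: "'a::real_normed_vector \<Rightarrow> 'b::real_normed_vector"
  using polynomial_function_compose[of f g] by (simp add: o_def)

lemma polynomial_function_bilinear:
  fixes B :: "'a::euclidean_space \<Rightarrow> 'a \<Rightarrow> 'b::euclidean_space"
  assumes B: "bilinear B" and f: "polynomial_function f" and g: "polynomial_function g"
  shows "polynomial_function (\<lambda>x. B (f x) (g x))"
proof -
  interpret l: linear "B x" for x using B by (simp add: bilinear_def)
  interpret r: linear "\<lambda>x. B x y" for y using B by (simp add: bilinear_def)
  have "B x y = (\<Sum>b\<in>Basis. \<Sum>c\<in>Basis. (y \<bullet> b) *\<^sub>R (x \<bullet> c) *\<^sub>R B c b)" for x y
  proof -
    have "B x y = B (\<Sum>c\<in>Basis. (x \<bullet> c) *\<^sub>R c) (\<Sum>b\<in>Basis. (y \<bullet> b) *\<^sub>R b)"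
      by (simp only: euclidean_representation)
    then show ?thesis by (simp only: l.sum l.scale r.sum r.scale scaleR_right.sum)
  qed
  note eq = this
  have "polynomial_function (\<lambda>x. f x \<bullet> c)" "polynomial_function (\<lambda>x. g x \<bullet> c)" for c
    using f[unfolded polynomial_function_def, rule_format, OF bounded_linear_inner_left[of c]]
      g[unfolded polynomial_function_def, rule_format, OF bounded_linear_inner_left[of c]]
    by (simp_all add: o_def real_polynomial_function_eq)
  then have "polynomial_function (\<lambda>x. \<Sum>b\<in>Basis. \<Sum>c\<in>Basis. (g x \<bullet> b) *\<^sub>R (f x \<bullet> c) *\<^sub>R B c b)"
    by (intro polynomial_function_sum polynomial_function_mult polynomial_function_const finite_Basis)
  moreover have "(\<lambda>x. B (f x) (g x)) = (\<lambda>x. \<Sum>b\<in>Basis. \<Sum>c\<in>Basis. (g x \<bullet> b) *\<^sub>R (f x \<bullet> c) *\<^sub>R B c b)"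
    using eq by (intro ext)
  ultimately show ?thesis by (rule ssubst[rotated])
qed

section \<open>The Baker-Campbell-Hausdorff polynomial\<close>

lemma finite_bch_index:
  "finite {ps. ps \<noteq> [] \<and> (\<forall>(r, s) \<in> set ps. r + s > 0) \<and> (\<Sum>(r, s)\<leftarrow>ps. r + s) \<le> (N::nat)}"
proof -
  have *: "set ps \<subseteq> {..N} \<times> {..N} \<and> length ps \<le> N"
    if "\<forall>(r, s) \<in> set ps. r + s > 0" "(\<Sum>(r, s)\<leftarrow>ps. r + s) \<le> N" for ps
    using that
  proof (induction ps arbitrary: N)
    case (Cons p ps)
    obtain r s where p: "p = (r, s)" by force
    have "set ps \<subseteq> {..N - (r + s)} \<times> {..N - (r + s)} \<and> length ps \<le> N - (r + s)"
      using Cons.prems p by (intro Cons.IH) auto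
    moreover have "r + s > 0" "r + s \<le> N" using Cons.prems p by auto
    moreover have "{..N - (r + s)} \<times> {..N - (r + s)} \<subseteq> {..N} \<times> {..N}" by auto
    ultimately show ?case using p by auto
  qed simp
  have "finite {ps. set ps \<subseteq> {..N} \<times> {..N} \<and> length ps \<le> N}"
    by (rule finite_lists_length_le) auto
  then show ?thesis by (rule rev_finite_subset) (use * in blast)
qed

lemma nested_bracket_linear:
  assumes "linear L" "\<And>x y. L (br x y) = br (L x) (L y)"
  shows "L (nested_bracket br vs) = nested_bracket br (map L vs)"
proof (induction vs rule: induct_list012)
  case 1 then show ?case using linear_0[OF assms(1)] by simp
qed (use assms(2) in \<open>auto\<close>)

lemma nested_bracket_polynomial:
  fixes br :: "'a::euclidean_space \<Rightarrow> 'a \<Rightarrow> 'a"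
  assumes B: "bilinear br" and "\<And>f. f \<in> set fs \<Longrightarrow> polynomial_function f"
  shows "polynomial_function (\<lambda>x. nested_bracket br (map (\<lambda>f. f x) fs))"
  using assms(2)
proof (induction fs rule: induct_list012)
  case (3 f g fs)
  then show ?case by (auto intro!: polynomial_function_bilinear[OF B])
qed auto

lemma nested_bracket_multiples:
  fixes br :: "'a::euclidean_space \<Rightarrow> 'a \<Rightarrow> 'a"
  assumes B: "bilinear br" and alt: "br w w = 0" and "\<And>v. v \<in> set vs \<Longrightarrow> \<exists>c. v = c *\<^sub>R w"
  shows "(\<exists>c. nested_bracket br vs = c *\<^sub>R w) \<and> (length vs \<ge> 2 \<longrightarrow> nested_bracket br vs = 0)"
  using assms(3)
proof (induction vs rule: induct_list012)
  case 1
  then show ?case by (auto intro: exI[of _ 0])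
next
  case (3 x y zs)
  then obtain a b where "x = a *\<^sub>R w" "nested_bracket br (y # zs) = b *\<^sub>R w" by fastforce
  then have "nested_bracket br (x # y # zs) = 0"
    using B alt by (simp add: bilinear_lmul bilinear_rmul)
  then show ?case by (auto intro: exI[of _ 0])
qed auto

text \<open>With the two coordinate projections as letters, the word becomes a list of polynomial
  functions of the pair \<open>(x, y)\<close>.\<close>

lemma bch_word: "concat (map (\<lambda>(r, s). replicate r x @ replicate s y) ps) =
    map (\<lambda>f. f (x, y)) (concat (map (\<lambda>(r, s). replicate r fst @ replicate s snd) ps))"
  by (induction ps) auto

lemma bch_word_map: "map L (concat (map (\<lambda>(r, s). replicate r x @ replicate s y) ps)) =
    concat (map (\<lambda>(r, s). replicate r (L x) @ replicate s (L y)) ps)"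
  by (induction ps) auto

lemma bch_word_length: "length (concat (map (\<lambda>(r, s). replicate r x @ replicate s y) ps)) = (\<Sum>(r, s)\<leftarrow>ps. r + s)"
  by (induction ps) auto

lemma bch_linear:
  assumes L: "linear L" "\<And>x y. L (br x y) = br (L x) (L y)"
  shows "L (bch br N x y) = bch br N (L x) (L y)"
  unfolding bch_def by (simp only: linear_sum[OF L(1)] linear_scale[OF L(1)] nested_bracket_linear[of L br, OF L] bch_word_map)

lemma bch_polynomial:
  fixes br :: "'a::euclidean_space \<Rightarrow> 'a \<Rightarrow> 'a"
  assumes B: "bilinear br"
  shows "polynomial_function (\<lambda>z. bch br N (fst z) (snd z))"
  unfolding bch_def
proof (intro polynomial_function_sum polynomial_function_cmul finite_bch_index)
  fix ps
  have "polynomial_function (\<lambda>z. nested_bracket br (map (\<lambda>f. f z) (concat (map (\<lambda>(r, s). replicate r fst @ replicate s snd) ps))))"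
    by (rule nested_bracket_polynomial[OF B])
       (auto intro: polynomial_function_bounded_linear bounded_linear_fst bounded_linear_snd)
  then show "polynomial_function (\<lambda>z. nested_bracket br (concat (map (\<lambda>(r, s). replicate r (fst z) @ replicate s (snd z)) ps)))"
    unfolding bch_word[of "fst _" "snd _"] by simp
qed

lemma bch_multiples:
  fixes br :: "'a::euclidean_space \<Rightarrow> 'a \<Rightarrow> 'a"
  assumes B: "bilinear br" and alt: "br w w = 0" and N: "N \<ge> 1"
  shows "bch br N (a *\<^sub>R w) (b *\<^sub>R w) = (a + b) *\<^sub>R w"
proof -
  let ?I = "{ps. ps \<noteq> [] \<and> (\<forall>(r, s) \<in> set ps. r + s > 0) \<and> (\<Sum>(r, s)\<leftarrow>ps. r + s) \<le> N}"
  let ?w = "\<lambda>ps. concat (map (\<lambda>(r, s). replicate r (a *\<^sub>R w) @ replicate s (b *\<^sub>R w)) ps)"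
  let ?t = "\<lambda>ps. ((- 1) ^ (length ps - 1) /
           (real (length ps) * real (\<Sum>(r, s)\<leftarrow>ps. r + s) * (\<Prod>(r, s)\<leftarrow>ps. fact r * fact s)))
        *\<^sub>R nested_bracket br (?w ps)"
  have "bch br N (a *\<^sub>R w) (b *\<^sub>R w) = sum ?t ?I" by (simp only: bch_def)
  also have "\<dots> = sum ?t {[(1, 0)], [(0, 1)]}"
  proof (rule sum.mono_neutral_right)
    show "finite ?I" by (rule finite_bch_index)
    show "{[(1, 0)], [(0, 1)]} \<subseteq> ?I" using N by auto
    show "\<forall>ps\<in>?I - {[(1, 0)], [(0, 1)]}. ?t ps = 0"
    proof
      fix ps assume ps: "ps \<in> ?I - {[(1, 0)], [(0, 1)]}"
      then obtain r s qs where q: "ps = (r, s) # qs" by (cases ps) auto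
      have rs: "r + s > 0" using ps q by auto
      have "(\<Sum>(r, s)\<leftarrow>ps. r + s) \<ge> 2"
      proof (cases qs)
        case Nil
        then have "(r, s) \<noteq> (1, 0)" "(r, s) \<noteq> (0, 1)" using ps q by auto
        then show ?thesis using rs q Nil by (cases r; cases s) auto
      next
        case (Cons p rest)
        obtain r' s' where p: "p = (r', s')" by force
        then have "r' + s' > 0" using ps q Cons by auto
        moreover have "(\<Sum>(r, s)\<leftarrow>ps. r + s) = (r + s) + ((r' + s') + (\<Sum>(r, s)\<leftarrow>rest. r + s))"
          using q Cons p by simp
        ultimately show ?thesis using rs by linarith
      qed
      then have "length (?w ps) \<ge> 2" by (simp only: bch_word_length)
      moreover have "\<exists>c. v = c *\<^sub>R w" if "v \<in> set (?w ps)" for v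
        using that by (auto split: if_splits)
      ultimately have "nested_bracket br (?w ps) = 0"
        using nested_bracket_multiples[OF B alt, of "?w ps"] by blast
      then show "?t ps = 0" by simp
    qed
  qed
  also have "\<dots> = a *\<^sub>R w + b *\<^sub>R w" by simp
  finally show ?thesis by (simp add: scaleR_add_left)
qed

section \<open>Degrees, dilations and the differential of the group law\<close>

locale hom_group =
  fixes G :: "('a::euclidean_space) graded_group" and e :: "nat \<Rightarrow> 'a"
  assumes hg: "homogeneous_group G" and gb: "graded_basis G e"
begin

abbreviation gm :: "'a \<Rightarrow> 'a \<Rightarrow> 'a" (infixl "\<star>" 70) where "x \<star> y \<equiv> gmul G x y"
abbreviation "deg \<equiv> index_degree G"

sublocale orthonormal_frame e
  by unfold_locales (use gb in \<open>auto simp: graded_basis_def\<close>)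

sublocale grp: group "gmul G" 0 uminus
  using hg by (simp add: homogeneous_group_def)

lemma step_pos: "step G \<ge> 1" and layer_subspace: "subspace (layer G j)"
  and layer_trivial: "j \<notin> {1..step G} \<Longrightarrow> layer G j = {0}"
  and layers_orthogonal: "i \<noteq> j \<Longrightarrow> x \<in> layer G i \<Longrightarrow> y \<in> layer G j \<Longrightarrow> x \<bullet> y = 0"
  and layers_span: "span (\<Union>j\<in>{1..step G}. layer G j) = UNIV"
  and bracket_bilinear: "bilinear (bracket G)"
  and bracket_alt: "bracket G x x = 0"
  and bracket_layer: "i \<ge> 1 \<Longrightarrow> j \<ge> 1 \<Longrightarrow> x \<in> layer G i \<Longrightarrow> y \<in> layer G j \<Longrightarrow> bracket G x y \<in> layer G (i + j)"
  and gmul_bch: "x \<star> y = bch (bracket G) (step G) x y"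
  using hg unfolding homogeneous_group_def orthogonal_def by blast+

lemma layer_basis: "j \<in> {1..step G} \<Longrightarrow> span (e ` {layer_sum G (j - 1)<..layer_sum G j}) = layer G j"
  using gb by (simp add: graded_basis_def)

lemma layer_sum_mono: "i \<le> j \<Longrightarrow> layer_sum G i \<le> layer_sum G j"
  unfolding layer_sum_def by (rule sum_mono2) auto

text \<open>Since the layers span, their index blocks exhaust \<open>{1..DIM('a)}\<close>. Hence the
  definite description in \<open>index_degree\<close> has exactly one solution, the least
  \<open>j\<close> with \<open>i \<le> layer_sum G j\<close>.\<close>

lemma deg_bounds:
  assumes i: "i \<in> {1..DIM('a)}"
  shows "deg i \<in> {1..step G}" and "e i \<in> layer G (deg i)"
proof -
  have "layer G j \<subseteq> span (e ` {1..layer_sum G (step G)})" if "j \<in> {1..step G}" for j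
  proof -
    have "layer_sum G j \<le> layer_sum G (step G)" using that by (intro layer_sum_mono) auto
    then have "{layer_sum G (j - 1)<..layer_sum G j} \<subseteq> {1..layer_sum G (step G)}" by auto
    then show ?thesis unfolding layer_basis[OF that, symmetric] by (intro span_mono image_mono)
  qed
  then have "span (\<Union>j\<in>{1..step G}. layer G j) \<subseteq> span (e ` {1..layer_sum G (step G)})"
    by (intro span_minimal UN_least subspace_span) auto
  then have "UNIV \<subseteq> span (e ` {1..layer_sum G (step G)})" using layers_span by simp
  then have "dim (UNIV :: 'a set) \<le> card (e ` {1..layer_sum G (step G)})"
    by (intro dim_le_card) auto
  also have "\<dots> \<le> layer_sum G (step G)" using card_image_le[of "{1..layer_sum G (step G)}" e] by simp
  finally have q: "DIM('a) \<le> layer_sum G (step G)" by simp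
  define j where "j = (LEAST j. i \<le> layer_sum G j)"
  have ij: "i \<le> layer_sum G j" unfolding j_def by (rule LeastI[of _ "step G"]) (use i q in auto)
  have jst: "j \<le> step G" unfolding j_def by (rule Least_le) (use i q in auto)
  have j1: "j \<ge> 1" using i ij by (cases j) (auto simp: layer_sum_def)
  have lt: "layer_sum G (j - 1) < i"
    using not_less_Least[of "j - 1" "\<lambda>j. i \<le> layer_sum G j"] j1 by (auto simp: j_def[symmetric])
  have "deg i = j"
    unfolding index_degree_def
  proof (rule the_equality)
    show "1 \<le> j \<and> layer_sum G (j - 1) < i \<and> i \<le> layer_sum G j" using j1 lt ij by simp
    fix l assume l: "1 \<le> l \<and> layer_sum G (l - 1) < i \<and> i \<le> layer_sum G l"
    show "l = j"
    proof (rule antisym)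
      show "j \<le> l" unfolding j_def by (rule Least_le) (use l in simp)
      show "l \<le> j"
      proof (rule ccontr)
        assume "\<not> l \<le> j"
        then have "layer_sum G j \<le> layer_sum G (l - 1)" by (intro layer_sum_mono) auto
        then show False using l ij by simp
      qed
    qed
  qed
  then show "deg i \<in> {1..step G}" using j1 jst by simp
  have "e i \<in> span (e ` {layer_sum G (j - 1)<..layer_sum G j})" using lt ij by (intro span_base) auto
  then show "e i \<in> layer G (deg i)" using layer_basis[of j] j1 jst \<open>deg i = j\<close> by simp
qed

lemma layer_coords: "x \<in> layer G j \<Longrightarrow> i \<in> {1..DIM('a)} \<Longrightarrow> deg i \<noteq> j \<Longrightarrow> x \<bullet> e i = 0"
  using layers_orthogonal[of j "deg i" x "e i"] deg_bounds(2)[of i] by auto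

text \<open>The explicit form of \<open>dilation\<close>, diagonal in the graded basis. At
  \<open>r = 0\<close> it collapses to 0 because all degrees are positive, which later serves as the
  left end of an intermediate value argument.\<close>

definition dl :: "real \<Rightarrow> 'a \<Rightarrow> 'a" where
  "dl r x = (\<Sum>i\<in>{1..DIM('a)}. (r ^ deg i * (x \<bullet> e i)) *\<^sub>R e i)"

lemma dl_coord: "i \<in> {1..DIM('a)} \<Longrightarrow> dl r x \<bullet> e i = r ^ deg i * (x \<bullet> e i)"
  unfolding dl_def by (rule inner_sum_e)

lemma linear_dl: "linear (dl r)"
  by (rule linearI; rule coords_eqI) (simp_all add: dl_coord inner_add_left distrib_left)

lemma dl_layer: "x \<in> layer G j \<Longrightarrow> dl r x = r ^ j *\<^sub>R x"
proof (rule coords_eqI)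
  fix i assume x: "x \<in> layer G j" and i: "i \<in> {1..DIM('a)}"
  show "dl r x \<bullet> e i = (r ^ j *\<^sub>R x) \<bullet> e i"
    using layer_coords[OF x i] by (cases "deg i = j") (auto simp: dl_coord[OF i])
qed

lemma dilation_eq: "dilation G r = dl r"
  unfolding dilation_def
proof (rule the_equality)
  show "linear (dl r) \<and> (\<forall>j\<in>{1..step G}. \<forall>x\<in>layer G j. dl r x = r ^ j *\<^sub>R x)"
    using linear_dl dl_layer by blast
  fix f assume f: "linear f \<and> (\<forall>j\<in>{1..step G}. \<forall>x\<in>layer G j. f x = r ^ j *\<^sub>R x)"
  show "f = dl r"
  proof
    fix x
    have x: "x \<in> span (\<Union>j\<in>{1..step G}. layer G j)" using layers_span by simp
    show "f x = dl r x"
      by (rule linear_eq_on[OF _ linear_dl x]) (use f dl_layer in auto)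
  qed
qed

lemma dl_dl: "dl r (dl s x) = dl (r * s) x"
  by (rule coords_eqI) (simp add: dl_coord power_mult_distrib mult.assoc)

lemma dl_one [simp]: "dl 1 x = x"
  by (rule coords_eqI) (simp add: dl_coord)

lemma dl_zero_right [simp]: "dl r 0 = 0"
  using linear_0[OF linear_dl] .

lemma dl_zero_left: "dl 0 x = 0"
proof (rule coords_eqI)
  fix i assume i: "i \<in> {1..DIM('a)}"
  then have "deg i \<ge> 1" using deg_bounds(1)[OF i] by simp
  then show "dl 0 x \<bullet> e i = 0 \<bullet> e i" using i by (simp add: dl_coord power_0_left)
qed

lemma dl_inverse: "r \<noteq> 0 \<Longrightarrow> dl (1 / r) (dl r x) = x" "r \<noteq> 0 \<Longrightarrow> dl r (dl (1 / r) x) = x"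
  by (simp_all add: dl_dl)

lemma norm_dl_le:
  assumes "0 \<le> r" "r \<le> 1" shows "norm (dl r x) \<le> r * (\<Sum>i\<in>{1..DIM('a)}. norm x)"
proof -
  have "norm (dl r x) \<le> (\<Sum>i\<in>{1..DIM('a)}. norm ((r ^ deg i * (x \<bullet> e i)) *\<^sub>R e i))"
    unfolding dl_def by (rule norm_sum)
  also have "\<dots> \<le> (\<Sum>i\<in>{1..DIM('a)}. r * norm x)"
  proof (rule sum_mono)
    fix i assume i: "i \<in> {1..DIM('a)}"
    have n: "norm (e i) = 1" using orthonormal[OF i i] by (simp add: norm_eq_1)
    have "deg i \<ge> 1" using deg_bounds(1)[OF i] by simp
    then have "r ^ deg i \<le> r ^ 1" using assms by (intro power_decreasing) auto
    moreover have "\<bar>x \<bullet> e i\<bar> \<le> norm x" using Cauchy_Schwarz_ineq2[of x "e i"] n by simp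
    ultimately have "r ^ deg i * \<bar>x \<bullet> e i\<bar> \<le> r * norm x" using assms by (intro mult_mono) auto
    then show "norm ((r ^ deg i * (x \<bullet> e i)) *\<^sub>R e i) \<le> r * norm x" using assms n by (simp add: abs_mult)
  qed
  finally show ?thesis by (simp only: sum_distrib_left)
qed

lemma bracket_expand: "bracket G (\<Sum>i\<in>I. c i *\<^sub>R f i) (\<Sum>j\<in>J. b j *\<^sub>R h j) =
      (\<Sum>j\<in>J. b j *\<^sub>R (\<Sum>i\<in>I. c i *\<^sub>R bracket G (f i) (h j)))"
proof -
  have l: "linear (bracket G x)" and r: "linear (\<lambda>x. bracket G x y)" for x y
    using bracket_bilinear by (simp_all add: bilinear_def)
  show ?thesis by (simp only: linear_sum[OF l] linear_scale[OF l] linear_sum[OF r] linear_scale[OF r])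
qed

lemma bracket_dl: "dl r (bracket G x y) = bracket G (dl r x) (dl r y)"
proof -
  let ?Q = "{1..DIM('a)}"
  have b: "dl r (bracket G (e i) (e j)) = r ^ (deg i + deg j) *\<^sub>R bracket G (e i) (e j)"
    if "i \<in> ?Q" "j \<in> ?Q" for i j
    by (rule dl_layer, rule bracket_layer) (use that deg_bounds in auto)
  have "dl r (bracket G x y) = dl r (bracket G (\<Sum>i\<in>?Q. (x \<bullet> e i) *\<^sub>R e i) (\<Sum>j\<in>?Q. (y \<bullet> e j) *\<^sub>R e j))"
    using expand[of x] expand[of y] by simp
  also have "\<dots> = (\<Sum>j\<in>?Q. (y \<bullet> e j) *\<^sub>R (\<Sum>i\<in>?Q. (x \<bullet> e i) *\<^sub>R dl r (bracket G (e i) (e j))))"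
    by (simp only: bracket_expand linear_sum[OF linear_dl] linear_scale[OF linear_dl])
  also have "\<dots> = (\<Sum>j\<in>?Q. (r ^ deg j * (y \<bullet> e j)) *\<^sub>R (\<Sum>i\<in>?Q. (r ^ deg i * (x \<bullet> e i)) *\<^sub>R bracket G (e i) (e j)))"
    by (intro sum.cong refl) (simp add: b scaleR_right.sum power_add mult_ac)
  also have "\<dots> = bracket G (dl r x) (dl r y)" unfolding dl_def bracket_expand ..
  finally show ?thesis .
qed

lemma dl_gmul: "dl r (x \<star> y) = dl r x \<star> dl r y"
proof -
  have "dl r (bracket G x y) = bracket G (dl r x) (dl r y)" for x y by (rule bracket_dl)
  from bch_linear[of "dl r" "bracket G" "step G" x y, OF linear_dl this] show ?thesis
    by (simp only: gmul_bch)
qed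

lemma gmul_multiples: "(a *\<^sub>R w) \<star> (b *\<^sub>R w) = (a + b) *\<^sub>R w"
  unfolding gmul_bch by (rule bch_multiples[OF bracket_bilinear bracket_alt step_pos])

lemma gmul_inverse [simp]: "- x \<star> x = 0" "x \<star> - x = 0"
  using grp.left_neutral grp.right_neutral grp.left_inverse grp.right_inverse by auto

lemma gmul_assoc: "x \<star> y \<star> z = x \<star> (y \<star> z)"
  by (rule grp.assoc)

lemma gmul_cancel [simp]: "- x \<star> (x \<star> y) = y" "x \<star> (- x \<star> y) = y"
  by (simp_all add: gmul_assoc[symmetric])

text \<open>\<open>GD\<close> is the differential of the product, \<open>Dl p\<close> the differential at \<open>0\<close> of the left
  translation by \<open>p\<close>, and \<open>Il p\<close> its inverse. Thus \<open>\<lambda>p. Dl p v\<close> is the left invariant field with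
  value \<open>v\<close> at \<open>0\<close>.\<close>

definition GD :: "'a \<times> 'a \<Rightarrow> 'a \<times> 'a \<Rightarrow> 'a" where
  "GD z = frechet_derivative (\<lambda>z. fst z \<star> snd z) (at z)"

lemma gmul_polynomial: "polynomial_function (\<lambda>z. fst z \<star> snd z)"
  unfolding gmul_bch by (rule bch_polynomial[OF bracket_bilinear])

lemma gmul_has_derivative: "((\<lambda>z. fst z \<star> snd z) has_derivative GD z) (at z)"
  unfolding GD_def by (rule polynomial_function_has_derivative(1)[OF gmul_polynomial])

lemma GD_polynomial: "polynomial_function (\<lambda>z. GD z v)"
  unfolding GD_def by (rule polynomial_function_has_derivative(2)[OF gmul_polynomial])

lemma linear_GD: "linear (GD z)"
  using gmul_has_derivative has_derivative_linear by blast

lemma gmul_derivative_compose: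
  assumes "(f has_derivative f') (at x within S)" "(g has_derivative g') (at x within S)"
  shows "((\<lambda>x. f x \<star> g x) has_derivative (\<lambda>h. GD (f x, g x) (f' h, g' h))) (at x within S)"
proof -
  have "((\<lambda>x. (f x, g x)) has_derivative (\<lambda>h. (f' h, g' h))) (at x within S)"
    using assms by (rule has_derivative_Pair)
  from has_derivative_compose[OF this gmul_has_derivative] show ?thesis by simp
qed

lemma continuous_gmul:
  assumes "continuous_on S f" "continuous_on S g"
  shows "continuous_on S (\<lambda>x. f x \<star> g x)"
proof -
  have "continuous_on UNIV (\<lambda>z. fst z \<star> snd z)"
    by (rule polynomial_function_continuous[OF gmul_polynomial])
  from continuous_on_compose2[OF this continuous_on_Pair[OF assms]] show ?thesis by simp
qed

lemma gmul_left_derivative: "(gmul G p has_derivative (\<lambda>v. GD (p, x) (0, v))) (at x)"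
  using gmul_derivative_compose[of "\<lambda>_. p" "\<lambda>_. 0" x UNIV "\<lambda>x. x" "\<lambda>h. h"] by simp

lemma frechet_gmul: "frechet_derivative (gmul G p) (at x) v = GD (p, x) (0, v)"
  using frechet_derivative_at[OF gmul_left_derivative, of p x] by metis

definition Dl :: "'a \<Rightarrow> 'a \<Rightarrow> 'a" where "Dl p v = GD (p, 0) (0, v)"
definition Il :: "'a \<Rightarrow> 'a \<Rightarrow> 'a" where "Il p v = GD (- p, p) (0, v)"

lemma linear_GD_right: "linear (\<lambda>v. GD z (0, v))"
proof (rule linearI)
  show "GD z (0, a + b) = GD z (0, a) + GD z (0, b)" for a b
    using linear_add[OF linear_GD, of z "(0, a)" "(0, b)"] by simp
  show "GD z (0, r *\<^sub>R b) = r *\<^sub>R GD z (0, b)" for r b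
    using linear_scale[OF linear_GD, of z r "(0, b)"] by simp
qed

lemma linear_Dl: "linear (Dl p)" and linear_Il: "linear (Il p)"
  unfolding Dl_def Il_def by (rule linear_GD_right)+

text \<open>The chain rule applied to associativity. Specialized to points with product 0 it shows
  that \<open>Il\<close> inverts \<open>Dl\<close>.\<close>

lemma GD_right_chain: "GD (p, x \<star> y) (0, GD (x, y) (0, v)) = GD (p \<star> x, y) (0, v)"
proof -
  have "((\<lambda>y. p \<star> (x \<star> y)) has_derivative (\<lambda>v. GD (p, x \<star> y) (0, GD (x, y) (0, v)))) (at y)"
    using has_derivative_compose[OF gmul_left_derivative[of x y] gmul_left_derivative[of p "x \<star> y"]] by simp
  moreover have "((\<lambda>y. p \<star> (x \<star> y)) has_derivative (\<lambda>v. GD (p \<star> x, y) (0, v))) (at y)"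
  proof -
    have "(\<lambda>y. p \<star> (x \<star> y)) = gmul G (p \<star> x)" by (simp add: fun_eq_iff gmul_assoc)
    then show ?thesis using gmul_left_derivative[of "p \<star> x" y] by simp
  qed
  ultimately show ?thesis by (metis has_derivative_unique)
qed

lemma GD_zero_left [simp]: "GD (0, x) (0, v) = v"
proof -
  have "((\<lambda>y. y) has_derivative (\<lambda>v. GD (0, x) (0, v))) (at x)"
  proof -
    have "(\<lambda>y. y) = gmul G 0" by (simp add: fun_eq_iff)
    then show ?thesis using gmul_left_derivative[of 0 x] by simp
  qed
  then show ?thesis by (metis has_derivative_unique has_derivative_ident)
qed

lemma Dl_zero [simp]: "Dl 0 v = v"
  unfolding Dl_def by simp

lemma Il_Dl [simp]: "Il p (Dl p v) = v"
  using GD_right_chain[of "- p" p 0 v] by (simp add: Il_def Dl_def)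

lemma Dl_Il [simp]: "Dl p (Il p v) = v"
  using GD_right_chain[of p "- p" p v] by (simp add: Il_def Dl_def)

lemma Dl_gmul: "GD (p, x) (0, Dl x v) = Dl (p \<star> x) v"
  using GD_right_chain[of p x 0 v] by (simp add: Dl_def)

lemma GD_translate: "GD (p, x) (0, v) = Dl (p \<star> x) (Il x v)"
  using Dl_gmul[of p x "Il x v"] by simp

lemma GD_zero: "GD (0, 0) (h, k) = h + k"
proof -
  have "GD (0, 0) (h, 0) = h"
  proof -
    have "((\<lambda>y. y) has_derivative (\<lambda>v. GD (0, 0) (v, 0))) (at 0)"
      using gmul_derivative_compose[of "\<lambda>x. x" "\<lambda>h. h" 0 UNIV "\<lambda>_. 0" "\<lambda>_. 0"] by simp
    then show ?thesis by (metis has_derivative_unique has_derivative_ident)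
  qed
  moreover have "GD (0, 0) (h, k) = GD (0, 0) (h, 0) + GD (0, 0) (0, k)"
    using linear_add[OF linear_GD, of "(0,0)" "(h, 0)" "(0, k)"] by simp
  ultimately show ?thesis by simp
qed

lemma Dl_polynomial: "polynomial_function (\<lambda>p. Dl p v)"
proof -
  have "polynomial_function (\<lambda>p::'a. (p, 0::'a))"
    by (intro polynomial_function_bounded_linear bounded_linear_Pair bounded_linear_ident bounded_linear_zero)
  from polynomial_function_compose'[OF this GD_polynomial] show ?thesis by (simp add: Dl_def)
qed

lemma Il_polynomial: "polynomial_function (\<lambda>p. Il p v)"
proof -
  have "polynomial_function (\<lambda>p::'a. (- p, p))"
    by (intro polynomial_function_bounded_linear bounded_linear_Pair bounded_linear_ident bounded_linear_minus)
  from polynomial_function_compose'[OF this GD_polynomial] show ?thesis by (simp add: Il_def)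
qed

text \<open>Differentiating \<open>(t w)(s w) = (t + s) w\<close> in \<open>s\<close> shows that the
  left invariant field of \<open>w\<close> is constant along the ray of \<open>w\<close>. So rays
  are integral curves, and they are the limits of the rescaled curves.\<close>

lemma Dl_multiple: "Dl (t *\<^sub>R w) w = w"
proof -
  have "((\<lambda>s::real. (t *\<^sub>R w) \<star> (s *\<^sub>R w)) has_derivative (\<lambda>h. GD (t *\<^sub>R w, 0 *\<^sub>R w) (0, h *\<^sub>R w))) (at 0)"
    by (rule gmul_derivative_compose[where f = "\<lambda>_. t *\<^sub>R w" and g = "\<lambda>s. s *\<^sub>R w" and f' = "\<lambda>_. 0" and x = 0])
       (auto intro!: derivative_eq_intros)
  moreover have "((\<lambda>s::real. (t *\<^sub>R w) \<star> (s *\<^sub>R w)) has_derivative (\<lambda>h. h *\<^sub>R w)) (at 0)"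
    unfolding gmul_multiples by (auto intro!: derivative_eq_intros)
  ultimately have "(\<lambda>h. GD (t *\<^sub>R w, 0 *\<^sub>R w) (0, h *\<^sub>R w)) = (\<lambda>h::real. h *\<^sub>R w)"
    by (rule has_derivative_unique)
  from fun_cong[OF this, of 1] show ?thesis by (simp add: Dl_def)
qed

text \<open>The derivative at 0 of the automorphism property of dilations. It says that dilating a
  curve dilates its left translated velocity.\<close>

lemma Dl_dl: "Dl (dl r x) (dl r v) = dl r (Dl x v)"
proof -
  have bl: "bounded_linear (dl r)" using linear_dl linear_conv_bounded_linear by blast
  have "((\<lambda>y. dl r x \<star> dl r y) has_derivative (\<lambda>v. GD (dl r x, dl r 0) (0, dl r v))) (at 0)"
    by (rule gmul_derivative_compose) (auto intro: bounded_linear_imp_has_derivative[OF bl])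
  moreover have "((\<lambda>y. dl r (x \<star> y)) has_derivative (\<lambda>v. dl r (GD (x, 0) (0, v)))) (at 0)"
    by (rule bounded_linear.has_derivative[OF bl gmul_left_derivative])
  ultimately have "(\<lambda>v. GD (dl r x, dl r 0) (0, dl r v)) = (\<lambda>v. dl r (GD (x, 0) (0, v)))"
    unfolding dl_gmul by (rule has_derivative_unique)
  from fun_cong[OF this, of v] show ?thesis by (simp add: Dl_def)
qed

end

subsection \<open>Homogeneous distances\<close>

text \<open>A limit of a maximizing sequence is a maximum under upper semicontinuity, the only
  regularity established below for the volumes of slices.\<close>

lemma usc_attains_max:
  fixes c :: "'a::metric_space \<Rightarrow> real"
  assumes K: "compact K" "K \<noteq> {}" and bdd: "bdd_above (c ` K)"
    and usc: "\<And>u v. (\<And>k. v k \<in> K) \<Longrightarrow> v \<longlonglongrightarrow> u \<Longrightarrow> u \<in> K \<Longrightarrow> \<forall>\<epsilon>>0. \<exists>k0. \<forall>k\<ge>k0. c (v k) \<le> c u + \<epsilon>"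
  shows "\<exists>u\<in>K. \<forall>v\<in>K. c v \<le> c u"
proof -
  define S where "S = (SUP u\<in>K. c u)"
  have "\<exists>u\<in>K. S - 1 / real (Suc k) < c u" for k
  proof -
    have "S - 1 / real (Suc k) < S" by simp
    then show ?thesis unfolding S_def using less_cSUP_iff[OF K(2) bdd] by blast
  qed
  then obtain u where u: "\<And>k. u k \<in> K" "\<And>k. S - 1 / real (Suc k) < c (u k)" by metis
  obtain l r where l: "l \<in> K" "strict_mono r" "(u \<circ> r) \<longlonglongrightarrow> l"
    using K(1) u(1) unfolding compact_def by meson
  have "S \<le> c l"
  proof (rule field_le_epsilon)
    fix \<epsilon> :: real assume e: "\<epsilon> > 0"
    obtain k0 where k0: "\<forall>k\<ge>k0. c ((u \<circ> r) k) \<le> c l + \<epsilon> / 2"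
      using usc[of "u \<circ> r" l] u(1) l e by (auto dest!: spec[of _ "\<epsilon> / 2"])
    obtain k1 where k1: "1 / real (Suc k1) < \<epsilon> / 2" using e by (meson half_gt_zero nat_approx_posE)
    define k where "k = max k0 k1"
    have "k1 \<le> r k" using seq_suble[OF l(2), of k] by (simp add: k_def)
    then have "1 / real (Suc (r k)) \<le> 1 / real (Suc k1)" by (simp add: frac_le)
    moreover have "c (u (r k)) \<le> c l + \<epsilon> / 2" using k0 by (simp add: k_def)
    ultimately show "S \<le> c l + \<epsilon>" using u(2)[of "r k"] k1 by linarith
  qed
  moreover have "c v \<le> S" if "v \<in> K" for v unfolding S_def by (rule cSUP_upper[OF that bdd])
  ultimately show ?thesis using l(1) by force
qed

text \<open>The assumption \<open>layer1\<close> provides a horizontal direction, along which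
  \<open>d\<close> grows linearly; this gives balls of radius \<open>r\<close> the diameter
  \<open>2 * r\<close>.\<close>

locale hom_metric_group = hom_group G e for G :: "('a::euclidean_space) graded_group" and e +
  fixes d :: "'a \<Rightarrow> 'a \<Rightarrow> real"
  assumes hd: "homogeneous_distance G d" and layer1: "layer G 1 \<noteq> {0}"
begin

sublocale dm: Metric_space UNIV d
  using hd by (simp add: homogeneous_distance_def)

lemma d_left: "d (z \<star> x) (z \<star> y) = d x y"
  and d_dl: "r > 0 \<Longrightarrow> d (dl r x) (dl r y) = r * d x y"
  using hd unfolding homogeneous_distance_def dilation_eq by blast+

lemma d_facts: "d x x = 0" "d x y \<ge> 0" "d x y = d y x" "d x z \<le> d x y + d y z" "d x y = 0 \<Longrightarrow> x = y"
  using dm.commute dm.triangle[of x y z] dm.zero[of x y] by auto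

lemma d_zero_eq: "d x y = d 0 (- x \<star> y)"
  using d_left[of "- x" x y] by simp

lemma d0_minus: "d 0 (- x) = d 0 x"
  using d_left[of "x" 0 "- x"] d_facts(3) by simp

lemma d0_gmul_le: "d 0 (x \<star> y) \<le> d 0 x + d 0 y"
  using d_facts(4)[of 0 "x \<star> y" x] d_left[of x 0 y] by simp

lemma d0_dl: "r > 0 \<Longrightarrow> d 0 (dl r x) = r * d 0 x"
  using d_dl[of r 0 x] by simp

text \<open>For \<open>t > 0\<close> the vector \<open>t *\<^sub>R e i\<close> is the dilation of
  \<open>e i\<close> by the root of \<open>t\<close> of order \<open>deg i\<close>.\<close>

lemma d0_basis_multiple:
  assumes i: "i \<in> {1..DIM('a)}"
  shows "d 0 (t *\<^sub>R e i) = root (deg i) \<bar>t\<bar> * d 0 (e i)"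
proof -
  have dg: "deg i > 0" using deg_bounds(1)[OF i] by simp
  have pos: "d 0 (t *\<^sub>R e i) = root (deg i) t * d 0 (e i)" if t: "t > 0" for t
  proof -
    have "dl (root (deg i) t) (e i) = t *\<^sub>R e i"
      using dl_layer[OF deg_bounds(2)[OF i], of "root (deg i) t"] dg t by simp
    then show ?thesis using d0_dl[of "root (deg i) t" "e i"] dg t by simp
  qed
  consider "t > 0" | "t = 0" | "t < 0" by linarith
  then show ?thesis
  proof cases
    case 3
    then have "d 0 (- (- t *\<^sub>R e i)) = root (deg i) (- t) * d 0 (e i)"
      using pos[of "- t"] unfolding d0_minus by simp
    then show ?thesis using 3 by simp
  qed (use pos dg d_facts(1) in auto)
qed

text \<open>Products of elements of the one-parameter subgroups through the basis vectors cover a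
  neighbourhood of \<open>0\<close>, and on each of them \<open>d\<close> is explicit.\<close>

definition second_kind :: "nat list \<Rightarrow> 'a \<Rightarrow> 'a" where
  "second_kind is x = foldr (\<lambda>i y. ((x \<bullet> e i) *\<^sub>R e i) \<star> y) is 0"

lemma second_kind_simps: "second_kind [] x = 0"
  "second_kind (i # is) x = ((x \<bullet> e i) *\<^sub>R e i) \<star> second_kind is x"
  by (simp_all add: second_kind_def)

lemma second_kind_zero: "second_kind is 0 = 0"
  by (induction "is") (simp_all add: second_kind_simps)

lemma second_kind_continuous: "continuous_on UNIV (second_kind is)"
proof (induction "is")
  case (Cons i "is")
  have "continuous_on UNIV (\<lambda>x. ((x \<bullet> e i) *\<^sub>R e i) \<star> second_kind is x)"
    by (rule continuous_gmul) (intro continuous_intros, rule Cons)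
  then show ?case by (simp add: second_kind_simps(2)[abs_def])
qed (simp add: second_kind_simps(1)[abs_def])

lemma second_kind_derivative:
  "(second_kind is has_derivative (\<lambda>h. \<Sum>i\<leftarrow>is. (h \<bullet> e i) *\<^sub>R e i)) (at 0)"
proof (induction "is")
  case (Cons i "is")
  have 1: "((\<lambda>x. (x \<bullet> e i) *\<^sub>R e i) has_derivative (\<lambda>h. (h \<bullet> e i) *\<^sub>R e i)) (at 0)"
    by (intro bounded_linear_imp_has_derivative bounded_linear_scaleR_left[THEN bounded_linear_compose] bounded_linear_inner_left)
  have "((\<lambda>x. ((x \<bullet> e i) *\<^sub>R e i) \<star> second_kind is x) has_derivative
      (\<lambda>h. GD ((0 \<bullet> e i) *\<^sub>R e i, second_kind is 0) ((h \<bullet> e i) *\<^sub>R e i, \<Sum>i\<leftarrow>is. (h \<bullet> e i) *\<^sub>R e i))) (at 0)"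
    by (rule gmul_derivative_compose[OF 1 Cons])
  then show ?case by (simp add: second_kind_zero GD_zero second_kind_simps(2)[abs_def])
qed (simp add: second_kind_simps(1)[abs_def])

lemma d0_second_kind_le:
  assumes "set is \<subseteq> {1..DIM('a)}"
  shows "d 0 (second_kind is x) \<le> (\<Sum>i\<leftarrow>is. root (deg i) \<bar>x \<bullet> e i\<bar> * d 0 (e i))"
  using assms
proof (induction "is")
  case (Cons i "is")
  have "d 0 (second_kind (i # is) x) \<le> d 0 ((x \<bullet> e i) *\<^sub>R e i) + d 0 (second_kind is x)"
    unfolding second_kind_simps by (rule d0_gmul_le)
  then show ?case using Cons d0_basis_multiple[of i "x \<bullet> e i"] by simp
qed (simp add: second_kind_simps d_facts)

text \<open>Compatibility of \<open>d\<close> with the Euclidean topology has to be derived from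
  homogeneity. The derivative of \<open>second_kind\<close> at 0 is the identity, so by Sussmann's
  open mapping theorem the image of a small ball is a neighbourhood of 0, and on that image
  \<open>d 0\<close> is bounded by roots of small coordinates.\<close>

lemma d0_small:
  assumes "\<epsilon> > 0" obtains \<rho> where "\<rho> > 0" "\<And>y. norm y < \<rho> \<Longrightarrow> d 0 y < \<epsilon>"
proof -
  let ?is = "[1..<Suc DIM('a)]"
  define b where "b x = (\<Sum>i\<in>{1..DIM('a)}. root (deg i) \<bar>x \<bullet> e i\<bar> * d 0 (e i))" for x
  have s: "set ?is = {1..DIM('a)}" by auto
  have sl: "(\<Sum>i\<leftarrow>?is. f i) = (\<Sum>i\<in>{1..DIM('a)}. f i)" for f :: "nat \<Rightarrow> 'b::comm_monoid_add"
    using sum_list_distinct_conv_sum_set[of ?is f] unfolding s by (simp del: upt_Suc)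
  have bd: "d 0 (second_kind ?is x) \<le> b x" for x
    using d0_second_kind_le[of ?is x] s by (simp only: sl b_def order_refl simp_thms)
  have "continuous_on UNIV b" unfolding b_def by (intro continuous_intros)
  then have "b \<midarrow>0\<rightarrow> b 0" by (simp add: continuous_on_def)
  moreover have "b 0 = 0" unfolding b_def by (rule sum.neutral) simp
  ultimately have "b \<midarrow>0\<rightarrow> 0" by simp
  then have "\<exists>\<eta>>0. \<forall>x. x \<noteq> 0 \<and> norm (x - 0) < \<eta> \<longrightarrow> norm (b x - 0) < \<epsilon>"
    using assms unfolding LIM_eq by blast
  then obtain \<eta> where eta: "\<eta> > 0" "\<And>x. x \<noteq> 0 \<Longrightarrow> norm x < \<eta> \<Longrightarrow> \<bar>b x\<bar> < \<epsilon>" by auto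
  have small: "d 0 (second_kind ?is x) < \<epsilon>" if x: "norm x < \<eta>" for x
  proof (cases "x = 0")
    case True then show ?thesis using assms by (simp only: second_kind_zero d_facts)
  next
    case False
    then show ?thesis using eta(2)[OF False x] bd[of x] by linarith
  qed
  have "(\<lambda>h. \<Sum>i\<leftarrow>?is. (h \<bullet> e i) *\<^sub>R e i) = (\<lambda>h. h)"
  proof
    fix h
    have "(\<Sum>i\<leftarrow>?is. (h \<bullet> e i) *\<^sub>R e i) = (\<Sum>i\<in>{1..DIM('a)}. (h \<bullet> e i) *\<^sub>R e i)"
      by (rule sl)
    then show "(\<Sum>i\<leftarrow>?is. (h \<bullet> e i) *\<^sub>R e i) = h" using expand[of h] by (simp only:)
  qed
  then have D: "(second_kind ?is has_derivative (\<lambda>h. h)) (at 0)"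
    using second_kind_derivative[of ?is] by simp
  have "second_kind ?is 0 \<in> interior (second_kind ?is ` ball 0 \<eta>)"
    by (rule sussmann_open_mapping[OF open_UNIV second_kind_continuous _ D, of "\<lambda>h. h"])
       (use eta in \<open>auto simp: o_def id_def interior_open bounded_linear_ident\<close>)
  then obtain \<rho> where "\<rho> > 0" "ball 0 \<rho> \<subseteq> second_kind ?is ` ball 0 \<eta>"
    unfolding second_kind_zero mem_interior by blast
  then show ?thesis using small by (intro that[of \<rho>]) (auto simp: subset_iff)
qed

lemma d_continuous: "continuous_on UNIV (\<lambda>z. d (fst z) (snd z))"
proof -
  have "\<exists>\<delta>>0. \<forall>x'. dist x' x < \<delta> \<longrightarrow> d x x' < \<epsilon>" if eps: "\<epsilon> > 0" for x \<epsilon>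
  proof -
    obtain \<rho> where r: "\<rho> > 0" "\<And>y. norm y < \<rho> \<Longrightarrow> d 0 y < \<epsilon>" by (rule d0_small[OF eps]) blast
    have "continuous_on UNIV (\<lambda>x'. - x \<star> x')" by (intro continuous_gmul continuous_intros)
    then obtain \<delta> where "\<delta> > 0" "\<And>x'. dist x' x < \<delta> \<Longrightarrow> dist (- x \<star> x') (- x \<star> x) < \<rho>"
      unfolding continuous_on_iff using r(1) by (meson UNIV_I)
    then show ?thesis using r(2) by (intro exI[of _ \<delta>]) (auto simp: d_zero_eq[of x])
  qed
  note near = this
  show ?thesis unfolding continuous_on_iff
  proof (intro ballI allI impI)
    fix z :: "'a \<times> 'a" and \<epsilon> :: real assume e: "\<epsilon> > 0"
    obtain x y where z: "z = (x, y)" by force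
    obtain d1 where d1: "d1 > 0" "\<And>x'. dist x' x < d1 \<Longrightarrow> d x x' < \<epsilon> / 2" using near[of "\<epsilon> / 2" x] e by auto
    obtain d2 where d2: "d2 > 0" "\<And>x'. dist x' y < d2 \<Longrightarrow> d y x' < \<epsilon> / 2" using near[of "\<epsilon> / 2" y] e by auto
    show "\<exists>\<delta>>0. \<forall>w\<in>UNIV. dist w z < \<delta> \<longrightarrow> dist (d (fst w) (snd w)) (d (fst z) (snd z)) < \<epsilon>"
    proof (intro exI[of _ "min d1 d2"] conjI ballI impI)
      fix w assume w: "dist w z < min d1 d2"
      have "d x (fst w) < \<epsilon> / 2"
        using w dist_fst_le[of w z] z by (intro d1) auto
      moreover have "d y (snd w) < \<epsilon> / 2"
        using w dist_snd_le[of w z] z by (intro d2) auto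
      moreover have "d (fst w) (snd w) \<le> d x (fst w) + d x y + d y (snd w)"
        using d_facts(4)[of "fst w" "snd w" x] d_facts(4)[of x "snd w" y] d_facts(3)[of x "fst w"] by linarith
      moreover have "d x y \<le> d x (fst w) + d (fst w) (snd w) + d y (snd w)"
        using d_facts(4)[of x y "fst w"] d_facts(4)[of "fst w" y "snd w"] d_facts(3)[of y "snd w"] by linarith
      ultimately show "dist (d (fst w) (snd w)) (d (fst z) (snd z)) < \<epsilon>"
        using z by (simp add: dist_real_def)
    qed (use d1 d2 in auto)
  qed
qed

lemma continuous_d:
  assumes "continuous_on S f" "continuous_on S g"
  shows "continuous_on S (\<lambda>x. d (f x) (g x))"
  using continuous_on_compose2[OF d_continuous continuous_on_Pair[OF assms]] by simp

text \<open>By compactness \<open>d 0\<close> has a positive minimum \<open>c\<close> on the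
  Euclidean unit sphere. A point of norm at least 1 is moved onto the sphere by some dilation with
  factor at most 1, so \<open>d 0 x < c\<close> forces norm below 1; other radii follow by
  dilation.\<close>

lemma d0_ball_bounded:
  obtains R where "R > 0" "\<And>x. d 0 x \<le> M \<Longrightarrow> norm x \<le> R"
proof -
  have "continuous_on (sphere 0 1) (d 0)" by (intro continuous_d continuous_intros)
  moreover have "sphere (0::'a) 1 \<noteq> {}" by simp
  ultimately obtain x0 where x0: "x0 \<in> sphere 0 1" "\<And>x. x \<in> sphere 0 1 \<Longrightarrow> d 0 x0 \<le> d 0 x"
    using continuous_attains_inf[of "sphere 0 1" "d 0"] compact_sphere by blast
  define c where "c = d 0 x0"
  have "x0 \<noteq> 0" using x0(1) by auto
  then have c: "c > 0" using d_facts(2)[of 0 x0] d_facts(5)[of 0 x0] unfolding c_def by (metis less_eq_real_def)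
  have le1: "norm x < 1" if x: "d 0 x < c" for x
  proof (rule ccontr)
    assume "\<not> norm x < 1"
    have "continuous_on UNIV (\<lambda>r. dl r x)" unfolding dl_def by (intro continuous_intros)
    then have "continuous_on {0..1} (\<lambda>r. norm (dl r x))"
      by (intro continuous_on_norm) (rule continuous_on_subset, auto)
    then obtain r where r: "0 \<le> r" "r \<le> 1" "norm (dl r x) = 1"
      using IVT'[of "\<lambda>r. norm (dl r x)" 0 1 1] \<open>\<not> norm x < 1\<close> by (auto simp: dl_zero_left)
    have "r \<noteq> 0" using r(3) by (auto simp: dl_zero_left)
    then have "c \<le> r * d 0 x" using x0(2)[of "dl r x"] r d0_dl[of r x] unfolding c_def by simp
    also have "\<dots> \<le> 1 * d 0 x" using r d_facts(2) by (intro mult_right_mono) auto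
    finally show False using x by simp
  qed
  \<comment> \<open>Chosen so that \<open>dl s\<close> takes the ball of radius \<open>M\<close>
    strictly inside the ball of radius \<open>c\<close>.\<close>
  define s where "s = c / (\<bar>M\<bar> + 1)"
  have s: "s > 0" using c by (simp add: s_def)
  have "compact (dl (1 / s) ` cball 0 1)"
    using linear_continuous_on[of "dl (1 / s)"] linear_dl linear_conv_bounded_linear
    by (intro compact_continuous_image) auto
  then obtain R where R: "R > 0" "\<And>y. y \<in> dl (1 / s) ` cball 0 1 \<Longrightarrow> norm y \<le> R"
    using compact_imp_bounded bounded_pos by metis
  have "norm x \<le> R" if "d 0 x \<le> M" for x
  proof -
    have "d 0 (dl s x) = s * d 0 x" using s by (rule d0_dl)
    also have "\<dots> \<le> s * \<bar>M\<bar>" using that s by (intro mult_left_mono) auto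
    also have "\<dots> < c" using c by (simp add: s_def field_simps)
    finally have "dl s x \<in> cball 0 1" using le1[of "dl s x"] by simp
    moreover have "x = dl (1 / s) (dl s x)" using s dl_inverse(1)[of s x] by simp
    ultimately show ?thesis using R(2) by blast
  qed
  then show ?thesis using R(1) that by blast
qed

lemma closed_d_ball: "closed {y. d x y \<le> r}"
  by (intro closed_Collect_le continuous_d continuous_intros)

lemma compact_d0_ball: "compact {y. d 0 y \<le> r}"
proof -
  obtain R where "R > 0" "\<And>y. d 0 y \<le> r \<Longrightarrow> norm y \<le> R" by (rule d0_ball_bounded[where M = r]) blast
  then have "bounded {y. d 0 y \<le> r}" by (auto simp: bounded_iff)
  then show ?thesis using closed_d_ball[of 0 r] by (simp add: compact_eq_bounded_closed)
qed

text \<open>The unit ball of \<open>d\<close> is bounded, so its dilation by \<open>s\<close> has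
  Euclidean size of order \<open>s\<close>; left translation moves this to \<open>p\<close>.\<close>

lemma d_ball_in_open:
  assumes "open V" "p \<in> V"
  obtains s where "s > 0" "\<And>y. d p y < s \<Longrightarrow> y \<in> V"
proof -
  obtain R where R: "R > 0" "\<And>x. d 0 x \<le> 1 \<Longrightarrow> norm x \<le> R" by (rule d0_ball_bounded[where M = 1]) blast
  have "continuous_on UNIV (gmul G p)" using continuous_gmul[of UNIV "\<lambda>_. p" "\<lambda>x. x"] by (simp add: continuous_on_const)
  then have "open (gmul G p -` V)" using assms(1) by (simp add: open_vimage)
  moreover have "0 \<in> gmul G p -` V" using assms(2) by simp
  ultimately obtain \<eta> where eta: "\<eta> > 0" "ball 0 \<eta> \<subseteq> gmul G p -` V" using openE by blast
  define K where "K = (\<Sum>i\<in>{1..DIM('a)}. R)"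
  have K: "K \<ge> 0" unfolding K_def using R by (intro sum_nonneg) auto
  \<comment> \<open>\<open>K\<close> bounds the growth in \<open>norm_dl_le\<close> on the unit
    ball, so points at distance below \<open>s\<close> have norm below
    \<open>\<eta>\<close>.\<close>
  define s where "s = min 1 (\<eta> / (2 * (K + 1)))"
  have s: "s > 0" "s \<le> 1" using eta K by (auto simp: s_def)
  have "y \<in> V" if y: "d p y < s" for y
  proof -
    define z where "z = - p \<star> y"
    have z: "d 0 z < s" using y d_zero_eq[of p y] z_def by simp
    define w where "w = dl (1 / s) z"
    have w: "z = dl s w" using s dl_inverse(2)[of s z] w_def by simp
    have "d 0 w = 1 / s * d 0 z" unfolding w_def using s by (intro d0_dl) auto
    then have "s * d 0 w < s * 1" using z s by simp
    then have "d 0 w \<le> 1" using s by (simp only: mult_less_cancel_left_pos less_imp_le)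
    then have nw: "norm w \<le> R" using R by blast
    have "norm z \<le> s * (\<Sum>i\<in>{1..DIM('a)}. norm w)" unfolding w using s by (intro norm_dl_le) auto
    also have "\<dots> \<le> s * K" unfolding K_def using nw s by (intro mult_left_mono sum_mono) auto
    also have "\<dots> \<le> \<eta> / (2 * (K + 1)) * K" using K by (intro mult_right_mono) (auto simp: s_def)
    also have "\<dots> < \<eta>" using eta K by (simp add: field_simps add_nonneg_pos)
    finally have "p \<star> z \<in> V" using eta(2) by (auto simp: subset_iff)
    then show ?thesis by (simp add: z_def)
  qed
  then show ?thesis using s(1) that by blast
qed

lemma mcball_eq: "dm.mcball x r = {y. d x y \<le> r}"
  by (auto simp: dm.mcball_def)

text \<open>The triangle inequality is sharp for the points \<open>x \<star> v\<close> and
  \<open>x \<star> - v\<close> with \<open>v\<close> horizontal of length \<open>r\<close>: the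
  product of \<open>v\<close> with itself is the dilation of \<open>v\<close> by 2.\<close>

lemma diam_mcball:
  assumes r: "r > 0"
  shows "diam d (dm.mcball x r) = 2 * r"
proof -
  obtain w where w: "w \<in> layer G 1" "w \<noteq> 0" using layer1 layer_subspace[of 1] subspace_0 by blast
  have "d 0 w \<noteq> 0" using d_facts(5)[of 0 w] w by auto
  then have dw: "d 0 w > 0" using d_facts(2)[of 0 w] by linarith
  define v where "v = (r / d 0 w) *\<^sub>R w"
  have mult: "d 0 (t *\<^sub>R w) = t * d 0 w" if "t > 0" for t
    using d0_dl[OF that, of w] dl_layer[OF w(1), of t] by simp
  have dv: "d 0 v = r" unfolding v_def using mult[of "r / d 0 w"] r dw by simp
  have v2: "v \<star> v = (2 * r / d 0 w) *\<^sub>R w"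
    unfolding v_def gmul_multiples by (simp add: add_divide_distrib[symmetric])
  have in1: "x \<star> v \<in> dm.mcball x r" unfolding mcball_eq using d_left[of x 0 v] dv by simp
  have in2: "x \<star> - v \<in> dm.mcball x r" unfolding mcball_eq using d_left[of x 0 "- v"] dv d0_minus by simp
  have "d (x \<star> - v) (x \<star> v) = d 0 (v \<star> v)"
    unfolding d_left using d_zero_eq[of "- v" v] by simp
  also have "\<dots> = 2 * r" unfolding v2 using mult[of "2 * r / d 0 w"] r dw by simp
  finally have att: "d (x \<star> - v) (x \<star> v) = 2 * r" .
  have le: "d y z \<le> 2 * r" if "y \<in> dm.mcball x r" "z \<in> dm.mcball x r" for y z
    using that d_facts(4)[of y z x] d_facts(3)[of x y] unfolding mcball_eq by auto
  show ?thesis unfolding diam_def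
  proof (rule cSup_eq_maximum)
    show "2 * r \<in> (\<lambda>(x, y). d x y) ` (dm.mcball x r \<times> dm.mcball x r)"
      by (rule image_eqI[of _ _ "(x \<star> - v, x \<star> v)"]) (use att in1 in2 in auto)
  qed (use le in auto)
qed

end

subsection \<open>Curves almost tangent to a graded subspace\<close>

lemma real_polynomial_function_lipschitz:
  assumes f: "real_polynomial_function f" and S: "bounded S"
  shows "\<exists>C\<ge>0. \<forall>x\<in>S. \<forall>y\<in>S. \<bar>f x\<bar> \<le> C \<and> \<bar>f x - f y\<bar> \<le> C * norm (x - y)"
  using f
proof induction
  case (linear f)
  obtain K where K: "K \<ge> 0" "\<And>x. \<bar>f x\<bar> \<le> norm x * K"
    using bounded_linear.nonneg_bounded[OF linear] by auto
  obtain b where b: "b > 0" "\<And>x. x \<in> S \<Longrightarrow> norm x \<le> b" using S bounded_pos by metis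
  show ?case
  proof (intro exI[of _ "K + b * K"] conjI ballI)
    fix x y assume "x \<in> S" "y \<in> S"
    have "\<bar>f x\<bar> \<le> b * K" using K(2)[of x] mult_right_mono[OF b(2)[OF \<open>x \<in> S\<close>] K(1)] by linarith
    then show "\<bar>f x\<bar> \<le> K + b * K" using K(1) by linarith
    have "\<bar>f x - f y\<bar> \<le> norm (x - y) * K"
      using K(2)[of "x - y"] by (simp add: linear_diff[OF bounded_linear.linear[OF linear]])
    also have "\<dots> \<le> norm (x - y) * (K + b * K)" using K b by (intro mult_left_mono) auto
    finally show "\<bar>f x - f y\<bar> \<le> (K + b * K) * norm (x - y)" by (simp only: mult.commute)
  qed (use K b in auto)
next
  case (const c)
  show ?case by (intro exI[of _ "\<bar>c\<bar>"]) auto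
next
  case (add f g)
  then obtain C D where CD: "C \<ge> 0" "D \<ge> 0"
    "\<And>x y. x \<in> S \<Longrightarrow> y \<in> S \<Longrightarrow> \<bar>f x\<bar> \<le> C \<and> \<bar>f x - f y\<bar> \<le> C * norm (x - y)"
    "\<And>x y. x \<in> S \<Longrightarrow> y \<in> S \<Longrightarrow> \<bar>g x\<bar> \<le> D \<and> \<bar>g x - g y\<bar> \<le> D * norm (x - y)" by blast
  show ?case
  proof (intro exI[of _ "C + D"] conjI ballI)
    fix x y assume "x \<in> S" "y \<in> S"
    note CD(3)[OF this] CD(4)[OF this]
    then show "\<bar>f x + g x\<bar> \<le> C + D" "\<bar>f x + g x - (f y + g y)\<bar> \<le> (C + D) * norm (x - y)"
      unfolding distrib_right by linarith+
  qed (use CD in auto)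
next
  case (mult f g)
  then obtain C D where CD: "C \<ge> 0" "D \<ge> 0"
    "\<And>x y. x \<in> S \<Longrightarrow> y \<in> S \<Longrightarrow> \<bar>f x\<bar> \<le> C \<and> \<bar>f x - f y\<bar> \<le> C * norm (x - y)"
    "\<And>x y. x \<in> S \<Longrightarrow> y \<in> S \<Longrightarrow> \<bar>g x\<bar> \<le> D \<and> \<bar>g x - g y\<bar> \<le> D * norm (x - y)" by blast
  show ?case
  proof (intro exI[of _ "C * D + C * D"] conjI ballI)
    fix x y assume xy: "x \<in> S" "y \<in> S"
    note F = CD(3)[OF xy] CD(4)[OF xy] CD(4)[OF xy(2,1)]
    have "\<bar>f x * g x\<bar> \<le> C * D" unfolding abs_mult using F CD by (intro mult_mono) auto
    then show "\<bar>f x * g x\<bar> \<le> C * D + C * D" using CD mult_nonneg_nonneg[of C D] by linarith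
    have "f x * g x - f y * g y = f x * (g x - g y) + (f x - f y) * g y" by (simp add: algebra_simps)
    then have "\<bar>f x * g x - f y * g y\<bar> \<le> \<bar>f x\<bar> * \<bar>g x - g y\<bar> + \<bar>f x - f y\<bar> * \<bar>g y\<bar>"
      using abs_triangle_ineq[of "f x * (g x - g y)" "(f x - f y) * g y"] by (simp add: abs_mult)
    also have "\<dots> \<le> C * (D * norm (x - y)) + (C * norm (x - y)) * D"
      using F CD by (intro add_mono mult_mono) auto
    finally show "\<bar>f x * g x - f y * g y\<bar> \<le> (C * D + C * D) * norm (x - y)"
      by (simp add: algebra_simps)
  qed (use CD in auto)
qed

lemma polynomial_function_lipschitz:
  fixes f :: "'a::real_normed_vector \<Rightarrow> 'b::euclidean_space"
  assumes f: "polynomial_function f" and S: "bounded S"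
  shows "\<exists>C\<ge>0. \<forall>x\<in>S. \<forall>y\<in>S. norm (f x) \<le> C \<and> norm (f x - f y) \<le> C * norm (x - y)"
proof -
  have "\<exists>C\<ge>0. \<forall>x\<in>S. \<forall>y\<in>S. \<bar>f x \<bullet> b\<bar> \<le> C \<and> \<bar>f x \<bullet> b - f y \<bullet> b\<bar> \<le> C * norm (x - y)" for b
    using f[unfolded polynomial_function_def, rule_format, OF bounded_linear_inner_left[of b]]
    by (intro real_polynomial_function_lipschitz[OF _ S]) (simp add: o_def)
  then obtain C where C: "\<And>b. C b \<ge> 0" "\<And>b x y. x \<in> S \<Longrightarrow> y \<in> S \<Longrightarrow> \<bar>f x \<bullet> b\<bar> \<le> C b"
    "\<And>b x y. x \<in> S \<Longrightarrow> y \<in> S \<Longrightarrow> \<bar>f x \<bullet> b - f y \<bullet> b\<bar> \<le> C b * norm (x - y)" by metis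
  show ?thesis
  proof (intro exI[of _ "\<Sum>b\<in>Basis. C b"] conjI ballI)
    fix x y assume xy: "x \<in> S" "y \<in> S"
    have "norm (f x) \<le> (\<Sum>b\<in>Basis. \<bar>f x \<bullet> b\<bar>)" by (rule norm_le_l1)
    also have "\<dots> \<le> (\<Sum>b\<in>Basis. C b)" using C(2) xy by (intro sum_mono) auto
    finally show "norm (f x) \<le> (\<Sum>b\<in>Basis. C b)" .
    have "norm (f x - f y) \<le> (\<Sum>b\<in>Basis. \<bar>(f x - f y) \<bullet> b\<bar>)" by (rule norm_le_l1)
    also have "\<dots> \<le> (\<Sum>b\<in>Basis. C b * norm (x - y))" unfolding inner_diff_left using C(3) xy by (intro sum_mono) auto
    finally show "norm (f x - f y) \<le> (\<Sum>b\<in>Basis. C b) * norm (x - y)" by (simp only: sum_distrib_right)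
  qed (use C in \<open>auto intro: sum_nonneg\<close>)
qed

text \<open>The differential inequality is available only while the norm is at most 1. The resulting
  bound is strictly below 1, so a first time of norm 1 cannot exist and the inequality holds
  throughout.\<close>

lemma gronwall_bound:
  fixes u :: "real \<Rightarrow> 'a::euclidean_space"
  assumes u0: "u 0 = 0" and du: "\<And>t. t \<in> {0..1} \<Longrightarrow> (u has_vector_derivative u' t) (at t within {0..1})"
    and bd: "\<And>t. t \<in> {0..1} \<Longrightarrow> norm (u t) \<le> 1 \<Longrightarrow> norm (u' t) \<le> C * norm (u t) + \<kappa>"
    and C: "C \<ge> 0" and k: "\<kappa> \<ge> 0" "\<kappa> * exp (C + 1) < 1" and t: "t \<in> {0..1}"
  shows "norm (u t) \<le> \<kappa> * exp (C + 1)"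
proof -
  have cu: "continuous_on {0..1} u"
    unfolding continuous_on_eq_continuous_within
    by (intro ballI has_vector_derivative_continuous[OF du])
  have local: "norm (u \<tau>) \<le> \<kappa> * exp (C + 1)" if tau: "\<tau> \<in> {0..1}" "\<And>t. t \<in> {0..\<tau>} \<Longrightarrow> norm (u t) \<le> 1" for \<tau>
  proof -
    \<comment> \<open>Adding the square of \<open>\<kappa>\<close> absorbs the inhomogeneous term
      through \<open>2 \<kappa> |u| \<le> \<kappa>^2 + |u|^2\<close>, which raises the rate
      \<open>2 * C\<close> to \<open>2 * C + 1\<close>. Squaring avoids differentiating the norm at
      0.\<close>
    define h where "h t = (u t \<bullet> u t + \<kappa>\<^sup>2) * exp (- ((2 * C + 1) * t))" for t
    have "h \<tau> \<le> h 0"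
    proof (rule DERIV_nonpos_imp_decreasing_open[of 0 \<tau>])
      show "0 \<le> \<tau>" using tau by simp
      have "continuous_on {0..\<tau>} u" using cu by (rule continuous_on_subset) (use tau in auto)
      then show "continuous_on {0..\<tau>} h" unfolding h_def by (intro continuous_intros)
      fix x assume x: "0 < x" "x < \<tau>"
      have "(u has_vector_derivative u' x) (at x)"
        using du[of x] x tau at_within_Icc_at[of 0 x 1] by simp
      then have "(u has_derivative (\<lambda>h. h *\<^sub>R u' x)) (at x)" by (simp add: has_vector_derivative_def)
      from has_derivative_inner[OF this this]
      have "((\<lambda>t. u t \<bullet> u t) has_derivative (\<lambda>h. u x \<bullet> (h *\<^sub>R u' x) + (h *\<^sub>R u' x) \<bullet> u x)) (at x)" .
      moreover have "(\<lambda>h. u x \<bullet> (h *\<^sub>R u' x) + (h *\<^sub>R u' x) \<bullet> u x) = (*) (2 * (u x \<bullet> u' x))"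
        by (simp add: fun_eq_iff inner_commute[of "u' x" "u x"])
      ultimately have d1: "((\<lambda>t. u t \<bullet> u t) has_real_derivative 2 * (u x \<bullet> u' x)) (at x)"
        by (simp add: has_field_derivative_def)
      define E where "E = exp (- ((2 * C + 1) * x))"
      have "(h has_real_derivative 2 * (u x \<bullet> u' x) * E + (u x \<bullet> u x + \<kappa>\<^sup>2) * (- (2 * C + 1) * E)) (at x)"
        unfolding h_def E_def by (auto intro!: derivative_eq_intros d1)
      moreover have "2 * (u x \<bullet> u' x) * E + (u x \<bullet> u x + \<kappa>\<^sup>2) * (- (2 * C + 1) * E) \<le> 0"
      proof -
        let ?n = "norm (u x)"
        have "u x \<bullet> u' x \<le> ?n * norm (u' x)" by (rule norm_cauchy_schwarz)
        also have "\<dots> \<le> ?n * (C * ?n + \<kappa>)"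
          using bd[of x] tau x by (intro mult_left_mono) auto
        finally have 1: "u x \<bullet> u' x \<le> C * ?n\<^sup>2 + \<kappa> * ?n" by (simp add: algebra_simps power2_eq_square)
        have 2: "2 * (\<kappa> * ?n) \<le> \<kappa>\<^sup>2 + ?n\<^sup>2"
          using zero_le_power2[of "\<kappa> - ?n"] by (simp add: power2_eq_square algebra_simps)
        have 3: "0 \<le> C * \<kappa>\<^sup>2" using C by simp
        have "2 * (u x \<bullet> u' x) - (u x \<bullet> u x + \<kappa>\<^sup>2) * (2 * C + 1) \<le> 0"
          using 1 2 3 unfolding power2_norm_eq_inner[symmetric] by (simp add: algebra_simps)
        then have "(2 * (u x \<bullet> u' x) - (u x \<bullet> u x + \<kappa>\<^sup>2) * (2 * C + 1)) * E \<le> 0"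
          by (intro mult_nonpos_nonneg) (auto simp: E_def)
        then show ?thesis by (simp add: algebra_simps)
      qed
      ultimately show "\<exists>y. (h has_real_derivative y) (at x) \<and> y \<le> 0" by blast
    qed
    then have "(u \<tau> \<bullet> u \<tau> + \<kappa>\<^sup>2) * exp (- ((2 * C + 1) * \<tau>)) \<le> \<kappa>\<^sup>2" by (simp add: h_def u0)
    then have "(u \<tau> \<bullet> u \<tau> + \<kappa>\<^sup>2) * exp (- ((2 * C + 1) * \<tau>)) * exp ((2 * C + 1) * \<tau>)
        \<le> \<kappa>\<^sup>2 * exp ((2 * C + 1) * \<tau>)" by (intro mult_right_mono) auto
    moreover have "exp (- ((2 * C + 1) * \<tau>)) * exp ((2 * C + 1) * \<tau>) = 1"
      by (simp only: exp_add[symmetric] add.left_inverse exp_zero)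
    ultimately have "(u \<tau> \<bullet> u \<tau> + \<kappa>\<^sup>2) \<le> \<kappa>\<^sup>2 * exp ((2 * C + 1) * \<tau>)"
      by (simp only: mult.assoc mult_1_right)
    also have "\<dots> \<le> \<kappa>\<^sup>2 * exp (2 * (C + 1))"
    proof -
      have "(2 * C + 1) * \<tau> \<le> (2 * C + 1) * 1" using tau C by (intro mult_left_mono) auto
      then show ?thesis by (intro mult_left_mono) auto
    qed
    also have "\<dots> = (\<kappa> * exp (C + 1))\<^sup>2"
      by (simp only: power_mult_distrib exp_double)
    finally have "(norm (u \<tau>))\<^sup>2 \<le> (\<kappa> * exp (C + 1))\<^sup>2"
      unfolding power2_norm_eq_inner using zero_le_power2[of \<kappa>] by linarith
    moreover have "0 \<le> \<kappa> * exp (C + 1)" by (rule mult_nonneg_nonneg[OF k(1) exp_ge_zero])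
    ultimately show ?thesis by (rule power2_le_imp_le)
  qed
  have "norm (u s) \<le> 1" if s: "s \<in> {0..1}" for s
  proof (rule ccontr)
    assume n: "\<not> norm (u s) \<le> 1"
    define T where "T = {0..s} \<inter> (\<lambda>t. norm (u t)) -` {1}"
    have cs: "continuous_on {0..s} (\<lambda>t. norm (u t))"
      using cu s by (intro continuous_on_norm) (rule continuous_on_subset, auto)
    have "closed T" unfolding T_def by (rule continuous_closed_preimage[OF cs]) auto
    moreover have "bounded T" by (rule bounded_subset[of "{0..s}"]) (auto simp: T_def)
    ultimately have cT: "compact T" unfolding compact_eq_bounded_closed by blast
    have "\<exists>t1. 0 \<le> t1 \<and> t1 \<le> s \<and> norm (u t1) = 1"
      by (rule IVT'[OF _ _ _ cs]) (use n s u0 in simp_all)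
    then obtain t1 where "0 \<le> t1" "t1 \<le> s" "norm (u t1) = 1" by blast
    then have "T \<noteq> {}" unfolding T_def by auto
    \<comment> \<open>The first time at which the norm equals 1.\<close>
    then obtain s0 where s0: "s0 \<in> T" "\<And>t. t \<in> T \<Longrightarrow> s0 \<le> t"
      using compact_attains_inf[OF cT] by blast
    have "norm (u t) \<le> 1" if t: "t \<in> {0..s0}" for t
    proof (rule ccontr)
      assume n: "\<not> norm (u t) \<le> 1"
      have ts: "{0..t} \<subseteq> {0..s}" using t s0(1) unfolding T_def by auto
      have "\<exists>t2. 0 \<le> t2 \<and> t2 \<le> t \<and> norm (u t2) = 1"
        by (rule IVT'[OF _ _ _ continuous_on_subset[OF cs ts]]) (use n t u0 in simp_all)
      then obtain t2 where t2: "0 \<le> t2" "t2 \<le> t" "norm (u t2) = 1" by blast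
      then have "t2 \<in> T" using ts unfolding T_def by auto
      then have "s0 \<le> t2" by (rule s0(2))
      then have "t = s0" using t2 t by auto
      then show False using n s0(1) unfolding T_def by auto
    qed
    then have "norm (u s0) \<le> \<kappa> * exp (C + 1)" using s0(1) s unfolding T_def by (intro local) auto
    then show False using k(2) s0(1) unfolding T_def by auto
  qed
  then show ?thesis using t by (intro local) auto
qed

section \<open>Coordinates on a graded subspace\<close>

locale adapted_basis = hom_group G e for G :: "('a::euclidean_space) graded_group" and e +
  fixes ax :: "'n::finite \<Rightarrow> 'a" and k :: "'n \<Rightarrow> nat"
  assumes ax_orthonormal: "ax i \<bullet> ax j = (if i = j then 1 else 0)"
    and ax_layer: "ax i \<in> layer G (k i)"
begin

text \<open>\<open>emb\<close> identifies \<open>real ^ 'n\<close> isometrically with the span of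
  the \<open>ax i\<close>, \<open>pr\<close> is its adjoint, that is, the orthogonal projection in
  coordinates, and \<open>dn\<close> is the dilation transported to these coordinates.\<close>

definition emb :: "real ^ 'n \<Rightarrow> 'a" where "emb w = (\<Sum>i\<in>UNIV. w $ i *\<^sub>R ax i)"
definition pr :: "'a \<Rightarrow> real ^ 'n" where "pr x = (\<chi> i. x \<bullet> ax i)"
definition dn :: "real \<Rightarrow> real ^ 'n \<Rightarrow> real ^ 'n" where "dn r w = (\<chi> i. r ^ k i * w $ i)"

lemma linear_emb: "linear emb"
  by (rule linearI) (simp_all add: emb_def scaleR_add_left sum.distrib scaleR_right.sum)

lemma linear_pr: "linear pr"
  by (rule linearI) (simp_all add: pr_def vec_eq_iff inner_add_left)

lemma linear_dn: "linear (dn r)"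
  by (rule linearI) (simp_all add: dn_def vec_eq_iff distrib_left)

lemma pr_emb [simp]: "pr (emb w) = w"
proof -
  have "emb w \<bullet> ax i = w $ i" for i
  proof -
    have "emb w \<bullet> ax i = (\<Sum>j\<in>UNIV. if j = i then w $ i else 0)"
      unfolding emb_def inner_sum_left by (intro sum.cong) (auto simp: ax_orthonormal)
    then show ?thesis by simp
  qed
  then show ?thesis by (simp add: pr_def vec_eq_iff)
qed

lemma emb_inner: "emb w \<bullet> x = w \<bullet> pr x"
  unfolding emb_def inner_sum_left inner_scaleR_left inner_vec_def pr_def by (simp add: inner_commute)

lemma norm_emb [simp]: "norm (emb w) = norm w"
  unfolding norm_eq_sqrt_inner emb_inner by simp

lemma norm_pr_le: "norm (pr x) \<le> norm x"
proof -
  have "norm (pr x) * norm (pr x) = emb (pr x) \<bullet> x"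
    by (simp add: emb_inner power2_norm_eq_inner[symmetric] power2_eq_square)
  also have "\<dots> \<le> norm (emb (pr x)) * norm x" by (rule norm_cauchy_schwarz)
  finally have "norm (pr x) * norm (pr x) \<le> norm (pr x) * norm x" by simp
  then show ?thesis
    by (cases "norm (pr x) = 0") (auto simp: mult_le_cancel_left_pos zero_less_norm_iff)
qed

lemma dl_inner: "dl r x \<bullet> y = x \<bullet> dl r y"
proof -
  have "dl r x \<bullet> y = (\<Sum>i\<in>{1..DIM('a)}. (r ^ deg i * (x \<bullet> e i)) * (y \<bullet> e i))"
    unfolding inner_expand[of "dl r x" y] by (intro sum.cong refl) (simp add: dl_coord)
  also have "\<dots> = x \<bullet> dl r y"
    unfolding inner_expand[of x "dl r y"] by (intro sum.cong refl) (simp add: dl_coord)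
  finally show ?thesis .
qed

lemma pr_dl: "pr (dl r x) = dn r (pr x)"
proof -
  have "dl r x \<bullet> ax i = r ^ k i * (x \<bullet> ax i)" for i
    unfolding dl_inner dl_layer[OF ax_layer] by simp
  then show ?thesis by (simp add: pr_def dn_def vec_eq_iff)
qed

lemma dl_emb: "dl r (emb w) = emb (dn r w)"
  unfolding emb_def linear_sum[OF linear_dl] linear_scale[OF linear_dl] dl_layer[OF ax_layer]
  by (simp add: dn_def mult.commute)

lemma Dl_bounds:
  obtains L where "L > 0" "\<And>x v. norm x \<le> \<rho> \<Longrightarrow> norm (Dl x v) \<le> L * norm v"
    "\<And>x y v. norm x \<le> \<rho> \<Longrightarrow> norm y \<le> \<rho> \<Longrightarrow> norm (Dl x v - Dl y v) \<le> L * norm (x - y) * norm v"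
proof -
  have "\<exists>C\<ge>0. \<forall>x\<in>cball 0 \<rho>. \<forall>y\<in>cball 0 \<rho>. norm (Dl x b) \<le> C \<and> norm (Dl x b - Dl y b) \<le> C * norm (x - y)" for b
    by (rule polynomial_function_lipschitz[OF Dl_polynomial bounded_cball])
  then obtain C where C: "\<And>b. C b \<ge> 0" "\<And>b x. x \<in> cball 0 \<rho> \<Longrightarrow> norm (Dl x b) \<le> C b"
     "\<And>b x y. x \<in> cball 0 \<rho> \<Longrightarrow> y \<in> cball 0 \<rho> \<Longrightarrow> norm (Dl x b - Dl y b) \<le> C b * norm (x - y)" by metis
  define L where "L = (\<Sum>b\<in>Basis. C b) + 1"
  have S0: "(\<Sum>b\<in>Basis. C b) \<ge> 0" using C(1) by (intro sum_nonneg)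
  have ex: "Dl x v = (\<Sum>b\<in>Basis. (v \<bullet> b) *\<^sub>R Dl x b)" for x v
    using linear_sum[OF linear_Dl, of x "\<lambda>b. (v \<bullet> b) *\<^sub>R b" Basis]
    by (simp only: euclidean_representation linear_scale[OF linear_Dl])
  have key: "norm (\<Sum>b\<in>Basis. (v \<bullet> b) *\<^sub>R z b) \<le> (\<Sum>b\<in>Basis. C b) * m * norm v"
    if "\<And>b. norm (z b) \<le> C b * m" "m \<ge> 0" for v :: 'a and z :: "'a \<Rightarrow> 'a" and m
  proof -
    have "norm (\<Sum>b\<in>Basis. (v \<bullet> b) *\<^sub>R z b) \<le> (\<Sum>b\<in>Basis. norm ((v \<bullet> b) *\<^sub>R z b))" by (rule norm_sum)
    also have "\<dots> \<le> (\<Sum>b\<in>Basis. (C b * m) * norm v)"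
    proof (rule sum_mono)
      fix b :: 'a assume "b \<in> Basis"
      then have "\<bar>v \<bullet> b\<bar> \<le> norm v" by (rule Basis_le_norm)
      then have "\<bar>v \<bullet> b\<bar> * norm (z b) \<le> norm v * (C b * m)" using that by (intro mult_mono) auto
      then show "norm ((v \<bullet> b) *\<^sub>R z b) \<le> (C b * m) * norm v" by (simp add: mult.commute)
    qed
    finally show ?thesis by (simp only: sum_distrib_right)
  qed
  show ?thesis
  proof (rule that[of L])
    show "L > 0" using S0 by (simp add: L_def)
    fix x v :: 'a assume x: "norm x \<le> \<rho>"
    have "norm (Dl x v) \<le> (\<Sum>b\<in>Basis. C b) * 1 * norm v"
      unfolding ex[of x v] by (rule key) (use C(2) x in auto)
    also have "\<dots> \<le> L * norm v" using S0 by (intro mult_right_mono) (auto simp: L_def)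
    finally show "norm (Dl x v) \<le> L * norm v" .
    fix y :: 'a assume y: "norm y \<le> \<rho>"
    have "Dl x v - Dl y v = (\<Sum>b\<in>Basis. (v \<bullet> b) *\<^sub>R (Dl x b - Dl y b))"
      unfolding ex[of x v] ex[of y v] by (simp only: scaleR_diff_right sum_subtractf)
    also have "norm \<dots> \<le> (\<Sum>b\<in>Basis. C b) * norm (x - y) * norm v"
      by (rule key) (use C(3) x y in auto)
    also have "\<dots> \<le> L * norm (x - y) * norm v" using S0 by (intro mult_right_mono) (auto simp: L_def)
    finally show "norm (Dl x v - Dl y v) \<le> L * norm (x - y) * norm v" .
  qed
qed

text \<open>By \<open>Dl_dl\<close> the point \<open>y\<close> may be dilated close to 0, where
  \<open>Dl\<close> is close to the identity and the composition with \<open>pr\<close> and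
  \<open>emb\<close> cannot vanish on a nonzero vector.\<close>

lemma pr_Dl_injective:
  assumes z: "pr (Dl y (emb a)) = 0" shows "a = 0"
proof -
  obtain L where L: "L > 0" "\<And>x y v. norm x \<le> 1 \<Longrightarrow> norm y \<le> 1 \<Longrightarrow> norm (Dl x v - Dl y v) \<le> L * norm (x - y) * norm v"
    using Dl_bounds[of 1] by metis
  define m where "m = (\<Sum>i\<in>{1..DIM('a)}. norm y)"
  have m: "m \<ge> 0" unfolding m_def by (intro sum_nonneg) auto
  \<comment> \<open>Brings \<open>dl r y\<close> within distance \<open>1 / (2 * L + 1)\<close> of
    0, so the Lipschitz error of \<open>Dl\<close> is at most one half.\<close>
  define r where "r = 1 / ((2 * L + 1) * (m + 1))"
  have den: "(2 * L + 1) * (m + 1) \<ge> 1" using L m mult_mono[of 1 "2 * L + 1" 1 "m + 1"] by simp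
  then have r: "r > 0" "r \<le> 1" by (auto simp: r_def divide_le_eq_1)
  have "norm (dl r y) \<le> r * m" unfolding m_def using r by (intro norm_dl_le) auto
  also have "\<dots> \<le> r * (m + 1)" using r by (intro mult_left_mono) auto
  also have "\<dots> = 1 / (2 * L + 1)" using m by (simp add: r_def)
  finally have n: "norm (dl r y) \<le> 1 / (2 * L + 1)" .
  have "1 / (2 * L + 1) \<le> 1" using L by simp
  then have n1: "norm (dl r y) \<le> 1" using n by linarith
  have "L * norm (dl r y) \<le> L * (1 / (2 * L + 1))" using n L by (intro mult_left_mono) auto
  also have "\<dots> \<le> 1 / 2" using L by (simp add: field_simps)
  finally have half: "L * norm (dl r y) \<le> 1 / 2" .
  let ?b = "dn r a"
  have "pr (Dl (dl r y) (emb ?b)) = dn r (pr (Dl y (emb a)))"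
    unfolding dl_emb[symmetric] Dl_dl pr_dl ..
  also have "\<dots> = 0" unfolding z using linear_0[OF linear_dn] .
  finally have "pr (Dl 0 (emb ?b) - Dl (dl r y) (emb ?b)) = ?b"
    using linear_diff[OF linear_pr] by simp
  then have "norm ?b \<le> norm (Dl 0 (emb ?b) - Dl (dl r y) (emb ?b))"
    using norm_pr_le by metis
  also have "\<dots> \<le> L * norm (0 - dl r y) * norm (emb ?b)" using n1 by (intro L(2)) auto
  also have "\<dots> \<le> 1 / 2 * norm ?b" using mult_right_mono[OF half norm_ge_zero[of ?b]] by simp
  finally have "?b = 0" by simp
  then have "r ^ k i * a $ i = 0" for i by (simp add: dn_def vec_eq_iff)
  then show ?thesis using r by (simp add: vec_eq_iff)
qed

text \<open>Compactness of a ball times the unit sphere makes the injectivity uniform.\<close>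

lemma pr_Dl_bounded_below:
  obtains c where "c > 0" "\<And>y a. norm y \<le> \<rho> \<Longrightarrow> c * norm a \<le> norm (pr (Dl y (emb a)))"
proof (cases "\<rho> \<ge> 0")
  case True
  let ?K = "cball (0::'a) \<rho> \<times> sphere (0::real ^ 'n) 1"
  let ?f = "\<lambda>z. norm (pr (Dl (fst z) (emb (snd z))))"
  have ex: "pr (Dl y (emb a)) = (\<Sum>i\<in>UNIV. a $ i *\<^sub>R pr (Dl y (ax i)))" for y a
    unfolding emb_def by (simp add: linear_sum[OF linear_Dl] linear_scale[OF linear_Dl] linear_sum[OF linear_pr] linear_scale[OF linear_pr])
  have blp: "bounded_linear pr" using linear_pr linear_conv_bounded_linear by blast
  have cD: "continuous_on UNIV (\<lambda>y. Dl y v)" for v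
    by (rule polynomial_function_continuous[OF Dl_polynomial])
  have cont: "continuous_on UNIV (\<lambda>z::'a \<times> (real ^ 'n). pr (Dl (fst z) v))" for v
    by (intro bounded_linear.continuous_on[OF blp] continuous_on_compose2[OF cD] continuous_intros) auto
  have "continuous_on UNIV ?f" unfolding ex
    by (intro continuous_on_norm continuous_on_sum continuous_on_scaleR cont continuous_intros)
  then have cf: "continuous_on ?K ?f" by (rule continuous_on_subset) simp
  have ne: "?K \<noteq> {}"
  proof -
    have "(0, axis undefined 1) \<in> ?K" using True by (simp add: norm_axis_1)
    then show ?thesis by blast
  qed
  have "compact ?K" by (intro compact_Times) auto
  then obtain z0 where z0: "z0 \<in> ?K" "\<And>z. z \<in> ?K \<Longrightarrow> ?f z0 \<le> ?f z"
    using continuous_attains_inf[OF _ ne cf] by blast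
  have "?f z0 \<noteq> 0"
  proof
    assume "?f z0 = 0"
    then have "snd z0 = 0" using pr_Dl_injective[of "fst z0" "snd z0"] by simp
    then show False using z0(1) by auto
  qed
  then have pos: "?f z0 > 0" by simp
  show ?thesis
  proof (rule that[OF pos])
    fix y :: 'a and a :: "real ^ 'n" assume y: "norm y \<le> \<rho>"
    show "?f z0 * norm a \<le> norm (pr (Dl y (emb a)))"
    proof (cases "a = 0")
      case False
      let ?a = "(1 / norm a) *\<^sub>R a"
      have "?f z0 \<le> ?f (y, ?a)" using y False by (intro z0(2)) auto
      also have "pr (Dl y (emb ?a)) = (1 / norm a) *\<^sub>R pr (Dl y (emb a))"
        by (simp only: linear_scale[OF linear_emb] linear_scale[OF linear_Dl] linear_scale[OF linear_pr])
      then have "?f (y, ?a) = norm (pr (Dl y (emb a))) / norm a" by simp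
      finally show ?thesis using False by (simp add: field_simps)
    qed simp
  qed
next
  case False
  have "\<not> norm y \<le> \<rho>" for y :: 'a using False norm_ge_zero[of y] by linarith
  then show ?thesis using that[of 1] by simp
qed

text \<open>The curve \<open>f\<close> has velocity nearly tangent to the left invariant fields given by \<open>range emb\<close>.
  If it were exactly tangent, the prescribed projection would force \<open>f t = t *\<^sub>R emb w\<close>, since lines
  through \<open>0\<close> are one-parameter subgroups and \<open>pr \<circ> Dl y\<close> is injective on \<open>range emb\<close>.
  Gronwall's inequality gives the perturbed version.\<close>

lemma almost_tangent_curve:
  assumes R: "R > 0" and eta: "\<eta> > 0"
  shows "\<exists>\<epsilon>>0. \<forall>f \<xi> w. norm w \<le> R \<longrightarrow> f 0 = 0 \<longrightarrow>
    (\<forall>t\<in>{0..1}. (f has_vector_derivative Dl (f t) (\<xi> t)) (at t within {0..1})) \<longrightarrow>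
    (\<forall>t\<in>{0..1}. pr (f t) = t *\<^sub>R w) \<longrightarrow>
    (\<forall>t\<in>{0..1}. norm (\<xi> t - emb (pr (\<xi> t))) \<le> \<epsilon> * norm (pr (\<xi> t))) \<longrightarrow>
    (\<forall>t\<in>{0..1::real}. norm (f t - t *\<^sub>R emb w) \<le> \<eta>)"
proof -
  obtain L where L: "L > 0" "\<And>x v. norm x \<le> R + 1 \<Longrightarrow> norm (Dl x v) \<le> L * norm v"
    "\<And>x y v. norm x \<le> R + 1 \<Longrightarrow> norm y \<le> R + 1 \<Longrightarrow> norm (Dl x v - Dl y v) \<le> L * norm (x - y) * norm v"
    using Dl_bounds[of "R + 1"] by metis
  obtain c where c: "c > 0" "\<And>y a. norm y \<le> R + 1 \<Longrightarrow> c * norm a \<le> norm (pr (Dl y (emb a)))"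
    using pr_Dl_bounded_below[of "R + 1"] by metis
  \<comment> \<open>\<open>C\<close> and \<open>C'\<close> are the coefficients of
    \<open>norm (u t)\<close> and \<open>\<epsilon>\<close> in the final estimate of
    \<open>norm (u' t)\<close>.\<close>
  define C where "C = L * R + (L + c / 2) * (2 / c * (L * R))"
  define C' where "C' = (L + c / 2) * (2 / c * (L * R)) + L * R"
  have CC: "C \<ge> 0" "C' > 0" using L(1) c(1) R by (auto simp: C_def C'_def intro!: add_nonneg_nonneg add_pos_pos mult_pos_pos)
  define m where "m = min 1 \<eta>"
  have m: "m > 0" "m \<le> 1" "m \<le> \<eta>" using eta by (auto simp: m_def)
  \<comment> \<open>The first bound lets the error
    \<open>L * \<epsilon> * norm (\<alpha> - w)\<close> be absorbed by half of the lower bound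
    \<open>c\<close>; the second keeps the Gronwall bound below both 1 and
    \<open>\<eta>\<close>.\<close>
  define \<epsilon> where "\<epsilon> = min (c / (2 * L)) (m / (2 * C' * exp (C + 1)))"
  have e0: "\<epsilon> > 0" using L(1) c(1) CC m by (auto simp: \<epsilon>_def)
  have Le: "L * \<epsilon> \<le> c / 2"
  proof -
    have "L * \<epsilon> \<le> L * (c / (2 * L))" using L(1) by (intro mult_left_mono) (auto simp: \<epsilon>_def)
    then show ?thesis using L(1) by simp
  qed
  have Ke: "C' * \<epsilon> * exp (C + 1) \<le> m / 2"
  proof -
    have "C' * \<epsilon> * exp (C + 1) \<le> C' * (m / (2 * C' * exp (C + 1))) * exp (C + 1)"
      using CC by (intro mult_right_mono mult_left_mono) (auto simp: \<epsilon>_def)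
    also have "\<dots> = m / 2" using CC by simp
    finally show ?thesis .
  qed
  show ?thesis
  proof (intro exI[of _ \<epsilon>] conjI allI impI ballI)
    show "\<epsilon> > 0" by (rule e0)
    fix f :: "real \<Rightarrow> 'a" and \<xi> w and t :: real
    assume w: "norm w \<le> R" and f0: "f 0 = 0"
      and df: "\<forall>t\<in>{0..1}. (f has_vector_derivative Dl (f t) (\<xi> t)) (at t within {0..1})"
      and pf: "\<forall>t\<in>{0..1}. pr (f t) = t *\<^sub>R w"
      and xi: "\<forall>t\<in>{0..1}. norm (\<xi> t - emb (pr (\<xi> t))) \<le> \<epsilon> * norm (pr (\<xi> t))"
      and t: "t \<in> {0..1}"
    define u where "u t = f t - t *\<^sub>R emb w" for t
    define u' where "u' t = Dl (f t) (\<xi> t) - emb w" for t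
    have du: "(u has_vector_derivative u' t) (at t within {0..1})" if "t \<in> {0..1}" for t
      unfolding u_def u'_def using df that by (auto intro!: derivative_eq_intros)
    have est: "norm (u' t) \<le> C * norm (u t) + C' * \<epsilon>" if t: "t \<in> {0..1}" and u1: "norm (u t) \<le> 1" for t
    proof -
      define \<alpha> where "\<alpha> = pr (\<xi> t)"
      define \<beta> where "\<beta> = \<xi> t - emb \<alpha>"
      have be: "norm \<beta> \<le> \<epsilon> * norm \<alpha>" using xi t by (simp add: \<alpha>_def \<beta>_def)
      have tw: "norm (t *\<^sub>R emb w) \<le> R"
      proof -
        have "\<bar>t\<bar> * norm w \<le> 1 * R" using t w R by (intro mult_mono) auto
        then show ?thesis by simp
      qed
      have fR: "norm (f t) \<le> R + 1"
        using u1 tw norm_triangle_ineq[of "u t" "t *\<^sub>R emb w"] by (simp add: u_def)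
      have ff: "f t - t *\<^sub>R emb w = u t" by (simp add: u_def)
      \<comment> \<open>Differentiating the prescribed projection \<open>t *\<^sub>R w\<close> fixes
        the projection of the velocity.\<close>
      have prw: "pr (Dl (f t) (\<xi> t)) = w"
      proof -
        have "((\<lambda>t. pr (f t)) has_vector_derivative pr (Dl (f t) (\<xi> t))) (at t within {0..1})"
        proof -
          have blp: "bounded_linear pr" using linear_pr by (simp only: linear_conv_bounded_linear)
          have "(f has_vector_derivative Dl (f t) (\<xi> t)) (at t within {0..1})" using df t by blast
          from bounded_linear.has_vector_derivative[OF blp this] show ?thesis .
        qed
        then have "((\<lambda>t. t *\<^sub>R w) has_vector_derivative pr (Dl (f t) (\<xi> t))) (at t within {0..1})"
          by (rule has_vector_derivative_transform[OF t, rotated]) (use pf in auto)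
        moreover have "((\<lambda>t. t *\<^sub>R w) has_vector_derivative w) (at t within {0..1})"
          by (auto intro!: derivative_eq_intros)
        ultimately show ?thesis
          using vector_derivative_unique_within_closed_interval[of 0 1 t "\<lambda>t. t *\<^sub>R w"] t
          unfolding cbox_interval by simp
      qed
      have D1: "Dl (f t) (\<xi> t) = Dl (f t) (emb w) + Dl (f t) (emb (\<alpha> - w)) + Dl (f t) \<beta>"
      proof -
        have "\<xi> t = emb w + emb (\<alpha> - w) + \<beta>"
          unfolding linear_diff[OF linear_emb] by (simp add: \<beta>_def)
        then show ?thesis by (simp only: linear_add[OF linear_Dl])
      qed
      have diff: "norm (Dl (f t) (emb w) - emb w) \<le> L * R * norm (u t)"
      proof -
        have "norm (Dl (f t) (emb w) - Dl (t *\<^sub>R emb w) (emb w)) \<le> L * norm (f t - t *\<^sub>R emb w) * norm (emb w)"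
          using fR tw by (intro L(3)) auto
        also have "\<dots> \<le> L * norm (u t) * R" unfolding ff using w L(1) by (intro mult_left_mono) auto
        finally show ?thesis by (simp add: Dl_multiple mult_ac)
      qed
      have b2: "norm (Dl (f t) \<beta>) \<le> (c / 2) * norm (\<alpha> - w) + L * R * \<epsilon>"
      proof -
        have "norm \<alpha> \<le> norm (\<alpha> - w) + R" using w norm_triangle_ineq[of "\<alpha> - w" w] by simp
        have "norm (Dl (f t) \<beta>) \<le> L * norm \<beta>" by (rule L(2)[OF fR])
        also have "\<dots> \<le> L * (\<epsilon> * (norm (\<alpha> - w) + R))"
          using be L(1) e0 \<open>norm \<alpha> \<le> norm (\<alpha> - w) + R\<close> by (intro mult_left_mono order_trans[OF be]) auto
        also have "\<dots> = L * \<epsilon> * norm (\<alpha> - w) + L * R * \<epsilon>" by (simp add: algebra_simps)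
        also have "\<dots> \<le> (c / 2) * norm (\<alpha> - w) + L * R * \<epsilon>" using Le by (intro add_right_mono mult_right_mono) auto
        finally show ?thesis .
      qed
      \<comment> \<open>The identity \<open>prw\<close> is solved for the coefficient error
        \<open>\<alpha> - w\<close>: the uniform injectivity bounds it from below, and half of that
        bound absorbs the term on the right.\<close>
      have aw: "norm (\<alpha> - w) \<le> 2 / c * (L * R * norm (u t) + L * R * \<epsilon>)"
      proof -
        have s: "pr (Dl (f t) (emb w)) + pr (Dl (f t) (emb (\<alpha> - w))) + pr (Dl (f t) \<beta>) = w"
          using prw unfolding D1 linear_add[OF linear_pr] .
        have "pr (Dl (f t) (emb (\<alpha> - w))) =
            (pr (Dl (f t) (emb w)) + pr (Dl (f t) (emb (\<alpha> - w))) + pr (Dl (f t) \<beta>)) - pr (Dl (f t) (emb w)) - pr (Dl (f t) \<beta>)"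
          by simp
        then have "pr (Dl (f t) (emb (\<alpha> - w))) = pr (emb w - Dl (f t) (emb w) - Dl (f t) \<beta>)"
          unfolding s linear_diff[OF linear_pr] pr_emb .
        then have "norm (pr (Dl (f t) (emb (\<alpha> - w)))) \<le> norm (emb w - Dl (f t) (emb w) - Dl (f t) \<beta>)"
          using norm_pr_le by metis
        also have "\<dots> \<le> norm (emb w - Dl (f t) (emb w)) + norm (Dl (f t) \<beta>)" by (rule norm_triangle_ineq4)
        finally have "norm (pr (Dl (f t) (emb (\<alpha> - w)))) \<le> L * R * norm (u t) + ((c / 2) * norm (\<alpha> - w) + L * R * \<epsilon>)"
          using diff b2 by (simp add: norm_minus_commute)
        then have "c / 2 * norm (\<alpha> - w) \<le> L * R * norm (u t) + L * R * \<epsilon>"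
          using c(2)[OF fR, of "\<alpha> - w"] by linarith
        then have "2 / c * (c / 2 * norm (\<alpha> - w)) \<le> 2 / c * (L * R * norm (u t) + L * R * \<epsilon>)"
          using c(1) by (intro mult_left_mono) auto
        then show ?thesis using c(1) by simp
      qed
      have eq: "u' t = (Dl (f t) (emb w) - emb w) + Dl (f t) (emb (\<alpha> - w)) + Dl (f t) \<beta>"
        unfolding u'_def D1 by simp
      have "norm (u' t) \<le> norm (Dl (f t) (emb w) - emb w) + norm (Dl (f t) (emb (\<alpha> - w))) + norm (Dl (f t) \<beta>)"
        unfolding eq by (intro norm_triangle_le add_right_mono norm_triangle_ineq)
      also have "\<dots> \<le> L * R * norm (u t) + L * norm (\<alpha> - w) + ((c / 2) * norm (\<alpha> - w) + L * R * \<epsilon>)"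
        using diff b2 L(2)[OF fR, of "emb (\<alpha> - w)"] by simp
      also have "\<dots> = L * R * norm (u t) + (L + c / 2) * norm (\<alpha> - w) + L * R * \<epsilon>" by (simp add: algebra_simps)
      also have "\<dots> \<le> L * R * norm (u t) + (L + c / 2) * (2 / c * (L * R * norm (u t) + L * R * \<epsilon>)) + L * R * \<epsilon>"
        using aw L(1) c(1) by (intro add_right_mono add_left_mono mult_left_mono) auto
      also have "\<dots> = C * norm (u t) + C' * \<epsilon>" by (simp add: C_def C'_def algebra_simps)
      finally show ?thesis .
    qed
    have "norm (u t) \<le> (C' * \<epsilon>) * exp (C + 1)"
    proof (rule gronwall_bound[of u u' C "C' * \<epsilon>" t])
      show "u 0 = 0" by (simp add: u_def f0)
      show "(u has_vector_derivative u' t) (at t within {0..1})" if "t \<in> {0..1}" for t by (rule du[OF that])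
      show "norm (u' t) \<le> C * norm (u t) + C' * \<epsilon>" if "t \<in> {0..1}" "norm (u t) \<le> 1" for t by (rule est[OF that])
      show "0 \<le> C" by (rule CC(1))
      show "0 \<le> C' * \<epsilon>" by (rule less_imp_le[OF mult_pos_pos[OF CC(2) e0]])
      show "C' * \<epsilon> * exp (C + 1) < 1" using Ke m by linarith
      show "t \<in> {0..1}" by (rule t)
    qed
    also have "\<dots> \<le> \<eta>" using Ke m by linarith
    finally show "norm (f t - t *\<^sub>R emb w) \<le> \<eta>" by (simp add: u_def)
  qed
qed

end

subsection \<open>Submanifolds and tangent bases\<close>

lemma Ck_on_1I:
  assumes V: "open V" and D: "\<And>x. x \<in> V \<Longrightarrow> (f has_derivative f' x) (at x)"
    and C: "\<And>v. continuous_on V (\<lambda>x. f' x v)"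
  shows "Ck_on 1 V f"
proof -
  have "frechet_derivative f (at x) = f' x" if "x \<in> V" for x
    by (rule frechet_derivative_at[symmetric, OF D[OF that]])
  then have "continuous_on V (\<lambda>x. frechet_derivative f (at x) v)" for v
    using C[of v] by (simp cong: continuous_on_cong)
  moreover have "f differentiable_on V"
    unfolding differentiable_on_def differentiable_def using D has_derivative_at_withinI by blast
  ultimately show ?thesis by simp
qed

lemma Ck_on_1D:
  assumes "Ck_on 1 V f" "open V"
  shows "x \<in> V \<Longrightarrow> (f has_derivative frechet_derivative f (at x)) (at x)"
    and "continuous_on V (\<lambda>x. frechet_derivative f (at x) v)"
    and "continuous_on V f"
proof -
  have d: "f differentiable_on V" and c: "\<forall>v. continuous_on V (\<lambda>x. frechet_derivative f (at x) v)"
    using assms(1) by simp_all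
  show "(f has_derivative frechet_derivative f (at x)) (at x)" if "x \<in> V"
  proof -
    have "f differentiable (at x within V)" using d that by (simp add: differentiable_on_def)
    then have "f differentiable (at x)" using at_within_open[OF that assms(2)] by simp
    then show ?thesis by (simp add: frechet_derivative_works)
  qed
  show "continuous_on V (\<lambda>x. frechet_derivative f (at x) v)" using c by blast
  show "continuous_on V f" by (rule differentiable_imp_continuous_on[OF d])
qed

lemma linear_vec_expand:
  fixes L :: "real ^ 'n \<Rightarrow> 'b::real_vector"
  assumes "linear L" shows "L v = (\<Sum>i\<in>UNIV. v $ i *\<^sub>R L (axis i 1))"
proof -
  have "L v = L (\<Sum>i\<in>UNIV. v $ i *\<^sub>R axis i 1)"
    by (rule arg_cong[of _ _ L]) (simp add: vec_eq_iff axis_def if_distrib cong: if_cong)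
  also have "\<dots> = (\<Sum>i\<in>UNIV. v $ i *\<^sub>R L (axis i 1))"
    by (simp only: linear_sum[OF assms] linear_scale[OF assms])
  finally show ?thesis .
qed

section \<open>Charts and tangent spaces\<close>

locale chart =
  fixes \<Sigma> :: "'a::euclidean_space set" and V :: "(real ^ 'n::finite) set" and \<Phi> :: "real ^ 'n \<Rightarrow> 'a"
  assumes param: "local_param \<Sigma> V \<Phi>"
begin

abbreviation "D\<Phi> x \<equiv> frechet_derivative \<Phi> (at x)"

lemma open_V: "open V" and C1: "Ck_on 1 V \<Phi>" and inj_D: "x \<in> V \<Longrightarrow> inj (D\<Phi> x)"
  and open_image: "openin (top_of_set \<Sigma>) (\<Phi> ` V)" and homeo: "\<exists>\<Psi>. homeomorphism V (\<Phi> ` V) \<Phi> \<Psi>"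
  using param by (auto simp only: local_param_def)

lemma deriv: "x \<in> V \<Longrightarrow> (\<Phi> has_derivative D\<Phi> x) (at x)"
  and continuous_deriv: "continuous_on V (\<lambda>x. D\<Phi> x v)"
  and continuous_chart: "continuous_on V \<Phi>"
  using Ck_on_1D[OF C1 open_V] by auto

lemma linear_D: "x \<in> V \<Longrightarrow> linear (D\<Phi> x)"
  by (rule has_derivative_linear[OF deriv])

lemma image_subset: "\<Phi> ` V \<subseteq> \<Sigma>"
  using openin_imp_subset[OF open_image] .

lemma continuous_deriv_apply:
  assumes "continuous_on W g" "\<And>w. w \<in> W \<Longrightarrow> g w \<in> V" "continuous_on W h"
  shows "continuous_on W (\<lambda>w. D\<Phi> (g w) (h w))"
proof -
  have "continuous_on W (\<lambda>w. \<Sum>i\<in>UNIV. h w $ i *\<^sub>R D\<Phi> (g w) (axis i 1))"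
    using assms by (intro continuous_on_sum continuous_on_scaleR continuous_on_component
        continuous_on_compose2[OF continuous_deriv assms(1)]) auto
  moreover have "D\<Phi> (g w) (h w) = (\<Sum>i\<in>UNIV. h w $ i *\<^sub>R D\<Phi> (g w) (axis i 1))" if "w \<in> W" for w
    by (rule linear_vec_expand[OF linear_D[OF assms(2)[OF that]]])
  ultimately show ?thesis by (simp cong: continuous_on_cong)
qed

lemma compose_diffeo:
  fixes g :: "real ^ 'n \<Rightarrow> real ^ 'n"
  assumes W: "open W" and U: "open U" "U \<subseteq> V" and hom: "homeomorphism W U g h"
    and dg: "\<And>w. w \<in> W \<Longrightarrow> (g has_derivative g' w) (at w)"
    and inj: "\<And>w. w \<in> W \<Longrightarrow> inj (g' w)" and cg: "\<And>v. continuous_on W (\<lambda>w. g' w v)"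
  shows "local_param \<Sigma> W (\<Phi> \<circ> g)"
    and "\<And>w. w \<in> W \<Longrightarrow> frechet_derivative (\<Phi> \<circ> g) (at w) = (\<lambda>v. D\<Phi> (g w) (g' w v))"
proof -
  have gW: "g ` W = U" and cgW: "continuous_on W g" using hom by (auto simp: homeomorphism_def)
  have gV: "g w \<in> V" if "w \<in> W" for w using gW U(2) that by blast
  have D: "((\<Phi> \<circ> g) has_derivative (\<lambda>v. D\<Phi> (g w) (g' w v))) (at w)" if "w \<in> W" for w
    using diff_chain_at[OF dg[OF that] deriv[OF gV[OF that]]] by (simp add: o_def)
  show E: "frechet_derivative (\<Phi> \<circ> g) (at w) = (\<lambda>v. D\<Phi> (g w) (g' w v))" if "w \<in> W" for w
    by (rule frechet_derivative_at[symmetric, OF D[OF that]])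
  have img: "(\<Phi> \<circ> g) ` W = \<Phi> ` U" using gW by (metis image_comp)
  obtain \<Psi> where P: "homeomorphism V (\<Phi> ` V) \<Phi> \<Psi>" using homeo by blast
  have "openin (top_of_set (\<Phi> ` V)) (\<Phi> ` U)"
    by (rule homeomorphism_imp_open_map[OF P]) (use U in \<open>simp add: openin_open_eq open_V\<close>)
  then have op: "openin (top_of_set \<Sigma>) ((\<Phi> \<circ> g) ` W)"
    unfolding img using openin_trans open_image by blast
  have "homeomorphism U (\<Phi> ` U) \<Phi> \<Psi>"
    by (rule homeomorphism_of_subsets[OF P U(2)]) (use U(2) in auto)
  from homeomorphism_compose[OF hom this]
  have H: "homeomorphism W ((\<Phi> \<circ> g) ` W) (\<Phi> \<circ> g) (h \<circ> \<Psi>)" unfolding img .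
  have "Ck_on 1 W (\<Phi> \<circ> g)"
    by (rule Ck_on_1I[OF W D continuous_deriv_apply[OF cgW gV cg]])
  moreover have "inj (frechet_derivative (\<Phi> \<circ> g) (at w))" if "w \<in> W" for w
    unfolding E[OF that] using inj_compose[OF inj_D[OF gV[OF that]] inj[OF that]] by (simp add: o_def)
  ultimately show "local_param \<Sigma> W (\<Phi> \<circ> g)"
    unfolding local_param_def using W op H by blast
qed

text \<open>The inverse of the chart is only known to be continuous, so a curve in
  \<open>\<Sigma>\<close> need not lift to a differentiable one. Instead its velocity is
  approximated by values of the derivative of \<open>\<Phi>\<close> on secants, and the range of
  that derivative is closed.\<close>

lemma tangent_space_eq:
  assumes x: "x \<in> V"
  shows "tangent_space \<Sigma> (\<Phi> x) = range (D\<Phi> x)"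
proof (intro antisym subsetI)
  fix v assume "v \<in> range (D\<Phi> x)"
  then obtain h where h: "v = D\<Phi> x h" by blast
  obtain r where r: "r > 0" "ball x r \<subseteq> V" using open_V x openE by blast
  define \<epsilon> where "\<epsilon> = r / (norm h + 1)"
  have e: "\<epsilon> > 0" using r by (simp add: \<epsilon>_def add_nonneg_pos)
  define \<gamma> where "\<gamma> t = \<Phi> (x + t *\<^sub>R h)" for t
  have inV: "x + t *\<^sub>R h \<in> V" if "t \<in> {-\<epsilon><..<\<epsilon>}" for t
  proof -
    have "\<bar>t\<bar> * norm h \<le> \<bar>t\<bar> * (norm h + 1)" by (intro mult_left_mono) auto
    also have "\<dots> < \<epsilon> * (norm h + 1)" using that by (intro mult_strict_right_mono) (auto simp: add_nonneg_pos)
    also have "\<dots> = r" using add_nonneg_pos[OF norm_ge_zero[of h] zero_less_one] by (simp add: \<epsilon>_def)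
    finally have "dist x (x + t *\<^sub>R h) < r" by (simp add: dist_norm)
    then show ?thesis using r(2) by auto
  qed
  have D: "(\<gamma> has_derivative (\<lambda>s. D\<Phi> (x + t *\<^sub>R h) (s *\<^sub>R h))) (at t)" if "t \<in> {-\<epsilon><..<\<epsilon>}" for t
    unfolding \<gamma>_def
    by (rule has_derivative_compose[of "\<lambda>t. x + t *\<^sub>R h" "\<lambda>s. s *\<^sub>R h" t UNIV \<Phi>, OF _ deriv[OF inV[OF that]]])
       (auto intro!: derivative_eq_intros)
  have "Ck_on 1 {-\<epsilon><..<\<epsilon>} \<gamma>"
    by (rule Ck_on_1I[OF _ D]) (auto intro!: continuous_deriv_apply continuous_intros inV)
  moreover have "\<gamma> ` {-\<epsilon><..<\<epsilon>} \<subseteq> \<Sigma>" using inV image_subset by (auto simp: \<gamma>_def)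
  moreover have "(\<gamma> has_vector_derivative v) (at 0)"
  proof -
    have "(\<lambda>s. D\<Phi> x (s *\<^sub>R h)) = (\<lambda>s. s *\<^sub>R v)" unfolding h linear_scale[OF linear_D[OF x]] ..
    then show ?thesis using D[of 0] e by (simp add: has_vector_derivative_def)
  qed
  ultimately show "v \<in> tangent_space \<Sigma> (\<Phi> x)"
    unfolding tangent_space_def using e by (intro CollectI exI[of _ \<gamma>] exI[of _ \<epsilon>]) (simp add: \<gamma>_def)
next
  fix v assume "v \<in> tangent_space \<Sigma> (\<Phi> x)"
  then obtain \<gamma> \<epsilon> where g: "\<epsilon> > 0" "\<gamma> ` {-\<epsilon><..<\<epsilon>} \<subseteq> \<Sigma>" "\<gamma> 0 = \<Phi> x" "(\<gamma> has_vector_derivative v) (at (0::real))"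
    unfolding tangent_space_def by blast
  let ?L = "D\<Phi> x"
  obtain \<Psi> where P: "homeomorphism V (\<Phi> ` V) \<Phi> \<Psi>" using homeo by blast
  obtain B where B: "B > 0" "\<And>h. B * norm h \<le> norm (?L h)"
    using linear_inj_bounded_below_pos[OF linear_D[OF x] inj_D[OF x]] by metis
  have "v \<in> closure (range ?L)"
    unfolding closure_approachable
  proof (intro allI impI)
    fix \<eta> :: real assume eta: "\<eta> > 0"
    define \<eta>' where "\<eta>' = min 1 (\<eta> / 4)"
    have eta': "\<eta>' > 0" "\<eta>' \<le> 1" "\<eta>' \<le> \<eta> / 4" using eta by (auto simp: \<eta>'_def)
    define nv where "nv = norm v + 1"
    have nv: "nv > 0" using norm_ge_zero[of v] unfolding nv_def by linarith
    \<comment> \<open>The bound \<open>B / 2\<close> absorbs the linearization error and gives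
      \<open>norm (y - x) \<le> 2 / B * (t * nv)\<close>; the second bound then makes that error at
      most \<open>\<eta> / 4 * t\<close>.\<close>
    define \<delta> where "\<delta> = min (B / 2) (\<eta> * B / (8 * nv))"
    have dl: "\<delta> > 0" "\<delta> \<le> B / 2" "\<delta> \<le> \<eta> * B / (8 * nv)"
      unfolding \<delta>_def using eta B(1) nv by (simp_all only: min.cobounded1 min.cobounded2) simp
    obtain r1 where r1: "r1 > 0" "\<And>t. \<bar>t\<bar> < r1 \<Longrightarrow> norm (\<gamma> t - \<gamma> 0 - t *\<^sub>R v) \<le> \<eta>' * \<bar>t\<bar>"
      using g(4) eta'(1) unfolding has_vector_derivative_def has_derivative_at_alt by auto
    obtain r2 where r2: "r2 > 0" "\<And>y. norm (y - x) < r2 \<Longrightarrow> norm (\<Phi> y - \<Phi> x - ?L (y - x)) \<le> \<delta> * norm (y - x)"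
      using deriv[OF x] dl(1) unfolding has_derivative_at_alt by blast
    have "\<Phi> x \<in> \<Phi> ` V" using x by blast
    have cP: "continuous_on (\<Phi> ` V) \<Psi>" and Px: "\<Psi> (\<Phi> y) = y" if "y \<in> V" for y
      using P that by (auto simp: homeomorphism_def)
    obtain r3 where r3: "r3 > 0" "\<And>z. z \<in> \<Phi> ` V \<Longrightarrow> dist z (\<Phi> x) < r3 \<Longrightarrow> dist (\<Psi> z) (\<Psi> (\<Phi> x)) < r2"
      using cP[OF x] \<open>\<Phi> x \<in> \<Phi> ` V\<close> r2(1) unfolding continuous_on_iff by blast
    \<comment> \<open>Relative openness of the chart image puts the nearby points of the curve into
      the chart.\<close>
    obtain O' where O: "open O'" "\<Phi> ` V = \<Sigma> \<inter> O'" using open_image by (auto simp: openin_open)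
    obtain r4 where r4: "r4 > 0" "ball (\<Phi> x) r4 \<subseteq> O'"
      using O \<open>\<Phi> x \<in> \<Phi> ` V\<close> openE by blast
    have "isCont \<gamma> 0" using g(4) has_vector_derivative_continuous continuous_at by blast
    then obtain r5 where r5: "r5 > 0" "\<And>t. dist t 0 < r5 \<Longrightarrow> dist (\<gamma> t) (\<gamma> 0) < min r3 r4"
      unfolding continuous_at_eps_delta using r3(1) r4(1) by (metis min_less_iff_conj)
    define t where "t = min (min r1 r5) \<epsilon> / 2"
    have t: "0 < t" "t < r1" "t < r5" "t < \<epsilon>" using r1 r5 g by (auto simp: t_def)
    have gt: "dist (\<gamma> t) (\<gamma> 0) < min r3 r4" using r5(2)[of t] t by simp
    have "\<gamma> t \<in> \<Sigma>" using g(2) t by auto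
    moreover have "\<gamma> t \<in> O'" using gt r4(2) g(3) by (auto simp: dist_commute)
    ultimately have gV: "\<gamma> t \<in> \<Phi> ` V" using O(2) by simp
    then obtain y where y: "y \<in> V" "\<gamma> t = \<Phi> y" by blast
    have "dist (\<Psi> (\<gamma> t)) (\<Psi> (\<Phi> x)) < r2" using gV gt g(3) by (intro r3(2)) auto
    then have "norm (y - x) < r2" using y Px x by (simp add: dist_norm)
    then have 1: "norm (\<gamma> t - \<gamma> 0 - ?L (y - x)) \<le> \<delta> * norm (y - x)" using r2(2) y g(3) by simp
    have 2: "norm (\<gamma> t - \<gamma> 0 - t *\<^sub>R v) \<le> \<eta>' * t" using r1(2)[of t] t by simp
    have a: "norm (\<gamma> t - \<gamma> 0) \<le> t * nv"
    proof -
      have "norm (\<gamma> t - \<gamma> 0) \<le> norm (\<gamma> t - \<gamma> 0 - t *\<^sub>R v) + norm (t *\<^sub>R v)"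
        using norm_triangle_ineq[of "\<gamma> t - \<gamma> 0 - t *\<^sub>R v" "t *\<^sub>R v"] by simp
      also have "\<dots> \<le> 1 * t + t * norm v" using 2 eta' t by (intro add_mono order_trans[OF 2] mult_right_mono) auto
      finally show ?thesis by (simp add: nv_def algebra_simps)
    qed
    have "B * norm (y - x) \<le> norm (?L (y - x))" by (rule B(2))
    also have "\<dots> \<le> norm (\<gamma> t - \<gamma> 0) + norm (\<gamma> t - \<gamma> 0 - ?L (y - x))"
      using norm_triangle_ineq4[of "\<gamma> t - \<gamma> 0" "\<gamma> t - \<gamma> 0 - ?L (y - x)"] by simp
    also have "\<dots> \<le> t * nv + B / 2 * norm (y - x)"
      using a 1 mult_right_mono[OF dl(2) norm_ge_zero[of "y - x"]] by linarith
    finally have "B / 2 * norm (y - x) \<le> t * nv" by simp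
    then have yx: "norm (y - x) \<le> 2 / B * (t * nv)" using B(1) by (simp add: field_simps)
    have "\<delta> * norm (y - x) \<le> (\<eta> * B / (8 * nv)) * (2 / B * (t * nv))"
      using dl yx eta B nv by (intro mult_mono) auto
    also have "\<dots> = \<eta> / 4 * t" using B nv by (simp add: field_simps)
    finally have 3: "\<delta> * norm (y - x) \<le> \<eta> / 4 * t" .
    have "norm (?L (y - x) - t *\<^sub>R v) \<le> norm (\<gamma> t - \<gamma> 0 - t *\<^sub>R v) + norm (\<gamma> t - \<gamma> 0 - ?L (y - x))"
      using norm_triangle_ineq4[of "\<gamma> t - \<gamma> 0 - t *\<^sub>R v" "\<gamma> t - \<gamma> 0 - ?L (y - x)"] by simp
    also have "\<dots> \<le> \<eta> / 4 * t + \<eta> / 4 * t"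
      using 1 2 3 mult_right_mono[OF eta'(3), of t] t by linarith
    finally have 4: "norm (?L (y - x) - t *\<^sub>R v) \<le> \<eta> / 2 * t" by simp
    have "?L ((1 / t) *\<^sub>R (y - x)) = (1 / t) *\<^sub>R ?L (y - x)" by (rule linear_scale[OF linear_D[OF x]])
    then have "?L ((1 / t) *\<^sub>R (y - x)) - v = (1 / t) *\<^sub>R ?L (y - x) - (1 / t) *\<^sub>R (t *\<^sub>R v)"
      using t by simp
    also have "\<dots> = (1 / t) *\<^sub>R (?L (y - x) - t *\<^sub>R v)" by (simp only: scaleR_diff_right)
    finally have "?L ((1 / t) *\<^sub>R (y - x)) - v = (1 / t) *\<^sub>R (?L (y - x) - t *\<^sub>R v)" .
    then have "dist (?L ((1 / t) *\<^sub>R (y - x))) v = 1 / t * norm (?L (y - x) - t *\<^sub>R v)"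
      using t by (simp add: dist_norm)
    also have "\<dots> \<le> 1 / t * (\<eta> / 2 * t)" using 4 t by (intro mult_left_mono) auto
    also have "\<dots> < \<eta>" using t eta by simp
    finally show "\<exists>y\<in>range ?L. dist y v < \<eta>" by blast
  qed
  moreover have "closed (range ?L)"
    by (intro closed_subspace linear_subspace_image[OF linear_D[OF x]]) simp
  ultimately show "v \<in> range ?L" by (simp add: closure_closed)
qed

lemma image_borel: "\<Phi> ` V \<in> sets borel"
proof -
  obtain C where C: "\<And>k::nat. compact (C k)" "V = (\<Union>k. C k)"
    using open_Union_compact_subsets[OF open_V] by (metis UNIV_I)
  have "compact (\<Phi> ` C k)" for k
    using C continuous_on_subset[OF continuous_chart] by (intro compact_continuous_image) auto
  then have "(\<Union>k. \<Phi> ` C k) \<in> sets borel"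
    by (intro sets.countable_UN) (auto intro: borel_compact)
  then show ?thesis using C(2) by (simp add: image_UN)
qed

lemma inverse_continuous:
  obtains \<Psi> where "continuous_on (\<Phi> ` V) \<Psi>" "\<And>x. x \<in> V \<Longrightarrow> \<Psi> (\<Phi> x) = x"
  using homeo that by (auto simp: homeomorphism_def)

end

text \<open>Lindelof's theorem leaves countably many charts, so measurability can be checked chart
  by chart.\<close>

lemma submanifold_charts:
  assumes "C1_submanifold TYPE('n::finite) \<Sigma>" "\<Sigma> \<noteq> {}"
  obtains V :: "nat \<Rightarrow> (real ^ 'n) set" and \<Phi> :: "nat \<Rightarrow> real ^ 'n \<Rightarrow> 'a::euclidean_space"
  where "\<And>k. chart \<Sigma> (V k) (\<Phi> k)" "\<Sigma> = (\<Union>k. \<Phi> k ` V k)"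
proof -
  define \<F> where "\<F> = {U. \<exists>(V :: (real ^ 'n) set) \<Phi>. local_param \<Sigma> V \<Phi> \<and> U = \<Phi> ` V}"
  have cov: "\<Sigma> = \<Union>\<F>"
  proof
    show "\<Sigma> \<subseteq> \<Union>\<F>" using assms(1) unfolding C1_submanifold_def \<F>_def by blast
    show "\<Union>\<F> \<subseteq> \<Sigma>" unfolding \<F>_def using chart.image_subset[unfolded chart_def] by blast
  qed
  obtain \<F>' where F: "\<F>' \<subseteq> \<F>" "countable \<F>'" "\<Union>\<F>' = \<Union>\<F>"
    by (rule Lindelof_openin[of \<F> \<Sigma>]) (auto simp: \<F>_def local_param_def)
  have "\<F>' \<noteq> {}" using F(3) cov assms(2) by auto
  define U where "U = from_nat_into \<F>'"
  have U: "range U = \<F>'" unfolding U_def using F(2) \<open>\<F>' \<noteq> {}\<close> by (rule range_from_nat_into[rotated])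
  have "\<exists>(V :: (real ^ 'n) set) \<Phi>. local_param \<Sigma> V \<Phi> \<and> U k = \<Phi> ` V" for k
    using U F(1) unfolding \<F>_def by blast
  then obtain V :: "nat \<Rightarrow> (real ^ 'n) set" and \<Phi> where "\<And>k. local_param \<Sigma> (V k) (\<Phi> k)" "\<And>k. U k = \<Phi> k ` V k"
    by metis
  moreover have "\<Sigma> = (\<Union>k. U k)" using cov F(3) U by simp
  ultimately show ?thesis using that[of V \<Phi>] by (simp add: chart_def)
qed

lemma submanifold_borel:
  assumes "C1_submanifold TYPE('n::finite) \<Sigma>" "\<Sigma> \<noteq> {}"
  shows "\<Sigma> \<in> sets borel"
proof -
  obtain V :: "nat \<Rightarrow> (real ^ 'n) set" and \<Phi> where c: "\<And>k. chart \<Sigma> (V k) (\<Phi> k)" "\<Sigma> = (\<Union>k. \<Phi> k ` V k)"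
    by (rule submanifold_charts[OF assms]) blast
  have "(\<Union>k. \<Phi> k ` V k) \<in> sets borel" using chart.image_borel[OF c(1)] by (intro sets.countable_UN) auto
  then show ?thesis using c(2) by simp
qed

text \<open>The pieces are the complement of \<open>\<Sigma>\<close> and the images of countably
  many charts; on each image \<open>f\<close> is continuous because the chart has a continuous
  inverse.\<close>

lemma submanifold_borel_measurable:
  fixes f :: "'a::euclidean_space \<Rightarrow> real"
  assumes S: "C1_submanifold TYPE('n::finite) \<Sigma>" "\<Sigma> \<noteq> {}"
    and f: "\<And>(V :: (real ^ 'n) set) \<Phi>. chart \<Sigma> V \<Phi> \<Longrightarrow> continuous_on V (\<lambda>x. f (\<Phi> x))"
    and f0: "\<And>x. x \<notin> \<Sigma> \<Longrightarrow> f x = 0"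
  shows "f \<in> borel_measurable borel"
proof -
  obtain V :: "nat \<Rightarrow> (real ^ 'n) set" and \<Phi> where c: "\<And>k. chart \<Sigma> (V k) (\<Phi> k)" "\<Sigma> = (\<Union>k. \<Phi> k ` V k)"
    by (rule submanifold_charts[OF S]) blast
  define A where "A n = (case n of 0 \<Rightarrow> - \<Sigma> | Suc k \<Rightarrow> \<Phi> k ` V k)" for n
  have cont: "continuous_on (\<Phi> k ` V k) f" for k
  proof -
    obtain \<Psi> where P: "continuous_on (\<Phi> k ` V k) \<Psi>" "\<And>x. x \<in> V k \<Longrightarrow> \<Psi> (\<Phi> k x) = x"
      by (rule chart.inverse_continuous[OF c(1)[of k]]) blast
    have "continuous_on (\<Phi> k ` V k) (\<lambda>y. f (\<Phi> k (\<Psi> y)))"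
      by (rule continuous_on_compose2[OF f[OF c(1)] P(1)]) (use P(2) in auto)
    then show ?thesis by (rule continuous_on_eq) (use P(2) in auto)
  qed
  show ?thesis
  proof (rule measurable_piecewise_restrict2[of A])
    show "A n \<in> sets borel" for n
      using chart.image_borel[OF c(1)] submanifold_borel[OF S] by (cases n) (auto simp: A_def)
    have "x \<in> (\<Union>n. A n)" for x
    proof (cases "x \<in> \<Sigma>")
      case True
      then obtain k where "x \<in> \<Phi> k ` V k" using c(2) by blast
      then have "x \<in> A (Suc k)" by (simp add: A_def)
      then show ?thesis by blast
    next
      case False
      then have "x \<in> A 0" by (simp add: A_def)
      then show ?thesis by blast
    qed
    then show "space borel = (\<Union>n. A n)" by auto
    show "\<exists>h\<in>borel_measurable borel. \<forall>x\<in>A n. f x = h x" for n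
    proof (cases n)
      case 0
      then show ?thesis using f0 by (intro bexI[of _ "\<lambda>_. 0"]) (auto simp: A_def)
    next
      case (Suc k)
      have "(\<lambda>x. indicator (\<Phi> k ` V k) x *\<^sub>R f x) \<in> borel_measurable borel"
        by (rule borel_measurable_continuous_on_indicator[OF chart.image_borel[OF c(1)] cont])
      then show ?thesis using Suc by (intro bexI[of _ "\<lambda>x. indicator (\<Phi> k ` V k) x *\<^sub>R f x"]) (auto simp: A_def)
    qed
  qed
qed

section \<open>Bases of tangent spaces and their Gram determinants\<close>

definition basis_list :: "'a::euclidean_space set \<Rightarrow> 'a list \<Rightarrow> bool" where
  "basis_list T vs \<longleftrightarrow> distinct vs \<and> independent (set vs) \<and> span (set vs) = T"

lemma basis_list_length: "basis_list T vs \<Longrightarrow> length vs = dim T"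
  unfolding basis_list_def by (metis dim_span_eq_card_independent distinct_card)

lemma ex_enum: "\<exists>hs :: 'n::finite list. distinct hs \<and> set hs = UNIV"
  using finite_distinct_list[of "UNIV :: 'n set"] by auto

lemma enum_index:
  fixes hs :: "'n::finite list"
  assumes "distinct hs" "set hs = UNIV"
  obtains h where "bij_betw h UNIV {..<CARD('n)}" "\<And>i. hs ! h i = i" "\<And>k. k < CARD('n) \<Longrightarrow> h (hs ! k) = k"
    "length hs = CARD('n)"
proof -
  have len: "length hs = CARD('n)" using distinct_card[OF assms(1)] assms(2) by simp
  have b: "bij_betw ((!) hs) {..<CARD('n)} UNIV" using bij_betw_nth[OF assms(1) refl] assms(2) len by simp
  show ?thesis
  proof (rule that[of "inv_into {..<CARD('n)} ((!) hs)"])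
    show "bij_betw (inv_into {..<CARD('n)} ((!) hs)) UNIV {..<CARD('n)}" by (rule bij_betw_inv_into[OF b])
    show "hs ! inv_into {..<CARD('n)} ((!) hs) i = i" for i
      using b by (intro f_inv_into_f) (auto simp: bij_betw_def)
    show "inv_into {..<CARD('n)} ((!) hs) (hs ! k) = k" if "k < CARD('n)" for k
      using b that by (intro inv_into_f_f) (auto simp: bij_betw_def)
    show "length hs = CARD('n)" by (rule len)
  qed
qed

text \<open>One constant, the determinant of the change of basis, governs the wedge products after
  every linear map and the Gram determinants of every bilinear form. It makes the arbitrary choices
  in \<open>tangent_multivector\<close> and \<open>unit_tangent_multivector\<close>
  harmless.\<close>

lemma basis_list_change:
  fixes T :: "'a::euclidean_space set"
  assumes vs: "basis_list T vs" and ws: "basis_list T ws" and dimT: "dim T = CARD('n::finite)"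
  shows "\<exists>c. (\<forall>(e :: nat \<Rightarrow> 'a) L K. linear L \<longrightarrow> wedge_list e (map L vs) K = c * wedge_list e (map L ws) K) \<and>
    (\<forall>B. bilinear B \<longrightarrow> gram_det {..<length vs} B ((!) vs) = c\<^sup>2 * gram_det {..<length ws} B ((!) ws))"
proof -
  obtain hs :: "'n list" where hs: "distinct hs" "set hs = UNIV" using ex_enum by blast
  obtain h where h: "bij_betw h UNIV {..<CARD('n)}" "\<And>i. hs ! h i = i" "\<And>k. k < CARD('n) \<Longrightarrow> h (hs ! k) = k"
    "length hs = CARD('n)" by (rule enum_index[OF hs]) blast
  have len: "length vs = CARD('n)" "length ws = CARD('n)"
    using basis_list_length[OF vs] basis_list_length[OF ws] dimT by auto
  define v where "v i = vs ! h i" for i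
  define w where "w i = ws ! h i" for i
  have mv: "vs = map v hs" and mw: "ws = map w hs"
    using len h by (auto intro!: nth_equalityI simp: v_def w_def)
  have hlt: "h i < CARD('n)" for i using h(1) bij_betwE by fastforce
  have sw: "set ws = w ` UNIV" unfolding mw using hs(2) by simp
  have injw: "inj w"
  proof (rule injI)
    fix i j assume "w i = w j"
    then have "h i = h j" using ws len hlt by (simp add: w_def basis_list_def nth_eq_iff_index_eq)
    then show "i = j" using h(2) by metis
  qed
  have "\<exists>c. v i = (\<Sum>j\<in>UNIV. c j *\<^sub>R w j)" for i
  proof -
    have "v i \<in> set vs" unfolding mv using hs(2) by simp
    then have "v i \<in> span (set ws)" using vs ws span_base unfolding basis_list_def by metis
    then have "v i \<in> range (\<lambda>u. \<Sum>x\<in>w ` UNIV. u x *\<^sub>R x)" unfolding sw using span_finite[of "w ` UNIV"] by auto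
    then obtain u where "v i = (\<Sum>x\<in>w ` UNIV. u x *\<^sub>R x)" by blast
    then have "v i = (\<Sum>j\<in>UNIV. u (w j) *\<^sub>R w j)" unfolding sum.reindex[OF injw] o_def .
    then show ?thesis by (intro exI[of _ "\<lambda>j. u (w j)"])
  qed
  then obtain c where c: "\<And>i. v i = (\<Sum>j\<in>UNIV. c i j *\<^sub>R w j)" by metis
  define C :: "real ^ 'n ^ 'n" where "C = (\<chi> i j. c i j)"
  have vC: "v = (\<lambda>i. \<Sum>j\<in>UNIV. C $ i $ j *\<^sub>R w j)" using c by (simp add: C_def fun_eq_iff)
  show ?thesis
  proof (intro exI[of _ "det C"] conjI allI impI)
    fix e :: "nat \<Rightarrow> 'a" and L :: "'a \<Rightarrow> 'a" and K assume L: "linear L"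
    have "map L vs = map (\<lambda>i. \<Sum>j\<in>UNIV. C $ i $ j *\<^sub>R (L \<circ> w) j) hs"
      unfolding mv by (simp add: vC linear_sum[OF L] linear_scale[OF L])
    moreover have "map L ws = map (L \<circ> w) hs" unfolding mw by simp
    ultimately show "wedge_list e (map L vs) K = det C * wedge_list e (map L ws) K"
      using wedge_list_change_basis[OF hs, of e C "L \<circ> w" K] by simp
  next
    fix B :: "'a \<Rightarrow> 'a \<Rightarrow> real" assume B: "bilinear B"
    have "gram_det {..<length vs} B ((!) vs) = gram_det UNIV B v"
      using gram_det_reindex[of h "{..<CARD('n)}" B "(!) vs"] h(1) len by (simp add: v_def[abs_def] o_def)
    moreover have "gram_det {..<length ws} B ((!) ws) = gram_det UNIV B w"
      using gram_det_reindex[of h "{..<CARD('n)}" B "(!) ws"] h(1) len by (simp add: w_def[abs_def] o_def)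
    moreover have "gram_det UNIV B v = (det C)\<^sup>2 * gram_det UNIV B w"
      by (subst vC) (rule gram_det_change_basis[OF B])
    ultimately show "gram_det {..<length vs} B ((!) vs) = (det C)\<^sup>2 * gram_det {..<length ws} B ((!) ws)" by simp
  qed
qed

lemma gram_det_orthonormal:
  assumes "finite I" "\<And>i j. i \<in> I \<Longrightarrow> j \<in> I \<Longrightarrow> B (v i) (v j) = (if i = j then 1 else (0::real))"
  shows "gram_det I B v = 1"
proof -
  have "gram_det I B v = (\<Sum>\<pi>\<in>{id}. of_int (sign \<pi>) * (\<Prod>i\<in>I. B (v i) (v (\<pi> i))))"
    unfolding gram_det_def
  proof (rule sum.mono_neutral_right)
    show "finite {\<pi>. \<pi> permutes I}" by (rule finite_permutations[OF assms(1)])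
    show "{id} \<subseteq> {\<pi>. \<pi> permutes I}" by (simp add: permutes_id)
    show "\<forall>\<pi>\<in>{\<pi>. \<pi> permutes I} - {id}. of_int (sign \<pi>) * (\<Prod>i\<in>I. B (v i) (v (\<pi> i))) = 0"
    proof
      fix \<pi> assume p: "\<pi> \<in> {\<pi>. \<pi> permutes I} - {id}"
      then obtain i where i: "\<pi> i \<noteq> i" by (auto simp: fun_eq_iff)
      then have "i \<in> I" "\<pi> i \<in> I" using p permutes_not_in permutes_in_image by (metis DiffD1 mem_Collect_eq)+
      then have "B (v i) (v (\<pi> i)) = 0" using assms(2)[of i "\<pi> i"] i by simp
      then show "of_int (sign \<pi>) * (\<Prod>i\<in>I. B (v i) (v (\<pi> i))) = 0"
        using \<open>i \<in> I\<close> assms(1) by (auto simp: prod_zero_iff)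
    qed
  qed
  moreover have "(\<Prod>i\<in>I. B (v i) (v (id i))) = 1" using assms(2) by (intro prod.neutral) auto
  ultimately show ?thesis by simp
qed

lemma orthonormal_basis_list:
  fixes T :: "'a::euclidean_space set"
  assumes B: "bilinear B" "\<And>x y. B x y = B y x" "\<And>x. x \<noteq> 0 \<Longrightarrow> B x x > 0" and T: "subspace T"
  shows "\<exists>ws. basis_list T ws \<and> gram_det {..<length ws} B ((!) ws) = (1::real)"
proof -
  obtain v :: "nat \<Rightarrow> 'a" where v: "\<And>r s. r < dim T \<Longrightarrow> s < dim T \<Longrightarrow> B (v r) (v s) = (if r = s then 1 else 0)"
    "span (v ` {..<dim T}) = T"
    using bilinear_orthonormal_basis[OF B T refl] by blast
  let ?ws = "map v [0..<dim T]"
  have set: "set ?ws = v ` {..<dim T}" by (simp add: atLeast0LessThan)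
  have inj: "inj_on v {..<dim T}"
  proof (rule inj_onI)
    fix r s assume "r \<in> {..<dim T}" "s \<in> {..<dim T}" "v r = v s"
    then show "r = s" using v(1)[of r s] v(1)[of r r] by (auto split: if_splits)
  qed
  have "distinct ?ws" using inj by (simp add: distinct_map atLeast0LessThan)
  moreover have "independent (set ?ws)"
  proof (rule card_le_dim_spanning[of _ T])
    show "set ?ws \<subseteq> T" unfolding set using v(2) span_superset[of "v ` {..<dim T}"] by simp
    show "T \<subseteq> span (set ?ws)" unfolding set v(2) ..
    show "card (set ?ws) \<le> dim T" unfolding set using card_image_le[of "{..<dim T}" v] by simp
  qed simp
  ultimately have "basis_list T ?ws" unfolding basis_list_def using set v(2) by simp
  moreover have "gram_det {..<length ?ws} B ((!) ?ws) = 1"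
    by (rule gram_det_orthonormal) (use v(1) in auto)
  ultimately show ?thesis by blast
qed

lemma basis_list_gram_pos:
  fixes T :: "'a::euclidean_space set"
  assumes B: "bilinear B" "\<And>x y. B x y = B y x" "\<And>x. x \<noteq> 0 \<Longrightarrow> B x x > 0"
    and vs: "basis_list T vs" and dimT: "dim T = CARD('n::finite)"
  shows "gram_det {..<length vs} B ((!) vs) > (0::real)"
proof -
  have "subspace T" using vs unfolding basis_list_def by (metis subspace_span)
  then obtain ws where ws: "basis_list T ws" "gram_det {..<length ws} B ((!) ws) = 1"
    using orthonormal_basis_list[OF B] by blast
  obtain c where "1 = c\<^sup>2 * gram_det {..<length vs} B ((!) vs)"
    using basis_list_change[OF ws(1) vs dimT] B(1) ws(2) by metis
  then show ?thesis
    by (metis not_less zero_less_one mult_nonneg_nonpos zero_le_power2 linorder_not_le)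
qed

subsection \<open>Degree and intrinsic measure in a chart\<close>

lemma wedge_scale_right: "(X \<and>\<^sub>m (\<lambda>I. c * Y I)) K = c * (X \<and>\<^sub>m Y) K"
  by (simp add: wedge_def sum_distrib_left mult_ac)

lemma left_invariant_norm_scale: "left_invariant_norm q (\<lambda>I. c * X I) = \<bar>c\<bar> * left_invariant_norm q X"
  unfolding left_invariant_norm_def power_mult_distrib sum_distrib_left[symmetric] real_sqrt_mult by simp

lemma degree_proj_scale: "degree_proj G M (\<lambda>I. c * X I) = (\<lambda>I. c * degree_proj G M X I)"
  by (auto simp: degree_proj_def fun_eq_iff)

lemma left_invariant_norm_mv_inner: "(left_invariant_norm q X)\<^sup>2 = mv_inner q X X"
  unfolding left_invariant_norm_def mv_inner_def
  by (subst real_sqrt_pow2) (auto intro: sum_nonneg simp: power2_eq_square)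

context hom_group
begin

lemma left_invariant_iff: "X \<in> left_invariant_fields G \<longleftrightarrow> (\<forall>p. X p = Dl p (X 0))"
proof
  assume X: "X \<in> left_invariant_fields G"
  show "\<forall>p. X p = Dl p (X 0)"
  proof
    fix p
    have "X (p \<star> 0) = frechet_derivative (gmul G p) (at 0) (X 0)"
      using X unfolding left_invariant_fields_def by blast
    then show "X p = Dl p (X 0)" by (simp add: frechet_gmul Dl_def)
  qed
next
  assume X: "\<forall>p. X p = Dl p (X 0)"
  have "X (p \<star> x) = frechet_derivative (gmul G p) (at x) (X x)" for p x
    unfolding frechet_gmul using X Dl_gmul by metis
  then show "X \<in> left_invariant_fields G" unfolding left_invariant_fields_def by blast
qed

lemma frame_eq: "frame G e i = (\<lambda>p. Dl p (e i))"
  unfolding frame_def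
proof (rule the_equality)
  show "(\<lambda>p. Dl p (e i)) \<in> left_invariant_fields G \<and> Dl 0 (e i) = e i"
    by (simp add: left_invariant_iff)
  fix X assume "X \<in> left_invariant_fields G \<and> X 0 = e i"
  then have X: "X p = Dl p (X 0)" and X0: "X 0 = e i" for p unfolding left_invariant_iff by blast+
  show "X = (\<lambda>p. Dl p (e i))" by (rule ext) (simp only: X[unfolded X0])
qed

text \<open>The frame at \<open>p\<close> is the image of the basis \<open>e\<close> under the
  isomorphism \<open>Dl p\<close>, so coordinates at \<open>p\<close> are scalar products after
  translation to 0.\<close>

lemma vec_coeffs_eq: "vec_coeffs G e p v = vec_mv e (Il p v)"
proof -
  let ?Q = "{1..DIM('a)}"
  let ?b = "\<lambda>k. Dl p (e k)"
  have inj: "inj_on ?b ?Q"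
  proof (rule inj_onI)
    fix i j assume ij: "i \<in> ?Q" "j \<in> ?Q" "Dl p (e i) = Dl p (e j)"
    then have "e i = e j" by (metis Il_Dl)
    then show "i = j" using inj_e ij by (auto dest: inj_onD)
  qed
  have ex: "w = (\<Sum>k\<in>?Q. (Il p w \<bullet> e k) *\<^sub>R ?b k)" for w
  proof -
    have "w = Dl p (\<Sum>k\<in>?Q. (Il p w \<bullet> e k) *\<^sub>R e k)" using expand[of "Il p w"] by simp
    then show ?thesis by (simp only: linear_sum[OF linear_Dl] linear_scale[OF linear_Dl])
  qed
  have sp: "w \<in> span (?b ` ?Q)" for w
    by (subst ex[of w]) (intro span_sum span_scale span_base imageI)
  have ind: "independent (?b ` ?Q)"
  proof (rule card_le_dim_spanning[of _ UNIV])
    show "card (?b ` ?Q) \<le> dim (UNIV :: 'a set)" using card_image_le[of ?Q ?b] by simp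
  qed (use sp in auto)
  have "representation (?b ` ?Q) v (?b i) = Il p v \<bullet> e i" if i: "i \<in> ?Q" for i
  proof -
    define f where "f b = (if b \<in> ?b ` ?Q then Il p v \<bullet> Il p b else 0)" for b
    have "representation (?b ` ?Q) v = f"
    proof (rule representation_eqI[OF ind sp])
      show "b \<in> ?b ` ?Q" if "f b \<noteq> 0" for b using that by (auto simp: f_def split: if_splits)
      show "finite {b. f b \<noteq> 0}" by (rule finite_subset[of _ "?b ` ?Q"]) (auto simp: f_def split: if_splits)
      have "(\<Sum>b | f b \<noteq> 0. f b *\<^sub>R b) = (\<Sum>b\<in>?b ` ?Q. f b *\<^sub>R b)"
        by (rule sum.mono_neutral_left) (auto simp: f_def split: if_splits)
      also have "\<dots> = (\<Sum>k\<in>?Q. f (?b k) *\<^sub>R ?b k)" by (rule sum.reindex_cong[OF inj refl refl])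
      also have "\<dots> = (\<Sum>k\<in>?Q. (Il p v \<bullet> e k) *\<^sub>R ?b k)" by (intro sum.cong refl) (simp add: f_def)
      also have "\<dots> = v" by (rule ex[symmetric])
      finally show "(\<Sum>b | f b \<noteq> 0. f b *\<^sub>R b) = v" .
    qed
    then show ?thesis using i by (simp add: f_def)
  qed
  then show ?thesis unfolding vec_coeffs_def frame_eq vec_mv_def by (intro ext sum.cong) auto
qed

lemma simple_multivector_eq: "simple_multivector G e p vs = wedge_list e (map (Il p) vs)"
proof -
  have "vec_coeffs G e p = vec_mv e \<circ> Il p" by (simp add: fun_eq_iff vec_coeffs_eq)
  then show ?thesis unfolding simple_multivector_def wedge_list_def by simp
qed

lemma degree_values_finite: "finite {M. degree_proj G M (wedge_list e vs) \<noteq> (\<lambda>I. 0)}"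
  and degree_values_bound: "degree_proj G M (wedge_list e vs) \<noteq> (\<lambda>I. 0) \<Longrightarrow> M \<le> sum deg {1..DIM('a)}"
proof -
  show bd: "M \<le> sum deg {1..DIM('a)}" if nz: "degree_proj G M (wedge_list e vs) \<noteq> (\<lambda>I. 0)" for M
  proof -
    obtain I where "degree_proj G M (wedge_list e vs) I \<noteq> 0" using nz by auto
    then have I: "sum deg I = M" "wedge_list e vs I \<noteq> 0" by (auto simp: degree_proj_def split: if_splits)
    then have "I \<subseteq> {1..DIM('a)}" using wedge_list_outside by metis
    then show ?thesis unfolding I(1)[symmetric] by (intro sum_mono2) auto
  qed
  show "finite {M. degree_proj G M (wedge_list e vs) \<noteq> (\<lambda>I. 0)}"
    by (rule finite_subset[of _ "{..sum deg {1..DIM('a)}}"]) (use bd in auto)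
qed

lemma pointwise_degree_le:
  assumes "p \<in> \<Sigma>" shows "pointwise_degree G e \<Sigma> p \<le> manifold_degree G e \<Sigma>"
proof -
  \<comment> \<open>\<open>Max {}\<close> is an unspecified number. Adding it to the bound makes the
    set of pointwise degrees finite without first excluding an empty set of degrees.\<close>
  let ?B = "insert (Max {}) {..sum deg {1..DIM('a)}}"
  have "pointwise_degree G e \<Sigma> q \<in> ?B" for q
  proof -
    let ?S = "{M. degree_proj G M (tangent_multivector G e \<Sigma> q) \<noteq> (\<lambda>I. 0)}"
    have fS: "finite ?S" unfolding tangent_multivector_def simple_multivector_eq by (rule degree_values_finite)
    show ?thesis
    proof (cases "?S = {}")
      case True
      then have "pointwise_degree G e \<Sigma> q = Max {}" unfolding pointwise_degree_def by (simp only:)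
      then show ?thesis by (simp only: insertI1)
    next
      case False
      have "Max ?S \<in> ?S" by (rule Max_in[OF fS False])
      then have "Max ?S \<le> sum deg {1..DIM('a)}"
        unfolding tangent_multivector_def simple_multivector_eq using degree_values_bound by blast
      then show ?thesis unfolding pointwise_degree_def by simp
    qed
  qed
  then have "pointwise_degree G e \<Sigma> ` \<Sigma> \<subseteq> ?B" by (rule image_subsetI)
  then have "finite (pointwise_degree G e \<Sigma> ` \<Sigma>)" by (rule finite_subset) simp
  then show ?thesis unfolding manifold_degree_def using assms by (intro Max_ge imageI)
qed

lemma tangent_multivector_high_degree:
  assumes p: "p \<in> \<Sigma>" and K: "manifold_degree G e \<Sigma> < sum deg K"
  shows "tangent_multivector G e \<Sigma> p K = 0"
proof (rule ccontr)
  assume nz: "tangent_multivector G e \<Sigma> p K \<noteq> 0"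
  let ?S = "{M. degree_proj G M (tangent_multivector G e \<Sigma> p) \<noteq> (\<lambda>I. 0)}"
  have fS: "finite ?S" unfolding tangent_multivector_def simple_multivector_eq by (rule degree_values_finite)
  have "degree_proj G (sum deg K) (tangent_multivector G e \<Sigma> p) K \<noteq> 0" using nz by (simp add: degree_proj_def)
  then have "sum deg K \<in> ?S" by (auto simp: fun_eq_iff)
  then have "sum deg K \<le> Max ?S" by (rule Max_ge[OF fS])
  then show False using pointwise_degree_le[OF p] K unfolding pointwise_degree_def by linarith
qed

end

section \<open>Jacobians and the intrinsic measure\<close>

locale group_chart = hom_group G e + chart \<Sigma> V \<Phi>
  for G :: "('a::euclidean_space) graded_group" and e and \<Sigma> :: "'a set"
    and V :: "(real ^ 'n::finite) set" and \<Phi> :: "real ^ 'n \<Rightarrow> 'a"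
begin

text \<open>The left Maurer-Cartan form pulled back by the chart.\<close>

definition \<Lambda> :: "real ^ 'n \<Rightarrow> real ^ 'n \<Rightarrow> 'a" where "\<Lambda> x v = Il (\<Phi> x) (D\<Phi> x v)"

lemma linear_Lam: "x \<in> V \<Longrightarrow> linear (\<Lambda> x)"
  unfolding \<Lambda>_def using linear_compose[OF linear_D linear_Il] by (simp add: o_def)

lemma Il_expand: "Il p v = (\<Sum>b\<in>Basis. (v \<bullet> b) *\<^sub>R Il p b)"
  using linear_sum[OF linear_Il, of p "\<lambda>b. (v \<bullet> b) *\<^sub>R b" Basis]
  by (simp only: euclidean_representation linear_scale[OF linear_Il])

lemma continuous_Lam: "continuous_on V (\<lambda>x. \<Lambda> x v)"
  unfolding \<Lambda>_def Il_expand[of "\<Phi> _" "D\<Phi> _ v"]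
  by (intro continuous_on_sum continuous_on_scaleR continuous_on_inner continuous_on_const continuous_deriv
      continuous_on_compose2[OF polynomial_function_continuous[OF Il_polynomial, of UNIV] continuous_chart]) auto

lemma tangent_list_basis:
  fixes L :: "real ^ 'n \<Rightarrow> real ^ 'n"
  assumes x: "x \<in> V" and B: "linear L" "inj L" and hs: "distinct hs" "set hs = (UNIV :: 'n set)"
  shows "basis_list (tangent_space \<Sigma> (\<Phi> x)) (map (\<lambda>i. D\<Phi> x (L (axis i 1))) hs)"
proof -
  let ?f = "\<lambda>v. D\<Phi> x (L v)" 
  have lf: "linear ?f" using linear_compose[OF B(1) linear_D[OF x]] by (simp add: o_def)
  have jf: "inj ?f" using inj_compose[OF inj_D[OF x] B(2)] by (simp add: o_def)
  have surjL: "surj L" using linear_injective_imp_surjective[OF B] by simp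
  have im: "set (map (\<lambda>i. ?f (axis i 1)) hs) = ?f ` range (\<lambda>i. axis i 1)" using hs(2) by auto
  have bas: "range (\<lambda>i::'n. axis i (1::real)) = Basis" by (auto simp: Basis_vec_def)
  have ij: "inj (\<lambda>i::'n. ?f (axis i 1))"
  proof (rule injI)
    fix i j :: 'n assume "?f (axis i 1) = ?f (axis j 1)"
    then have "axis i 1 = (axis j 1 :: real ^ 'n)" by (rule injD[OF jf])
    then show "i = j" by (simp add: axis_eq_axis)
  qed
  have "distinct (map (\<lambda>i. ?f (axis i 1)) hs)"
    using hs(1) inj_on_subset[OF ij subset_UNIV] by (simp add: distinct_map)
  moreover have "independent (?f ` (Basis :: (real ^ 'n) set))"
    by (rule linear_independent_injective_image[OF lf independent_Basis]) (use jf in \<open>auto simp: inj_on_def inj_def\<close>)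
  moreover have "span (?f ` (Basis :: (real ^ 'n) set)) = tangent_space \<Sigma> (\<Phi> x)"
  proof -
    have "span (?f ` (Basis :: (real ^ 'n) set)) = ?f ` span Basis" by (rule linear_span_image[OF lf])
    also have "\<dots> = range (D\<Phi> x)" using surjL by (metis image_image span_Basis)
    finally show ?thesis using tangent_space_eq[OF x] by simp
  qed
  ultimately show ?thesis unfolding basis_list_def im bas by blast
qed

lemma dim_tangent_space: "x \<in> V \<Longrightarrow> dim (tangent_space \<Sigma> (\<Phi> x)) = CARD('n)"
  unfolding tangent_space_eq using dim_image_eq[OF linear_D inj_on_subset[OF inj_D], of x UNIV]
  by (simp add: dim_UNIV)

lemma tangent_multivector_list:
  assumes x: "x \<in> V" and vs: "basis_list (tangent_space \<Sigma> (\<Phi> x)) vs"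
  shows "\<exists>c. c \<noteq> 0 \<and> tangent_multivector G e \<Sigma> (\<Phi> x) = (\<lambda>K. c * wedge_list e (map (Il (\<Phi> x)) vs) K)"
proof -
  let ?T = "tangent_space \<Sigma> (\<Phi> x)"
  define ws where "ws = (SOME vs. tangent_basis \<Sigma> (\<Phi> x) vs)"
  have tb: "tangent_basis \<Sigma> (\<Phi> x) us = basis_list ?T us" for us
    by (simp add: tangent_basis_def basis_list_def)
  have ws: "basis_list ?T ws" unfolding ws_def tb using someI[of "basis_list ?T", OF vs] .
  obtain c where c: "\<And>(e :: nat \<Rightarrow> 'a) L K. linear L \<Longrightarrow> wedge_list e (map L ws) K = c * wedge_list e (map L vs) K"
    "\<And>B. bilinear B \<Longrightarrow> gram_det {..<length ws} B ((!) ws) = c\<^sup>2 * gram_det {..<length vs} B ((!) vs)"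
    using basis_list_change[OF ws vs dim_tangent_space[OF x]] by blast
  have bi: "bilinear (\<lambda>x y :: 'a. x \<bullet> y)"
    using bilinear_conv_bounded_bilinear bounded_bilinear_inner by blast
  have "gram_det {..<length ws} (\<bullet>) ((!) ws) > 0"
    by (rule basis_list_gram_pos[OF bi _ _ ws dim_tangent_space[OF x]]) (auto simp: inner_commute)
  then have "c \<noteq> 0" using c(2)[OF bi] by auto
  moreover have "tangent_multivector G e \<Sigma> (\<Phi> x) = (\<lambda>K. c * wedge_list e (map (Il (\<Phi> x)) vs) K)"
    unfolding tangent_multivector_def ws_def[symmetric] simple_multivector_eq
    by (rule ext) (rule c(1)[OF linear_Il])
  ultimately show ?thesis by blast
qed

text \<open>The density of the intrinsic measure with respect to Lebesgue measure in the chart; it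
  does not involve the auxiliary metric.\<close>

definition jac :: "'n list \<Rightarrow> nat \<Rightarrow> real ^ 'n \<Rightarrow> real" where
  "jac hs N x = left_invariant_norm DIM('a) (degree_proj G N (wedge_list e (map (\<lambda>i. \<Lambda> x (axis i 1)) hs)))"

lemma continuous_wedge_list:
  assumes "\<And>i. i \<in> set hs \<Longrightarrow> continuous_on S (\<lambda>x. f i x)"
  shows "continuous_on S (\<lambda>x. wedge_list e (map (\<lambda>i. f i x) hs) K)"
  using assms
proof (induction hs arbitrary: K)
  case Nil
  then show ?case by (simp add: wedge_list_Nil)
next
  case (Cons h hs)
  show ?case
  proof (cases "finite K")
    case True
    show ?thesis unfolding list.map wedge_list_Cons vec_mv_wedge[OF True]
      using Cons by (intro continuous_intros) auto
  qed (simp add: wedge_list_infinite)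
qed

lemma continuous_jac: "continuous_on V (jac hs N)"
  unfolding jac_def[abs_def] left_invariant_norm_def degree_proj_def
proof (intro continuous_on_real_sqrt continuous_on_sum continuous_on_power)
  fix I
  show "continuous_on V (\<lambda>x. if sum deg I = N then wedge_list e (map (\<lambda>i. \<Lambda> x (axis i 1)) hs) I else 0)"
    by (cases "sum deg I = N") (auto intro: continuous_wedge_list continuous_Lam)
qed

definition volume_density :: "('a \<Rightarrow> 'a \<Rightarrow> 'a \<Rightarrow> real) \<Rightarrow> real ^ 'n \<Rightarrow> real" where
  "volume_density g x = sqrt (gram_det UNIV (g (\<Phi> x)) (\<lambda>i. D\<Phi> x (axis i 1)))"

text \<open>Normalizing the coordinate multivector by \<open>g\<close> divides it by the volume
  density. The Riemannian measure multiplies by the same density, so the two cancel.\<close>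

lemma unit_tangent_norm:
  assumes g: "riemannian_metric g" and x: "x \<in> V" and hs: "distinct hs" "set hs = (UNIV :: 'n set)"
  shows "volume_density g x > 0"
    and "left_invariant_norm DIM('a) (degree_proj G N (unit_tangent_multivector G e g \<Sigma> (\<Phi> x))) = jac hs N x / volume_density g x"
proof -
  let ?T = "tangent_space \<Sigma> (\<Phi> x)" and ?B = "g (\<Phi> x)"
  have B: "bilinear ?B" "\<And>v w. ?B v w = ?B w v" "\<And>v. v \<noteq> 0 \<Longrightarrow> ?B v v > 0"
    using g unfolding riemannian_metric_def by blast+
  let ?us = "map (\<lambda>i. D\<Phi> x (axis i 1)) hs"
  have us: "basis_list ?T ?us" using tangent_list_basis[OF x linear_id _ hs] by simp
  have "subspace ?T" using us unfolding basis_list_def by (metis subspace_span)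
  let ?P = "\<lambda>vs. tangent_basis \<Sigma> (\<Phi> x) vs \<and> sqrt (gram_det {..<length vs} ?B (\<lambda>i. vs ! i)) = 1"
  obtain ws0 where "basis_list ?T ws0" "gram_det {..<length ws0} ?B ((!) ws0) = 1"
    using orthonormal_basis_list[OF B \<open>subspace ?T\<close>] by blast
  then have "?P ws0" by (simp add: tangent_basis_def basis_list_def)
  define ws where "ws = (SOME vs. ?P vs)"
  have "?P ws" unfolding ws_def by (rule someI[of ?P, OF \<open>?P ws0\<close>])
  then have ws: "basis_list ?T ws" "gram_det {..<length ws} ?B ((!) ws) = 1"
    by (auto simp: tangent_basis_def basis_list_def)
  obtain c where c: "\<And>(e :: nat \<Rightarrow> 'a) L K. linear L \<Longrightarrow> wedge_list e (map L ws) K = c * wedge_list e (map L ?us) K"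
    "\<And>B. bilinear B \<Longrightarrow> gram_det {..<length ws} B ((!) ws) = c\<^sup>2 * gram_det {..<length ?us} B ((!) ?us)"
    using basis_list_change[OF ws(1) us dim_tangent_space[OF x]] by blast
  obtain h where h: "bij_betw h UNIV {..<CARD('n)}" "\<And>i. hs ! h i = i" "\<And>k. k < CARD('n) \<Longrightarrow> h (hs ! k) = k"
    "length hs = CARD('n)" by (rule enum_index[OF hs]) blast
  have hlt: "h i < length hs" for i using h(1,4) bij_betwE by fastforce
  have "gram_det {..<length ?us} ?B ((!) ?us) = gram_det UNIV ?B ((!) ?us \<circ> h)"
    using h(1,4) by (intro gram_det_reindex) simp
  also have "(!) ?us \<circ> h = (\<lambda>i. D\<Phi> x (axis i 1))" using hlt h(2) by (simp add: fun_eq_iff)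
  finally have gr: "gram_det {..<length ?us} ?B ((!) ?us) = gram_det UNIV ?B (\<lambda>i. D\<Phi> x (axis i 1))" .
  let ?\<gamma> = "gram_det UNIV ?B (\<lambda>i. D\<Phi> x (axis i 1))"
  have pos: "?\<gamma> > 0" using basis_list_gram_pos[OF B us dim_tangent_space[OF x]] gr by simp
  then show vp: "volume_density g x > 0" by (simp add: volume_density_def)
  have "c\<^sup>2 * ?\<gamma> = 1" using c(2)[OF B(1)] ws(2) gr by simp
  then have "\<bar>c\<bar> * volume_density g x = 1"
    unfolding volume_density_def by (metis real_sqrt_abs real_sqrt_mult real_sqrt_one)
  then have c1: "\<bar>c\<bar> = 1 / volume_density g x" using vp by (simp add: field_simps)
  have "unit_tangent_multivector G e g \<Sigma> (\<Phi> x) = (\<lambda>K. c * wedge_list e (map (\<lambda>i. \<Lambda> x (axis i 1)) hs) K)"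
  proof
    fix K
    have "unit_tangent_multivector G e g \<Sigma> (\<Phi> x) K = wedge_list e (map (Il (\<Phi> x)) ws) K"
      unfolding unit_tangent_multivector_def ws_def[symmetric] simple_multivector_eq ..
    also have "\<dots> = c * wedge_list e (map (Il (\<Phi> x)) ?us) K" by (rule c(1)[OF linear_Il])
    also have "map (Il (\<Phi> x)) ?us = map (\<lambda>i. \<Lambda> x (axis i 1)) hs" by (simp add: \<Lambda>_def)
    finally show "unit_tangent_multivector G e g \<Sigma> (\<Phi> x) K = c * wedge_list e (map (\<lambda>i. \<Lambda> x (axis i 1)) hs) K" .
  qed
  then show "left_invariant_norm DIM('a) (degree_proj G N (unit_tangent_multivector G e g \<Sigma> (\<Phi> x))) = jac hs N x / volume_density g x"
    unfolding jac_def by (simp add: degree_proj_scale left_invariant_norm_scale c1)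
qed

lemma continuous_volume_density:
  assumes g: "riemannian_metric g"
  shows "continuous_on V (volume_density g)"
proof -
  have B: "bilinear (g p)" for p using g unfolding riemannian_metric_def by blast
  have Ck: "Ck_on 0 UNIV (\<lambda>p. g p v w)" for v w using g unfolding riemannian_metric_def by blast
  then have cg: "continuous_on UNIV (\<lambda>p. g p v w)" for v w by simp
  have ex: "g p v w = (\<Sum>c\<in>Basis. (w \<bullet> c) * (\<Sum>b\<in>Basis. (v \<bullet> b) * g p b c))" for p v w
  proof -
    have l: "linear (g p v)" and r: "linear (\<lambda>v. g p v w)" for v w using B[of p] by (auto simp: bilinear_def)
    have "g p v w = (\<Sum>c\<in>Basis. (w \<bullet> c) * g p v c)"
      using linear_sum[OF l[of v], of "\<lambda>c. (w \<bullet> c) *\<^sub>R c" Basis]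
      by (simp only: euclidean_representation linear_scale[OF l[of v]] real_scaleR_def)
    moreover have "g p v c = (\<Sum>b\<in>Basis. (v \<bullet> b) * g p b c)" for c
      using linear_sum[OF r[of c], of "\<lambda>b. (v \<bullet> b) *\<^sub>R b" Basis]
      by (simp only: euclidean_representation linear_scale[OF r[of c]] real_scaleR_def)
    ultimately show ?thesis by simp
  qed
  have "continuous_on V (\<lambda>x. g (\<Phi> x) (D\<Phi> x v) (D\<Phi> x w))" for v w
    unfolding ex[of "\<Phi> _" "D\<Phi> _ v" "D\<Phi> _ w"]
    by (intro continuous_on_sum continuous_on_mult continuous_on_inner continuous_on_const continuous_deriv
        continuous_on_compose2[OF cg continuous_chart]) auto
  then show ?thesis unfolding volume_density_def[abs_def] gram_det_def
    by (intro continuous_on_real_sqrt continuous_on_sum continuous_on_mult continuous_on_prod continuous_on_const)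
qed

end

context hom_group
begin

lemma intrinsic_density_measurable:
  assumes S: "C1_submanifold TYPE('n::finite) \<Sigma>" "\<Sigma> \<noteq> {}" and g: "riemannian_metric g"
  shows "(\<lambda>p. if p \<in> \<Sigma> then left_invariant_norm DIM('a) (degree_proj G N (unit_tangent_multivector G e g \<Sigma> p)) else 0)
    \<in> borel_measurable borel"
proof (rule submanifold_borel_measurable[OF S])
  fix V :: "(real ^ 'n) set" and \<Phi> assume "chart \<Sigma> V \<Phi>"
  then interpret group_chart G e \<Sigma> V \<Phi> unfolding group_chart_def using hom_group_axioms by blast
  obtain hs :: "'n list" where hs: "distinct hs" "set hs = UNIV" using ex_enum by blast
  have "continuous_on V (\<lambda>x. jac hs N x / volume_density g x)"
    using unit_tangent_norm(1)[OF g _ hs]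
    by (intro continuous_on_divide continuous_jac continuous_volume_density[OF g]) force
  then show "continuous_on V (\<lambda>x. if \<Phi> x \<in> \<Sigma> then left_invariant_norm DIM('a)
      (degree_proj G N (unit_tangent_multivector G e g \<Sigma> (\<Phi> x))) else 0)"
    by (rule continuous_on_eq) (use unit_tangent_norm(2)[OF g _ hs] image_subset in auto)
qed auto

end

context group_chart
begin

text \<open>\<open>riemannian_measure\<close> prescribes \<open>\<sigma>\<close> only on Borel
  subsets of the chart image. There \<open>\<sigma>\<close> agrees with a push-forward of weighted
  Lebesgue measure; restricting both measures to the image by an indicator density makes them equal,
  and integrals can be transferred.\<close>

lemma emeasure_intrinsic:
  assumes S: "C1_submanifold TYPE('n) \<Sigma>" and g: "riemannian_metric g"
    and \<sigma>: "riemannian_measure TYPE('n) g \<Sigma> \<sigma>" and hs: "distinct hs" "set hs = (UNIV :: 'n set)"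
    and N: "manifold_degree G e \<Sigma> = N" and B: "B \<in> sets borel" "B \<subseteq> \<Phi> ` V" and ne: "\<Sigma> \<noteq> {}"
  shows "emeasure (intrinsic_measure G e g \<Sigma> \<sigma>) B = (\<integral>\<^sup>+ x \<in> V \<inter> \<Phi> -` B. ennreal (jac hs N x) \<partial>lborel)"
proof -
  define f where "f p = (if p \<in> \<Sigma> then left_invariant_norm DIM('a) (degree_proj G N (unit_tangent_multivector G e g \<Sigma> p)) else 0)" for p
  have fm: "f \<in> borel_measurable borel" unfolding f_def[abs_def] by (rule intrinsic_density_measurable[OF S ne g])
  have s\<sigma>: "sets \<sigma> = sets borel" using \<sigma> by (simp add: riemannian_measure_def)
  then have fm': "(\<lambda>p. ennreal (f p)) \<in> borel_measurable \<sigma>"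
    using fm by (simp cong: measurable_cong_sets)
  have im: "intrinsic_measure G e g \<Sigma> \<sigma> = density \<sigma> (\<lambda>p. ennreal (f p))"
    unfolding intrinsic_measure_def N f_def by (rule arg_cong[of _ _ "density \<sigma>"]) auto
  have Bs: "B \<in> sets \<sigma>" using B s\<sigma> by simp
  have e1: "emeasure (intrinsic_measure G e g \<Sigma> \<sigma>) B = (\<integral>\<^sup>+ p. ennreal (f p) * indicator B p \<partial>\<sigma>)"
    unfolding im by (rule emeasure_density[OF fm' Bs])
  define U where "U = \<Phi> ` V"
  have U: "U \<in> sets borel" unfolding U_def by (rule image_borel)
  have Us: "U \<in> sets \<sigma>" using U s\<sigma> by simp
  define vd where "vd x = ennreal (volume_density g x) * indicator V x" for x
  have Vm: "V \<in> sets borel" using open_V by simp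
  have cm: "h \<in> borel_measurable borel" if "continuous_on V h'" "h = (\<lambda>x. indicator V x *\<^sub>R h' x)"
    for h h' :: "real ^ 'n \<Rightarrow> 'b::{second_countable_topology, real_normed_vector}"
    unfolding that(2) by (rule borel_measurable_continuous_on_indicator[OF Vm that(1)])
  have vdm: "vd \<in> borel_measurable lborel"
  proof -
    have "(\<lambda>x. indicator V x *\<^sub>R volume_density g x) \<in> borel_measurable borel"
      by (rule cm[OF continuous_volume_density[OF g] refl])
    then have "(\<lambda>x. ennreal (indicator V x *\<^sub>R volume_density g x)) \<in> borel_measurable lborel" by simp
    moreover have "vd = (\<lambda>x. ennreal (indicator V x *\<^sub>R volume_density g x))"
      by (auto simp: vd_def fun_eq_iff indicator_def)
    ultimately show ?thesis by simp
  qed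
  \<comment> \<open>Extension by 0 makes the chart a Borel map on the whole space.\<close>
  define \<Phi>' where "\<Phi>' x = indicator V x *\<^sub>R \<Phi> x" for x
  have Pm: "\<Phi>' \<in> borel_measurable borel" unfolding \<Phi>'_def[abs_def] by (rule cm[OF continuous_chart refl])
  have P: "\<Phi>' x = \<Phi> x" if "x \<in> V" for x using that by (simp add: \<Phi>'_def)
  define \<nu> where "\<nu> = distr (density lborel vd) borel \<Phi>'"
  have Pm': "\<Phi>' \<in> measurable (density lborel vd) borel" using Pm by simp
  have nu: "emeasure \<nu> A = emeasure \<sigma> A" if A: "A \<in> sets borel" "A \<subseteq> U" for A
  proof -
    have Am: "\<Phi>' -` A \<in> sets lborel" using measurable_sets[OF Pm A(1)] by simp
    have "emeasure \<nu> A = (\<integral>\<^sup>+ x. vd x * indicator (\<Phi>' -` A) x \<partial>lborel)"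
      unfolding \<nu>_def using A(1) Am by (subst emeasure_distr[OF Pm']) (auto simp: emeasure_density[OF vdm])
    also have "\<dots> = (\<integral>\<^sup>+ x \<in> V \<inter> \<Phi> -` A. ennreal (volume_density g x) \<partial>lborel)"
      by (intro nn_integral_cong) (auto simp: vd_def indicator_def P)
    also have "\<dots> = emeasure \<sigma> A"
      using \<sigma> A param unfolding riemannian_measure_def volume_density_def U_def by auto
    finally show ?thesis .
  qed
  have dens: "density \<sigma> (indicator U) = density \<nu> (indicator U)"
  proof (rule measure_eqI)
    show "sets (density \<sigma> (indicator U)) = sets (density \<nu> (indicator U))" by (simp add: s\<sigma> \<nu>_def)
    fix A assume "A \<in> sets (density \<sigma> (indicator U))"
    then have A: "A \<in> sets borel" by (simp add: s\<sigma>)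
    have "emeasure (density \<sigma> (indicator U)) A = emeasure \<sigma> (U \<inter> A)"
      using A Us s\<sigma> by (intro emeasure_restricted) auto
    moreover have "emeasure (density \<nu> (indicator U)) A = emeasure \<nu> (U \<inter> A)"
      using A U by (intro emeasure_restricted) (auto simp: \<nu>_def)
    ultimately show "emeasure (density \<sigma> (indicator U)) A = emeasure (density \<nu> (indicator U)) A"
      using nu[of "U \<inter> A"] A U by simp
  qed
  have mB: "(\<lambda>p. ennreal (f p) * indicator B p) \<in> borel_measurable borel" using fm B(1) by measurable
  have "(\<integral>\<^sup>+ p. ennreal (f p) * indicator B p \<partial>\<sigma>) = (\<integral>\<^sup>+ p. indicator U p * (ennreal (f p) * indicator B p) \<partial>\<sigma>)"
    using B(2) by (intro nn_integral_cong) (auto simp: indicator_def U_def)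
  also have "\<dots> = (\<integral>\<^sup>+ p. ennreal (f p) * indicator B p \<partial>density \<sigma> (indicator U))"
    using Us mB s\<sigma> by (intro nn_integral_density[symmetric]) (auto cong: measurable_cong_sets)
  also have "\<dots> = (\<integral>\<^sup>+ p. indicator U p * (ennreal (f p) * indicator B p) \<partial>\<nu>)"
    unfolding dens using U mB by (intro nn_integral_density) (auto simp: \<nu>_def)
  also have "\<dots> = (\<integral>\<^sup>+ x. indicator U (\<Phi>' x) * (ennreal (f (\<Phi>' x)) * indicator B (\<Phi>' x)) \<partial>density lborel vd)"
    unfolding \<nu>_def using U mB by (intro nn_integral_distr[OF Pm']) auto
  also have "\<dots> = (\<integral>\<^sup>+ x. vd x * (indicator U (\<Phi>' x) * (ennreal (f (\<Phi>' x)) * indicator B (\<Phi>' x))) \<partial>lborel)"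
  proof (rule nn_integral_density[OF vdm])
    have "(\<lambda>p. indicator U p * (ennreal (f p) * indicator B p)) \<in> borel_measurable borel" using U mB by measurable
    from measurable_compose[OF Pm this]
    show "(\<lambda>x. indicator U (\<Phi>' x) * (ennreal (f (\<Phi>' x)) * indicator B (\<Phi>' x))) \<in> borel_measurable lborel" by simp
  qed
  also have "\<dots> = (\<integral>\<^sup>+ x \<in> V \<inter> \<Phi> -` B. ennreal (jac hs N x) \<partial>lborel)"
  proof (intro nn_integral_cong)
    fix x
    show "vd x * (indicator U (\<Phi>' x) * (ennreal (f (\<Phi>' x)) * indicator B (\<Phi>' x))) = ennreal (jac hs N x) * indicator (V \<inter> \<Phi> -` B) x"
    proof (cases "x \<in> V \<and> \<Phi> x \<in> B")
      case True
      then have x: "x \<in> V" "\<Phi> x \<in> U" "\<Phi> x \<in> \<Sigma>" using image_subset by (auto simp: U_def)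
      note u = unit_tangent_norm(1)[OF g x(1) hs] unit_tangent_norm(2)[OF g x(1) hs, of N]
      have jn: "jac hs N x \<ge> 0" by (simp add: jac_def left_invariant_norm_def sum_nonneg)
      have "ennreal (volume_density g x) * ennreal (jac hs N x / volume_density g x) = ennreal (jac hs N x)"
        using u(1) jn by (subst ennreal_mult[symmetric]) auto
      then show ?thesis using True x u(2) by (simp add: vd_def P f_def)
    qed (auto simp: vd_def indicator_def P)
  qed
  finally show ?thesis using e1 by simp
qed

end

subsection \<open>Blow-up at a point of maximum degree\<close>

text \<open>The inverse function theorem describes the derivative of the inverse as an inverse
  operator; this provides its continuity, needed for the new chart to be C1.\<close>

lemma continuous_on_inverse_apply:
  fixes A :: "'b::metric_space \<Rightarrow> 'c::euclidean_space \<Rightarrow>\<^sub>L 'c"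
  assumes A: "continuous_on S A" and bij: "\<And>y. y \<in> S \<Longrightarrow> bij (blinfun_apply (A y))"
  shows "continuous_on S (\<lambda>y. inv (blinfun_apply (A y)) v)"
  unfolding continuous_on_iff
proof (intro ballI allI impI)
  fix y0 and \<epsilon> :: real assume y0: "y0 \<in> S" and e: "\<epsilon> > 0"
  have lin: "linear (blinfun_apply (A y0))" by (rule bounded_linear.linear[OF blinfun.bounded_linear_right])
  obtain b where b: "b > 0" "\<And>h. b * norm h \<le> norm (A y0 h)"
    using linear_inj_bounded_below_pos[OF lin bij_is_inj[OF bij[OF y0]]] by metis
  define u where "u = inv (blinfun_apply (A y0)) v"
  have Au: "A y0 u = v" unfolding u_def by (rule surj_f_inv_f[OF bij_is_surj[OF bij[OF y0]]])
  define nu where "nu = norm u + 1"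
  have nu: "nu > 0" using norm_ge_zero[of u] unfolding nu_def by linarith
  \<comment> \<open>The bound \<open>b / 2\<close> absorbs the error applied to
    \<open>z - u\<close>, and the second one leaves
    \<open>norm (z - u) \<le> \<epsilon> / 2\<close>.\<close>
  define \<eta> where "\<eta> = min (b / 2) (\<epsilon> * b / (4 * nu))"
  have eta: "\<eta> > 0" using b e nu by (simp add: \<eta>_def)
  have eta_le: "\<eta> \<le> b / 2" "\<eta> \<le> \<epsilon> * b / (4 * nu)"
    unfolding \<eta>_def by (rule min.cobounded1, rule min.cobounded2)
  obtain d where d: "d > 0" "\<And>y. y \<in> S \<Longrightarrow> dist y y0 < d \<Longrightarrow> dist (A y) (A y0) < \<eta>"
    using A y0 eta unfolding continuous_on_iff by blast
  show "\<exists>d>0. \<forall>y\<in>S. dist y y0 < d \<longrightarrow> dist (inv (blinfun_apply (A y)) v) (inv (blinfun_apply (A y0)) v) < \<epsilon>"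
  proof (intro exI[of _ d] conjI ballI impI d(1))
    fix y assume y: "y \<in> S" "dist y y0 < d"
    define z where "z = inv (blinfun_apply (A y)) v"
    have Az: "A y z = v" unfolding z_def by (rule surj_f_inv_f[OF bij_is_surj[OF bij[OF y(1)]]])
    have nA: "norm (A y - A y0) \<le> \<eta>" using d(2)[OF y] by (simp add: dist_norm)
    have near: "norm (A y h - A y0 h) \<le> \<eta> * norm h" for h
    proof -
      have "norm ((A y - A y0) h) \<le> norm (A y - A y0) * norm h" by (rule norm_blinfun)
      also have "\<dots> \<le> \<eta> * norm h" using nA by (intro mult_right_mono) auto
      finally show ?thesis by (simp add: blinfun.diff_left)
    qed
    have "A y (z - u) = A y0 u - A y u" using Az Au by (simp add: blinfun.diff_right)
    then have 1: "norm (A y (z - u)) \<le> \<eta> * norm u" using near[of u] by (simp add: norm_minus_commute)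
    have "b * norm (z - u) \<le> norm (A y0 (z - u))" by (rule b(2))
    also have "\<dots> \<le> norm (A y (z - u)) + norm (A y (z - u) - A y0 (z - u))"
      using norm_triangle_ineq4[of "A y (z - u)" "A y (z - u) - A y0 (z - u)"] by simp
    also have "\<dots> \<le> \<eta> * norm u + \<eta> * norm (z - u)" using 1 near[of "z - u"] by linarith
    also have "\<dots> \<le> \<eta> * norm u + b / 2 * norm (z - u)"
      by (intro add_left_mono mult_right_mono eta_le norm_ge_zero)
    finally have "b / 2 * norm (z - u) \<le> \<eta> * norm u" by simp
    also have "\<dots> \<le> (\<epsilon> * b / (4 * nu)) * nu"
      using eta eta_le(2) e b nu by (intro mult_mono) (auto simp: nu_def)
    also have "\<dots> = \<epsilon> * b / 4" using nu by simp
    finally have "b * (2 * norm (z - u)) \<le> b * \<epsilon>" by (simp add: algebra_simps)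
    then have "2 * norm (z - u) \<le> \<epsilon>" using b(1) by (simp only: mult_le_cancel_left_pos)
    then show "dist (inv (blinfun_apply (A y)) v) (inv (blinfun_apply (A y0)) v) < \<epsilon>"
      using e unfolding z_def[symmetric] u_def[symmetric] dist_norm by linarith
  qed
qed

context adapted_basis
begin

lemma ax_nonzero: "ax i \<noteq> 0"
  using ax_orthonormal[of i i] by auto

lemma k_bounds: "k i \<in> {1..step G}"
  using layer_trivial[of "k i"] ax_layer[of i] ax_nonzero[of i] by blast

lemma ax_coord: "l \<in> {1..DIM('a)} \<Longrightarrow> deg l \<noteq> k i \<Longrightarrow> ax i \<bullet> e l = 0"
  by (rule layer_coords[OF ax_layer])

lemma norm_dn_le:
  assumes "0 \<le> s" "s \<le> 1" shows "norm (dn s w) \<le> s * norm w"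
proof -
  have "norm (dn s w) \<le> norm (s *\<^sub>R w)"
  proof (rule norm_le_componentwise_cart)
    fix i
    have "s ^ k i \<le> s ^ 1" using assms k_bounds[of i] by (intro power_decreasing) auto
    then show "norm (dn s w $ i) \<le> norm ((s *\<^sub>R w) $ i)"
      using assms by (simp add: dn_def abs_mult mult_right_mono)
  qed
  then show ?thesis using assms by simp
qed

lemma dn_dn: "dn r (dn s w) = dn (r * s) w"
  by (simp add: dn_def vec_eq_iff power_mult_distrib mult.assoc)

lemma dn_one [simp]: "dn 1 w = w"
  by (simp add: dn_def vec_eq_iff)

text \<open>The hypotheses \<open>mhigh\<close>, \<open>mtop\<close> and \<open>mbd\<close> treat
  the components of \<open>m i\<close> for which the rescaling factor
  \<open>s ^ k i * (1 / s) ^ deg l\<close> has a negative, zero or positive exponent. Together they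
  make the dilated rays almost tangent to the span of the \<open>ax i\<close>.\<close>

lemma blowup_graph:
  assumes W: "open W" "0 \<in> W" and Y0: "Y 0 = 0" and prY: "\<And>w. w \<in> W \<Longrightarrow> pr (Y w) = w"
    and DY: "\<And>w. w \<in> W \<Longrightarrow> (Y has_derivative (\<lambda>h. Dl (Y w) (Lm w h))) (at w)"
    and dec: "\<And>w h. w \<in> W \<Longrightarrow> Lm w h = (\<Sum>i\<in>UNIV. pr (Lm w h) $ i *\<^sub>R (ax i + m i w))"
    and mhigh: "\<And>w i l. w \<in> W \<Longrightarrow> l \<in> {1..DIM('a)} \<Longrightarrow> k i < deg l \<Longrightarrow> m i w \<bullet> e l = 0"
    and mtop: "\<And>\<epsilon>. \<epsilon> > 0 \<Longrightarrow> \<exists>\<delta>>0. \<forall>w\<in>W. norm w < \<delta> \<longrightarrow> (\<forall>i. \<forall>l\<in>{1..DIM('a)}. deg l = k i \<longrightarrow> \<bar>m i w \<bullet> e l\<bar> \<le> \<epsilon>)"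
    and mbd: "\<And>w i. w \<in> W \<Longrightarrow> norm (m i w) \<le> B"
    and R: "R > 0" and eta: "\<eta> > 0"
  shows "\<exists>s0>0. \<forall>s. 0 < s \<and> s < s0 \<longrightarrow> (\<forall>w. norm w \<le> R \<longrightarrow>
      dn s w \<in> W \<and> norm (dl (1 / s) (Y (dn s w)) - emb w) \<le> \<eta>)"
proof -
  let ?Q = "{1..DIM('a)}"
  obtain \<epsilon> where eps: "\<epsilon> > 0" "\<And>f \<xi> w. norm w \<le> R \<Longrightarrow> f 0 = 0 \<Longrightarrow>
    (\<forall>t\<in>{0..1}. (f has_vector_derivative Dl (f t) (\<xi> t)) (at t within {0..1})) \<Longrightarrow>
    (\<forall>t\<in>{0..1}. pr (f t) = t *\<^sub>R w) \<Longrightarrow>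
    (\<forall>t\<in>{0..1}. norm (\<xi> t - emb (pr (\<xi> t))) \<le> \<epsilon> * norm (pr (\<xi> t))) \<Longrightarrow>
    (\<forall>t\<in>{0..1::real}. norm (f t - t *\<^sub>R emb w) \<le> \<eta>)"
    using almost_tangent_curve[OF R eta] by metis
  define n where "n = real (CARD('n) * DIM('a))"
  have n: "n > 0" by (simp add: n_def)
  \<comment> \<open>The total error is a sum over the \<open>CARD('n)\<close> vectors and their
    \<open>DIM('a)\<close> components.\<close>
  define \<epsilon>1 where "\<epsilon>1 = \<epsilon> / n"
  have e1: "\<epsilon>1 > 0" using eps n by (simp add: \<epsilon>1_def)
  obtain \<delta> where delta: "\<delta> > 0" "\<And>w i l. w \<in> W \<Longrightarrow> norm w < \<delta> \<Longrightarrow> l \<in> ?Q \<Longrightarrow> deg l = k i \<Longrightarrow> \<bar>m i w \<bullet> e l\<bar> \<le> \<epsilon>1"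
    using mtop[OF e1] by blast
  obtain r where r: "r > 0" "ball 0 r \<subseteq> W" using W openE by blast
  have B0: "B \<ge> 0" using mbd[OF W(2), of undefined] norm_ge_zero[of "m undefined 0"] by linarith
  \<comment> \<open>The bound by \<open>\<epsilon>1 / (B + 1)\<close> damps the components of low
    degree; the bound by \<open>min \<delta> r / (R + 1)\<close> keeps the dilated rays where
    \<open>mtop\<close> applies.\<close>
  define s0 where "s0 = min (min 1 (\<epsilon>1 / (B + 1))) (min \<delta> r / (R + 1))"
  have s0: "s0 > 0" "s0 \<le> 1" "s0 \<le> \<epsilon>1 / (B + 1)" "s0 \<le> min \<delta> r / (R + 1)"
    using e1 B0 delta(1) r(1) R by (auto simp: s0_def)
  have small: "norm (s ^ k i *\<^sub>R dl (1 / s) (m i w)) \<le> DIM('a) * \<epsilon>1"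
    if s: "0 < s" "s < s0" and w: "w \<in> W" "norm w < \<delta>" for s w i
  proof -
    have s1: "s \<le> 1" using s s0 by linarith
    have c: "\<bar>s ^ k i * (1 / s) ^ deg l * (m i w \<bullet> e l)\<bar> \<le> \<epsilon>1" if l: "l \<in> ?Q" for l
    proof -
      consider "k i < deg l" | "deg l = k i" | "deg l < k i" by linarith
      then show ?thesis
      proof cases
        case 1
        then show ?thesis using mhigh[OF w(1) l 1] e1 by simp
      next
        case 2
        then show ?thesis using delta(2)[OF w l 2] s by (simp add: power_one_over)
      next
        case 3
        then have "s ^ k i = s ^ deg l * s ^ (k i - deg l)" by (simp add: power_add[symmetric])
        then have eq: "s ^ k i * (1 / s) ^ deg l = s ^ (k i - deg l)" using s by (simp add: power_one_over)
        have "s ^ (k i - deg l) \<le> s ^ 1" using s s1 3 by (intro power_decreasing) auto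
        moreover have "\<bar>m i w \<bullet> e l\<bar> \<le> B"
        proof -
          have "norm (e l) = 1" using orthonormal[OF l l] by (simp add: norm_eq_1)
          then show ?thesis using Cauchy_Schwarz_ineq2[of "m i w" "e l"] mbd[OF w(1), of i] by simp
        qed
        ultimately have "s ^ (k i - deg l) * \<bar>m i w \<bullet> e l\<bar> \<le> s * B" using s by (intro mult_mono) auto
        also have "\<dots> \<le> (\<epsilon>1 / (B + 1)) * (B + 1)" using s s0(3) B0 e1 by (intro mult_mono) auto
        also have "\<dots> = \<epsilon>1" using B0 by simp
        finally show ?thesis unfolding eq using s by (simp add: abs_mult)
      qed
    qed
    have ex: "s ^ k i *\<^sub>R dl (1 / s) (m i w) = (\<Sum>l\<in>?Q. (s ^ k i * (1 / s) ^ deg l * (m i w \<bullet> e l)) *\<^sub>R e l)"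
      unfolding dl_def scaleR_right.sum by (simp add: mult.assoc)
    have "norm (s ^ k i *\<^sub>R dl (1 / s) (m i w)) \<le> (\<Sum>l\<in>?Q. norm ((s ^ k i * (1 / s) ^ deg l * (m i w \<bullet> e l)) *\<^sub>R e l))"
      unfolding ex by (rule norm_sum)
    also have "\<dots> \<le> (\<Sum>l\<in>?Q. \<epsilon>1)"
    proof (rule sum_mono)
      fix l assume l: "l \<in> ?Q"
      have "norm (e l) = 1" using orthonormal[OF l l] by (simp add: norm_eq_1)
      then show "norm ((s ^ k i * (1 / s) ^ deg l * (m i w \<bullet> e l)) *\<^sub>R e l) \<le> \<epsilon>1" using c[OF l] by simp
    qed
    finally show ?thesis by simp
  qed
  show ?thesis
  proof (intro exI[of _ s0] conjI allI impI s0(1))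
    fix s and w :: "real ^ 'n" assume s: "0 < s \<and> s < s0" and w: "norm w \<le> R"
    have s1: "s \<le> 1" using s s0 by linarith
    have nd: "norm (dn s (t *\<^sub>R w)) < min \<delta> r" if t: "t \<in> {0..1}" for t
    proof -
      have "norm (dn s (t *\<^sub>R w)) \<le> s * norm (t *\<^sub>R w)" using s s1 by (intro norm_dn_le) auto
      also have "\<dots> \<le> s * (1 * R)"
      proof (rule mult_left_mono)
        have "\<bar>t\<bar> * norm w \<le> 1 * R" by (rule mult_mono) (use t w R in auto)
        then show "norm (t *\<^sub>R w) \<le> 1 * R" by simp
      qed (use s in simp)
      also have "\<dots> < s * (R + 1)" using s by simp
      also have "\<dots> \<le> (min \<delta> r / (R + 1)) * (R + 1)" using s s0(4) R by (intro mult_right_mono) auto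
      also have "\<dots> = min \<delta> r" using R by simp
      finally show ?thesis .
    qed
    have inW: "dn s (t *\<^sub>R w) \<in> W" if "t \<in> {0..1}" for t
      using nd[OF that] r(2) by (auto simp: subset_iff)
    show "dn s w \<in> W" using inW[of 1] by simp
    define f where "f t = dl (1 / s) (Y (dn s (t *\<^sub>R w)))" for t
    \<comment> \<open>The left translated velocity of \<open>f\<close>, by the chain rule and
      \<open>Dl_dl\<close>.\<close>
    define \<xi> where "\<xi> t = dl (1 / s) (Lm (dn s (t *\<^sub>R w)) (dn s w))" for t
    have "\<forall>t\<in>{0..1::real}. norm (f t - t *\<^sub>R emb w) \<le> \<eta>"
    proof (rule eps(2)[OF w, of f \<xi>])
      show "f 0 = 0" by (simp add: f_def linear_0[OF linear_dn] Y0)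
      show "\<forall>t\<in>{0..1}. (f has_vector_derivative Dl (f t) (\<xi> t)) (at t within {0..1})"
      proof
        fix t :: real assume t: "t \<in> {0..1}"
        have bld: "bounded_linear (dl (1 / s))" using linear_dl by (simp only: linear_conv_bounded_linear)
        have bdn: "bounded_linear (dn s)" using linear_dn by (simp only: linear_conv_bounded_linear)
        have "((\<lambda>t. t *\<^sub>R w) has_derivative (\<lambda>h. h *\<^sub>R w)) (at t)" by (auto intro!: derivative_eq_intros)
        from bounded_linear.has_derivative[OF bdn this]
        have "((\<lambda>t. dn s (t *\<^sub>R w)) has_derivative (\<lambda>h. dn s (h *\<^sub>R w))) (at t)" .
        from has_derivative_compose[OF this DY[OF inW[OF t]]]
        have "((\<lambda>t. Y (dn s (t *\<^sub>R w))) has_derivative (\<lambda>h. Dl (Y (dn s (t *\<^sub>R w))) (Lm (dn s (t *\<^sub>R w)) (dn s (h *\<^sub>R w))))) (at t)" .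
        from bounded_linear.has_derivative[OF bld this]
        have fd: "(f has_derivative (\<lambda>h. dl (1 / s) (Dl (Y (dn s (t *\<^sub>R w))) (Lm (dn s (t *\<^sub>R w)) (dn s (h *\<^sub>R w)))))) (at t)"
          unfolding f_def[abs_def] .
        have "(f has_vector_derivative (dl (1 / s) (Dl (Y (dn s (t *\<^sub>R w))) (Lm (dn s (t *\<^sub>R w)) (dn s (1 *\<^sub>R w)))))) (at t)"
        proof -
          have lf: "linear (\<lambda>h. dl (1 / s) (Dl (Y (dn s (t *\<^sub>R w))) (Lm (dn s (t *\<^sub>R w)) (dn s (h *\<^sub>R w)))))"
            by (rule has_derivative_linear[OF fd])
          have "(\<lambda>h. dl (1 / s) (Dl (Y (dn s (t *\<^sub>R w))) (Lm (dn s (t *\<^sub>R w)) (dn s (h *\<^sub>R w))))) =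
             (\<lambda>h. h *\<^sub>R dl (1 / s) (Dl (Y (dn s (t *\<^sub>R w))) (Lm (dn s (t *\<^sub>R w)) (dn s (1 *\<^sub>R w)))))"
            using linear_scale[OF lf, of _ 1] by (simp add: fun_eq_iff)
          then show ?thesis using fd unfolding has_vector_derivative_def by simp
        qed
        then show "(f has_vector_derivative Dl (f t) (\<xi> t)) (at t within {0..1})"
          unfolding f_def \<xi>_def Dl_dl by (simp add: has_vector_derivative_at_within)
      qed
      show "\<forall>t\<in>{0..1}. pr (f t) = t *\<^sub>R w"
        using s by (auto simp: f_def pr_dl prY[OF inW] dn_dn)
      show "\<forall>t\<in>{0..1}. norm (\<xi> t - emb (pr (\<xi> t))) \<le> \<epsilon> * norm (pr (\<xi> t))"
      proof
        fix t :: real assume t: "t \<in> {0..1}"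
        let ?w = "dn s (t *\<^sub>R w)"
        have wW: "?w \<in> W" "norm ?w < \<delta>" using inW[OF t] nd[OF t] by auto
        define c where "c = pr (Lm ?w (dn s w))"
        have pc: "pr (\<xi> t) = dn (1 / s) c" by (simp add: \<xi>_def pr_dl c_def)
        have "\<xi> t = (\<Sum>i\<in>UNIV. c $ i *\<^sub>R dl (1 / s) (ax i + m i ?w))"
          unfolding \<xi>_def c_def by (subst dec[OF wW(1)]) (simp only: linear_sum[OF linear_dl] linear_scale[OF linear_dl])
        also have "\<dots> = (\<Sum>i\<in>UNIV. c $ i *\<^sub>R dl (1 / s) (ax i)) + (\<Sum>i\<in>UNIV. c $ i *\<^sub>R dl (1 / s) (m i ?w))"
          by (simp only: linear_add[OF linear_dl] scaleR_add_right sum.distrib)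
        also have "(\<Sum>i\<in>UNIV. c $ i *\<^sub>R dl (1 / s) (ax i)) = emb (pr (\<xi> t))"
          unfolding pc emb_def by (intro sum.cong refl) (simp add: dl_layer[OF ax_layer] dn_def)
        finally have split: "\<xi> t = emb (pr (\<xi> t)) + (\<Sum>i\<in>UNIV. c $ i *\<^sub>R dl (1 / s) (m i ?w))" .
        have "\<xi> t - emb (pr (\<xi> t)) = (\<Sum>i\<in>UNIV. c $ i *\<^sub>R dl (1 / s) (m i ?w))"
          by (rule diff_eq_eq[THEN iffD2, OF trans[OF split add.commute]])
        \<comment> \<open>The coordinates of \<open>c\<close> are \<open>s ^ k i\<close> times those
          of \<open>pr (\<xi> t)\<close>; this is the factor that balances \<open>dl (1 / s)\<close>
          in \<open>small\<close>.\<close>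
        also have "\<dots> = (\<Sum>i\<in>UNIV. (pr (\<xi> t)) $ i *\<^sub>R (s ^ k i *\<^sub>R dl (1 / s) (m i ?w)))"
          unfolding pc by (intro sum.cong refl) (use s in \<open>simp add: dn_def power_one_over\<close>)
        finally have eq: "\<xi> t - emb (pr (\<xi> t)) = (\<Sum>i\<in>UNIV. (pr (\<xi> t)) $ i *\<^sub>R (s ^ k i *\<^sub>R dl (1 / s) (m i ?w)))" .
        have "norm (\<xi> t - emb (pr (\<xi> t))) \<le> (\<Sum>i\<in>UNIV. norm ((pr (\<xi> t)) $ i *\<^sub>R (s ^ k i *\<^sub>R dl (1 / s) (m i ?w))))"
          by (rule ord_eq_le_trans[OF arg_cong[OF eq, of norm] norm_sum])
        also have "\<dots> \<le> (\<Sum>i\<in>(UNIV::'n set). norm (pr (\<xi> t)) * (DIM('a) * \<epsilon>1))"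
        proof (rule sum_mono)
          fix i
          have "\<bar>pr (\<xi> t) $ i\<bar> * norm (s ^ k i *\<^sub>R dl (1 / s) (m i ?w)) \<le> norm (pr (\<xi> t)) * (DIM('a) * \<epsilon>1)"
            using small[of s ?w i] s wW by (intro mult_mono component_le_norm_cart) auto
          then show "norm ((pr (\<xi> t)) $ i *\<^sub>R (s ^ k i *\<^sub>R dl (1 / s) (m i ?w))) \<le> norm (pr (\<xi> t)) * (DIM('a) * \<epsilon>1)"
            by (simp only: norm_scaleR real_norm_def)
        qed
        also have "\<dots> = \<epsilon> * norm (pr (\<xi> t))" using n by (simp add: \<epsilon>1_def n_def)
        finally show "norm (\<xi> t - emb (pr (\<xi> t))) \<le> \<epsilon> * norm (pr (\<xi> t))" .
      qed
    qed
    then have "norm (f 1 - 1 *\<^sub>R emb w) \<le> \<eta>" by (rule bspec) simp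
    then show "norm (dl (1 / s) (Y (dn s w)) - emb w) \<le> \<eta>" by (simp add: f_def)
  qed
qed

text \<open>The component of \<open>v i\<close> along \<open>b\<close> is the coefficient of the wedge product of the \<open>v j\<close>
  obtained by replacing \<open>ax i\<close> by \<open>b\<close>; its degree is \<open>(\<Sum>j. k j) - k i + j\<close> for \<open>b\<close> in layer \<open>j\<close>.\<close>

lemma coefficient_replace:
  fixes rest :: "'n list"
  assumes v: "\<And>i j. v i \<bullet> ax j = (if i = j then 1 else 0)" and d: "distinct (i # rest)"
  shows "mv_inner DIM('a) (wedge_list e (map v (i # rest))) (wedge_list e (b # map ax rest)) = v i \<bullet> b"
proof -
  have "mv_inner DIM('a) (wedge_list e (v i # map v rest)) (wedge_list e (b # map ax rest)) =
      (v i \<bullet> b) * mv_inner DIM('a) (wedge_list e (map v rest)) (wedge_list e (map ax rest))"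
    by (rule mv_inner_wedge_list_Cons) (use v d in auto)
  also have "mv_inner DIM('a) (wedge_list e (map v rest)) (wedge_list e (map ax rest)) = 1"
    by (rule mv_inner_dual) (use v d in auto)
  finally show ?thesis by simp
qed

text \<open>A wedge product of homogeneous vectors lives in a single degree:
  \<open>wedge_list_top_degree\<close> is applied with each vector as its own leading part. The
  option type gives the extra vector \<open>b\<close> the index \<open>None\<close>.\<close>

lemma replaced_degree:
  assumes b: "b \<in> layer G j" and nz: "wedge_list e (b # map ax rest) K \<noteq> 0"
  shows "sum deg K = j + (\<Sum>h\<leftarrow>rest. k h)"
proof -
  let ?v = "\<lambda>h. case h of None \<Rightarrow> b | Some i \<Rightarrow> ax i" and ?k = "\<lambda>h. case h of None \<Rightarrow> j | Some i \<Rightarrow> k i"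
  let ?hs = "None # map Some rest"
  have c: "?v h \<bullet> e l = 0" if "l \<in> {1..DIM('a)}" "deg l \<noteq> ?k h" for h l
    using that layer_coords[OF b, of l] ax_coord[of l] by (cases h) auto
  have "wedge_list e (map ?v ?hs) K = (if sum deg K = (\<Sum>h\<leftarrow>?hs. ?k h) then wedge_list e (map ?v ?hs) K else 0)"
    by (rule wedge_list_top_degree[THEN conjunct2]) (use c in auto)
  moreover have "map ?v ?hs = b # map ax rest" "(\<Sum>h\<leftarrow>?hs. ?k h) = j + (\<Sum>h\<leftarrow>rest. k h)" by (simp_all add: o_def)
  ultimately show ?thesis using nz by (metis (no_types, lifting))
qed

text \<open>The component \<open>b\<close> of \<open>v i - ax i\<close> in layer \<open>j\<close> is
  itself orthogonal to all \<open>ax i'\<close>, because each of these is homogeneous. So it is an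
  admissible test vector, and pairing it with \<open>v i\<close> gives its squared norm.\<close>

lemma component_vanish:
  fixes v :: "'n \<Rightarrow> 'a"
  assumes v: "\<And>i j. v i \<bullet> ax j = (if i = j then 1 else 0)"
    and orth: "\<And>b. b \<in> layer G j \<Longrightarrow> (\<And>i. b \<bullet> ax i = 0) \<Longrightarrow> v i \<bullet> b = 0"
    and l: "l \<in> {1..DIM('a)}" "deg l = j"
  shows "(v i - ax i) \<bullet> e l = 0"
proof -
  let ?Q = "{1..DIM('a)}"
  let ?m = "v i - ax i"
  define b where "b = (\<Sum>l\<in>?Q. (if deg l = j then ?m \<bullet> e l else 0) *\<^sub>R e l)"
  have be: "b \<bullet> e l = (if deg l = j then ?m \<bullet> e l else 0)" if "l \<in> ?Q" for l
    unfolding b_def by (rule inner_sum_e[OF that])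
  have bl: "b \<in> layer G j"
    unfolding b_def
  proof (rule subspace_sum[OF layer_subspace])
    fix l assume "l \<in> ?Q"
    then show "(if deg l = j then ?m \<bullet> e l else 0) *\<^sub>R e l \<in> layer G j"
      using deg_bounds(2)[of l] layer_subspace[of j] by (auto simp: subspace_scale subspace_0)
  qed
  have mo: "?m \<bullet> ax i' = 0" for i'
    using v[of i i'] ax_orthonormal[of i i'] by (simp add: inner_diff_left)
  have bo: "b \<bullet> ax i' = 0" for i'
  proof (cases "k i' = j")
    case True
    have "b \<bullet> ax i' = ?m \<bullet> ax i'"
      unfolding inner_expand[of b "ax i'"] inner_expand[of ?m "ax i'"]
      using True by (intro sum.cong refl) (auto simp: be ax_coord)
    then show ?thesis using mo by simp
  next
    case False
    then show ?thesis unfolding inner_expand[of b "ax i'"]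
      by (intro sum.neutral) (auto simp: be ax_coord)
  qed
  have "v i \<bullet> b = 0" by (rule orth[OF bl bo])
  moreover have "ax i \<bullet> b = 0" using bo[of i] by (simp add: inner_commute)
  ultimately have "?m \<bullet> b = 0" by (simp add: inner_diff_left)
  moreover have "?m \<bullet> b = b \<bullet> b"
    unfolding inner_expand[of ?m b] inner_expand[of b b] by (intro sum.cong refl) (auto simp: be)
  ultimately have "b = 0" by simp
  then show ?thesis using be[OF l(1)] l(2) by simp
qed

lemma top_degree_wedge:
  fixes hs :: "'n list"
  assumes "\<And>i l. l \<in> {1..DIM('a)} \<Longrightarrow> k i \<le> deg l \<Longrightarrow> (v i - ax i) \<bullet> e l = 0"
  shows "degree_proj G (\<Sum>h\<leftarrow>hs. k h) (wedge_list e (map v hs)) = wedge_list e (map ax hs)"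
proof
  fix K
  have vax: "v i \<bullet> e l = ax i \<bullet> e l" if "l \<in> {1..DIM('a)}" "k i \<le> deg l" for i l
    using assms[OF that] by (simp add: inner_diff_left)
  have "wedge_list e (map ax hs) K = (if sum deg K = (\<Sum>h\<leftarrow>hs. k h) then wedge_list e (map v hs) K else 0)"
    by (rule wedge_list_top_degree[THEN conjunct2]) (use vax ax_coord in auto)
  then show "degree_proj G (\<Sum>h\<leftarrow>hs. k h) (wedge_list e (map v hs)) K = wedge_list e (map ax hs) K"
    by (simp add: degree_proj_def)
qed

end

lemma basis_listI:
  assumes "span (set us) = T" "length us = dim T"
  shows "basis_list T us"
proof -
  have le: "card (set us) \<le> dim T" using card_length[of us] assms(2) by simp
  have T: "T \<subseteq> span (set us)" "set us \<subseteq> T" using assms(1) span_superset[of "set us"] by auto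
  have ind: "independent (set us)" by (rule card_le_dim_spanning[OF T(2) T(1) _ le]) simp
  have "dim T = card (set us)" using assms(1) dim_span[of "set us"] dim_eq_card_independent[OF ind] by simp
  then have "distinct us" using assms(2) by (intro card_distinct) simp
  then show ?thesis using ind assms(1) by (simp add: basis_list_def)
qed

context hom_group
begin

lemma in_layerI:
  assumes "\<And>l. l \<in> {1..DIM('a)} \<Longrightarrow> deg l \<noteq> j \<Longrightarrow> x \<bullet> e l = 0"
  shows "x \<in> layer G j"
proof -
  have "(\<Sum>l\<in>{1..DIM('a)}. (x \<bullet> e l) *\<^sub>R e l) \<in> layer G j"
  proof (rule subspace_sum[OF layer_subspace])
    fix l assume l: "l \<in> {1..DIM('a)}"
    show "(x \<bullet> e l) *\<^sub>R e l \<in> layer G j"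
      using assms[OF l] deg_bounds(2)[OF l] layer_subspace[of j]
      by (cases "deg l = j") (auto simp: subspace_scale subspace_0)
  qed
  then show ?thesis using expand[of x] by simp
qed

end

section \<open>Leading part of the tangent space at a point\<close>

context group_chart
begin

text \<open>Quantifying over all bases makes this depend on the chart only through the point \<open>\<Phi> x\<close>.\<close>

definition leading_wedge :: "real ^ 'n \<Rightarrow> nat \<Rightarrow> ('n \<Rightarrow> 'a) \<Rightarrow> bool" where
  "leading_wedge x N ax \<longleftrightarrow> (\<forall>hs vs. distinct hs \<longrightarrow> set hs = UNIV \<longrightarrow> basis_list (tangent_space \<Sigma> (\<Phi> x)) vs \<longrightarrow>
    (\<exists>c. c \<noteq> 0 \<and> degree_proj G N (wedge_list e (map (Il (\<Phi> x)) vs)) = (\<lambda>K. c * wedge_list e (map ax hs) K)))"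

text \<open>The vectors \<open>ax i\<close> are the leading parts of an echelon basis of the left
  translated tangent space. Their wedge product is nonzero and is the top degree part of the tangent
  multivector, so the degree is the sum of the \<open>k i\<close> and the homogeneous tangent space
  is their span.\<close>

lemma tangent_structure:
  assumes x: "x \<in> V" and Np: "pointwise_degree G e \<Sigma> (\<Phi> x) = N"
  shows "\<exists>ax k. adapted_basis G e ax k \<and> (\<Sum>i\<in>(UNIV :: 'n set). k i) = N \<and>
    homogeneous_tangent_space G e \<Sigma> (\<Phi> x) = span (range ax) \<and> leading_wedge x N ax"
proof -
  let ?p = "\<Phi> x" let ?T = "tangent_space \<Sigma> ?p" let ?n = "CARD('n)" let ?Q = "{1..DIM('a)}"
  define U where "U = Il ?p ` ?T"
  have sT: "subspace ?T" unfolding tangent_space_eq[OF x] by (intro linear_subspace_image[OF linear_D[OF x]]) simp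
  have sU: "subspace U" unfolding U_def by (rule linear_subspace_image[OF linear_Il sT])
  have injI: "inj (Il ?p)" by (rule injI) (metis Dl_Il)
  have dU: "dim U = ?n" unfolding U_def
    using dim_image_eq[OF linear_Il inj_on_subset[OF injI], of ?T] dim_tangent_space[OF x] by simp
  obtain a :: "nat \<Rightarrow> 'a" and v k0 where ech0: "(\<forall>r<?n. \<forall>s<?n. a r \<bullet> a s = (if r = s then 1 else 0)) \<and>
    (\<forall>r<?n. \<forall>i\<in>?Q. k0 r < deg i \<longrightarrow> v r \<bullet> e i = 0) \<and>
    (\<forall>r<?n. \<forall>i\<in>?Q. a r \<bullet> e i = (if deg i = k0 r then v r \<bullet> e i else 0)) \<and>
    span (v ` {..<?n}) = U"
    using graded_echelon_basis[OF sU dU, of deg] by (elim exE)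
  note ech = ech0[THEN conjunct1, rule_format] ech0[THEN conjunct2, THEN conjunct1, rule_format]
    ech0[THEN conjunct2, THEN conjunct2, THEN conjunct1, rule_format]
    ech0[THEN conjunct2, THEN conjunct2, THEN conjunct2]
  obtain hs0 :: "'n list" where hs0: "distinct hs0" "set hs0 = UNIV" using ex_enum by blast
  obtain h where h: "bij_betw h (UNIV :: 'n set) {..<?n}" by (rule enum_index[OF hs0]) (rule that)
  have hlt: "h i < ?n" for i using h bij_betwE by fastforce
  have hinj: "h i = h j \<longleftrightarrow> i = j" for i j using h by (auto simp: bij_betw_def inj_eq)
  define ax where "ax i = a (h i)" for i
  define vv where "vv i = v (h i)" for i
  define k where "k i = k0 (h i)" for i
  have ax0: "ax i \<bullet> e l = (if deg l = k i then vv i \<bullet> e l else 0)" if "l \<in> ?Q" for i l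
    using ech(3)[OF hlt that] by (simp add: ax_def vv_def k_def)
  have vv0: "vv i \<bullet> e l = 0" if "l \<in> ?Q" "k i < deg l" for i l
    using ech(2)[OF hlt that(1)] that(2) by (simp add: vv_def k_def)
  have AB: "adapted_basis G e ax k"
  proof (intro adapted_basis.intro adapted_basis_axioms.intro hom_group_axioms)
    show "ax i \<bullet> ax j = (if i = j then 1 else 0)" for i j
      using ech(1)[OF hlt hlt, of i j] by (simp add: ax_def hinj)
    show "ax i \<in> layer G (k i)" for i
      by (rule in_layerI) (simp add: ax0)
  qed
  interpret AB: adapted_basis G e ax k by (rule AB)
  have us: "basis_list ?T (map (\<lambda>i. Dl ?p (vv i)) hs)" if hs: "distinct hs" "set hs = UNIV" for hs
  proof (rule basis_listI)
    have "set (map (\<lambda>i. Dl ?p (vv i)) hs) = Dl ?p ` (v ` (h ` UNIV))" using hs(2) by (auto simp: vv_def)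
    also have "h ` UNIV = {..<?n}" using h by (simp add: bij_betw_def)
    finally have "span (set (map (\<lambda>i. Dl ?p (vv i)) hs)) = Dl ?p ` U"
      using linear_span_image[OF linear_Dl, of ?p "v ` {..<?n}"] ech(4) by simp
    also have "Dl ?p ` U = ?T" unfolding U_def by (simp add: image_comp o_def)
    finally show "span (set (map (\<lambda>i. Dl ?p (vv i)) hs)) = ?T" .
    show "length (map (\<lambda>i. Dl ?p (vv i)) hs) = dim ?T"
      using distinct_card[OF hs(1)] hs(2) dim_tangent_space[OF x] by simp
  qed
  have mI: "map (Il ?p) (map (\<lambda>i. Dl ?p (vv i)) hs) = map vv hs" for hs by simp
  let ?N = "\<Sum>i\<in>UNIV. k i"
  have sl: "(\<Sum>h\<leftarrow>hs. k h) = ?N" if "distinct hs" "set hs = UNIV" for hs :: "'n list"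
    using sum_list_distinct_conv_sum_set[OF that(1), of k] that(2) by simp
  have top: "?N < sum deg K \<Longrightarrow> wedge_list e (map vv hs) K = 0"
    "wedge_list e (map ax hs) K = (if sum deg K = ?N then wedge_list e (map vv hs) K else 0)"
    if hs: "distinct hs" "set hs = UNIV" for hs :: "'n list" and K
    using wedge_list_top_degree[of hs k deg vv ax K] vv0 ax0 unfolding sl[OF hs] by auto
  have dp: "degree_proj G ?N (wedge_list e (map vv hs)) = wedge_list e (map ax hs)"
    if hs: "distinct hs" "set hs = UNIV" for hs :: "'n list"
    by (rule ext) (simp add: degree_proj_def top(2)[OF hs])
  have ip1: "mv_inner DIM('a) (wedge_list e (map ax hs)) (wedge_list e (map ax hs)) = 1"
    if hs: "distinct hs" for hs
    by (rule mv_inner_dual[OF hs]) (rule AB.ax_orthonormal)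
  have axnz: "wedge_list e (map ax hs) \<noteq> (\<lambda>I. 0)" if hs: "distinct hs" for hs
    using ip1[OF hs] by (auto simp: mv_inner_def)
  obtain c0 where c0: "c0 \<noteq> 0" "tangent_multivector G e \<Sigma> ?p = (\<lambda>K. c0 * wedge_list e (map vv hs0) K)"
    using tangent_multivector_list[OF x us[OF hs0]] unfolding mI by blast
  have "pointwise_degree G e \<Sigma> ?p = ?N"
    unfolding pointwise_degree_def
  proof (rule Max_eqI)
    show "finite {M. degree_proj G M (tangent_multivector G e \<Sigma> ?p) \<noteq> (\<lambda>I. 0)}"
      unfolding tangent_multivector_def simple_multivector_eq by (rule degree_values_finite)
    show "M \<le> ?N" if M: "M \<in> {M. degree_proj G M (tangent_multivector G e \<Sigma> ?p) \<noteq> (\<lambda>I. 0)}" for M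
    proof (rule ccontr)
      assume "\<not> M \<le> ?N"
      then have "degree_proj G M (tangent_multivector G e \<Sigma> ?p) K = 0" for K
        unfolding c0(2) degree_proj_def using top(1)[OF hs0, of K] by auto
      then show False using M by auto
    qed
    have "degree_proj G ?N (tangent_multivector G e \<Sigma> ?p) = (\<lambda>K. c0 * wedge_list e (map ax hs0) K)"
      unfolding c0(2) degree_proj_scale dp[OF hs0] ..
    then show "?N \<in> {M. degree_proj G M (tangent_multivector G e \<Sigma> ?p) \<noteq> (\<lambda>I. 0)}"
      using axnz[OF hs0(1)] c0(1) by (auto simp: fun_eq_iff)
  qed
  then have N: "?N = N" using Np by simp
  have LW: "leading_wedge x N ax"
    unfolding leading_wedge_def
  proof (intro allI impI)
    fix hs :: "'n list" and vs assume hs: "distinct hs" "set hs = UNIV" and vs: "basis_list ?T vs"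
    obtain c1 where c1: "c1 \<noteq> 0" "tangent_multivector G e \<Sigma> ?p = (\<lambda>K. c1 * wedge_list e (map (Il ?p) vs) K)"
      using tangent_multivector_list[OF x vs] by blast
    obtain c2 where c2: "c2 \<noteq> 0" "tangent_multivector G e \<Sigma> ?p = (\<lambda>K. c2 * wedge_list e (map vv hs) K)"
      using tangent_multivector_list[OF x us[OF hs]] unfolding mI by blast
    have eq: "c1 * wedge_list e (map (Il ?p) vs) K = c2 * wedge_list e (map vv hs) K" for K
      using c1(2) c2(2) by metis
    have "wedge_list e (map (Il ?p) vs) = (\<lambda>K. (c2 / c1) * wedge_list e (map vv hs) K)"
    proof
      fix K show "wedge_list e (map (Il ?p) vs) K = (c2 / c1) * wedge_list e (map vv hs) K"
        using eq[of K] c1(1) by (simp add: field_simps)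
    qed
    then have "degree_proj G N (wedge_list e (map (Il ?p) vs)) = (\<lambda>K. (c2 / c1) * wedge_list e (map ax hs) K)"
      using degree_proj_scale[of G N "c2 / c1"] dp[OF hs] N by simp
    then show "\<exists>c. c \<noteq> 0 \<and> degree_proj G N (wedge_list e (map (Il ?p) vs)) = (\<lambda>K. c * wedge_list e (map ax hs) K)"
      using c1(1) c2(1) by (intro exI[of _ "c2 / c1"]) simp
  qed
  have "homogeneous_tangent_space G e \<Sigma> ?p = {y. \<forall>K. (vec_mv e y \<and>\<^sub>m wedge_list e (map ax hs0)) K = 0}"
  proof -
    have dpt: "degree_proj G (pointwise_degree G e \<Sigma> ?p) (tangent_multivector G e \<Sigma> ?p) = (\<lambda>K. c0 * wedge_list e (map ax hs0) K)"
      unfolding Np N[symmetric] c0(2) degree_proj_scale dp[OF hs0] ..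
    have w0: "(vec_mv e y \<and>\<^sub>m (\<lambda>K. c0 * wedge_list e (map ax hs0) K)) = (\<lambda>I. 0) \<longleftrightarrow>
        (\<forall>K. (vec_mv e y \<and>\<^sub>m wedge_list e (map ax hs0)) K = 0)" for y
      using c0(1) by (auto simp: fun_eq_iff wedge_scale_right)
    have tf: "X \<in> tangent_fields G e \<Sigma> ?p \<longleftrightarrow> (\<forall>q. X q = Dl q (X 0)) \<and>
        (\<forall>K. (vec_mv e (X 0) \<and>\<^sub>m wedge_list e (map ax hs0)) K = 0)" for X
    proof (cases "\<forall>q. X q = Dl q (X 0)")
      case True
      have "X ?p = Dl ?p (X 0)" by (rule True[rule_format])
      then have vc: "vec_coeffs G e ?p (X ?p) = vec_mv e (X 0)" by (simp only: vec_coeffs_eq Il_Dl)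
      show ?thesis unfolding tangent_fields_def dpt left_invariant_iff mem_Collect_eq vc w0 ..
    next
      case False
      then show ?thesis unfolding tangent_fields_def left_invariant_iff mem_Collect_eq by blast
    qed
    show ?thesis
    proof (intro antisym subsetI)
      fix y assume "y \<in> homogeneous_tangent_space G e \<Sigma> ?p"
      then show "y \<in> {y. \<forall>K. (vec_mv e y \<and>\<^sub>m wedge_list e (map ax hs0)) K = 0}"
        unfolding homogeneous_tangent_space_def using tf by blast
    next
      fix y assume y: "y \<in> {y. \<forall>K. (vec_mv e y \<and>\<^sub>m wedge_list e (map ax hs0)) K = 0}"
      have "(\<lambda>q. Dl q y) \<in> tangent_fields G e \<Sigma> ?p" unfolding tf using y by simp
      then show "y \<in> homogeneous_tangent_space G e \<Sigma> ?p"
        unfolding homogeneous_tangent_space_def by (rule rev_image_eqI) simp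
    qed
  qed
  also have "\<dots> = span (ax ` set hs0)"
    by (rule wedge_annihilator[OF hs0(1)]) (rule AB.ax_orthonormal)
  finally have "homogeneous_tangent_space G e \<Sigma> ?p = span (range ax)" unfolding hs0(2) .
  then show ?thesis using AB N LW by blast
qed

end

section \<open>Charts adapted to the homogeneous tangent space\<close>

locale adapted_chart = group_chart G e \<Sigma> V \<Phi> + adapted_basis G e ax k
  for G :: "('a::euclidean_space) graded_group" and e and \<Sigma> :: "'a set"
    and V :: "(real ^ 'n::finite) set" and \<Phi> :: "real ^ 'n \<Rightarrow> 'a" and ax :: "'n \<Rightarrow> 'a" and k
begin

lemma enum_cons:
  obtains rest :: "'n list" where "distinct (i # rest)" "set (i # rest) = UNIV"
    "k i + (\<Sum>h\<leftarrow>rest. k h) = (\<Sum>h\<in>UNIV. k h)"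
proof -
  obtain rest :: "'n list" where r: "set rest = - {i}" "distinct rest"
    using finite_distinct_list[of "- {i}"] by auto
  have "(\<Sum>h\<leftarrow>rest. k h) = sum k (- {i})" using sum_list_distinct_conv_sum_set[OF r(2), of k] r(1) by simp
  then have "k i + (\<Sum>h\<leftarrow>rest. k h) = (\<Sum>h\<in>UNIV. k h)"
    using sum.remove[of UNIV i k] by (simp add: Compl_eq_Diff_UNIV)
  then show ?thesis using r by (intro that[of rest]) auto
qed

text \<open>With \<open>L\<close> a right inverse of \<open>pr \<circ> \<Lambda> x\<close> this is
  the vector \<open>a_i + m_i\<close> of the overview.\<close>

definition graph_vector :: "real ^ 'n \<Rightarrow> (real ^ 'n \<Rightarrow> real ^ 'n) \<Rightarrow> 'n \<Rightarrow> 'a" where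
  "graph_vector x L i = \<Lambda> x (L (axis i 1))"

lemma graph_vector_dual:
  assumes "\<And>h. pr (\<Lambda> x (L h)) = h"
  shows "graph_vector x L i \<bullet> ax j = (if i = j then 1 else 0)"
proof -
  have "pr (graph_vector x L i) $ j = axis i 1 $ j" unfolding graph_vector_def assms ..
  then show ?thesis by (simp add: pr_def axis_def)
qed

lemma graph_vector_wedge:
  assumes x: "x \<in> V" and L: "linear L" "inj L" and hs: "distinct hs" "set hs = (UNIV :: 'n set)"
  shows "basis_list (tangent_space \<Sigma> (\<Phi> x)) (map (\<lambda>i. D\<Phi> x (L (axis i 1))) hs)"
    and "map (Il (\<Phi> x)) (map (\<lambda>i. D\<Phi> x (L (axis i 1))) hs) = map (graph_vector x L) hs"
  using tangent_list_basis[OF x L hs] by (auto simp: graph_vector_def \<Lambda>_def)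

text \<open>Pairing with a vector \<open>b\<close> of degree above \<open>k i\<close> reads off
  coefficients of the tangent multivector of total degree above \<open>N\<close>, which vanish at
  every point of \<open>\<Sigma>\<close>.\<close>

lemma graph_vector_high:
  assumes x: "x \<in> V" and L: "linear L" "inj L" "\<And>h. pr (\<Lambda> x (L h)) = h"
    and N: "manifold_degree G e \<Sigma> = (\<Sum>i\<in>UNIV. k i)"
    and l: "l \<in> {1..DIM('a)}" "k i < deg l"
  shows "(graph_vector x L i - ax i) \<bullet> e l = 0"
proof (rule component_vanish[OF graph_vector_dual[OF L(3)] _ l(1) refl])
  fix b assume b: "b \<in> layer G (deg l)"
  obtain rest :: "'n list" where r: "distinct (i # rest)" "set (i # rest) = UNIV"
    "k i + (\<Sum>h\<leftarrow>rest. k h) = (\<Sum>h\<in>UNIV. k h)" by (rule enum_cons)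
  obtain c where c: "c \<noteq> 0" "tangent_multivector G e \<Sigma> (\<Phi> x) = (\<lambda>K. c * wedge_list e (map (graph_vector x L) (i # rest)) K)"
    using tangent_multivector_list[OF x graph_vector_wedge(1)[OF x L(1,2) r(1,2)]]
    unfolding graph_vector_wedge(2)[OF x L(1,2) r(1,2)] by blast
  have px: "\<Phi> x \<in> \<Sigma>" using image_subset x by blast
  have "wedge_list e (map (graph_vector x L) (i # rest)) K * wedge_list e (b # map ax rest) K = 0" for K
  proof (cases "wedge_list e (b # map ax rest) K = 0")
    case False
    then have "sum deg K = deg l + (\<Sum>h\<leftarrow>rest. k h)" by (rule replaced_degree[OF b])
    then have "manifold_degree G e \<Sigma> < sum deg K" using l(2) N r(3) by linarith
    then have "tangent_multivector G e \<Sigma> (\<Phi> x) K = 0" by (rule tangent_multivector_high_degree[OF px])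
    then show ?thesis using c by simp
  qed simp
  then have "mv_inner DIM('a) (wedge_list e (map (graph_vector x L) (i # rest))) (wedge_list e (b # map ax rest)) = 0"
    unfolding mv_inner_def by (intro sum.neutral) auto
  then show "graph_vector x L i \<bullet> b = 0"
    using coefficient_replace[of "graph_vector x L", OF graph_vector_dual[OF L(3)] r(1)] by simp
qed

text \<open>For \<open>b\<close> of degree exactly \<open>k i\<close> the coefficients involved have
  degree \<open>N\<close>. At a point with known leading wedge they are proportional to those of the
  \<open>ax i\<close>, whose pairing contains the factor
  \<open>ax i \<bullet> b = 0\<close>.\<close>

lemma graph_vector_top:
  assumes x: "x \<in> V" and L: "linear L" "inj L" "\<And>h. pr (\<Lambda> x (L h)) = h"
    and LW: "leading_wedge x (\<Sum>i\<in>UNIV. k i) ax"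
    and l: "l \<in> {1..DIM('a)}" "deg l = k i"
  shows "(graph_vector x L i - ax i) \<bullet> e l = 0"
proof (rule component_vanish[OF graph_vector_dual[OF L(3)] _ l])
  fix b assume b: "b \<in> layer G (k i)" and bo: "\<And>i. b \<bullet> ax i = 0"
  let ?N = "\<Sum>i\<in>UNIV. k i"
  obtain rest :: "'n list" where r: "distinct (i # rest)" "set (i # rest) = UNIV"
    "k i + (\<Sum>h\<leftarrow>rest. k h) = ?N" by (rule enum_cons)
  obtain c where c: "degree_proj G ?N (wedge_list e (map (graph_vector x L) (i # rest))) =
      (\<lambda>K. c * wedge_list e (map ax (i # rest)) K)"
    using LW[unfolded leading_wedge_def, rule_format, OF r(1,2) graph_vector_wedge(1)[OF x L(1,2) r(1,2)]]
    unfolding graph_vector_wedge(2)[OF x L(1,2) r(1,2)] by blast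
  have "wedge_list e (map (graph_vector x L) (i # rest)) K * wedge_list e (b # map ax rest) K =
      c * (wedge_list e (map ax (i # rest)) K * wedge_list e (b # map ax rest) K)" for K
  proof (cases "wedge_list e (b # map ax rest) K = 0")
    case False
    then have "sum deg K = ?N" using replaced_degree[OF b False] r(3) by simp
    then have "wedge_list e (map (graph_vector x L) (i # rest)) K = c * wedge_list e (map ax (i # rest)) K"
      using fun_cong[OF c, of K] by (simp add: degree_proj_def)
    then show ?thesis by simp
  qed simp
  then have "mv_inner DIM('a) (wedge_list e (map (graph_vector x L) (i # rest))) (wedge_list e (b # map ax rest)) =
      c * mv_inner DIM('a) (wedge_list e (map ax (i # rest))) (wedge_list e (b # map ax rest))"
    unfolding mv_inner_def sum_distrib_left by (intro sum.cong refl)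
  then have "graph_vector x L i \<bullet> b = c * (ax i \<bullet> b)"
    using coefficient_replace[of "graph_vector x L", OF graph_vector_dual[OF L(3)] r(1), of b]
      coefficient_replace[of ax, OF ax_orthonormal r(1), of b] by simp
  then show "graph_vector x L i \<bullet> b = 0" using bo[of i] by (simp add: inner_commute)
qed

text \<open>A tangent vector with zero projection is completed to a basis. Its wedge product pairs
  to 0 with that of the \<open>ax i\<close> by contraction, but only coefficients of degree
  \<open>N\<close> enter the pairing, and these give the nonzero constant of the leading
  wedge.\<close>

lemma pr_Lam_injective:
  assumes x: "x \<in> V" and LW: "leading_wedge x (\<Sum>i\<in>UNIV. k i) ax" and z: "pr (\<Lambda> x h) = 0"
  shows "h = 0"
proof (rule ccontr)
  assume "h \<noteq> 0"
  let ?T = "tangent_space \<Sigma> (\<Phi> x)" let ?N = "\<Sum>i\<in>UNIV. k i"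
  define u where "u = D\<Phi> x h"
  have uT: "u \<in> ?T" unfolding u_def tangent_space_eq[OF x] by blast
  have "u \<noteq> 0"
    using injD[OF inj_D[OF x], of h 0] \<open>h \<noteq> 0\<close> linear_0[OF linear_D[OF x]] unfolding u_def by metis
  then have "independent {u}" by simp
  then obtain B where B: "{u} \<subseteq> B" "B \<subseteq> ?T" "independent B" "?T \<subseteq> span B"
    using maximal_independent_subset_extend[of "{u}" ?T] uT by blast
  have fB: "finite B" by (rule independent_imp_finite[OF B(3)])
  obtain ws where ws: "set ws = B - {u}" "distinct ws" using finite_distinct_list[of "B - {u}"] fB by auto
  have sT: "subspace ?T" unfolding tangent_space_eq[OF x] by (intro linear_subspace_image[OF linear_D[OF x]]) simp
  have "set (u # ws) = B" using ws B(1) by auto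
  moreover have "span B = ?T" using B sT by (intro antisym span_minimal)
  ultimately have bl: "basis_list ?T (u # ws)" unfolding basis_list_def using B(3) ws by auto
  obtain hs :: "'n list" where hs: "distinct hs" "set hs = UNIV" using ex_enum by blast
  obtain c where c: "c \<noteq> 0" "degree_proj G ?N (wedge_list e (map (Il (\<Phi> x)) (u # ws))) = (\<lambda>K. c * wedge_list e (map ax hs) K)"
    using LW[unfolded leading_wedge_def, rule_format, OF hs bl] by blast
  let ?X = "wedge_list e (map (Il (\<Phi> x)) (u # ws))" and ?Y = "wedge_list e (map ax hs)"
  have sl: "(\<Sum>h\<leftarrow>hs. k h) = ?N"
    using sum_list_distinct_conv_sum_set[OF hs(1), of k] hs(2) by simp
  have "?X K * ?Y K = c * (?Y K * ?Y K)" for K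
  proof (cases "?Y K = 0")
    case False
    have "wedge_list e (map ax hs) K = (if sum deg K = (\<Sum>h\<leftarrow>hs. k h) then wedge_list e (map ax hs) K else 0)"
      by (rule wedge_list_top_degree[THEN conjunct2]) (use ax_coord in auto)
    then have "sum deg K = ?N" using False sl by metis
    then show ?thesis using fun_cong[OF c(2), of K] by (simp add: degree_proj_def)
  qed simp
  then have "mv_inner DIM('a) ?X ?Y = c * mv_inner DIM('a) ?Y ?Y"
    unfolding mv_inner_def sum_distrib_left by (intro sum.cong refl)
  also have "mv_inner DIM('a) ?Y ?Y = 1" by (rule mv_inner_dual[OF hs(1) ax_orthonormal])
  finally have 1: "mv_inner DIM('a) ?X ?Y = c" by simp
  have o: "Il (\<Phi> x) u \<bullet> b = 0" if "b \<in> set (map ax hs)" for b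
  proof -
    obtain j where "b = ax j" using \<open>b \<in> set (map ax hs)\<close> by auto
    moreover have "pr (\<Lambda> x h) $ j = 0" using z by simp
    ultimately show ?thesis by (simp add: pr_def \<Lambda>_def u_def)
  qed
  have "mv_inner DIM('a) ?X ?Y = mv_inner DIM('a) (wedge_list e (map (Il (\<Phi> x)) ws)) (contract e (Il (\<Phi> x) u) ?Y)"
    by (simp add: wedge_list_Cons mv_inner_wedge_contract)
  also have "\<dots> = 0"
    unfolding mv_inner_def using contract_wedge_list_orthogonal[of "map ax hs" "Il (\<Phi> x) u", OF o]
    by (intro sum.neutral) auto
  finally show False using 1 c(1) by simp
qed

lemma Dl_expand: "Dl y v = (\<Sum>b\<in>Basis. (v \<bullet> b) *\<^sub>R Dl y b)"
  using linear_sum[OF linear_Dl, of y "\<lambda>b. (v \<bullet> b) *\<^sub>R b" Basis]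
  by (simp only: euclidean_representation linear_scale[OF linear_Dl])

lemma bounded_linear_pr: "bounded_linear pr"
  using linear_pr by (simp only: linear_conv_bounded_linear)

lemma translated_derivative:
  assumes "x \<in> V"
  shows "((\<lambda>x. - p \<star> \<Phi> x) has_derivative (\<lambda>h. Dl (- p \<star> \<Phi> x) (\<Lambda> x h))) (at x)"
  using has_derivative_compose[OF deriv[OF assms] gmul_left_derivative[of "- p" "\<Phi> x"]]
  unfolding GD_translate \<Lambda>_def .

text \<open>The inverse function theorem applies to the projection of the translated chart, whose
  derivative at \<open>x0\<close> is \<open>pr \<circ> \<Lambda> x0\<close>; the projection then
  becomes the new parameter.\<close>

lemma exists_normalized_chart:
  assumes x0: "x0 \<in> V" and inj0: "\<And>h. pr (\<Lambda> x0 h) = 0 \<Longrightarrow> h = 0"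
  shows "\<exists>W \<Psi>. chart \<Sigma> W \<Psi> \<and> (0 :: real ^ 'n) \<in> W \<and> \<Psi> 0 = \<Phi> x0 \<and> (\<forall>w\<in>W. pr (- \<Phi> x0 \<star> \<Psi> w) = w)"
proof -
  define p where "p = \<Phi> x0"
  define F where "F x = pr (- p \<star> \<Phi> x)" for x
  define A where "A x h = pr (Dl (- p \<star> \<Phi> x) (\<Lambda> x h))" for x h
  have dF: "(F has_derivative A x) (at x)" if "x \<in> V" for x
    unfolding F_def[abs_def] A_def[abs_def]
    by (rule bounded_linear.has_derivative[OF bounded_linear_pr translated_derivative[OF that]])
  have blA: "bounded_linear (A x)" if "x \<in> V" for x using has_derivative_bounded_linear[OF dF[OF that]] .
  define f' where "f' x = Blinfun (A x)" for x
  have f': "blinfun_apply (f' x) = A x" if "x \<in> V" for x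
    unfolding f'_def by (rule bounded_linear_Blinfun_apply[OF blA[OF that]])
  have cy: "continuous_on V (\<lambda>x. - p \<star> \<Phi> x)" by (intro continuous_gmul continuous_on_const continuous_chart)
  have cA: "continuous_on V (\<lambda>x. A x v)" for v
    unfolding A_def Dl_expand[of _ "\<Lambda> _ v"]
    by (intro bounded_linear.continuous_on[OF bounded_linear_pr] continuous_on_sum continuous_on_scaleR
        continuous_on_inner continuous_on_const continuous_Lam
        continuous_on_compose2[OF polynomial_function_continuous[OF Dl_polynomial, of UNIV] cy]) auto
  have cf': "continuous_on V f'"
    by (rule continuous_on_blinfun_componentwise)
       (use continuous_on_eq[OF cA] f' in auto)
  have A0: "A x0 h = pr (\<Lambda> x0 h)" for h by (simp add: A_def p_def)
  have lA: "linear (A x0)" by (rule bounded_linear.linear[OF blA[OF x0]])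
  have "inj (A x0)" using linear_injective_0[OF lA] inj0 A0 by auto
  then obtain g0 where g0: "linear g0" "g0 \<circ> A x0 = id" using linear_injective_left_inverse[OF lA] by blast
  have "Blinfun g0 o\<^sub>L f' x0 = id_blinfun"
  proof (rule blinfun_eqI)
    fix i
    have "bounded_linear g0" using g0(1) by (simp only: linear_conv_bounded_linear)
    then show "blinfun_apply (Blinfun g0 o\<^sub>L f' x0) i = blinfun_apply id_blinfun i"
      using g0(2) by (simp add: bounded_linear_Blinfun_apply f'[OF x0] fun_eq_iff)
  qed
  from inverse_function_theorem[OF open_V _ cf' x0 this, of F]
  obtain U W g g' where I: "open U" "U \<subseteq> V" "x0 \<in> U" "open W" "F x0 \<in> W" "homeomorphism U W F g"
    "\<And>y. y \<in> W \<Longrightarrow> (g has_derivative g' y) (at y)"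
    "\<And>y. y \<in> W \<Longrightarrow> g' y = inv (blinfun_apply (f' (g y)))"
    "\<And>y. y \<in> W \<Longrightarrow> bij (blinfun_apply (f' (g y)))"
    using dF f' by metis
  have hom: "homeomorphism W U g F" using I(6) by (rule homeomorphism_symD)
  have gW: "g ` W = U" and cg: "continuous_on W g" and Fg: "\<And>w. w \<in> W \<Longrightarrow> F (g w) = w" and gF: "\<And>x. x \<in> U \<Longrightarrow> g (F x) = x"
    using hom by (auto simp: homeomorphism_def)
  have gV: "g w \<in> V" if "w \<in> W" for w using gW I(2) that by blast
  have cfg: "continuous_on W (\<lambda>w. f' (g w))"
    by (rule continuous_on_compose2[OF cf' cg]) (use gV in auto)
  have lp: "local_param \<Sigma> W (\<Phi> \<circ> g)"
  proof (rule compose_diffeo(1)[OF I(4) I(1,2) hom I(7)])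
    show "inj (g' w)" if "w \<in> W" for w
      unfolding I(8)[OF that] by (rule surj_imp_inj_inv[OF bij_is_surj[OF I(9)[OF that]]])
    show "continuous_on W (\<lambda>w. g' w v)" for v
      using continuous_on_inverse_apply[OF cfg I(9), of v] I(8) by (simp cong: continuous_on_cong)
  qed
  have F0: "F x0 = 0" by (simp add: F_def p_def linear_0[OF linear_pr])
  show ?thesis
  proof (intro exI[of _ W] exI[of _ "\<Phi> \<circ> g"] conjI ballI)
    show "chart \<Sigma> W (\<Phi> \<circ> g)" using lp by (rule chart.intro)
    show "0 \<in> W" using I(5) F0 by simp
    show "(\<Phi> \<circ> g) 0 = \<Phi> x0" using gF[OF I(3)] F0 by simp
    show "pr (- \<Phi> x0 \<star> (\<Phi> \<circ> g) w) = w" if "w \<in> W" for w using Fg[OF that] by (simp add: F_def p_def)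
  qed
qed

end

text \<open>A chart in which \<open>\<Sigma>\<close>, translated so that \<open>p = \<Phi> 0\<close> becomes the identity, is a graph over
  the span of the \<open>ax i\<close>, which will be the homogeneous tangent space at \<open>p\<close>.\<close>

locale normalized_chart = adapted_chart G e \<Sigma> V \<Phi> ax k
  for G :: "('a::euclidean_space) graded_group" and e and \<Sigma> :: "'a set"
    and V :: "(real ^ 'n::finite) set" and \<Phi> :: "real ^ 'n \<Rightarrow> 'a" and ax :: "'n \<Rightarrow> 'a" and k +
  assumes zero_V: "0 \<in> V" and graph: "w \<in> V \<Longrightarrow> pr (- \<Phi> 0 \<star> \<Phi> w) = w"
    and degree_sum: "manifold_degree G e \<Sigma> = (\<Sum>i\<in>UNIV. k i)"
    and leading: "leading_wedge 0 (\<Sum>i\<in>UNIV. k i) ax"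
begin

definition Y :: "real ^ 'n \<Rightarrow> 'a" where "Y w = - \<Phi> 0 \<star> \<Phi> w"

lemma Y_derivative: "w \<in> V \<Longrightarrow> (Y has_derivative (\<lambda>h. Dl (Y w) (\<Lambda> w h))) (at w)"
  unfolding Y_def[abs_def] by (rule translated_derivative)

lemma Y_zero: "Y 0 = 0"
  by (simp add: Y_def)

lemma pr_Lam_zero: "pr (\<Lambda> 0 h) = h"
proof -
  have 1: "((\<lambda>w. pr (Y w)) has_derivative (\<lambda>h. pr (Dl (Y 0) (\<Lambda> 0 h)))) (at 0)"
    by (rule bounded_linear.has_derivative[OF bounded_linear_pr Y_derivative[OF zero_V]])
  have "((\<lambda>w. w) has_derivative (\<lambda>h. pr (Dl (Y 0) (\<Lambda> 0 h)))) (at 0)"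
    by (rule has_derivative_transform_within_open[OF 1 open_V zero_V]) (simp add: Y_def graph)
  then have "(\<lambda>h. pr (Dl (Y 0) (\<Lambda> 0 h))) = (\<lambda>h. h)"
    using has_derivative_unique has_derivative_ident by blast
  then show ?thesis by (simp add: Y_zero fun_eq_iff)
qed

text \<open>At the centre the vectors \<open>m_i\<close> have only components of degree below
  \<open>k i\<close>, so the part of degree \<open>N\<close> is the wedge product of the orthonormal
  family \<open>ax\<close>.\<close>

lemma jac_zero:
  assumes hs: "distinct hs" "set hs = (UNIV :: 'n set)"
  shows "jac hs (manifold_degree G e \<Sigma>) 0 = 1"
proof -
  have L: "linear (\<lambda>h::real ^ 'n. h)" "inj (\<lambda>h::real ^ 'n. h)" by (auto simp: linear_ident)
  have z: "(graph_vector 0 (\<lambda>h. h) i - ax i) \<bullet> e l = 0" if "l \<in> {1..DIM('a)}" "k i \<le> deg l" for i l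
    using graph_vector_high[OF zero_V L pr_Lam_zero degree_sum that(1), of i]
      graph_vector_top[OF zero_V L pr_Lam_zero leading that(1), of i] that(2) by linarith
  have sl: "(\<Sum>h\<leftarrow>hs. k h) = (\<Sum>i\<in>UNIV. k i)"
    using sum_list_distinct_conv_sum_set[OF hs(1), of k] hs(2) by simp
  have "degree_proj G (\<Sum>h\<leftarrow>hs. k h) (wedge_list e (map (graph_vector 0 (\<lambda>h. h)) hs)) = wedge_list e (map ax hs)"
    by (rule top_degree_wedge[OF z])
  then have "jac hs (manifold_degree G e \<Sigma>) 0 = left_invariant_norm DIM('a) (wedge_list e (map ax hs))"
    unfolding jac_def degree_sum sl graph_vector_def[abs_def] by simp
  moreover have "(left_invariant_norm DIM('a) (wedge_list e (map ax hs)))\<^sup>2 = 1"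
    unfolding left_invariant_norm_mv_inner by (rule mv_inner_dual[OF hs(1) ax_orthonormal])
  moreover have "left_invariant_norm DIM('a) (wedge_list e (map ax hs)) \<ge> 0"
    by (simp add: left_invariant_norm_def sum_nonneg)
  ultimately show ?thesis by (simp add: power2_eq_1_iff)
qed

text \<open>Near 0 the map \<open>pr \<circ> \<Lambda> w\<close> is within one half of the identity.
  The tolerance \<open>1 / (2 * ?n)\<close> on each basis vector adds up to this over the
  coordinates.\<close>

lemma graph_inverse:
  obtains \<delta> where "\<delta> > 0" "ball 0 \<delta> \<subseteq> V"
    "\<And>w h. w \<in> ball 0 \<delta> \<Longrightarrow> norm (pr (\<Lambda> w h) - h) \<le> 1 / 2 * norm h"
proof -
  let ?n = "real CARD('n)"
  have "\<exists>d>0. \<forall>w\<in>V. dist w 0 < d \<longrightarrow> dist (pr (\<Lambda> w (axis i 1))) (pr (\<Lambda> 0 (axis i 1))) < 1 / (2 * ?n)" for i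
  proof -
    have "continuous_on V (\<lambda>w. pr (\<Lambda> w (axis i 1)))"
      by (rule bounded_linear.continuous_on[OF bounded_linear_pr continuous_Lam])
    then show ?thesis using zero_V unfolding continuous_on_iff by (auto simp del: dist_0_norm)
  qed
  then obtain d where d: "\<And>i. d i > 0" "\<And>i w. w \<in> V \<Longrightarrow> dist w 0 < d i \<Longrightarrow>
      dist (pr (\<Lambda> w (axis i 1))) (pr (\<Lambda> 0 (axis i 1))) < 1 / (2 * ?n)" by metis
  obtain r where r: "r > 0" "ball 0 r \<subseteq> V" using open_V zero_V openE by blast
  define \<delta> where "\<delta> = min r (Min (range d))"
  have dp: "\<delta> > 0" using r(1) d(1) by (auto simp: \<delta>_def)
  have bV: "ball 0 \<delta> \<subseteq> V" using r(2) by (auto simp: \<delta>_def subset_iff)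
  have "norm (pr (\<Lambda> w h) - h) \<le> 1 / 2 * norm h" if w: "w \<in> ball 0 \<delta>" for w h
  proof -
    have wV: "w \<in> V" using bV w by blast
    have lin: "linear (\<lambda>h. pr (\<Lambda> w h) - h)"
      using linear_compose[OF linear_Lam[OF wV] linear_pr] by (intro linear_compose_sub) (auto simp: o_def linear_ident)
    have c: "norm (pr (\<Lambda> w (axis i 1)) - axis i 1) \<le> 1 / (2 * ?n)" for i
    proof -
      have "\<delta> \<le> d i" unfolding \<delta>_def by (rule min.coboundedI2) (rule Min_le, auto)
      then have "dist w 0 < d i" using w by (simp add: dist_commute)
      from d(2)[OF wV this] show ?thesis by (simp add: pr_Lam_zero dist_norm)
    qed
    have "norm (pr (\<Lambda> w h) - h) = norm (\<Sum>i\<in>UNIV. h $ i *\<^sub>R (pr (\<Lambda> w (axis i 1)) - axis i 1))"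
      using linear_vec_expand[OF lin, of h] by simp
    also have "\<dots> \<le> (\<Sum>i\<in>UNIV. norm (h $ i *\<^sub>R (pr (\<Lambda> w (axis i 1)) - axis i 1)))" by (rule norm_sum)
    also have "\<dots> \<le> (\<Sum>i\<in>(UNIV::'n set). norm h * (1 / (2 * ?n)))"
    proof (rule sum_mono)
      fix i
      have "\<bar>h $ i\<bar> * norm (pr (\<Lambda> w (axis i 1)) - axis i 1) \<le> norm h * (1 / (2 * ?n))"
        using c[of i] component_le_norm_cart[of h i] by (intro mult_mono) auto
      then show "norm (h $ i *\<^sub>R (pr (\<Lambda> w (axis i 1)) - axis i 1)) \<le> norm h * (1 / (2 * ?n))" by simp
    qed
    finally show ?thesis by simp
  qed
  then show ?thesis using that dp bV by blast
qed

text \<open>Here \<open>L w\<close> inverts \<open>pr \<circ> \<Lambda> w\<close>, and the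
  hypotheses of \<open>blowup_graph\<close> are verified for the resulting
  \<open>m i w\<close>.\<close>

lemma rescaled_limit:
  assumes R: "R > 0" and eta: "\<eta> > 0"
  shows "\<exists>s0>0. \<forall>s. 0 < s \<and> s < s0 \<longrightarrow> (\<forall>w. norm w \<le> R \<longrightarrow>
      dn s w \<in> V \<and> norm (dl (1 / s) (Y (dn s w)) - emb w) \<le> \<eta>)"
proof -
  obtain \<delta>0 where d0: "\<delta>0 > 0" "ball 0 \<delta>0 \<subseteq> V"
    "\<And>w h. w \<in> ball 0 \<delta>0 \<Longrightarrow> norm (pr (\<Lambda> w h) - h) \<le> 1 / 2 * norm h" by (rule graph_inverse) (rule that)
  have "\<exists>L. linear L \<and> inj L \<and> (\<forall>h. pr (\<Lambda> w (L h)) = h)" if w: "w \<in> ball 0 \<delta>0" for w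
  proof -
    have wV: "w \<in> V" using d0(2) w by blast
    have lin: "linear (\<lambda>h. pr (\<Lambda> w h))" using linear_compose[OF linear_Lam[OF wV] linear_pr] by (simp add: o_def)
    have "h = 0" if "pr (\<Lambda> w h) = 0" for h using d0(3)[OF w, of h] that by simp
    then have "inj (\<lambda>h. pr (\<Lambda> w h))" using linear_injective_0[OF lin] by blast
    then have "surj (\<lambda>h. pr (\<Lambda> w h))" using linear_injective_imp_surjective[OF lin] by simp
    then obtain L where L: "linear L" "(\<lambda>h. pr (\<Lambda> w h)) \<circ> L = id" using linear_surjective_right_inverse[OF lin] by blast
    have e: "pr (\<Lambda> w (L h)) = h" for h using fun_cong[OF L(2), of h] by simp
    then have "inj L" by (intro injI) metis
    then show ?thesis using L(1) e by blast
  qed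
  then obtain L where L: "\<And>w. w \<in> ball 0 \<delta>0 \<Longrightarrow> linear (L w)" "\<And>w. w \<in> ball 0 \<delta>0 \<Longrightarrow> inj (L w)"
    "\<And>w h. w \<in> ball 0 \<delta>0 \<Longrightarrow> pr (\<Lambda> w (L w h)) = h" by metis
  define m where "m i w = graph_vector w (L w) i - ax i" for i w
  have qn: "norm (L w (axis i 1)) \<le> 2" if w: "w \<in> ball 0 \<delta>0" for w i
  proof -
    have "norm (axis i 1 - L w (axis i 1)) \<le> 1 / 2 * norm (L w (axis i 1))"
      using d0(3)[OF w, of "L w (axis i 1)"] unfolding L(3)[OF w] .
    moreover have "norm (L w (axis i 1)) \<le> norm (axis i (1::real)) + norm (axis i 1 - L w (axis i 1))"
      using norm_triangle_ineq4[of "axis i 1" "axis i 1 - L w (axis i 1)"] by simp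
    ultimately show ?thesis by (simp add: norm_axis_1)
  qed
  have Lam_small: "\<exists>d>0. d \<le> \<delta>0 \<and> (\<forall>w\<in>ball 0 d. \<forall>h. norm (\<Lambda> w h - \<Lambda> 0 h) \<le> \<epsilon> * norm h)" if eps: "\<epsilon> > 0" for \<epsilon> :: real
  proof -
    let ?n = "real CARD('n)"
    have "\<exists>d>0. \<forall>w\<in>V. dist w 0 < d \<longrightarrow> dist (\<Lambda> w (axis i 1)) (\<Lambda> 0 (axis i 1)) < \<epsilon> / ?n" for i
      using continuous_Lam[of "axis i 1"] zero_V eps unfolding continuous_on_iff by (auto simp del: dist_0_norm)
    then obtain d where d: "\<And>i. d i > 0" "\<And>i w. w \<in> V \<Longrightarrow> dist w 0 < d i \<Longrightarrow>
        dist (\<Lambda> w (axis i 1)) (\<Lambda> 0 (axis i 1)) < \<epsilon> / ?n" by metis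
    define dd where "dd = min \<delta>0 (Min (range d))"
    show ?thesis
    proof (intro exI[of _ dd] conjI ballI allI)
      show "dd > 0" using d0(1) d(1) by (auto simp: dd_def)
      show "dd \<le> \<delta>0" unfolding dd_def by (rule min.cobounded1)
      fix w :: "real ^ 'n" and h assume w: "w \<in> ball 0 dd"
      have wV: "w \<in> V" using d0(2) w \<open>dd \<le> \<delta>0\<close> by (auto simp: subset_iff)
      have lin: "linear (\<lambda>h. \<Lambda> w h - \<Lambda> 0 h)"
        by (intro linear_compose_sub linear_Lam wV zero_V)
      have c: "norm (\<Lambda> w (axis i 1) - \<Lambda> 0 (axis i 1)) \<le> \<epsilon> / ?n" for i
      proof -
        have "dd \<le> d i" unfolding dd_def by (rule min.coboundedI2) (rule Min_le, auto)
        then have "dist w 0 < d i" using w by (simp add: dist_commute)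
        from d(2)[OF wV this] show ?thesis by (simp add: dist_norm)
      qed
      have "norm (\<Lambda> w h - \<Lambda> 0 h) = norm (\<Sum>i\<in>UNIV. h $ i *\<^sub>R (\<Lambda> w (axis i 1) - \<Lambda> 0 (axis i 1)))"
        using linear_vec_expand[OF lin, of h] by simp
      also have "\<dots> \<le> (\<Sum>i\<in>UNIV. norm (h $ i *\<^sub>R (\<Lambda> w (axis i 1) - \<Lambda> 0 (axis i 1))))" by (rule norm_sum)
      also have "\<dots> \<le> (\<Sum>i\<in>(UNIV::'n set). norm h * (\<epsilon> / ?n))"
      proof (rule sum_mono)
        fix i
        have "\<bar>h $ i\<bar> * norm (\<Lambda> w (axis i 1) - \<Lambda> 0 (axis i 1)) \<le> norm h * (\<epsilon> / ?n)"
          using c[of i] component_le_norm_cart[of h i] by (intro mult_mono) auto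
        then show "norm (h $ i *\<^sub>R (\<Lambda> w (axis i 1) - \<Lambda> 0 (axis i 1))) \<le> norm h * (\<epsilon> / ?n)" by simp
      qed
      finally show "norm (\<Lambda> w h - \<Lambda> 0 h) \<le> \<epsilon> * norm h" by (simp add: mult.commute)
    qed
  qed
  obtain C where C: "C > 0" "\<And>h. norm (\<Lambda> 0 h) \<le> C * norm h"
    using linear_bounded_pos[OF linear_Lam[OF zero_V]] by metis
  \<comment> \<open>\<open>L w\<close> comes from a choice, so continuity of \<open>m i\<close> at 0
    is estimated directly. At 0 itself \<open>pr \<circ> \<Lambda> 0\<close> is the identity, which
    gives the comparison value.\<close>
  have close: "\<exists>d>0. d \<le> \<delta>0 \<and> (\<forall>w\<in>ball 0 d. \<forall>i. norm (m i w - (\<Lambda> 0 (axis i 1) - ax i)) \<le> \<epsilon>)" if eps: "\<epsilon> > 0" for \<epsilon> :: real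
  proof -
    \<comment> \<open>By \<open>qn\<close> the vector \<open>?q\<close> has norm at most 2; the two
      error terms are then at most \<open>2 * e1\<close> and \<open>2 * C * e1\<close>.\<close>
    define e1 where "e1 = \<epsilon> / (2 + 2 * C)"
    have e1: "e1 > 0" using eps C(1) by (simp add: e1_def)
    obtain d where d: "d > 0" "d \<le> \<delta>0" "\<And>w h. w \<in> ball 0 d \<Longrightarrow> norm (\<Lambda> w h - \<Lambda> 0 h) \<le> e1 * norm h"
      using Lam_small[OF e1] by blast
    show ?thesis
    proof (intro exI[of _ d] conjI ballI allI d(1,2))
      fix w :: "real ^ 'n" and i assume w: "w \<in> ball 0 d"
      have w0: "w \<in> ball 0 \<delta>0" using w d(2) by auto
      let ?q = "L w (axis i 1)"
      have "norm (?q - axis i 1) = norm (pr (\<Lambda> 0 ?q - \<Lambda> w ?q))"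
        using L(3)[OF w0, of "axis i 1"] by (simp add: linear_diff[OF linear_pr] pr_Lam_zero)
      also have "\<dots> \<le> norm (\<Lambda> 0 ?q - \<Lambda> w ?q)" by (rule norm_pr_le)
      also have "\<dots> \<le> e1 * norm ?q" using d(3)[OF w, of ?q] by (simp add: norm_minus_commute)
      also have "\<dots> \<le> e1 * 2" using e1 qn[OF w0, of i] by (intro mult_left_mono) auto
      finally have 1: "norm (?q - axis i 1) \<le> e1 * 2" .
      have "m i w - (\<Lambda> 0 (axis i 1) - ax i) = (\<Lambda> w ?q - \<Lambda> 0 ?q) + \<Lambda> 0 (?q - axis i 1)"
        unfolding m_def graph_vector_def linear_diff[OF linear_Lam[OF zero_V]] by simp
      then have "norm (m i w - (\<Lambda> 0 (axis i 1) - ax i)) \<le> norm (\<Lambda> w ?q - \<Lambda> 0 ?q) + norm (\<Lambda> 0 (?q - axis i 1))"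
        using norm_triangle_ineq[of "\<Lambda> w ?q - \<Lambda> 0 ?q" "\<Lambda> 0 (?q - axis i 1)"] by simp
      also have "\<dots> \<le> e1 * 2 + C * (e1 * 2)"
      proof (rule add_mono)
        show "norm (\<Lambda> w ?q - \<Lambda> 0 ?q) \<le> e1 * 2"
          using d(3)[OF w, of ?q] mult_left_mono[OF qn[OF w0, of i], of e1] e1 by linarith
        show "norm (\<Lambda> 0 (?q - axis i 1)) \<le> C * (e1 * 2)"
          using C(2)[of "?q - axis i 1"] mult_left_mono[OF 1, of C] C(1) by linarith
      qed
      also have "\<dots> = e1 * (2 + 2 * C)" by (simp add: algebra_simps)
      also have "\<dots> = \<epsilon>" using C(1) by (simp add: e1_def)
      finally show "norm (m i w - (\<Lambda> 0 (axis i 1) - ax i)) \<le> \<epsilon>" .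
    qed
  qed
  obtain \<delta>1 where d1: "\<delta>1 > 0" "\<delta>1 \<le> \<delta>0" "\<And>w i. w \<in> ball 0 \<delta>1 \<Longrightarrow> norm (m i w - (\<Lambda> 0 (axis i 1) - ax i)) \<le> 1"
    using close[of 1] by auto
  define B where "B = 1 + (\<Sum>i\<in>UNIV. norm (\<Lambda> 0 (axis i 1) - ax i))"
  let ?W = "ball (0 :: real ^ 'n) \<delta>1"
  have W0: "w \<in> ball 0 \<delta>0" if "w \<in> ?W" for w using that d1(2) by auto
  have WV: "w \<in> V" if "w \<in> ?W" for w using W0[OF that] d0(2) by blast
  have "\<exists>s0>0. \<forall>s. 0 < s \<and> s < s0 \<longrightarrow> (\<forall>w. norm w \<le> R \<longrightarrow>
      dn s w \<in> ?W \<and> norm (dl (1 / s) (Y (dn s w)) - emb w) \<le> \<eta>)"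
  proof (rule blowup_graph[where W = ?W and Y = Y and Lm = \<Lambda> and m = m and B = B, OF open_ball _ Y_zero _ _ _ _ _ _ R eta])
    show "0 \<in> ?W" using d1(1) by simp
    show "pr (Y w) = w" if "w \<in> ?W" for w using graph[OF WV[OF that]] by (simp add: Y_def)
    show "(Y has_derivative (\<lambda>h. Dl (Y w) (\<Lambda> w h))) (at w)" if "w \<in> ?W" for w
      by (rule Y_derivative[OF WV[OF that]])
    show "\<Lambda> w h = (\<Sum>i\<in>UNIV. pr (\<Lambda> w h) $ i *\<^sub>R (ax i + m i w))" if "w \<in> ?W" for w h
    proof -
      \<comment> \<open>The estimate by one half also makes \<open>pr \<circ> \<Lambda> w\<close>
        injective, so its right inverse is a left inverse.\<close>
      have "L w (pr (\<Lambda> w h)) = h"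
      proof -
        have "pr (\<Lambda> w (L w (pr (\<Lambda> w h)))) = pr (\<Lambda> w h)" by (rule L(3)[OF W0[OF that]])
        then have "pr (\<Lambda> w (L w (pr (\<Lambda> w h)) - h)) = 0"
          by (simp add: linear_diff[OF linear_Lam[OF WV[OF that]]] linear_diff[OF linear_pr])
        then have "norm (L w (pr (\<Lambda> w h)) - h) \<le> 1 / 2 * norm (L w (pr (\<Lambda> w h)) - h)"
          using d0(3)[OF W0[OF that], of "L w (pr (\<Lambda> w h)) - h"] by (simp only: diff_0 norm_minus_cancel)
        then show ?thesis by simp
      qed
      then have "\<Lambda> w h = \<Lambda> w (L w (pr (\<Lambda> w h)))" by simp
      also have "\<dots> = (\<Sum>i\<in>UNIV. pr (\<Lambda> w h) $ i *\<^sub>R \<Lambda> w (L w (axis i 1)))"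
      proof -
        have "linear (\<lambda>h. \<Lambda> w (L w h))"
          using linear_compose[OF L(1)[OF W0[OF that]] linear_Lam[OF WV[OF that]]] by (simp add: o_def)
        from linear_vec_expand[OF this, of "pr (\<Lambda> w h)"] show ?thesis .
      qed
      finally show ?thesis by (simp add: m_def graph_vector_def)
    qed
    show "m i w \<bullet> e l = 0" if "w \<in> ?W" "l \<in> {1..DIM('a)}" "k i < deg l" for w i l
      unfolding m_def
      using graph_vector_high[OF WV[OF that(1)] L(1)[OF W0[OF that(1)]] L(2)[OF W0[OF that(1)]] L(3)[OF W0[OF that(1)]] degree_sum that(2,3)] .
    show "\<exists>\<delta>>0. \<forall>w\<in>?W. norm w < \<delta> \<longrightarrow> (\<forall>i. \<forall>l\<in>{1..DIM('a)}. deg l = k i \<longrightarrow> \<bar>m i w \<bullet> e l\<bar> \<le> \<epsilon>)" if eps: "\<epsilon> > 0" for \<epsilon>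
    proof -
      obtain d where d: "d > 0" "d \<le> \<delta>0" "\<And>w i. w \<in> ball 0 d \<Longrightarrow> norm (m i w - (\<Lambda> 0 (axis i 1) - ax i)) \<le> \<epsilon>"
        using close[OF eps] by blast
      show ?thesis
      proof (intro exI[of _ d] conjI ballI impI allI d(1))
        fix w i l assume w: "w \<in> ?W" "norm w < d" and l: "l \<in> {1..DIM('a)}" "deg l = k i"
        have LI: "linear (\<lambda>h::real ^ 'n. h)" "inj (\<lambda>h::real ^ 'n. h)" by (auto simp: linear_ident)
        have "(\<Lambda> 0 (axis i 1) - ax i) \<bullet> e l = 0"
          using graph_vector_top[OF zero_V LI pr_Lam_zero leading l] by (simp add: graph_vector_def)
        then have "m i w \<bullet> e l = (m i w - (\<Lambda> 0 (axis i 1) - ax i)) \<bullet> e l" by (simp add: inner_diff_left)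
        also have "\<bar>\<dots>\<bar> \<le> norm (m i w - (\<Lambda> 0 (axis i 1) - ax i)) * norm (e l)" by (rule Cauchy_Schwarz_ineq2)
        also have "norm (e l) = 1" using orthonormal[OF l(1) l(1)] by (simp add: norm_eq_1)
        also have "norm (m i w - (\<Lambda> 0 (axis i 1) - ax i)) * 1 \<le> \<epsilon>" using d(3)[of w i] w(2) by simp
        finally show "\<bar>m i w \<bullet> e l\<bar> \<le> \<epsilon>" .
      qed
    qed
    show "norm (m i w) \<le> B" if "w \<in> ?W" for w i
    proof -
      have "norm (m i w) \<le> norm (m i w - (\<Lambda> 0 (axis i 1) - ax i)) + norm (\<Lambda> 0 (axis i 1) - ax i)"
        using norm_triangle_ineq[of "m i w - (\<Lambda> 0 (axis i 1) - ax i)" "\<Lambda> 0 (axis i 1) - ax i"] by simp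
      also have "norm (\<Lambda> 0 (axis i 1) - ax i) \<le> (\<Sum>i\<in>UNIV. norm (\<Lambda> 0 (axis i 1) - ax i))"
        by (rule member_le_sum) auto
      finally show ?thesis using d1(3)[OF that, of i] by (simp add: B_def)
    qed
  qed
  then show ?thesis using WV by blast
qed

end

subsection \<open>Federer density and volume of slices\<close>

context hom_metric_group
begin

lemma density_term:
  assumes "r > 0" "C \<ge> 0"
  shows "ennreal (2 powr real N) * ennreal (C * r ^ N) / ennreal ((2 * r) powr real N) = ennreal C"
proof -
  have "ennreal (2 powr real N) * ennreal (C * r ^ N) = ennreal (2 ^ N * (C * r ^ N))"
    using assms by (simp add: powr_realpow ennreal_mult)
  also have "2 ^ N * (C * r ^ N) = C * (2 * r) ^ N" by (simp add: power_mult_distrib)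
  finally have 1: "ennreal (2 powr real N) * ennreal (C * r ^ N) = ennreal (C * (2 * r) ^ N)" .
  have 2: "(2 * r) powr real N = (2 * r) ^ N" using assms by (simp add: powr_realpow)
  have "ennreal (C * (2 * r) ^ N) / ennreal ((2 * r) ^ N) = ennreal (C * (2 * r) ^ N / (2 * r) ^ N)"
    using assms by (intro divide_ennreal) auto
  also have "C * (2 * r) ^ N / (2 * r) ^ N = C" using assms by simp
  finally show ?thesis unfolding 1 2 .
qed

text \<open>In the lower bound the radius is enlarged to \<open>r * (1 + \<rho>)\<close>, so that the approximation error of
  the blow-up cannot push points out of the ball.\<close>

lemma federer_density_eqI:
  assumes upper: "\<And>\<rho>. 0 < \<rho> \<Longrightarrow> \<rho> < 1 \<Longrightarrow> \<exists>s>0. \<forall>r y. 0 < r \<longrightarrow> r < s \<longrightarrow> d y p \<le> r \<longrightarrow>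
      emeasure \<mu> (dm.mcball y r) \<le> ennreal ((1 + \<rho>) ^ (N + 1) * \<beta> * r ^ N)"
    and lower: "\<And>\<rho>. 0 < \<rho> \<Longrightarrow> \<rho> < 1 \<Longrightarrow> \<exists>s>0. \<forall>r. 0 < r \<longrightarrow> r < s \<longrightarrow>
      (\<exists>y. d y p \<le> r * (1 + \<rho>) \<and> ennreal ((1 - \<rho>) * \<beta> * r ^ N) \<le> emeasure \<mu> (dm.mcball y (r * (1 + \<rho>))))"
    and beta: "\<beta> \<ge> 0"
  shows "federer_density d (real N) \<mu> p = ennreal \<beta>"
proof (rule antisym)
  let ?D = "\<lambda>\<epsilon>. {B. (\<exists>y r. r > 0 \<and> B = dm.mcball y r) \<and> p \<in> B \<and> diam d B < \<epsilon>}"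
  let ?T = "\<lambda>B. ennreal (2 powr real N) * emeasure \<mu> B / ennreal (diam d B powr real N)"
  have ev: "eventually (\<lambda>\<rho>::real. 0 < \<rho> \<and> \<rho> < 1) (at_right 0)"
    unfolding eventually_at_right_field by (intro exI[of _ 1]) auto
  have le: "federer_density d (real N) \<mu> p \<le> ennreal ((1 + \<rho>) ^ (N + 1) * \<beta>)" if rho: "0 < \<rho>" "\<rho> < 1" for \<rho>
  proof -
    obtain s where s: "s > 0" "\<And>r y. 0 < r \<Longrightarrow> r < s \<Longrightarrow> d y p \<le> r \<Longrightarrow>
        emeasure \<mu> (dm.mcball y r) \<le> ennreal ((1 + \<rho>) ^ (N + 1) * \<beta> * r ^ N)" using upper[OF rho] by blast
    \<comment> \<open>A ball of radius \<open>r\<close> has diameter \<open>2 * r\<close>, so a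
      diameter below \<open>2 * s\<close> means \<open>r < s\<close>.\<close>
    have "(SUP B \<in> ?D (2 * s). ?T B) \<le> ennreal ((1 + \<rho>) ^ (N + 1) * \<beta>)"
    proof (rule SUP_least)
      fix B assume "B \<in> ?D (2 * s)"
      then obtain y r where B: "r > 0" "B = dm.mcball y r" "p \<in> B" "diam d B < 2 * s" by blast
      have r: "r < s" using B(4) diam_mcball[OF B(1), of y] unfolding B(2) by simp
      have y: "d y p \<le> r" using B(3) unfolding B(2) mcball_eq by simp
      have "?T B \<le> ennreal (2 powr real N) * ennreal ((1 + \<rho>) ^ (N + 1) * \<beta> * r ^ N) / ennreal ((2 * r) powr real N)"
        unfolding B(2) diam_mcball[OF B(1)]
        by (intro divide_right_mono_ennreal mult_left_mono s(2)[OF B(1) r y]) simp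
      also have "\<dots> = ennreal ((1 + \<rho>) ^ (N + 1) * \<beta>)"
        using beta rho by (intro density_term B(1)) simp
      finally show "?T B \<le> ennreal ((1 + \<rho>) ^ (N + 1) * \<beta>)" .
    qed
    then show ?thesis unfolding federer_density_def by (rule INF_lower2[rotated]) (use s(1) in simp)
  qed
  have "((\<lambda>\<rho>. (1 + \<rho>) ^ (N + 1) * \<beta>) \<longlongrightarrow> (1 + 0) ^ (N + 1) * \<beta>) (at_right 0)" by (intro tendsto_intros)
  then have "((\<lambda>\<rho>. ennreal ((1 + \<rho>) ^ (N + 1) * \<beta>)) \<longlongrightarrow> ennreal \<beta>) (at_right 0)"
    by (intro tendsto_ennrealI) simp
  then show "federer_density d (real N) \<mu> p \<le> ennreal \<beta>"
    by (rule tendsto_lowerbound) (use le in \<open>auto intro: eventually_mono[OF ev]\<close>)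
  have ge: "ennreal ((1 - \<rho>) * \<beta> / (1 + \<rho>) ^ N) \<le> (SUP B \<in> ?D \<epsilon>. ?T B)" if rho: "0 < \<rho>" "\<rho> < 1" and eps: "\<epsilon> > 0" for \<rho> \<epsilon>
  proof -
    obtain s where s: "s > 0" "\<And>r. 0 < r \<Longrightarrow> r < s \<Longrightarrow> \<exists>y. d y p \<le> r * (1 + \<rho>) \<and>
        ennreal ((1 - \<rho>) * \<beta> * r ^ N) \<le> emeasure \<mu> (dm.mcball y (r * (1 + \<rho>)))" using lower[OF rho] by blast
    \<comment> \<open>The enlarged radius is at most \<open>2 * r\<close>, so the diameter of the
      ball is at most \<open>4 * r\<close> and stays below \<open>\<epsilon>\<close>.\<close>
    define r where "r = min (s / 2) (\<epsilon> / 8)"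
    have r: "r > 0" "r < s" "r \<le> \<epsilon> / 8" using s(1) eps by (auto simp: r_def)
    obtain y where y: "d y p \<le> r * (1 + \<rho>)"
      "ennreal ((1 - \<rho>) * \<beta> * r ^ N) \<le> emeasure \<mu> (dm.mcball y (r * (1 + \<rho>)))" using s(2)[OF r(1,2)] by blast
    define t where "t = r * (1 + \<rho>)"
    have t: "t > 0" using r rho by (simp add: t_def)
    have "t \<le> r * 2" unfolding t_def using r(1) rho by (intro mult_left_mono) auto
    then have t2: "2 * t < \<epsilon>" using r(3) eps by linarith
    have mem: "dm.mcball y t \<in> ?D \<epsilon>"
      using t t2 y(1) diam_mcball[OF t, of y] by (auto simp: mcball_eq t_def)
    have "(1 - \<rho>) * \<beta> * r ^ N = (1 - \<rho>) * \<beta> / (1 + \<rho>) ^ N * t ^ N"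
      using rho by (simp add: t_def power_mult_distrib)
    then have "ennreal ((1 - \<rho>) * \<beta> / (1 + \<rho>) ^ N * t ^ N) \<le> emeasure \<mu> (dm.mcball y t)"
      using y(2) by (simp add: t_def)
    then have "ennreal (2 powr real N) * ennreal ((1 - \<rho>) * \<beta> / (1 + \<rho>) ^ N * t ^ N) / ennreal ((2 * t) powr real N)
        \<le> ?T (dm.mcball y t)"
      unfolding diam_mcball[OF t] by (intro divide_right_mono_ennreal mult_left_mono) simp_all
    moreover have "ennreal (2 powr real N) * ennreal ((1 - \<rho>) * \<beta> / (1 + \<rho>) ^ N * t ^ N) / ennreal ((2 * t) powr real N)
        = ennreal ((1 - \<rho>) * \<beta> / (1 + \<rho>) ^ N)"
      using beta rho by (intro density_term t) simp
    ultimately have "ennreal ((1 - \<rho>) * \<beta> / (1 + \<rho>) ^ N) \<le> ?T (dm.mcball y t)" by simp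
    also have "\<dots> \<le> (SUP B \<in> ?D \<epsilon>. ?T B)" by (rule SUP_upper[OF mem])
    finally show ?thesis .
  qed
  have "((\<lambda>\<rho>. (1 - \<rho>) * \<beta> / (1 + \<rho>) ^ N) \<longlongrightarrow> (1 - 0) * \<beta> / (1 + 0) ^ N) (at_right 0)"
    by (intro tendsto_intros) simp
  then have lim: "((\<lambda>\<rho>. ennreal ((1 - \<rho>) * \<beta> / (1 + \<rho>) ^ N)) \<longlongrightarrow> ennreal \<beta>) (at_right 0)"
    by (intro tendsto_ennrealI) simp
  show "ennreal \<beta> \<le> federer_density d (real N) \<mu> p"
    unfolding federer_density_def
  proof (rule INF_greatest)
    fix \<epsilon> :: real assume "\<epsilon> \<in> {0<..}"
    then have "\<epsilon> > 0" by simp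
    then have "eventually (\<lambda>\<rho>. ennreal ((1 - \<rho>) * \<beta> / (1 + \<rho>) ^ N) \<le> (SUP B \<in> ?D \<epsilon>. ?T B)) (at_right 0)"
      using ge by (auto intro: eventually_mono[OF ev])
    then show "ennreal \<beta> \<le> (SUP B \<in> ?D \<epsilon>. ?T B)"
      by (rule tendsto_upperbound[OF lim]) simp
  qed
qed

text \<open>Uniform continuity of \<open>d\<close> on a compact set near the diagonal. It converts
  the Euclidean error of the blow-up into an error of \<open>d\<close>.\<close>

lemma d_small_of_norm_small:
  assumes "\<rho> > 0"
  obtains \<eta> where "0 < \<eta>" "\<eta> \<le> 1" "\<And>z z'. norm z \<le> R \<Longrightarrow> norm z' \<le> R \<Longrightarrow> norm (z - z') \<le> \<eta> \<Longrightarrow> d z z' \<le> \<rho>"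
proof -
  let ?K = "cball (0::'a) R \<times> cball (0::'a) R"
  have "uniformly_continuous_on ?K (\<lambda>z. d (fst z) (snd z))"
    by (intro compact_uniformly_continuous continuous_on_subset[OF d_continuous] compact_Times compact_cball) simp
  then obtain \<delta> where dl: "\<delta> > 0" "\<And>x x'. x \<in> ?K \<Longrightarrow> x' \<in> ?K \<Longrightarrow> dist x' x < \<delta> \<Longrightarrow>
      dist (d (fst x') (snd x')) (d (fst x) (snd x)) < \<rho>"
    unfolding uniformly_continuous_on_def using assms by meson
  show ?thesis
  proof (rule that[of "min 1 (\<delta> / 2)"])
    fix z z' :: 'a assume z: "norm z \<le> R" "norm z' \<le> R" "norm (z - z') \<le> min 1 (\<delta> / 2)"
    have "dist (z, z') (z, z) = norm (z - z')" by (simp add: dist_Pair_Pair dist_norm norm_minus_commute)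
    also have "\<dots> < \<delta>" using z(3) dl(1) by simp
    finally have "dist (d z z') (d z z) < \<rho>" using dl(2)[of "(z, z)" "(z, z')"] z by simp
    then show "d z z' \<le> \<rho>" by (simp add: d_facts(1) dist_real_def)
  qed (use dl(1) in auto)
qed

end

section \<open>Volumes of slices of balls\<close>

context adapted_basis
begin

lemma dn_inverse:
  assumes "s > 0"
  shows "dn s (dn (1 / s) w) = w" "dn (1 / s) (dn s w) = w"
  using assms by (simp_all add: dn_dn)

lemma range_emb: "range emb = span (range ax)"
proof
  show "range emb \<subseteq> span (range ax)"
  proof (rule image_subsetI)
    fix w show "emb w \<in> span (range ax)"
      unfolding emb_def by (intro span_sum span_scale span_base rangeI)
  qed
  have "ax i = emb (axis i 1)" for i
    by (simp add: emb_def axis_def if_distrib[of "\<lambda>x. x *\<^sub>R _"] cong: if_cong)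
  then have "range ax \<subseteq> range emb" by blast
  then show "span (range ax) \<subseteq> range emb"
    by (rule span_minimal[OF _ linear_subspace_image[OF linear_emb subspace_UNIV]])
qed

lemma dist_emb: "dist (emb x) (emb y) = dist x y"
  by (simp add: dist_norm linear_diff[OF linear_emb, symmetric])

lemma continuous_emb: "continuous_on S emb"
  by (rule linear_continuous_on) (use linear_emb in \<open>simp only: linear_conv_bounded_linear\<close>)

lemma dn_borel: "dn s \<in> borel_measurable borel"
  unfolding dn_def[abs_def]
  by (intro borel_measurable_continuous_onI continuous_intros)

text \<open>The Jacobian of the diagonal map is the product of the \<open>s ^ k i\<close>. This is
  how the degree, as the sum of the \<open>k i\<close>, becomes the exponent of the density.\<close>

lemma emeasure_dn_image:
  assumes s: "s > 0" and E: "E \<in> sets borel"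
  shows "dn s ` E \<in> sets borel"
    and "emeasure lborel (dn s ` E) = ennreal (s ^ (\<Sum>i\<in>UNIV. k i)) * emeasure lborel E"
proof -
  have im: "dn s ` E = dn (1 / s) -` E"
    using dn_inverse[OF s] by (auto simp: image_iff) metis
  show B: "dn s ` E \<in> sets borel"
    unfolding im using measurable_sets[OF dn_borel E, of "1 / s"] by simp
  define c :: "real ^ 'n \<Rightarrow> real" where "c b = s ^ k (axis_index b)" for b
  have Bs: "(Basis :: (real ^ 'n) set) = range (\<lambda>i. axis i 1)" by (auto simp: Basis_vec_def)
  have inj: "inj (\<lambda>i::'n. axis i (1::real))" by (rule injI) (simp add: axis_eq_axis)
  have T: "dn s x = 0 + (\<Sum>b\<in>Basis. (c b * (x \<bullet> b)) *\<^sub>R b)" for x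
    using basis_expansion[of "dn s x"]
    unfolding Bs sum.reindex[OF inj] o_def scalar_mult_eq_scaleR
    by (simp add: dn_def c_def inner_axis)
  have pc: "(\<Prod>b\<in>Basis. \<bar>c b\<bar>) = s ^ (\<Sum>i\<in>UNIV. k i)"
    unfolding Bs prod.reindex[OF inj] o_def using s by (simp add: c_def axis_index_axis power_sum)
  have "c b \<noteq> 0" for b using s by (simp add: c_def)
  then have "lborel = density (distr lborel borel (\<lambda>x. 0 + (\<Sum>b\<in>Basis. (c b * (x \<bullet> b)) *\<^sub>R b))) (\<lambda>_. (\<Prod>b\<in>Basis. \<bar>c b\<bar>))"
    by (intro lborel_affine_euclidean)
  then have lb: "lborel = density (distr lborel borel (dn s)) (\<lambda>_. ennreal (s ^ (\<Sum>i\<in>UNIV. k i)))"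
    unfolding T[symmetric] pc .
  have "emeasure lborel (dn s ` E) = ennreal (s ^ (\<Sum>i\<in>UNIV. k i)) * emeasure (distr lborel borel (dn s)) (dn s ` E)"
    by (subst lb) (use B in \<open>simp add: emeasure_density_const\<close>)
  also have "emeasure (distr lborel borel (dn s)) (dn s ` E) = emeasure lborel (dn s -` (dn s ` E) \<inter> space lborel)"
    by (rule emeasure_distr) (use dn_borel B in simp_all)
  also have "dn s -` (dn s ` E) \<inter> space lborel = E"
    using dn_inverse(2)[OF s] by auto metis
  finally show "emeasure lborel (dn s ` E) = ennreal (s ^ (\<Sum>i\<in>UNIV. k i)) * emeasure lborel E" .
qed

end

locale metric_basis = hom_metric_group G e d + adapted_basis G e ax k
  for G :: "('a::euclidean_space) graded_group" and e d and ax :: "'n::finite \<Rightarrow> 'a" and k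
begin

text \<open>A ball intersected with the graded subspace, in the coordinates
  \<open>emb\<close>.\<close>

definition slice :: "real \<Rightarrow> 'a \<Rightarrow> (real ^ 'n) set" where
  "slice r u = {w. d (emb w) u \<le> r}"

lemma closed_slice: "closed (slice r u)"
  unfolding slice_def
  by (intro closed_Collect_le continuous_d continuous_emb continuous_on_const)

lemma slice_borel: "slice r u \<in> sets borel"
  using closed_slice by (rule borel_closed)

lemma bounded_slice: "bounded (slice r u)"
proof -
  obtain R where R: "\<And>x. d 0 x \<le> d 0 u + r \<Longrightarrow> norm x \<le> R" by (rule d0_ball_bounded[where M = "d 0 u + r"]) blast
  have "norm w \<le> R" if "w \<in> slice r u" for w
    using R[of "emb w"] d_facts(4)[of 0 "emb w" u] d_facts(3)[of u "emb w"] that by (simp add: slice_def)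
  then show ?thesis by (auto simp: bounded_iff)
qed

lemma emeasure_slice_finite: "emeasure lborel (slice r u) < \<infinity>"
  by (rule emeasure_bounded_finite[OF bounded_slice])

definition vol :: "'a \<Rightarrow> real" where "vol u = measure lborel (slice 1 u)"

lemma emeasure_slice: "emeasure lborel (slice 1 u) = ennreal (vol u)"
  unfolding vol_def using emeasure_slice_finite[of 1 u] by (intro emeasure_eq_ennreal_measure) auto

lemma hausdorff_slice: "hausdorff TYPE('n) (dm.mcball u 1 \<inter> span (range ax)) = ennreal (vol u)"
proof -
  have "dm.mcball u 1 \<inter> span (range ax) = emb ` slice 1 u"
    unfolding range_emb[symmetric] mcball_eq slice_def using d_facts(3)[of u] by auto
  then show ?thesis
    using hausdorff_isometric_image[OF slice_borel bounded_slice dist_emb] emeasure_slice by simp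
qed

lemma slice_scale:
  assumes r: "r > 0"
  shows "slice r u = dn r ` slice 1 (dl (1 / r) u)"
proof -
  have eq: "d (emb (dn r w)) u \<le> r \<longleftrightarrow> d (emb w) (dl (1 / r) u) \<le> 1" for w
  proof -
    have "d (emb (dn r w)) u = d (dl r (emb w)) (dl r (dl (1 / r) u))"
      using dl_emb[of r w] dl_inverse[of r u] r by simp
    also have "\<dots> = r * d (emb w) (dl (1 / r) u)" by (rule d_dl[OF r])
    finally show ?thesis using r by (simp add: mult_le_cancel_left2)
  qed
  show ?thesis
  proof (intro antisym subsetI)
    fix w assume "w \<in> slice r u"
    then have "dn (1 / r) w \<in> slice 1 (dl (1 / r) u)" using eq[of "dn (1 / r) w"] dn_inverse[OF r, of w] by (simp add: slice_def)
    then show "w \<in> dn r ` slice 1 (dl (1 / r) u)" using dn_inverse(1)[OF r, of w] by (metis imageI)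
  qed (use eq in \<open>auto simp: slice_def\<close>)
qed

lemma emeasure_slice_scale:
  assumes r: "r > 0"
  shows "emeasure lborel (slice r u) = ennreal (r ^ (\<Sum>i\<in>UNIV. k i) * vol (dl (1 / r) u))"
  unfolding slice_scale[OF r] emeasure_dn_image(2)[OF r slice_borel] emeasure_slice
  using r by (simp add: ennreal_mult vol_def)

text \<open>For \<open>v\<close> close to \<open>u\<close> the slice at \<open>v\<close> lies in a
  slightly larger slice at \<open>u\<close>. As the radius decreases to 1 these shrink to the closed
  slice, and their volumes converge because they are finite.\<close>

lemma vol_upper_semicontinuous:
  assumes v: "v \<longlonglongrightarrow> u" and eps: "\<epsilon> > 0"
  shows "\<exists>k0. \<forall>k\<ge>k0. vol (v k) \<le> vol u + \<epsilon>"
proof -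
  define A where "A j = slice (1 + 1 / real (Suc j)) u" for j
  have "(\<lambda>j. emeasure lborel (A j)) \<longlonglongrightarrow> emeasure lborel (\<Inter>j. A j)"
  proof (rule Lim_emeasure_decseq)
    show "range A \<subseteq> sets lborel" using slice_borel by (auto simp: A_def)
    show "decseq A"
    proof (rule decseq_SucI)
      fix j
      have "1 / real (Suc (Suc j)) \<le> 1 / real (Suc j)" by (intro divide_left_mono) auto
      then show "A (Suc j) \<le> A j" by (auto simp: A_def slice_def)
    qed
    show "emeasure lborel (A j) \<noteq> \<infinity>" for j using emeasure_slice_finite[of "1 + 1 / real (Suc j)" u] unfolding A_def by simp
  qed
  moreover have "(\<Inter>j. A j) = slice 1 u"
  proof
    show "(\<Inter>j. A j) \<subseteq> slice 1 u"
    proof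
      fix w assume w: "w \<in> (\<Inter>j. A j)"
      have "d (emb w) u \<le> 1 + \<epsilon>" if e: "\<epsilon> > 0" for \<epsilon>
      proof -
        obtain j where "1 / real (Suc j) < \<epsilon>" using e by (meson nat_approx_posE)
        moreover have "d (emb w) u \<le> 1 + 1 / real (Suc j)" using w by (auto simp: A_def slice_def)
        ultimately show ?thesis by linarith
      qed
      then have "d (emb w) u \<le> 1" by (rule field_le_epsilon)
      then show "w \<in> slice 1 u" by (simp add: slice_def)
    qed
    show "slice 1 u \<subseteq> (\<Inter>j. A j)"
    proof (intro INT_greatest subsetI)
      fix j w assume "w \<in> slice 1 u"
      moreover have "0 \<le> 1 / real (Suc j)" by simp
      ultimately show "w \<in> A j" unfolding A_def slice_def mem_Collect_eq by linarith
    qed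
  qed
  ultimately have "(\<lambda>j. emeasure lborel (A j)) \<longlonglongrightarrow> ennreal (vol u)" by (simp add: emeasure_slice)
  moreover have "ennreal (vol u) < ennreal (vol u + \<epsilon>)" using eps by (intro ennreal_lessI) (auto simp: vol_def add_nonneg_pos)
  ultimately have "eventually (\<lambda>j. emeasure lborel (A j) < ennreal (vol u + \<epsilon>)) sequentially"
    by (rule order_tendstoD(2))
  then obtain j where j: "emeasure lborel (A j) < ennreal (vol u + \<epsilon>)" using eventually_happens'[OF sequentially_bot] by blast
  have "(\<lambda>i. d (v i) u) \<longlonglongrightarrow> d u u"
  proof (rule continuous_on_tendsto_compose[of UNIV "\<lambda>x. d x u" v u])
    show "continuous_on UNIV (\<lambda>x. d x u)" by (intro continuous_d continuous_on_id continuous_on_const)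
  qed (use v in auto)
  then have "eventually (\<lambda>i. d (v i) u < 1 / real (Suc j)) sequentially"
    unfolding d_facts(1) by (rule order_tendstoD(2)) simp
  then obtain k0 where k0: "\<And>i. i \<ge> k0 \<Longrightarrow> d (v i) u < 1 / real (Suc j)" unfolding eventually_sequentially by blast
  have "vol (v i) \<le> vol u + \<epsilon>" if i: "i \<ge> k0" for i
  proof -
    have "slice 1 (v i) \<subseteq> A j"
    proof
      fix w assume "w \<in> slice 1 (v i)"
      then have "d (emb w) (v i) \<le> 1" by (simp add: slice_def)
      then have "d (emb w) u \<le> 1 + 1 / real (Suc j)" using d_facts(4)[of "emb w" u "v i"] k0[OF i] by linarith
      then show "w \<in> A j" by (simp add: A_def slice_def)
    qed
    then have "ennreal (vol (v i)) \<le> emeasure lborel (A j)"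
      unfolding emeasure_slice[symmetric] by (rule emeasure_mono) (simp add: A_def slice_borel)
    then have "ennreal (vol (v i)) \<le> ennreal (vol u + \<epsilon>)" using j by simp
    moreover have "0 \<le> vol u + \<epsilon>" using eps by (simp add: vol_def add_nonneg_nonneg)
    ultimately show ?thesis by (simp add: ennreal_le_iff)
  qed
  then show ?thesis by blast
qed

text \<open>Attainment identifies the value selected by \<open>GREATEST\<close> in
  \<open>spherical_factor\<close>.\<close>

lemma spherical_factor_attained:
  obtains u where "d u 0 \<le> 1" "\<And>v. d v 0 \<le> 1 \<Longrightarrow> vol v \<le> vol u"
    "spherical_factor TYPE('n) d (span (range ax)) = ennreal (vol u)"
proof -
  let ?K = "{u. d 0 u \<le> 1}"
  have "\<exists>u\<in>?K. \<forall>v\<in>?K. vol v \<le> vol u"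
  proof (rule usc_attains_max[OF compact_d0_ball])
    have "0 \<in> ?K" by (simp add: d_facts(1))
    then show "?K \<noteq> {}" by blast
    have "vol u \<le> measure lborel (slice 2 0)" if "u \<in> ?K" for u
    proof -
      have "slice 1 u \<subseteq> slice 2 0"
      proof
        fix w assume "w \<in> slice 1 u"
        then have "d (emb w) u \<le> 1" by (simp add: slice_def)
        then have "d (emb w) 0 \<le> 2" using d_facts(4)[of "emb w" 0 u] d_facts(3)[of u 0] that by simp
        then show "w \<in> slice 2 0" by (simp add: slice_def)
      qed
      then have "emeasure lborel (slice 1 u) \<le> emeasure lborel (slice 2 0)"
        by (rule emeasure_mono) (simp add: slice_borel)
      then show ?thesis
        unfolding vol_def measure_def using emeasure_slice_finite[of 2 0] by (intro enn2real_mono) auto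
    qed
    then show "bdd_above (vol ` ?K)" by (auto simp: bdd_above_def)
    show "\<forall>\<epsilon>>0. \<exists>k0. \<forall>k\<ge>k0. vol (v k) \<le> vol u + \<epsilon>" if "v \<longlonglongrightarrow> u" for v u
      using vol_upper_semicontinuous[OF that] by blast
  qed
  then obtain u where u: "d 0 u \<le> 1" "\<And>v. d 0 v \<le> 1 \<Longrightarrow> vol v \<le> vol u" by blast
  have u0: "d u 0 \<le> 1" using u(1) d_facts(3)[of u 0] by simp
  have um: "vol v \<le> vol u" if "d v 0 \<le> 1" for v using u(2)[of v] that d_facts(3)[of v 0] by simp
  have "spherical_factor TYPE('n) d (span (range ax)) = ennreal (vol u)"
    unfolding spherical_factor_def hausdorff_slice
  proof (rule Greatest_equality)
    show "\<exists>ua. d ua 0 \<le> 1 \<and> ennreal (vol u) = ennreal (vol ua)" using u0 by blast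
    show "c \<le> ennreal (vol u)" if "\<exists>u. d u 0 \<le> 1 \<and> c = ennreal (vol u)" for c
      using that um by (auto intro: ennreal_leI)
  qed
  then show ?thesis using that u0 um by blast
qed

end

context chart
begin

lemma inj_chart: "inj_on \<Phi> V"
proof -
  obtain \<Psi> where "\<And>x. x \<in> V \<Longrightarrow> \<Psi> (\<Phi> x) = x" by (rule inverse_continuous) (rule that)
  then show ?thesis by (rule inj_on_inverseI)
qed

lemma openin_image:
  assumes "open U" "U \<subseteq> V"
  shows "openin (top_of_set \<Sigma>) (\<Phi> ` U)"
proof -
  obtain \<Psi> where "homeomorphism V (\<Phi> ` V) \<Phi> \<Psi>" using homeo by blast
  then have "openin (top_of_set (\<Phi> ` V)) (\<Phi> ` U)"
    by (rule homeomorphism_imp_open_map) (use assms in \<open>simp add: openin_open_eq open_V\<close>)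
  then show ?thesis using openin_trans open_image by blast
qed

lemma preimage_borel:
  assumes "closed T"
  shows "V \<inter> \<Phi> -` T \<in> sets borel"
proof -
  have "closedin (top_of_set V) (V \<inter> \<Phi> -` T)"
    by (rule continuous_closedin_preimage[OF continuous_chart assms])
  then obtain C where "closed C" "V \<inter> \<Phi> -` T = V \<inter> C" unfolding closedin_closed by blast
  then show ?thesis using open_V by simp
qed

end

lemma (in hom_group) intrinsic_measure_complement:
  assumes S: "C1_submanifold TYPE('n::finite) \<Sigma>" "\<Sigma> \<noteq> {}" and g: "riemannian_metric g"
    and \<sigma>: "riemannian_measure TYPE('n) g \<Sigma> \<sigma>"
  shows "sets (intrinsic_measure G e g \<Sigma> \<sigma>) = sets borel"
    and "emeasure (intrinsic_measure G e g \<Sigma> \<sigma>) (- \<Sigma>) = 0"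
proof -
  define f where "f p = (if p \<in> \<Sigma> then left_invariant_norm DIM('a) (degree_proj G (manifold_degree G e \<Sigma>) (unit_tangent_multivector G e g \<Sigma> p)) else 0)" for p
  have fm: "f \<in> borel_measurable borel" unfolding f_def[abs_def] by (rule intrinsic_density_measurable[OF S g])
  have s\<sigma>: "sets \<sigma> = sets borel" using \<sigma> by (simp add: riemannian_measure_def)
  have fm': "(\<lambda>p. ennreal (f p)) \<in> borel_measurable \<sigma>"
    using fm s\<sigma> by (simp cong: measurable_cong_sets)
  have im: "intrinsic_measure G e g \<Sigma> \<sigma> = density \<sigma> (\<lambda>p. ennreal (f p))"
    unfolding intrinsic_measure_def f_def by (rule arg_cong[of _ _ "density \<sigma>"]) auto
  show "sets (intrinsic_measure G e g \<Sigma> \<sigma>) = sets borel" unfolding im using s\<sigma> by simp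
  have "- \<Sigma> \<in> sets \<sigma>" using submanifold_borel[OF S] s\<sigma> by simp
  then have "emeasure (density \<sigma> (\<lambda>p. ennreal (f p))) (- \<Sigma>) = (\<integral>\<^sup>+ p. ennreal (f p) * indicator (- \<Sigma>) p \<partial>\<sigma>)"
    by (rule emeasure_density[OF fm'])
  also have "\<dots> = (\<integral>\<^sup>+ p. 0 \<partial>\<sigma>)" by (rule nn_integral_cong) (simp add: f_def indicator_def)
  finally show "emeasure (intrinsic_measure G e g \<Sigma> \<sigma>) (- \<Sigma>) = 0" unfolding im by simp
qed

section \<open>Small balls in a normalized chart\<close>

locale normalized_metric_chart = normalized_chart G e \<Sigma> V \<Phi> ax k + metric_basis G e d ax k
  for G :: "('a::euclidean_space) graded_group" and e and \<Sigma> :: "'a set"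
    and V :: "(real ^ 'n::finite) set" and \<Phi> :: "real ^ 'n \<Rightarrow> 'a" and ax :: "'n \<Rightarrow> 'a" and k and d
begin

text \<open>Chart images are relatively open in \<open>\<Sigma>\<close>, so no other sheet of
  \<open>\<Sigma>\<close> comes near the point. The radius is halved because the centre
  \<open>y\<close> may itself be at distance \<open>r\<close> from it.\<close>

lemma ball_in_chart:
  assumes "\<delta> > 0"
  obtains s where "s > 0" "\<And>y r. r < s \<Longrightarrow> d y (\<Phi> 0) \<le> r \<Longrightarrow> dm.mcball y r \<inter> \<Sigma> \<subseteq> \<Phi> ` (V \<inter> ball 0 \<delta>)"
proof -
  have "openin (top_of_set \<Sigma>) (\<Phi> ` (V \<inter> ball 0 \<delta>))"
    by (rule openin_image) (auto simp: open_V)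
  then obtain Q where Q: "open Q" "\<Phi> ` (V \<inter> ball 0 \<delta>) = \<Sigma> \<inter> Q" unfolding openin_open by blast
  have "0 \<in> V \<inter> ball 0 \<delta>" using zero_V assms by simp
  then have "\<Phi> 0 \<in> Q" using Q(2) by blast
  then obtain s where s: "s > 0" "\<And>y. d (\<Phi> 0) y < s \<Longrightarrow> y \<in> Q" using d_ball_in_open[OF Q(1)] by blast
  have "dm.mcball y r \<inter> \<Sigma> \<subseteq> \<Phi> ` (V \<inter> ball 0 \<delta>)" if r: "r < s / 2" and y: "d y (\<Phi> 0) \<le> r" for y r
  proof
    fix q assume q: "q \<in> dm.mcball y r \<inter> \<Sigma>"
    then have "d y q \<le> r" by (simp add: mcball_eq)
    then have "d (\<Phi> 0) q < s" using d_facts(4)[of "\<Phi> 0" q y] d_facts(3)[of y "\<Phi> 0"] r y by linarith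
    then show "q \<in> \<Phi> ` (V \<inter> ball 0 \<delta>)" unfolding Q(2) using s(2) q by blast
  qed
  then show ?thesis using s(1) by (intro that[of "s / 2"]) auto
qed

text \<open>The density \<open>jac\<close> is continuous with value 1 at the centre, and small balls
  only see parameters near 0.\<close>

lemma intrinsic_measure_bounds:
  assumes S: "C1_submanifold TYPE('n) \<Sigma>" and g: "riemannian_metric g"
    and \<sigma>: "riemannian_measure TYPE('n) g \<Sigma> \<sigma>" and rho: "\<rho> > 0"
  shows "\<exists>s>0. \<forall>y r. r < s \<longrightarrow> d y (\<Phi> 0) \<le> r \<longrightarrow>
      ennreal (1 - \<rho>) * emeasure lborel {x \<in> V. d y (\<Phi> x) \<le> r} \<le> emeasure (intrinsic_measure G e g \<Sigma> \<sigma>) (dm.mcball y r) \<and>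
      emeasure (intrinsic_measure G e g \<Sigma> \<sigma>) (dm.mcball y r) \<le> ennreal (1 + \<rho>) * emeasure lborel {x \<in> V. d y (\<Phi> x) \<le> r} \<and>
      {x \<in> V. d y (\<Phi> x) \<le> r} \<in> sets borel"
proof -
  let ?N = "manifold_degree G e \<Sigma>" and ?\<mu> = "intrinsic_measure G e g \<Sigma> \<sigma>"
  have ne: "\<Sigma> \<noteq> {}" using image_subset zero_V by blast
  note \<mu> = intrinsic_measure_complement[OF S ne g \<sigma>]
  obtain hs :: "'n list" where hs: "distinct hs" "set hs = UNIV" using ex_enum by blast
  obtain \<delta> where dl: "\<delta> > 0" "\<And>x. x \<in> V \<Longrightarrow> dist x 0 < \<delta> \<Longrightarrow> dist (jac hs ?N x) (jac hs ?N 0) < \<rho>"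
    using continuous_jac[of hs ?N] zero_V rho unfolding continuous_on_iff by blast
  obtain s where s: "s > 0" "\<And>y r. r < s \<Longrightarrow> d y (\<Phi> 0) \<le> r \<Longrightarrow> dm.mcball y r \<inter> \<Sigma> \<subseteq> \<Phi> ` (V \<inter> ball 0 \<delta>)"
    by (rule ball_in_chart[OF dl(1)]) (rule that)
  show ?thesis
  proof (intro exI[of _ s] conjI[OF s(1)] allI impI conjI)
    fix y r assume r: "r < s" and y: "d y (\<Phi> 0) \<le> r"
    let ?M = "dm.mcball y r" let ?E = "{x \<in> V. d y (\<Phi> x) \<le> r}"
    have cM: "closed ?M" unfolding mcball_eq by (rule closed_d_ball)
    have E: "?E = V \<inter> \<Phi> -` ?M" by (auto simp: mcball_eq)
    have Eb: "?E \<in> sets borel" unfolding E by (rule preimage_borel[OF cM])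
    define B where "B = ?M \<inter> \<Phi> ` V"
    have Bb: "B \<in> sets borel" unfolding B_def using cM image_borel by auto
    \<comment> \<open>Outside the chart image a small ball contains only points off
      \<open>\<Sigma>\<close>, a null set.\<close>
    have M: "?M = B \<union> (?M - \<Sigma>)" using s(2)[OF r y] by (auto simp: B_def)
    have cS: "- \<Sigma> \<in> null_sets ?\<mu>" using \<mu> submanifold_borel[OF S ne] by (intro null_setsI) simp_all
    have "?M - \<Sigma> \<in> null_sets ?\<mu>"
      by (rule null_sets_subset[OF cS]) (use \<mu>(1) cM submanifold_borel[OF S ne] in auto)
    then have "emeasure ?\<mu> (B \<union> (?M - \<Sigma>)) = emeasure ?\<mu> B" using Bb \<mu>(1) by (intro emeasure_Un_null_set) simp_all
    then have "emeasure ?\<mu> ?M = emeasure ?\<mu> B" using M by simp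
    also have "\<dots> = (\<integral>\<^sup>+ x \<in> V \<inter> \<Phi> -` B. ennreal (jac hs ?N x) \<partial>lborel)"
      by (rule emeasure_intrinsic[OF S g \<sigma> hs refl Bb _ ne]) (simp add: B_def)
    also have "V \<inter> \<Phi> -` B = ?E" by (auto simp: B_def mcball_eq)
    finally have eq: "emeasure ?\<mu> ?M = (\<integral>\<^sup>+ x \<in> ?E. ennreal (jac hs ?N x) \<partial>lborel)" .
    have near: "1 - \<rho> \<le> jac hs ?N x \<and> jac hs ?N x \<le> 1 + \<rho>" if x: "x \<in> ?E" for x
    proof -
      have "\<Phi> x \<in> ?M \<inter> \<Sigma>" using x image_subset by (auto simp: mcball_eq)
      then have "\<Phi> x \<in> \<Phi> ` (V \<inter> ball 0 \<delta>)" using s(2)[OF r y] by blast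
      then have "x \<in> ball 0 \<delta>" using x inj_on_image_mem_iff[OF inj_chart, of x "V \<inter> ball 0 \<delta>"] by auto
      then have "dist (jac hs ?N x) 1 < \<rho>" using dl(2)[of x] x jac_zero[OF hs] by (simp add: dist_commute)
      then show ?thesis by (simp add: dist_real_def abs_less_iff)
    qed
    have const: "(\<integral>\<^sup>+ x. c * indicator ?E x \<partial>lborel) = c * emeasure lborel ?E" for c
      by (rule nn_integral_cmult_indicator) (simp add: Eb)
    show "ennreal (1 - \<rho>) * emeasure lborel ?E \<le> emeasure ?\<mu> ?M"
      unfolding eq const[symmetric]
      by (rule nn_integral_mono) (use near in \<open>auto simp: indicator_def intro: ennreal_leI\<close>)
    show "emeasure ?\<mu> ?M \<le> ennreal (1 + \<rho>) * emeasure lborel ?E"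
      unfolding eq const[symmetric]
      by (rule nn_integral_mono) (use near in \<open>auto simp: indicator_def intro: ennreal_leI\<close>)
    show "?E \<in> sets borel" by (rule Eb)
  qed
qed

text \<open>In rescaled coordinates each chart point is within \<open>\<rho>\<close> of its
  projection to the graded subspace, so each inclusion costs \<open>\<rho>\<close> in the unit
  radius.\<close>

lemma chart_ball_inclusions:
  assumes rho: "\<rho> > 0"
  shows "\<exists>s>0. \<forall>r. 0 < r \<longrightarrow> r < s \<longrightarrow>
      (\<forall>y. d y (\<Phi> 0) \<le> r \<longrightarrow> {x \<in> V. d y (\<Phi> x) \<le> r} \<subseteq> dn r ` slice (1 + \<rho>) (dl (1 / r) (- \<Phi> 0 \<star> y))) \<and>
      (\<forall>u. d u 0 \<le> 1 \<longrightarrow> dn r ` slice 1 u \<subseteq> {x \<in> V. d (\<Phi> 0 \<star> dl r u) (\<Phi> x) \<le> r * (1 + \<rho>)})"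
proof -
  \<comment> \<open>The rescaled centre is at distance at most 1 from 0, and the points considered
    are at distance at most 1 from it, hence the bound 2.\<close>
  obtain R where R: "R > 0" "\<And>x. d 0 x \<le> 2 \<Longrightarrow> norm x \<le> R" by (rule d0_ball_bounded[where M = 2]) blast
  obtain \<eta> where eta: "0 < \<eta>" "\<eta> \<le> 1" "\<And>z z'. norm z \<le> R + 1 \<Longrightarrow> norm z' \<le> R + 1 \<Longrightarrow> norm (z - z') \<le> \<eta> \<Longrightarrow> d z z' \<le> \<rho>"
    by (rule d_small_of_norm_small[OF rho, where R = "R + 1"]) (rule that)
  obtain s where s: "s > 0" "\<And>r w. 0 < r \<Longrightarrow> r < s \<Longrightarrow> norm w \<le> R \<Longrightarrow>
      dn r w \<in> V \<and> norm (dl (1 / r) (Y (dn r w)) - emb w) \<le> \<eta>"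
    using rescaled_limit[OF R(1) eta(1)] by blast
  have close: "d (dl (1 / r) (Y (dn r w))) (emb w) \<le> \<rho>" if r: "0 < r" "r < s" and w: "norm w \<le> R" for r w
  proof -
    let ?z = "dl (1 / r) (Y (dn r w))"
    have n: "norm (?z - emb w) \<le> \<eta>" using s(2)[OF r w] by blast
    have "norm ?z \<le> norm (emb w) + norm (?z - emb w)" using norm_triangle_ineq[of "emb w" "?z - emb w"] by simp
    then have "norm ?z \<le> R + 1" using n eta(2) w norm_emb[of w] by linarith
    then show ?thesis using eta(3)[OF _ _ n] w by simp
  qed
  have dY: "d (\<Phi> 0 \<star> a) (\<Phi> x) = d a (Y x)" for a x
    using d_left[of "- \<Phi> 0" "\<Phi> 0 \<star> a" "\<Phi> x"] by (simp add: Y_def gmul_cancel)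
  show ?thesis
  proof (intro exI[of _ s] conjI[OF s(1)] allI impI conjI subsetI)
    fix r y x assume r: "0 < r" "r < s" and y: "d y (\<Phi> 0) \<le> r" and x: "x \<in> {x \<in> V. d y (\<Phi> x) \<le> r}"
    define u where "u = dl (1 / r) (- \<Phi> 0 \<star> y)"
    define z where "z = dl (1 / r) (Y x)"
    define w where "w = dn (1 / r) x"
    have r1: "1 / r > 0" using r by simp
    have "d u z = 1 / r * d (- \<Phi> 0 \<star> y) (Y x)" unfolding u_def z_def by (rule d_dl[OF r1])
    also have "d (- \<Phi> 0 \<star> y) (Y x) = d y (\<Phi> x)" unfolding Y_def by (rule d_left)
    also have "1 / r * d y (\<Phi> x) \<le> 1 / r * r" using x r by (intro mult_left_mono) auto
    finally have uz: "d u z \<le> 1" using r by simp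
    have "d 0 u = 1 / r * d 0 (- \<Phi> 0 \<star> y)" unfolding u_def by (rule d0_dl[OF r1])
    also have "d 0 (- \<Phi> 0 \<star> y) = d y (\<Phi> 0)" using d_zero_eq[of "\<Phi> 0" y] d_facts(3)[of y "\<Phi> 0"] by simp
    also have "1 / r * d y (\<Phi> 0) \<le> 1 / r * r" using y r by (intro mult_left_mono) auto
    finally have "d 0 u \<le> 1" using r by simp
    then have "d 0 z \<le> 2" using uz d_facts(4)[of 0 z u] by linarith
    then have nz: "norm z \<le> R" by (rule R(2))
    have "pr (Y x) = x" using graph x by (simp add: Y_def)
    then have "w = pr z" unfolding w_def z_def pr_dl by simp
    then have nw: "norm w \<le> R" using nz norm_pr_le[of z] by simp
    have xw: "dn r w = x" unfolding w_def by (rule dn_inverse(1)[OF r(1)])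
    have "d z (emb w) \<le> \<rho>" using close[OF r nw] unfolding xw z_def .
    then have "d (emb w) u \<le> 1 + \<rho>"
      using uz d_facts(4)[of "emb w" u z] d_facts(3)[of z "emb w"] d_facts(3)[of z u] by linarith
    then have "w \<in> slice (1 + \<rho>) u" by (simp add: slice_def)
    then show "x \<in> dn r ` slice (1 + \<rho>) (dl (1 / r) (- \<Phi> 0 \<star> y))"
      unfolding u_def[symmetric] using xw by blast
  next
    fix r u x assume r: "0 < r" "r < s" and u: "d u 0 \<le> 1" and x: "x \<in> dn r ` slice 1 u"
    obtain w where w: "w \<in> slice 1 u" "x = dn r w" using x by blast
    have wu: "d (emb w) u \<le> 1" using w(1) by (simp add: slice_def)
    then have "d 0 (emb w) \<le> 2" using u d_facts(4)[of "emb w" 0 u] d_facts(3)[of 0 "emb w"] by linarith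
    then have nw: "norm w \<le> R" using R(2)[of "emb w"] by simp
    let ?z = "dl (1 / r) (Y x)"
    have "d ?z (emb w) \<le> \<rho>" using close[OF r nw] unfolding w(2) .
    then have "d u ?z \<le> 1 + \<rho>"
      using wu d_facts(4)[of u ?z "emb w"] d_facts(3)[of u "emb w"] d_facts(3)[of ?z "emb w"] by linarith
    then have "r * d u ?z \<le> r * (1 + \<rho>)" using r by (intro mult_left_mono) auto
    moreover have "r * d u ?z = d (dl r u) (Y x)"
      using d_dl[OF r(1), of u ?z] dl_inverse[of r "Y x"] r by simp
    ultimately have "d (\<Phi> 0 \<star> dl r u) (\<Phi> x) \<le> r * (1 + \<rho>)" unfolding dY by simp
    then show "x \<in> {x \<in> V. d (\<Phi> 0 \<star> dl r u) (\<Phi> x) \<le> r * (1 + \<rho>)}"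
      using s(2)[OF r nw] w(2) by blast
  qed
qed

lemma federer_density_eq:
  assumes S: "C1_submanifold TYPE('n) \<Sigma>" and g: "riemannian_metric g"
    and \<sigma>: "riemannian_measure TYPE('n) g \<Sigma> \<sigma>"
  shows "federer_density d (real (manifold_degree G e \<Sigma>)) (intrinsic_measure G e g \<Sigma> \<sigma>) (\<Phi> 0) =
    spherical_factor TYPE('n) d (span (range ax))"
proof -
  let ?\<mu> = "intrinsic_measure G e g \<Sigma> \<sigma>" let ?N = "\<Sum>i\<in>UNIV. k i" let ?p = "\<Phi> 0"
  obtain u where u: "d u 0 \<le> 1" "\<And>v. d v 0 \<le> 1 \<Longrightarrow> vol v \<le> vol u"
    "spherical_factor TYPE('n) d (span (range ax)) = ennreal (vol u)" by (rule spherical_factor_attained) (rule that)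
  have vp: "vol v \<ge> 0" for v by (simp add: vol_def)
  have "federer_density d (real ?N) ?\<mu> ?p = ennreal (vol u)"
  proof (rule federer_density_eqI)
    fix \<rho> :: real assume rho: "0 < \<rho>" "\<rho> < 1"
    obtain s1 where s1: "s1 > 0" "\<And>y r. r < s1 \<Longrightarrow> d y ?p \<le> r \<Longrightarrow>
        ennreal (1 - \<rho>) * emeasure lborel {x \<in> V. d y (\<Phi> x) \<le> r} \<le> emeasure ?\<mu> (dm.mcball y r) \<and>
        emeasure ?\<mu> (dm.mcball y r) \<le> ennreal (1 + \<rho>) * emeasure lborel {x \<in> V. d y (\<Phi> x) \<le> r} \<and>
        {x \<in> V. d y (\<Phi> x) \<le> r} \<in> sets borel"
      using intrinsic_measure_bounds[OF S g \<sigma> rho(1)] by blast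
    obtain s2 where s2': "s2 > 0 \<and> (\<forall>r. 0 < r \<longrightarrow> r < s2 \<longrightarrow>
        (\<forall>y. d y ?p \<le> r \<longrightarrow> {x \<in> V. d y (\<Phi> x) \<le> r} \<subseteq> dn r ` slice (1 + \<rho>) (dl (1 / r) (- ?p \<star> y))) \<and>
        (\<forall>u. d u 0 \<le> 1 \<longrightarrow> dn r ` slice 1 u \<subseteq> {x \<in> V. d (?p \<star> dl r u) (\<Phi> x) \<le> r * (1 + \<rho>)}))"
      using chart_ball_inclusions[OF rho(1)] by (elim exE)
    note s2 = s2'[THEN conjunct1]
      s2'[THEN conjunct2, THEN spec, THEN mp, THEN mp, THEN conjunct1, THEN spec, THEN mp]
      s2'[THEN conjunct2, THEN spec, THEN mp, THEN mp, THEN conjunct2, THEN spec, THEN mp]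
    show "\<exists>s>0. \<forall>r y. 0 < r \<longrightarrow> r < s \<longrightarrow> d y ?p \<le> r \<longrightarrow>
        emeasure ?\<mu> (dm.mcball y r) \<le> ennreal ((1 + \<rho>) ^ (?N + 1) * vol u * r ^ ?N)"
    proof (intro exI[of _ "min s1 s2"] conjI allI impI)
      fix r y assume r: "0 < r" "r < min s1 s2" and y: "d y ?p \<le> r"
      \<comment> \<open>The rescaled centre is dilated once more by \<open>1 / (1 + \<rho>)\<close>,
        which turns the slice of radius \<open>1 + \<rho>\<close> into one of radius 1 and keeps the
        centre in the unit ball.\<close>
      define v where "v = dl (1 / (1 + \<rho>)) (dl (1 / r) (- ?p \<star> y))"
      have "d 0 v = 1 / (1 + \<rho>) * (1 / r * d 0 (- ?p \<star> y))"
        unfolding v_def using rho r by (simp add: d0_dl)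
      also have "\<dots> = d y ?p / ((1 + \<rho>) * r)" using d_zero_eq[of ?p y] d_facts(3)[of y ?p] by simp
      also have "\<dots> \<le> 1"
      proof -
        have "1 * r \<le> (1 + \<rho>) * r" using rho r by (intro mult_right_mono) auto
        then have "d y ?p \<le> (1 + \<rho>) * r" using y by linarith
        then show ?thesis using rho r by simp
      qed
      finally have "vol v \<le> vol u" using u(2)[of v] d_facts(3)[of v 0] by simp
      then have vv: "(1 + \<rho>) ^ ?N * vol v \<le> (1 + \<rho>) ^ ?N * vol u" by (rule mult_left_mono) (use rho in simp)
      have "emeasure lborel {x \<in> V. d y (\<Phi> x) \<le> r} \<le> emeasure lborel (dn r ` slice (1 + \<rho>) (dl (1 / r) (- ?p \<star> y)))"
        using r y s2(2)[of r y] emeasure_dn_image(1)[OF r(1) slice_borel] by (intro emeasure_mono) auto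
      also have "\<dots> = ennreal (r ^ ?N) * ennreal ((1 + \<rho>) ^ ?N * vol v)"
        unfolding emeasure_dn_image(2)[OF r(1) slice_borel] v_def using rho by (simp add: emeasure_slice_scale)
      also have "\<dots> \<le> ennreal (r ^ ?N) * ennreal ((1 + \<rho>) ^ ?N * vol u)"
        by (rule mult_left_mono[OF ennreal_leI[OF vv]]) simp
      finally have 1: "emeasure lborel {x \<in> V. d y (\<Phi> x) \<le> r} \<le> ennreal (r ^ ?N) * ennreal ((1 + \<rho>) ^ ?N * vol u)" .
      have "emeasure ?\<mu> (dm.mcball y r) \<le> ennreal (1 + \<rho>) * emeasure lborel {x \<in> V. d y (\<Phi> x) \<le> r}"
        using s1(2)[of r y] r y by simp
      also have "\<dots> \<le> ennreal (1 + \<rho>) * (ennreal (r ^ ?N) * ennreal ((1 + \<rho>) ^ ?N * vol u))"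
        by (intro mult_left_mono 1) simp
      also have "\<dots> = ennreal ((1 + \<rho>) * (r ^ ?N * ((1 + \<rho>) ^ ?N * vol u)))"
        using rho r vp by (simp add: ennreal_mult)
      \<comment> \<open>One factor \<open>1 + \<rho>\<close> comes from the density of the measure
        and \<open>N\<close> of them from the enlarged slice.\<close>
      also have "(1 + \<rho>) * (r ^ ?N * ((1 + \<rho>) ^ ?N * vol u)) = (1 + \<rho>) ^ (?N + 1) * vol u * r ^ ?N" by simp
      finally show "emeasure ?\<mu> (dm.mcball y r) \<le> ennreal ((1 + \<rho>) ^ (?N + 1) * vol u * r ^ ?N)" .
    qed (use s1 s2 in simp)
    show "\<exists>s>0. \<forall>r. 0 < r \<longrightarrow> r < s \<longrightarrow> (\<exists>y. d y ?p \<le> r * (1 + \<rho>) \<and>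
        ennreal ((1 - \<rho>) * vol u * r ^ ?N) \<le> emeasure ?\<mu> (dm.mcball y (r * (1 + \<rho>))))"
    \<comment> \<open>\<open>s1\<close> is halved because the measure estimate is used at the radius
      \<open>r * (1 + \<rho>)\<close>, below \<open>2 * r\<close>.\<close>
    proof (intro exI[of _ "min (s1 / 2) s2"] conjI allI impI)
      fix r assume r: "0 < r" "r < min (s1 / 2) s2"
      define y where "y = ?p \<star> dl r u"
      have "d y ?p = d (dl r u) (dl r 0)" unfolding y_def using d_left[of ?p "dl r u" 0] by (simp add: dl_zero_right)
      also have "\<dots> = r * d u 0" by (rule d_dl[OF r(1)])
      also have "\<dots> \<le> r * (1 + \<rho>)" using u(1) r rho by (intro mult_left_mono) auto
      finally have yp: "d y ?p \<le> r * (1 + \<rho>)" .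
      have "r * (1 + \<rho>) \<le> r * 2" using r rho by (intro mult_left_mono) auto
      moreover have "r * 2 < s1" using r by simp
      ultimately have rs: "r * (1 + \<rho>) < s1" by linarith
      have "ennreal ((1 - \<rho>) * vol u * r ^ ?N) = ennreal (1 - \<rho>) * (ennreal (r ^ ?N) * ennreal (vol u))"
        using rho r vp by (simp add: ennreal_mult[symmetric] mult_ac)
      also have "ennreal (r ^ ?N) * ennreal (vol u) = emeasure lborel (dn r ` slice 1 u)"
        unfolding emeasure_dn_image(2)[OF r(1) slice_borel] emeasure_slice ..
      also have "emeasure lborel (dn r ` slice 1 u) \<le> emeasure lborel {x \<in> V. d y (\<Phi> x) \<le> r * (1 + \<rho>)}"
        using s2(3)[of r u] s1(2)[OF rs yp] r u(1) by (intro emeasure_mono) (auto simp: y_def)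
      also have "ennreal (1 - \<rho>) * emeasure lborel {x \<in> V. d y (\<Phi> x) \<le> r * (1 + \<rho>)} \<le> emeasure ?\<mu> (dm.mcball y (r * (1 + \<rho>)))"
        using s1(2)[OF rs yp] by blast
      finally have "ennreal ((1 - \<rho>) * vol u * r ^ ?N) \<le> emeasure ?\<mu> (dm.mcball y (r * (1 + \<rho>)))"
        by (simp add: mult_left_mono)
      then show "\<exists>y. d y ?p \<le> r * (1 + \<rho>) \<and>
          ennreal ((1 - \<rho>) * vol u * r ^ ?N) \<le> emeasure ?\<mu> (dm.mcball y (r * (1 + \<rho>)))" using yp by blast
    qed (use s1 s2 in simp)
  qed (rule vp)
  then show ?thesis unfolding u(3) degree_sum .
qed

end

theorem theorem1p1:
  fixes G :: "('a::euclidean_space) graded_group"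
    and e :: "nat \<Rightarrow> 'a"
    and d :: "'a \<Rightarrow> 'a \<Rightarrow> real"
    and \<Sigma> :: "'a set"
    and g :: "'a \<Rightarrow> 'a \<Rightarrow> 'a \<Rightarrow> real"
    and \<sigma> :: "'a measure"
    and N :: nat
    and p :: 'a
  assumes "homogeneous_group G"
    and "layer G 1 \<noteq> {0}"
    and "graded_basis G e"
    and "homogeneous_distance G d"
    and "C1_submanifold TYPE('n::finite) \<Sigma>"
    and "manifold_degree G e \<Sigma> = N"
    and "riemannian_metric g"
    and "riemannian_measure TYPE('n) g \<Sigma> \<sigma>"
    and "p \<in> \<Sigma>"
    and "algebraically_regular G e \<Sigma> p"
    and "pointwise_degree G e \<Sigma> p = N"
    and "horizontal_point G e \<Sigma> p \<or> step G = 2 \<or> CARD('n) = 1 \<or> transversal_point G e \<Sigma> p"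
  shows "federer_density d (real N) (intrinsic_measure G e g \<Sigma> \<sigma>) p =
         spherical_factor TYPE('n) d (homogeneous_tangent_space G e \<Sigma> p)"
proof -
  have hg: "hom_group G e" by (rule hom_group.intro[OF assms(1,3)])
  have hmg: "hom_metric_group G e d"
    by (rule hom_metric_group.intro[OF hg hom_metric_group_axioms.intro[OF assms(4,2)]])
  obtain V :: "(real ^ 'n) set" and \<Phi> where V: "local_param \<Sigma> V \<Phi>" "p \<in> \<Phi> ` V"
    using assms(5,9) unfolding C1_submanifold_def by blast
  obtain x0 where x0: "x0 \<in> V" "\<Phi> x0 = p" using V(2) by blast
  have gc: "group_chart G e \<Sigma> V \<Phi>" by (rule group_chart.intro[OF hg chart.intro[OF V(1)]])
  have "pointwise_degree G e \<Sigma> (\<Phi> x0) = N" using assms(11) x0(2) by simp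
  from group_chart.tangent_structure[OF gc x0(1) this]
  obtain ax :: "'n \<Rightarrow> 'a" and k where T: "adapted_basis G e ax k" "(\<Sum>i\<in>UNIV. k i) = N"
    "homogeneous_tangent_space G e \<Sigma> p = span (range ax)" "group_chart.leading_wedge G e \<Sigma> \<Phi> x0 N ax"
    unfolding x0(2) by blast
  have ac: "adapted_chart G e \<Sigma> V \<Phi> ax k" by (rule adapted_chart.intro[OF gc T(1)])
  have "h = 0" if "adapted_basis.pr ax (group_chart.\<Lambda> G \<Phi> x0 h) = 0" for h
    by (rule adapted_chart.pr_Lam_injective[OF ac x0(1) _ that]) (use T(2,4) in simp)
  from adapted_chart.exists_normalized_chart[OF ac x0(1) this]
  obtain W :: "(real ^ 'n) set" and \<Psi> where W: "chart \<Sigma> W \<Psi>" "0 \<in> W" "\<Psi> 0 = \<Phi> x0"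
    "\<And>w. w \<in> W \<Longrightarrow> adapted_basis.pr ax (gmul G (- \<Phi> x0) (\<Psi> w)) = w" by blast
  have gc': "group_chart G e \<Sigma> W \<Psi>" by (rule group_chart.intro[OF hg W(1)])
  \<comment> \<open>Both charts take the value \<open>p\<close> at the marked parameter, and
    \<open>leading_wedge\<close> depends on nothing else.\<close>
  have "group_chart.leading_wedge G e \<Sigma> \<Psi> 0 (\<Sum>i\<in>UNIV. k i) ax"
    using T(2,4) unfolding group_chart.leading_wedge_def[OF gc] group_chart.leading_wedge_def[OF gc'] W(3) by simp
  then have "normalized_chart G e \<Sigma> W \<Psi> ax k"
    using W(2-4) assms(6) T(2)
    by (intro normalized_chart.intro adapted_chart.intro gc' T(1) normalized_chart_axioms.intro) simp_all
  then have "normalized_metric_chart G e \<Sigma> W \<Psi> ax k d"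
    by (intro normalized_metric_chart.intro metric_basis.intro hmg T(1))
  from normalized_metric_chart.federer_density_eq[OF this assms(5,7,8)]
  show ?thesis unfolding assms(6) W(3) x0(2) T(3) .
qed

end
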